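(* Let $u, u' \in U$. (1) Suppose $\ell(\pi(u)) = d$ and $\ell(\pi(u')) = d-1$. Then $u' < u$ if and only if for some (or, equivalently, for each) reduced expression $\pi(u) = r_1 \cdots r_d$ as a product of simple reflections, with corresponding $s_1,\dots,s_d$ and $c_i = s_i^2$, we have that $u = s_1 \cdots s_d c$ for some $c \in C$, and that $$u' = u_i^0 = s_1 \cdots s_{i-1}s_{i+1} \cdots s_d c \qquad\text{or}\qquad u' = u_i^1 = s_1 \cdots s_{i-1}c_i s_{i+1} \cdots s_d c$$ for some $1 \leq i \leq d$. (2) Furthermore, for arbitrary $u,u'\in U$, $u' < u$ if and only if there exist $n\ge 2$ and $u_1,\dots,u_n \in U$ such that $u_1 = u'$, $u_n = u$, and, for every $1\le k<n$, $\ell(\pi(u_{k+1})) = \ell(\pi(u_k)) + 1$ and $u_k < u_{k+1}$.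
   Context: Setting. $G$ is a connected semisimple real Lie group with finite center whose Lie algebra $\mathfrak g$ is a split real form. Fix a Cartan decomposition $\mathfrak g=\mathfrak k\oplus\mathfrak s$ with Cartan involution $\theta$ and associated Cartan inner product $\langle\cdot,\cdot\rangle$; $K$ is the connected subgroup with Lie algebra $\mathfrak k$ (a maximal compact subgroup). Fix a maximal abelian $\mathfrak a\subset\mathfrak s$, with roots $\Pi\subset\mathfrak a^*$ and root spaces $\mathfrak g_\alpha$ (one-dimensional; the centralizer of $\mathfrak a$ in $\mathfrak k$ is $0$), a Weyl chamber, positive roots $\Pi^+$, negative roots $\Pi^-=-\Pi^+$, simple roots $\Sigma$, $\mathfrak n=\sum_{\alpha\in\Pi^+}\mathfrak g_\alpha$, $A=\exp\mathfrak a$, $N=\exp\mathfrak n$. Let $C=M$ be the centralizer and $U=M_*$ the normalizer of $\mathfrak a$ in $K$ (finite groups). $W=U/C$ is the Weyl group, $\pi$ restricted to $U$ is the quotient map $U\to W$, and $\ell$ is the length on $W$ with respect to the simple reflections $r_\alpha$, $\alpha\in\Sigma$. $K$ is identified with $G/AN$ via $k\mapsto kb$, where $b$ is the base coset $AN$; $G$ acts on $G/AN$ by left multiplication. Elements $s_\alpha$. For each $\alpha\in\Sigma$ let $H_\alpha\in\mathfrak a$ be defined by $\langle H_\alpha,H\rangle=\alpha(H)$, and fix $E_\alpha\in\mathfrak g_\alpha$ with $\langle E_\alpha,E_\alpha\rangle=2\pi^2/\langle H_\alpha,H_\alpha\rangle$ (here $\pi$ is the number). Put $F_\alpha=E_\alpha+\theta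 E_\alpha\in\mathfrak k$, $s_\alpha=\exp(F_\alpha/2)\in U$, $c_\alpha=s_\alpha^2=\exp(F_\alpha)\in C$; then $\pi(s_\alpha)=r_\alpha$. For an expression $r_1\cdots r_d$ in simple reflections $r_j=r_{\alpha_j}$, write $s_j=s_{\alpha_j}$, $c_j=c_{\alpha_j}$. Order on $U$. For $u\in U$ the Bruhat cell is $\mathcal B(u)=Nub\subset K$, the Schubert cell is its closure $\mathcal S(u)=\mathrm{cl}(\mathcal B(u))$, and $\partial\mathcal B(u)=\mathcal S(u)\setminus\mathcal B(u)$. The cells $\mathcal B(u)$, $u\in U$, are disjoint with union $K$, and $\partial\mathcal B(u)$ is a union of Bruhat cells. By definition $u'<u$ if and only if $\mathcal B(u')\subset\partial\mathcal B(u)$. *)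

theory Defs
  imports "HOL-Analysis.Analysis" "HOL-Algebra.Coset" "HOL-Algebra.Generated_Groups"
begin

section \<open>Lie groups\<close>

text \<open>For an open set \<open>S\<close> in a finite-dimensional space, \<open>Ck_on k S f\<close> says that \<open>f\<close> is of
  class \<open>C^k\<close> on \<open>S\<close>: all iterated directional derivatives of order at most \<open>k\<close> exist and are
  continuous.\<close>

primrec Ck_on :: "nat \<Rightarrow> 'a::real_normed_vector set \<Rightarrow> ('a \<Rightarrow> 'b::real_normed_vector) \<Rightarrow> bool"
  where
    "Ck_on 0 S f \<longleftrightarrow> continuous_on S f"
  | "Ck_on (Suc k) S f \<longleftrightarrow> (\<forall>x\<in>S. f differentiable (at x)) \<and>
       (\<forall>v. Ck_on k S (\<lambda>x. frechet_derivative f (at x) v))"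

definition smooth_on :: "'a::real_normed_vector set \<Rightarrow> ('a \<Rightarrow> 'b::real_normed_vector) \<Rightarrow> bool"
  where "smooth_on S f \<longleftrightarrow> (\<forall>k. Ck_on k S f)"

text \<open>A chart is a pair of a domain and a coordinate function with values in \<open>'e\<close>;
  the dimension of the group is \<open>DIM('e)\<close>.\<close>

record ('g, 'e) lie_group = "'g monoid" +
  gtop :: "'g topology"
  atlas :: "('g set \<times> ('g \<Rightarrow> 'e)) set"

definition is_chart :: "'g topology \<Rightarrow> 'g set \<times> ('g \<Rightarrow> 'e::euclidean_space) \<Rightarrow> bool"
  where "is_chart T = (\<lambda>(V, \<phi>). openin T V \<and> open (\<phi> ` V) \<and>
    homeomorphic_map (subtopology T V) (top_of_set (\<phi> ` V)) \<phi>)"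

definition lie_group :: "('g, 'e::euclidean_space, 'm) lie_group_scheme \<Rightarrow> bool"
  where "lie_group G \<longleftrightarrow>
    group G \<and> topspace (gtop G) = carrier G \<and>
    Hausdorff_space (gtop G) \<and> second_countable (gtop G) \<and>
    (\<forall>ch\<in>atlas G. is_chart (gtop G) ch) \<and> (\<Union>(V, \<phi>)\<in>atlas G. V) = carrier G \<and>
    (\<forall>(V, \<phi>)\<in>atlas G. \<forall>(V', \<phi>')\<in>atlas G.
       smooth_on (\<phi> ` (V \<inter> V')) (\<phi>' \<circ> inv_into V \<phi>)) \<and>
    continuous_map (prod_topology (gtop G) (gtop G)) (gtop G) (\<lambda>(x, y). x \<otimes>\<^bsub>G\<^esub> y) \<and>
    (\<forall>(V, \<phi>)\<in>atlas G. \<forall>(V', \<phi>')\<in>atlas G. \<forall>(V'', \<phi>'')\<in>atlas G.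
       smooth_on {(\<phi> x, \<phi>' y) | x y. x \<in> V \<and> y \<in> V' \<and> x \<otimes>\<^bsub>G\<^esub> y \<in> V''}
         (\<lambda>(p, q). \<phi>'' (inv_into V \<phi> p \<otimes>\<^bsub>G\<^esub> inv_into V' \<phi>' q))) \<and>
    continuous_map (gtop G) (gtop G) (\<lambda>x. inv\<^bsub>G\<^esub> x) \<and>
    (\<forall>(V, \<phi>)\<in>atlas G. \<forall>(V', \<phi>')\<in>atlas G.
       smooth_on {\<phi> x | x. x \<in> V \<and> inv\<^bsub>G\<^esub> x \<in> V'} (\<lambda>p. \<phi>' (inv\<^bsub>G\<^esub> (inv_into V \<phi> p))))"

section \<open>The Lie algebra of a Lie group\<close>

text \<open>The Lie algebra is the tangent space at the identity, identified with the coordinate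
  space \<open>'e\<close> through the differential of one chart around the identity. Another choice of
  chart gives a linearly isomorphic picture of the same Lie algebra, so nothing below depends
  on it. The Euclidean inner product of \<open>'e\<close> is not used as an invariant inner product; only
  the vector space structure of \<open>'e\<close> is meaningful.\<close>

definition one_chart :: "('g, 'e::euclidean_space, 'm) lie_group_scheme \<Rightarrow> 'g set \<times> ('g \<Rightarrow> 'e)"
  where "one_chart G = (SOME ch. ch \<in> atlas G \<and> \<one>\<^bsub>G\<^esub> \<in> fst ch)"

definition coord :: "('g, 'e::euclidean_space, 'm) lie_group_scheme \<Rightarrow> 'g \<Rightarrow> 'e"
  where "coord G = snd (one_chart G)"

definition coord_inv :: "('g, 'e::euclidean_space, 'm) lie_group_scheme \<Rightarrow> 'e \<Rightarrow> 'g"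
  where "coord_inv G = inv_into (fst (one_chart G)) (coord G)"

definition one_parameter_subgroup ::
    "('g, 'e::euclidean_space, 'm) lie_group_scheme \<Rightarrow> (real \<Rightarrow> 'g) \<Rightarrow> bool"
  where "one_parameter_subgroup G \<gamma> \<longleftrightarrow>
    continuous_map euclidean (gtop G) \<gamma> \<and>
    (\<forall>(V, \<phi>)\<in>atlas G. smooth_on {t. \<gamma> t \<in> V} (\<phi> \<circ> \<gamma>)) \<and>
    (\<forall>s t. \<gamma> (s + t) = \<gamma> s \<otimes>\<^bsub>G\<^esub> \<gamma> t)"

definition lexp :: "('g, 'e::euclidean_space, 'm) lie_group_scheme \<Rightarrow> 'e \<Rightarrow> 'g"
  where "lexp G X = (THE \<gamma>. one_parameter_subgroup G \<gamma> \<and>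
    ((\<lambda>t. coord G (\<gamma> t)) has_vector_derivative X) (at 0)) 1"

text \<open>\<open>Ad g\<close> is the differential at the identity of the conjugation by \<open>g\<close>, and
  the bracket is given by \<open>ad\<close>, the differential of \<open>Ad\<close> at the identity.\<close>

definition Ad :: "('g, 'e::euclidean_space, 'm) lie_group_scheme \<Rightarrow> 'g \<Rightarrow> 'e \<Rightarrow> 'e"
  where "Ad G g = frechet_derivative
    (\<lambda>p. coord G (g \<otimes>\<^bsub>G\<^esub> coord_inv G p \<otimes>\<^bsub>G\<^esub> inv\<^bsub>G\<^esub> g)) (at (coord G \<one>\<^bsub>G\<^esub>))"

definition bracket :: "('g, 'e::euclidean_space, 'm) lie_group_scheme \<Rightarrow> 'e \<Rightarrow> 'e \<Rightarrow> 'e"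
  where "bracket G X Y = vector_derivative (\<lambda>t. Ad G (lexp G (t *\<^sub>R X)) Y) (at 0)"

definition bracket_span ::
    "('g, 'e::euclidean_space, 'm) lie_group_scheme \<Rightarrow> 'e set \<Rightarrow> 'e set \<Rightarrow> 'e set"
  where "bracket_span G P Q = span {bracket G X Y | X Y. X \<in> P \<and> Y \<in> Q}"

primrec derived_series ::
    "('g, 'e::euclidean_space, 'm) lie_group_scheme \<Rightarrow> 'e set \<Rightarrow> nat \<Rightarrow> 'e set"
  where
    "derived_series G h 0 = h"
  | "derived_series G h (Suc k) = bracket_span G (derived_series G h k) (derived_series G h k)"

primrec lower_central_series ::
    "('g, 'e::euclidean_space, 'm) lie_group_scheme \<Rightarrow> 'e set \<Rightarrow> nat \<Rightarrow> 'e set"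
  where
    "lower_central_series G h 0 = h"
  | "lower_central_series G h (Suc k) = bracket_span G h (lower_central_series G h k)"

definition lie_ideal :: "('g, 'e::euclidean_space, 'm) lie_group_scheme \<Rightarrow> 'e set \<Rightarrow> bool"
  where "lie_ideal G h \<longleftrightarrow> subspace h \<and> (\<forall>X. \<forall>Y\<in>h. bracket G X Y \<in> h)"

definition semisimple :: "('g, 'e::euclidean_space, 'm) lie_group_scheme \<Rightarrow> bool"
  where "semisimple G \<longleftrightarrow>
    (\<forall>h. lie_ideal G h \<and> (\<exists>k. derived_series G h k = {0}) \<longrightarrow> h = {0})"

definition cartan_subalgebra :: "('g, 'e::euclidean_space, 'm) lie_group_scheme \<Rightarrow> 'e set \<Rightarrow> bool"
  where "cartan_subalgebra G h \<longleftrightarrow>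
    subspace h \<and> (\<forall>X\<in>h. \<forall>Y\<in>h. bracket G X Y \<in> h) \<and>
    (\<exists>k. lower_central_series G h k = {0}) \<and>
    {X. \<forall>Y\<in>h. bracket G X Y \<in> h} = h"

text \<open>A real semisimple Lie algebra is a split real form of its complexification if it has a
  Cartan subalgebra whose adjoint action is diagonalizable over the reals.\<close>

definition split_real_form :: "('g, 'e::euclidean_space, 'm) lie_group_scheme \<Rightarrow> bool"
  where "split_real_form G \<longleftrightarrow>
    (\<exists>h. cartan_subalgebra G h \<and>
      (\<forall>H\<in>h. span {X. \<exists>c. bracket G H X = c *\<^sub>R X} = UNIV))"

definition killing :: "('g, 'e::euclidean_space, 'm) lie_group_scheme \<Rightarrow> 'e \<Rightarrow> 'e \<Rightarrow> real"
  where "killing G X Y = (\<Sum>b\<in>Basis. bracket G X (bracket G Y b) \<bullet> b)"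

definition group_center :: "('g, 'm) monoid_scheme \<Rightarrow> 'g set"
  where "group_center G = {z\<in>carrier G. \<forall>g\<in>carrier G. z \<otimes>\<^bsub>G\<^esub> g = g \<otimes>\<^bsub>G\<^esub> z}"

section \<open>Cartan decomposition, roots and Weyl group\<close>

text \<open>A Lie group with the choices made for it: a Cartan involution, a maximal abelian
  subspace, a Weyl chamber, and a vector in the root space of each simple root.
  These are constrained by \<open>split_setting\<close> below.\<close>

record ('g, 'e) cartan_data = "('g, 'e) lie_group" +
  cinv :: "'e \<Rightarrow> 'e"
  asub :: "'e set"
  chamber :: "'e set"
  rootvec :: "('e \<Rightarrow> real) \<Rightarrow> 'e"

definition cip :: "('g, 'e::euclidean_space, 'm) cartan_data_scheme \<Rightarrow> 'e \<Rightarrow> 'e \<Rightarrow> real"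
  where "cip G X Y = - killing G X (cinv G Y)"

definition cartan_involution :: "('g, 'e::euclidean_space, 'm) cartan_data_scheme \<Rightarrow> bool"
  where "cartan_involution G \<longleftrightarrow>
    linear (cinv G) \<and> (\<forall>X. cinv G (cinv G X) = X) \<and>
    (\<forall>X Y. cinv G (bracket G X Y) = bracket G (cinv G X) (cinv G Y)) \<and>
    (\<forall>X. X \<noteq> 0 \<longrightarrow> cip G X X > 0)"

definition kalg :: "('g, 'e::euclidean_space, 'm) cartan_data_scheme \<Rightarrow> 'e set"
  where "kalg G = {X. cinv G X = X}"

definition ssub :: "('g, 'e::euclidean_space, 'm) cartan_data_scheme \<Rightarrow> 'e set"
  where "ssub G = {X. cinv G X = - X}"

definition abelian_in_s :: "('g, 'e::euclidean_space, 'm) cartan_data_scheme \<Rightarrow> 'e set \<Rightarrow> bool"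
  where "abelian_in_s G V \<longleftrightarrow>
    subspace V \<and> V \<subseteq> ssub G \<and> (\<forall>X\<in>V. \<forall>Y\<in>V. bracket G X Y = 0)"

definition maximal_abelian :: "('g, 'e::euclidean_space, 'm) cartan_data_scheme \<Rightarrow> bool"
  where "maximal_abelian G \<longleftrightarrow>
    abelian_in_s G (asub G) \<and> (\<forall>V. abelian_in_s G V \<and> asub G \<subseteq> V \<longrightarrow> V = asub G)"

text \<open>A linear functional on the subspace \<open>asub G\<close> is represented by the function that is
  extended by \<open>0\<close> outside \<open>asub G\<close>, so that equality of functions is equality of functionals.\<close>

definition adual :: "('g, 'e::euclidean_space, 'm) cartan_data_scheme \<Rightarrow> ('e \<Rightarrow> real) set"
  where "adual G = {\<alpha>.
    (\<forall>X\<in>asub G. \<forall>Y\<in>asub G. \<alpha> (X + Y) = \<alpha> X + \<alpha> Y) \<and>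
    (\<forall>c. \<forall>X\<in>asub G. \<alpha> (c *\<^sub>R X) = c * \<alpha> X) \<and>
    (\<forall>X. X \<notin> asub G \<longrightarrow> \<alpha> X = 0)}"

definition root_space ::
    "('g, 'e::euclidean_space, 'm) cartan_data_scheme \<Rightarrow> ('e \<Rightarrow> real) \<Rightarrow> 'e set"
  where "root_space G \<alpha> = {X. \<forall>H\<in>asub G. bracket G H X = \<alpha> H *\<^sub>R X}"

definition roots :: "('g, 'e::euclidean_space, 'm) cartan_data_scheme \<Rightarrow> ('e \<Rightarrow> real) set"
  where "roots G = {\<alpha>\<in>adual G. \<alpha> \<noteq> (\<lambda>_. 0) \<and> root_space G \<alpha> \<noteq> {0}}"

definition weyl_chamber :: "('g, 'e::euclidean_space, 'm) cartan_data_scheme \<Rightarrow> bool"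
  where "weyl_chamber G \<longleftrightarrow> chamber G \<in> components {H\<in>asub G. \<forall>\<alpha>\<in>roots G. \<alpha> H \<noteq> 0}"

definition pos_roots :: "('g, 'e::euclidean_space, 'm) cartan_data_scheme \<Rightarrow> ('e \<Rightarrow> real) set"
  where "pos_roots G = {\<alpha>\<in>roots G. \<forall>H\<in>chamber G. \<alpha> H > 0}"

definition simple_roots :: "('g, 'e::euclidean_space, 'm) cartan_data_scheme \<Rightarrow> ('e \<Rightarrow> real) set"
  where "simple_roots G = {\<alpha>\<in>pos_roots G.
    \<not> (\<exists>\<beta>\<in>pos_roots G. \<exists>\<gamma>\<in>pos_roots G. \<alpha> = (\<lambda>H. \<beta> H + \<gamma> H))}"

definition nalg :: "('g, 'e::euclidean_space, 'm) cartan_data_scheme \<Rightarrow> 'e set"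
  where "nalg G = span (\<Union>\<alpha>\<in>pos_roots G. root_space G \<alpha>)"

definition Hvec :: "('g, 'e::euclidean_space, 'm) cartan_data_scheme \<Rightarrow> ('e \<Rightarrow> real) \<Rightarrow> 'e"
  where "Hvec G \<alpha> = (THE H. H \<in> asub G \<and> (\<forall>H'\<in>asub G. cip G H H' = \<alpha> H'))"

definition split_setting :: "('g, 'e::euclidean_space, 'm) cartan_data_scheme \<Rightarrow> bool"
  where "split_setting G \<longleftrightarrow>
    lie_group G \<and> connected_space (gtop G) \<and> semisimple G \<and> finite (group_center G) \<and>
    split_real_form G \<and>
    cartan_involution G \<and> maximal_abelian G \<and> weyl_chamber G \<and>
    (\<forall>\<alpha>\<in>simple_roots G. rootvec G \<alpha> \<in> root_space G \<alpha> \<and>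
       cip G (rootvec G \<alpha>) (rootvec G \<alpha>) = 2 * pi\<^sup>2 / cip G (Hvec G \<alpha>) (Hvec G \<alpha>))"

text \<open>The connected Lie subgroup with Lie algebra \<open>kalg G\<close> is the subgroup generated by the
  image of \<open>kalg G\<close> under the exponential map.\<close>

definition Kgrp :: "('g, 'e::euclidean_space, 'm) cartan_data_scheme \<Rightarrow> 'g set"
  where "Kgrp G = generate G (lexp G ` kalg G)"

definition Agrp :: "('g, 'e::euclidean_space, 'm) cartan_data_scheme \<Rightarrow> 'g set"
  where "Agrp G = lexp G ` asub G"

definition Ngrp :: "('g, 'e::euclidean_space, 'm) cartan_data_scheme \<Rightarrow> 'g set"
  where "Ngrp G = lexp G ` nalg G"

definition Cgrp :: "('g, 'e::euclidean_space, 'm) cartan_data_scheme \<Rightarrow> 'g set"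
  where "Cgrp G = {k\<in>Kgrp G. \<forall>H\<in>asub G. Ad G k H = H}"

definition Ugrp :: "('g, 'e::euclidean_space, 'm) cartan_data_scheme \<Rightarrow> 'g set"
  where "Ugrp G = {k\<in>Kgrp G. Ad G k ` asub G = asub G}"

definition weyl_group :: "('g, 'e::euclidean_space, 'm) cartan_data_scheme \<Rightarrow> 'g set monoid"
  where "weyl_group G = (G\<lparr>carrier := Ugrp G\<rparr>) Mod (Cgrp G)"

definition wproj :: "('g, 'e::euclidean_space, 'm) cartan_data_scheme \<Rightarrow> 'g \<Rightarrow> 'g set"
  where "wproj G u = Cgrp G #>\<^bsub>G\<^esub> u"

text \<open>The class in \<open>U/C\<close> of the elements that act on \<open>asub G\<close> as the orthogonal reflection in
  the kernel of \<open>\<alpha>\<close>.\<close>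

definition simple_refl :: "('g, 'e::euclidean_space, 'm) cartan_data_scheme \<Rightarrow> ('e \<Rightarrow> real) \<Rightarrow> 'g set"
  where "simple_refl G \<alpha> = {u\<in>Ugrp G. \<forall>H\<in>asub G.
    Ad G u H = H - (2 * \<alpha> H / cip G (Hvec G \<alpha>) (Hvec G \<alpha>)) *\<^sub>R Hvec G \<alpha>}"

definition list_prod :: "('a, 'm) monoid_scheme \<Rightarrow> 'a list \<Rightarrow> 'a"
  where "list_prod M xs = foldr (\<lambda>x y. x \<otimes>\<^bsub>M\<^esub> y) xs \<one>\<^bsub>M\<^esub>"

text \<open>An expression in simple reflections is given by the list of the corresponding simple
  roots.\<close>

definition expression_of ::
    "('g, 'e::euclidean_space, 'm) cartan_data_scheme \<Rightarrow> 'g set \<Rightarrow> ('e \<Rightarrow> real) list \<Rightarrow> bool"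
  where "expression_of G w \<alpha>s \<longleftrightarrow>
    set \<alpha>s \<subseteq> simple_roots G \<and> w = list_prod (weyl_group G) (map (simple_refl G) \<alpha>s)"

definition wlen :: "('g, 'e::euclidean_space, 'm) cartan_data_scheme \<Rightarrow> 'g set \<Rightarrow> nat"
  where "wlen G w = (LEAST d. \<exists>\<alpha>s. expression_of G w \<alpha>s \<and> length \<alpha>s = d)"

definition reduced_expression ::
    "('g, 'e::euclidean_space, 'm) cartan_data_scheme \<Rightarrow> 'g set \<Rightarrow> ('e \<Rightarrow> real) list \<Rightarrow> bool"
  where "reduced_expression G w \<alpha>s \<longleftrightarrow> expression_of G w \<alpha>s \<and> length \<alpha>s = wlen G w"

definition s_elt :: "('g, 'e::euclidean_space, 'm) cartan_data_scheme \<Rightarrow> ('e \<Rightarrow> real) \<Rightarrow> 'g"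
  where "s_elt G \<alpha> = lexp G ((1/2) *\<^sub>R (rootvec G \<alpha> + cinv G (rootvec G \<alpha>)))"

definition c_elt :: "('g, 'e::euclidean_space, 'm) cartan_data_scheme \<Rightarrow> ('e \<Rightarrow> real) \<Rightarrow> 'g"
  where "c_elt G \<alpha> = s_elt G \<alpha> [^]\<^bsub>G\<^esub> (2::nat)"

section \<open>Bruhat cells and the order on U\<close>

definition base_coset :: "('g, 'e::euclidean_space, 'm) cartan_data_scheme \<Rightarrow> 'g set"
  where "base_coset G = Agrp G <#>\<^bsub>G\<^esub> Ngrp G"

text \<open>The orbit \<open>Nub\<close> in \<open>G/AN\<close>, moved to \<open>K\<close> by the identification of \<open>k\<close> with \<open>kb\<close>.\<close>

definition bruhat_cell :: "('g, 'e::euclidean_space, 'm) cartan_data_scheme \<Rightarrow> 'g \<Rightarrow> 'g set"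
  where "bruhat_cell G u = {k\<in>Kgrp G. \<exists>n\<in>Ngrp G.
    k <#\<^bsub>G\<^esub> base_coset G = (n \<otimes>\<^bsub>G\<^esub> u) <#\<^bsub>G\<^esub> base_coset G}"

definition schubert_cell :: "('g, 'e::euclidean_space, 'm) cartan_data_scheme \<Rightarrow> 'g \<Rightarrow> 'g set"
  where "schubert_cell G u = (subtopology (gtop G) (Kgrp G)) closure_of (bruhat_cell G u)"

definition bruhat_boundary :: "('g, 'e::euclidean_space, 'm) cartan_data_scheme \<Rightarrow> 'g \<Rightarrow> 'g set"
  where "bruhat_boundary G u = schubert_cell G u - bruhat_cell G u"

definition bruhat_less ::
    "('g, 'e::euclidean_space, 'm) cartan_data_scheme \<Rightarrow> 'g \<Rightarrow> 'g \<Rightarrow> bool"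
  where "bruhat_less G u' u \<longleftrightarrow> bruhat_cell G u' \<subseteq> bruhat_boundary G u"

text \<open>Positions in the list \<open>\<alpha>s\<close> count from \<open>0\<close>.\<close>

definition u_del0 ::
    "('g, 'e::euclidean_space, 'm) cartan_data_scheme \<Rightarrow> ('e \<Rightarrow> real) list \<Rightarrow> nat \<Rightarrow> 'g \<Rightarrow> 'g"
  where "u_del0 G \<alpha>s i c =
    list_prod G (map (s_elt G) (take i \<alpha>s) @ map (s_elt G) (drop (Suc i) \<alpha>s) @ [c])"

definition u_del1 ::
    "('g, 'e::euclidean_space, 'm) cartan_data_scheme \<Rightarrow> ('e \<Rightarrow> real) list \<Rightarrow> nat \<Rightarrow> 'g \<Rightarrow> 'g"
  where "u_del1 G \<alpha>s i c =
    list_prod G (map (s_elt G) (take i \<alpha>s) @ [c_elt G (\<alpha>s ! i)] @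
      map (s_elt G) (drop (Suc i) \<alpha>s) @ [c])"

definition deletion_cond ::
    "('g, 'e::euclidean_space, 'm) cartan_data_scheme \<Rightarrow> ('e \<Rightarrow> real) list \<Rightarrow> 'g \<Rightarrow> 'g \<Rightarrow> bool"
  where "deletion_cond G \<alpha>s u' u \<longleftrightarrow>
    (\<exists>c\<in>Cgrp G. u = list_prod G (map (s_elt G) \<alpha>s @ [c]) \<and>
      (\<exists>i<length \<alpha>s. u' = u_del0 G \<alpha>s i c \<or> u' = u_del1 G \<alpha>s i c))"

end

theory Submission imports Defs begin

text \<open>The Schubert cells are parametrized explicitly. For a simple root \<open>\<alpha>\<close> the arc
  \<open>t \<mapsto> exp (t F\<^sub>\<alpha>)\<close>, \<open>0 \<le> t \<le> 1\<close>, runs from \<open>\<one>\<close> through \<open>s\<^sub>\<alpha>\<close> to \<open>c\<^sub>\<alpha>\<close>. A computation in rank one puts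
  its interior points into \<open>N s\<^sub>\<alpha> A N\<close>, so that the open arc carries the Bruhat cell of \<open>v\<close> onto that of
  \<open>s\<^sub>\<alpha> v\<close> when \<open>r\<^sub>\<alpha>\<close> increases the length of \<open>v\<close>, and the closed arc always carries it onto the union
  of the cells of \<open>v\<close>, \<open>s\<^sub>\<alpha> v\<close> and \<open>c\<^sub>\<alpha> v\<close>. Hence, for \<open>u = s\<^sub>1 \<dots> s\<^sub>d c\<close> reduced, the products of points of
  the closed arcs form a compact set in which the cell of \<open>u\<close> is dense, that is, the Schubert cell, and
  it consists of the cells of the elements obtained from \<open>s\<^sub>1 \<dots> s\<^sub>d c\<close> by replacing each \<open>s\<^sub>i\<close> by \<open>\<one>\<close>, \<open>s\<^sub>i\<close>
  or \<open>c\<^sub>i\<close>. Length considerations single out the elements of codimension one, and intermediate elements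
  are found by the usual lifting argument, by induction on the length of \<open>u\<close>.

  The splitness hypothesis concerns an arbitrary Cartan subalgebra. A vector of minimal length in a
  closed invariant set through a regular element of it lies in \<open>\<ss>\<close>, and the Killing form is
  nonnegative on its centralizer. Moving it into \<open>\<aa>\<close> by an automorphism in the closure of \<open>Ad K\<close> shows
  that \<open>\<aa>\<close> has trivial centralizer in \<open>\<kk>\<close>.\<close>

section \<open>Calculus in charts\<close>

text \<open>Three difficulties shape the argument. The cells are indexed by \<open>U\<close>, not by
  the Weyl group, so that disjointness must also separate elements of the finite group
  \<open>C\<close>. This is done by a limit: conjugation by \<open>exp (ln s H0)\<close>, with
  \<open>H0\<close> in the chamber, contracts \<open>N\<close> to \<open>\<one>\<close> as
  \<open>s\<close> tends to \<open>0\<close>, and \<open>C\<close> acts on root lines by signs,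
  while limits of elements of \<open>A\<close> have nonnegative eigenvalues. Next,
  \<open>N = exp \<nn>\<close> is not known a priori to be a group. The generated group is studied
  through its orbit of \<open>H0\<close>, which fills exactly \<open>H0 + \<nn>\<close>, one root
  coordinate at a time. Finally, the adjoint action sees group elements only modulo the center. This
  ambiguity is removed along continuous paths, for \<open>N\<close> by finiteness of the center and
  for \<open>A\<close> by continuity of logarithms. That a position of a reduced word can be deleted
  in two ways reflects the two ends \<open>\<one>\<close> and \<open>c\<close> of its arc, which
  have the same image in the Weyl group.\<close>

lemma Ck_on_cong:
  fixes f g :: "'a::real_normed_vector \<Rightarrow> 'b::real_normed_vector"
  assumes "open S" "\<And>x. x \<in> S \<Longrightarrow> f x = g x"
  shows "Ck_on k S f \<Longrightarrow> Ck_on k S g"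
  using assms(2)
proof (induction k arbitrary: f g)
  case 0
  then show ?case by (metis Ck_on.simps(1) continuous_on_eq)
next
  case (Suc k)
  have D: "(g has_derivative frechet_derivative f (at x)) (at x)" if "x \<in> S" for x
  proof -
    have "(f has_derivative frechet_derivative f (at x)) (at x)"
      using Suc.prems(1) that frechet_derivative_works by auto
    then show ?thesis
      by (rule has_derivative_transform_within_open[OF _ assms(1) that]) (use Suc.prems in auto)
  qed
  then have E: "frechet_derivative g (at x) = frechet_derivative f (at x)" if "x \<in> S" for x
    using that frechet_derivative_at by metis
  have "Ck_on k S (\<lambda>x. frechet_derivative g (at x) v)" for v
    by (rule Suc.IH[of "\<lambda>x. frechet_derivative f (at x) v"]) (use Suc.prems E in auto)
  with D show ?case by (auto simp: differentiable_def)
qed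

lemma Ck_on_subset: "Ck_on k S f \<Longrightarrow> T \<subseteq> S \<Longrightarrow> Ck_on k T f"
  by (induction k arbitrary: f) (auto intro: continuous_on_subset)

text \<open>\<open>Ck_on\<close> recurses through the chosen \<open>frechet_derivative\<close>; here
  any exhibited derivative serves, so that each closure property below reduces to a differentiation
  rule.\<close>

lemma Ck_on_SucI:
  fixes f :: "'a::real_normed_vector \<Rightarrow> 'b::real_normed_vector"
  assumes "open S" "\<And>x. x \<in> S \<Longrightarrow> (f has_derivative f' x) (at x)"
    and "\<And>v. Ck_on k S (\<lambda>x. f' x v)"
  shows "Ck_on (Suc k) S f"
proof -
  have E: "frechet_derivative f (at x) = f' x" if "x \<in> S" for x
    using assms(2)[OF that] frechet_derivative_at by metis
  have "Ck_on k S (\<lambda>x. frechet_derivative f (at x) v)" for v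
    by (rule Ck_on_cong[OF assms(1) _ assms(3)[of v]]) (use E in auto)
  then show ?thesis using assms(2) by (auto simp: differentiable_def)
qed

lemma Ck_on_SucD:
  assumes "Ck_on (Suc k) S f" "x \<in> S"
  shows "(f has_derivative frechet_derivative f (at x)) (at x)"
  using assms frechet_derivative_works by auto

lemma Ck_on_Suc_imp: "Ck_on (Suc k) S f \<Longrightarrow> Ck_on k S f"
proof (induction k arbitrary: f)
  case 0
  then show ?case
    by (auto intro!: differentiable_imp_continuous_on simp: differentiable_on_def
        differentiable_at_withinI)
next
  case (Suc k)
  then show ?case using Ck_on.simps(2) by blast
qed

lemma Ck_on_const:
  assumes "open S" shows "Ck_on k S (\<lambda>x. c)"
proof (induction k arbitrary: c)
  case (Suc k)
  show ?case by (rule Ck_on_SucI[OF assms, where f' = "\<lambda>x v. 0"]) (auto simp: Suc)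
qed auto

lemma Ck_on_bounded_linear_compose:
  fixes f :: "'a::real_normed_vector \<Rightarrow> 'b::real_normed_vector"
  assumes "open S" "bounded_linear h"
  shows "Ck_on k S f \<Longrightarrow> Ck_on k S (\<lambda>x. h (f x))"
proof (induction k arbitrary: f)
  case 0
  then show ?case
    using assms(2) by (auto intro: continuous_on_compose2 linear_continuous_on)
next
  case (Suc k)
  show ?case
  proof (rule Ck_on_SucI[OF assms(1)])
    show "((\<lambda>x. h (f x)) has_derivative (\<lambda>v. h (frechet_derivative f (at x) v))) (at x)"
      if "x \<in> S" for x
      using bounded_linear.has_derivative[OF assms(2) Ck_on_SucD[OF Suc.prems that]] .
  qed (use Suc in auto)
qed

lemma Ck_on_add:
  fixes f g :: "'a::real_normed_vector \<Rightarrow> 'b::real_normed_vector"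
  assumes "open S"
  shows "Ck_on k S f \<Longrightarrow> Ck_on k S g \<Longrightarrow> Ck_on k S (\<lambda>x. f x + g x)"
proof (induction k arbitrary: f g)
  case 0
  then show ?case by (auto intro: continuous_on_add)
next
  case (Suc k)
  show ?case
    by (rule Ck_on_SucI[OF assms(1) has_derivative_add[OF Ck_on_SucD[OF Suc.prems(1)]
            Ck_on_SucD[OF Suc.prems(2)]]]) (use Suc in auto)
qed

lemma Ck_on_sum:
  fixes f :: "'i \<Rightarrow> 'a::real_normed_vector \<Rightarrow> 'b::real_normed_vector"
  assumes "open S" "finite I" "\<And>i. i \<in> I \<Longrightarrow> Ck_on k S (f i)"
  shows "Ck_on k S (\<lambda>x. \<Sum>i\<in>I. f i x)"
  using assms(2,3)
  by (induction I rule: finite_induct) (auto simp: Ck_on_const assms(1) Ck_on_add)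

lemma Ck_on_scaleR:
  fixes f :: "'a::real_normed_vector \<Rightarrow> real" and g :: "'a \<Rightarrow> 'b::real_normed_vector"
  assumes "open S"
  shows "Ck_on k S f \<Longrightarrow> Ck_on k S g \<Longrightarrow> Ck_on k S (\<lambda>x. f x *\<^sub>R g x)"
proof (induction k arbitrary: f g)
  case 0
  then show ?case by (auto intro: continuous_on_scaleR)
next
  case (Suc k)
  have f: "Ck_on k S f" and g: "Ck_on k S g" using Suc.prems Ck_on_Suc_imp by blast+
  show ?case
    by (rule Ck_on_SucI[OF assms(1) has_derivative_scaleR[OF Ck_on_SucD[OF Suc.prems(1)]
            Ck_on_SucD[OF Suc.prems(2)]]])
      (use Suc f g in \<open>auto intro!: Ck_on_add assms(1)\<close>)
qed

lemma Ck_on_bounded_linear: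
  fixes h :: "'a::real_normed_vector \<Rightarrow> 'b::real_normed_vector"
  assumes "open S" "bounded_linear h" shows "Ck_on k S h"
proof (cases k)
  case 0
  then show ?thesis using assms by (simp add: linear_continuous_on)
next
  case (Suc k)
  show ?thesis unfolding Suc
    by (rule Ck_on_SucI[OF assms(1), where f' = "\<lambda>x. h"])
      (auto simp: bounded_linear_imp_has_derivative assms Ck_on_const)
qed

text \<open>The chain rule feeds a varying vector into the derivative of \<open>f\<close>. Expanding
  that vector in the basis gives a finite sum of products, and the induction hypothesis is applied
  to the partial derivatives of \<open>f\<close>.\<close>

lemma Ck_on_compose:
  fixes f :: "'b::euclidean_space \<Rightarrow> 'c::real_normed_vector"
    and g :: "'a::real_normed_vector \<Rightarrow> 'b"
  assumes "open S" "open T" "g ` S \<subseteq> T"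
  shows "Ck_on k T f \<Longrightarrow> Ck_on k S g \<Longrightarrow> Ck_on k S (\<lambda>x. f (g x))"
proof (induction k arbitrary: f)
  case 0
  then show ?case using assms(3) by (auto intro: continuous_on_compose2)
next
  case (Suc k)
  have g: "Ck_on k S g" using Suc.prems Ck_on_Suc_imp by blast
  show ?case
  proof (rule Ck_on_SucI[OF assms(1)])
    fix x assume "x \<in> S"
    then have "g x \<in> T" using assms(3) by auto
    have l: "linear (frechet_derivative f (at (g x)))"
      using Ck_on_SucD[OF Suc.prems(1) \<open>g x \<in> T\<close>] has_derivative_linear by blast
    have "((\<lambda>x. f (g x)) has_derivative
       (\<lambda>v. frechet_derivative f (at (g x)) (frechet_derivative g (at x) v))) (at x)"
      by (rule has_derivative_compose[OF Ck_on_SucD[OF Suc.prems(2) \<open>x \<in> S\<close>]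
            Ck_on_SucD[OF Suc.prems(1) \<open>g x \<in> T\<close>]])
    also have "(\<lambda>v. frechet_derivative f (at (g x)) (frechet_derivative g (at x) v)) =
      (\<lambda>v. \<Sum>b\<in>Basis. (frechet_derivative g (at x) v \<bullet> b) *\<^sub>R frechet_derivative f (at (g x)) b)"
      (is "?l = ?r")
    proof
      fix v
      have "?l v = frechet_derivative f (at (g x))
          (\<Sum>b\<in>Basis. (frechet_derivative g (at x) v \<bullet> b) *\<^sub>R b)"
        by (simp add: euclidean_representation)
      also have "\<dots> = ?r v" by (simp add: linear_sum[OF l] linear_cmul[OF l])
      finally show "?l v = ?r v" .
    qed
    finally show "((\<lambda>x. f (g x)) has_derivative (\<lambda>v. \<Sum>b\<in>Basis.
        (frechet_derivative g (at x) v \<bullet> b) *\<^sub>R frechet_derivative f (at (g x)) b)) (at x)" .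
  next
    fix v
    show "Ck_on k S (\<lambda>x. \<Sum>b\<in>Basis. (frechet_derivative g (at x) v \<bullet> b) *\<^sub>R
        frechet_derivative f (at (g x)) b)"
      using Suc.prems g
      by (intro Ck_on_sum Ck_on_scaleR assms Suc.IH
            Ck_on_bounded_linear_compose[OF _ bounded_linear_inner_left]) auto
  qed
qed

section \<open>Lie groups in a chart at the identity\<close>

locale lie =
  fixes G :: "('g, 'e::euclidean_space, 'm) lie_group_scheme" (structure)
  assumes lie: "lie_group G"
begin

abbreviation "T \<equiv> gtop G"
abbreviation "V \<equiv> fst (one_chart G)"
abbreviation "\<phi> \<equiv> coord G"
abbreviation "\<psi> \<equiv> coord_inv G"
abbreviation "e0 \<equiv> coord G \<one>"

lemma is_group: "group G" and topspace_T: "topspace T = carrier G"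
  and Hausdorff_T: "Hausdorff_space T"
  and atlas_cover: "(\<Union>(U, f)\<in>atlas G. U) = carrier G"
  and mult_continuous: "continuous_map (prod_topology T T) T (\<lambda>(x, y). x \<otimes> y)"
  and inv_continuous: "continuous_map T T (\<lambda>x. inv x)"
  using lie unfolding lie_group_def by blast+

sublocale group G by (rule is_group)

lemma chart: assumes "(U, f) \<in> atlas G"
  shows chart_openin: "openin T U" and chart_open: "open (f ` U)"
    and chart_homeo: "homeomorphic_map (subtopology T U) (top_of_set (f ` U)) f"
  using lie assms unfolding lie_group_def is_chart_def by fastforce+

lemma chart_subset: "(U, f) \<in> atlas G \<Longrightarrow> U \<subseteq> carrier G"
  using chart_openin openin_subset topspace_T by fastforce

lemma chart_inj: "(U, f) \<in> atlas G \<Longrightarrow> inj_on f U"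
  using homeomorphic_imp_injective_map[OF chart_homeo] chart_subset topspace_T
  by (metis inf.absorb_iff2 topspace_subtopology)

lemma chart_inv [simp]: "(U, f) \<in> atlas G \<Longrightarrow> x \<in> U \<Longrightarrow> inv_into U f (f x) = x"
  by (simp add: chart_inj)

lemma chart_at: assumes "x \<in> carrier G" obtains U f where "(U, f) \<in> atlas G" "x \<in> U"
proof -
  have "x \<in> (\<Union>(U, f)\<in>atlas G. U)" using atlas_cover assms by simp
  then show ?thesis using that by (auto simp: case_prod_unfold)
qed

lemma one_chart: "(V, \<phi>) \<in> atlas G" "\<one> \<in> V"
proof -
  obtain U f where "(U, f) \<in> atlas G" "\<one> \<in> U" using chart_at by blast
  then have "\<exists>ch. ch \<in> atlas G \<and> \<one> \<in> fst ch" by force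
  then have "one_chart G \<in> atlas G \<and> \<one> \<in> fst (one_chart G)"
    unfolding one_chart_def by (rule someI_ex)
  then show "(V, \<phi>) \<in> atlas G" "\<one> \<in> V" by (auto simp: coord_def)
qed

lemma \<psi>_def: "\<psi> = inv_into V \<phi>" by (simp add: coord_inv_def)

lemma \<psi>\<phi> [simp]: "x \<in> V \<Longrightarrow> \<psi> (\<phi> x) = x" using one_chart by (simp add: \<psi>_def)

lemma \<phi>\<psi> [simp]: "p \<in> \<phi> ` V \<Longrightarrow> \<phi> (\<psi> p) = p" by (simp add: \<psi>_def f_inv_into_f)

lemma \<psi>_in: "p \<in> \<phi> ` V \<Longrightarrow> \<psi> p \<in> V" by (simp add: \<psi>_def inv_into_into)

lemma V_carrier: "x \<in> V \<Longrightarrow> x \<in> carrier G" using chart_subset one_chart by blast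

lemma \<psi>e0 [simp]: "\<psi> e0 = \<one>" using one_chart by simp

lemma open_\<phi>V: "open (\<phi> ` V)" using chart_open one_chart by blast

lemma e0_in: "e0 \<in> \<phi> ` V" using one_chart by blast

lemma chart_inv_continuous:
  assumes "(U, f) \<in> atlas G"
  shows "continuous_map (top_of_set (f ` U)) T (inv_into U f)"
proof -
  obtain g where g: "homeomorphic_maps (subtopology T U) (top_of_set (f ` U)) f g"
    using chart_homeo[OF assms] homeomorphic_map_maps by blast
  then have "continuous_map (top_of_set (f ` U)) T g"
    unfolding homeomorphic_maps_def using continuous_map_in_subtopology by blast
  moreover have "inv_into U f p = g p" if "p \<in> f ` U" for p
  proof -
    obtain x where x: "x \<in> U" "p = f x" using \<open>p \<in> f ` U\<close> by blast
    then have "x \<in> topspace (subtopology T U)"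
      using chart_subset[OF assms] by (auto simp: topspace_T)
    then show ?thesis using g x assms unfolding homeomorphic_maps_def by simp
  qed
  ultimately show ?thesis by (auto intro: continuous_map_eq)
qed

lemma chart_continuous:
  assumes "(U, f) \<in> atlas G"
  shows "continuous_map (subtopology T U) euclidean f"
  using homeomorphic_imp_continuous_map[OF chart_homeo[OF assms]] continuous_map_into_fulltopology
  by blast

lemma open_chart_preimage:
  assumes "(U, f) \<in> atlas G" "openin T W" "continuous_map T T h"
  shows "open {p\<in>f ` U. h (inv_into U f p) \<in> W}"
proof -
  have "continuous_map (top_of_set (f ` U)) T (h \<circ> inv_into U f)"
    using chart_inv_continuous assms continuous_map_compose by blast
  from openin_continuous_map_preimage[OF this assms(2)]
  have "openin (top_of_set (f ` U)) {p\<in>f ` U. h (inv_into U f p) \<in> W}" by simp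
  then show ?thesis using chart_open[OF assms(1)] openin_open_trans by blast
qed

section \<open>Limits and differentiability of the group operations\<close>

lemma continuous_map_lmult: assumes "g \<in> carrier G" shows "continuous_map T T (\<lambda>x. g \<otimes> x)"
proof -
  have "continuous_map T (prod_topology T T) (\<lambda>x. (g, x))"
    using assms by (intro continuous_map_pairedI) (auto simp: topspace_T)
  from continuous_map_compose[OF this mult_continuous] show ?thesis by (simp add: comp_def)
qed

lemma limitin_mult:
  assumes "limitin T f a F" "limitin T g b F"
  shows "limitin T (\<lambda>t. f t \<otimes> g t) (a \<otimes> b) F"
proof -
  have "limitin (prod_topology T T) (\<lambda>t. (f t, g t)) (a, b) F"
    using assms by (simp add: limitin_pairwise comp_def)
  from continuous_map_limit[OF mult_continuous this] show ?thesis by (simp add: comp_def)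
qed

lemma limitin_inv: assumes "limitin T f a F" shows "limitin T (\<lambda>t. inv (f t)) (inv a) F"
  using continuous_map_limit[OF inv_continuous assms] by (simp add: comp_def)

lemma limitin_const_T: "a \<in> carrier G \<Longrightarrow> limitin T (\<lambda>t. a) a F"
  using limitin_const_iff topspace_T by (simp add: limitin_def)

text \<open>Chart domains are open and inverse charts continuous, so convergence of coordinates
  suffices; this turns derivatives computed in coordinates into limits in the group.\<close>

lemma limitin_chart:
  assumes "(U, f) \<in> atlas G" "x \<in> U" "\<forall>\<^sub>F t in F. s t \<in> U" "((\<lambda>t. f (s t)) \<longlongrightarrow> f x) F"
  shows "limitin T s x F"
  unfolding limitin_def
proof (intro conjI allI impI)
  show "x \<in> topspace T" using assms chart_subset topspace_T by blast
  fix W assume W: "openin T W \<and> x \<in> W"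
  let ?P = "{p\<in>f ` U. inv_into U f p \<in> W}"
  have "open ?P" using open_chart_preimage[OF assms(1) _ continuous_map_id, of W] W by simp
  moreover have "f x \<in> ?P" using assms W by auto
  ultimately have "\<forall>\<^sub>F t in F. f (s t) \<in> ?P" using assms(4) topological_tendstoD by blast
  with assms(3) show "\<forall>\<^sub>F t in F. s t \<in> W"
    by eventually_elim (use assms(1) in auto)
qed

lemma limitin_chartD:
  assumes "(U, f) \<in> atlas G" "x \<in> U" "limitin T s x F"
  shows "\<forall>\<^sub>F t in F. s t \<in> U" "((\<lambda>t. f (s t)) \<longlongrightarrow> f x) F"
proof -
  show ev: "\<forall>\<^sub>F t in F. s t \<in> U"
    using assms chart_openin[OF assms(1)] unfolding limitin_def by blast
  have "limitin (subtopology T U) s x F"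
    using assms ev by (simp add: limitin_subtopology)
  from continuous_map_limit[OF chart_continuous[OF assms(1)] this]
  show "((\<lambda>t. f (s t)) \<longlongrightarrow> f x) F" by (simp add: comp_def)
qed

lemma Ck_mult:
  assumes "(U1, f1) \<in> atlas G" "(U2, f2) \<in> atlas G" "(U3, f3) \<in> atlas G"
  shows "Ck_on k {(f1 x, f2 y) | x y. x \<in> U1 \<and> y \<in> U2 \<and> x \<otimes> y \<in> U3}
         (\<lambda>(p, q). f3 (inv_into U1 f1 p \<otimes> inv_into U2 f2 q))"
proof -
  have "\<forall>(V, \<phi>)\<in>atlas G. \<forall>(V', \<phi>')\<in>atlas G. \<forall>(V'', \<phi>'')\<in>atlas G.
       smooth_on {(\<phi> x, \<phi>' y) | x y. x \<in> V \<and> y \<in> V' \<and> x \<otimes> y \<in> V''}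
         (\<lambda>(p, q). \<phi>'' (inv_into V \<phi> p \<otimes> inv_into V' \<phi>' q))"
    using lie unfolding lie_group_def by (elim conjE)
  from this[THEN bspec, OF assms(1), simplified, THEN bspec, OF assms(2), simplified,
      THEN bspec, OF assms(3), simplified] show ?thesis
    by (simp add: smooth_on_def)
qed

lemma open_mult_dom:
  assumes "(U1, f1) \<in> atlas G" "(U2, f2) \<in> atlas G" "(U3, f3) \<in> atlas G"
  shows "open {(f1 x, f2 y) | x y. x \<in> U1 \<and> y \<in> U2 \<and> x \<otimes> y \<in> U3}" (is "open ?D")
proof -
  have 1: "continuous_map (top_of_set (f1 ` U1 \<times> f2 ` U2)) T (inv_into U1 f1 \<circ> fst)"
    by (rule continuous_map_compose[OF _ chart_inv_continuous[OF assms(1)]])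
      (auto intro!: continuous_intros)
  have 2: "continuous_map (top_of_set (f1 ` U1 \<times> f2 ` U2)) T (inv_into U2 f2 \<circ> snd)"
    by (rule continuous_map_compose[OF _ chart_inv_continuous[OF assms(2)]])
      (auto intro!: continuous_intros)
  have "continuous_map (top_of_set (f1 ` U1 \<times> f2 ` U2)) T
      ((\<lambda>(x, y). x \<otimes> y) \<circ> (\<lambda>z. ((inv_into U1 f1 \<circ> fst) z, (inv_into U2 f2 \<circ> snd) z)))"
    using continuous_map_pairedI[OF 1 2] mult_continuous by (rule continuous_map_compose)
  from openin_continuous_map_preimage[OF this chart_openin[OF assms(3)]]
  have "openin (top_of_set (f1 ` U1 \<times> f2 ` U2))
    {z \<in> f1 ` U1 \<times> f2 ` U2. inv_into U1 f1 (fst z) \<otimes> inv_into U2 f2 (snd z) \<in> U3}"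
    by simp
  then have "open {z \<in> f1 ` U1 \<times> f2 ` U2. inv_into U1 f1 (fst z) \<otimes> inv_into U2 f2 (snd z) \<in> U3}"
    using openin_open_trans open_Times chart_open assms by blast
  also have "{z \<in> f1 ` U1 \<times> f2 ` U2. inv_into U1 f1 (fst z) \<otimes> inv_into U2 f2 (snd z) \<in> U3} = ?D"
    using assms by force
  finally show ?thesis .
qed

lemma mult_differentiable:
  assumes "(U1, f1) \<in> atlas G" "(U2, f2) \<in> atlas G" "(U3, f3) \<in> atlas G"
    and "x \<in> U1" "y \<in> U2" "x \<otimes> y \<in> U3"
  shows "(\<lambda>(p, q). f3 (inv_into U1 f1 p \<otimes> inv_into U2 f2 q)) differentiable (at (f1 x, f2 y))"
proof -
  have "(f1 x, f2 y) \<in> {(f1 x, f2 y) | x y. x \<in> U1 \<and> y \<in> U2 \<and> x \<otimes> y \<in> U3}"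
    using assms by blast
  then show ?thesis using Ck_mult[OF assms(1-3), of 1] by (simp only: One_nat_def Ck_on.simps)
qed

lemma lmult_differentiable:
  assumes "(U1, f1) \<in> atlas G" "(U2, f2) \<in> atlas G" "g \<in> carrier G" "x \<in> U1" "g \<otimes> x \<in> U2"
  shows "(\<lambda>p. f2 (g \<otimes> inv_into U1 f1 p)) differentiable (at (f1 x))"
proof -
  obtain U f where U: "(U, f) \<in> atlas G" "g \<in> U" using assms chart_at by blast
  have "(\<lambda>p. (f g, p)) differentiable (at (f1 x))"
    by (rule differentiableI, rule has_derivative_Pair) (rule has_derivative_const has_derivative_ident)+
  from differentiable_compose[OF mult_differentiable[OF U(1) assms(1,2) U(2) assms(4,5)] this]
  show ?thesis using U by simp
qed

lemma rmult_differentiable: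
  assumes "(U1, f1) \<in> atlas G" "(U2, f2) \<in> atlas G" "g \<in> carrier G" "x \<in> U1" "x \<otimes> g \<in> U2"
  shows "(\<lambda>p. f2 (inv_into U1 f1 p \<otimes> g)) differentiable (at (f1 x))"
proof -
  obtain U f where U: "(U, f) \<in> atlas G" "g \<in> U" using assms chart_at by blast
  have "(\<lambda>p. (p, f g)) differentiable (at (f1 x))"
    by (rule differentiableI, rule has_derivative_Pair) (rule has_derivative_const has_derivative_ident)+
  from differentiable_compose[OF mult_differentiable[OF assms(1) U(1) assms(2) assms(4) U(2) assms(5)] this]
  show ?thesis using U by simp
qed

text \<open>The two translations are composed through an auxiliary chart around \<open>a\<close>.
  The composite agrees with the two-sided translation only near \<open>e0\<close>, which is enough
  for a derivative there.\<close>

lemma lrmult_differentiable: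
  assumes "(U, f) \<in> atlas G" "a \<in> carrier G" "b \<in> carrier G" "a \<otimes> b \<in> U"
  shows "(\<lambda>p. f (a \<otimes> \<psi> p \<otimes> b)) differentiable (at e0)"
proof -
  obtain U' f' where U': "(U', f') \<in> atlas G" "a \<in> U'" using assms chart_at by blast
  have d: "(\<lambda>p. f' (a \<otimes> \<psi> p)) differentiable (at e0)"
    using lmult_differentiable[OF one_chart(1) U'(1) assms(2), of \<one>] one_chart U' assms
    by (simp add: \<psi>_def)
  have "(\<lambda>p. f (inv_into U' f' p \<otimes> b)) differentiable (at (f' (a \<otimes> \<psi> e0)))"
    using rmult_differentiable[OF U'(1) assms(1) assms(3) U'(2)] assms U' by simp
  from differentiable_compose[OF this d]
  have "(\<lambda>p. f (inv_into U' f' (f' (a \<otimes> \<psi> p)) \<otimes> b)) differentiable (at e0)" .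
  then obtain D where D: "((\<lambda>p. f (inv_into U' f' (f' (a \<otimes> \<psi> p)) \<otimes> b)) has_derivative D) (at e0)"
    by (auto simp: differentiable_def)
  let ?W = "{p\<in>\<phi> ` V. a \<otimes> inv_into V \<phi> p \<in> U'}"
  have W: "open ?W" by (rule open_chart_preimage[OF one_chart(1) chart_openin[OF U'(1)]
        continuous_map_lmult[OF assms(2)]])
  have "e0 \<in> ?W" using U' assms one_chart by (auto simp flip: \<psi>_def)
  then have "((\<lambda>p. f (a \<otimes> \<psi> p \<otimes> b)) has_derivative D) (at e0)"
    by (rule has_derivative_transform_within_open[OF D W]) (use U' in \<open>auto simp flip: \<psi>_def\<close>)
  then show ?thesis by (auto simp: differentiable_def)
qed

text \<open>Velocity of a curve through \<open>\<one>\<close>, in the chart that identifies the Lie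
  algebra with the coordinate space. Only the behaviour near \<open>0\<close> is constrained, so
  products, inverses and conjugates of such curves are again of this kind.\<close>

definition tang :: "(real \<Rightarrow> 'g) \<Rightarrow> 'e \<Rightarrow> bool" where
  "tang f X \<longleftrightarrow> f 0 = \<one> \<and> (\<forall>\<^sub>F t in at 0. f t \<in> V) \<and> ((\<lambda>t. \<phi> (f t)) has_vector_derivative X) (at 0)"

lemma tang_limitin: assumes "tang f X" shows "limitin T f \<one> (at 0)"
proof -
  have "isCont (\<lambda>t. \<phi> (f t)) 0"
    using assms has_vector_derivative_continuous unfolding tang_def by blast
  then have "((\<lambda>t. \<phi> (f t)) \<longlongrightarrow> \<phi> \<one>) (at 0)"
    using assms by (simp add: isCont_def tang_def)
  then show ?thesis
    using limitin_chart[OF one_chart, of f "at 0"] assms unfolding tang_def by blast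
qed

lemma chain_derivative:
  assumes "tang f X" "(U, h) \<in> atlas G" "a \<in> carrier G" "b \<in> carrier G" "a \<otimes> b \<in> U"
  shows "((\<lambda>t. h (a \<otimes> f t \<otimes> b)) has_vector_derivative
     frechet_derivative (\<lambda>p. h (a \<otimes> \<psi> p \<otimes> b)) (at e0) X) (at 0)"
proof -
  let ?D = "frechet_derivative (\<lambda>p. h (a \<otimes> \<psi> p \<otimes> b)) (at e0)"
  have D: "((\<lambda>p. h (a \<otimes> \<psi> p \<otimes> b)) has_derivative ?D) (at (\<phi> (f 0)))"
    using lrmult_differentiable[OF assms(2-5), THEN frechet_derivative_works[THEN iffD1]] assms(1)
    by (simp add: tang_def)
  have "((\<lambda>t. \<phi> (f t)) has_derivative (\<lambda>t. t *\<^sub>R X)) (at 0)"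
    using assms(1) by (simp add: tang_def has_vector_derivative_def)
  from has_derivative_compose[OF this D]
  have 1: "((\<lambda>t. h (a \<otimes> \<psi> (\<phi> (f t)) \<otimes> b)) has_derivative (\<lambda>t. ?D (t *\<^sub>R X))) (at 0)" .
  have "\<forall>\<^sub>F t in at 0. h (a \<otimes> \<psi> (\<phi> (f t)) \<otimes> b) = h (a \<otimes> f t \<otimes> b)"
    using assms(1) unfolding tang_def by (auto elim: eventually_mono)
  from has_derivative_transform_eventually[OF 1 this]
  have "((\<lambda>t. h (a \<otimes> f t \<otimes> b)) has_derivative (\<lambda>t. ?D (t *\<^sub>R X))) (at 0)"
    using assms(1) one_chart by (simp add: tang_def)
  moreover have "linear ?D" using D has_derivative_linear by blast
  ultimately show ?thesis by (simp add: has_vector_derivative_def linear_cmul)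
qed

lemma limitin_eventually_carrier: "limitin T f a F \<Longrightarrow> \<forall>\<^sub>F t in F. f t \<in> carrier G"
  using topspace_T unfolding limitin_def by (metis openin_topspace)

lemma limitin_eventually_V: "limitin T f \<one> F \<Longrightarrow> \<forall>\<^sub>F t in F. f t \<in> V"
  using limitin_chartD one_chart by blast

lemma tang_lrmult:
  assumes "tang f X" "a \<in> carrier G" "b \<in> carrier G" "a \<otimes> b = \<one>"
  shows "tang (\<lambda>t. a \<otimes> f t \<otimes> b) (frechet_derivative (\<lambda>p. \<phi> (a \<otimes> \<psi> p \<otimes> b)) (at e0) X)"
  unfolding tang_def
proof (intro conjI)
  show "a \<otimes> f 0 \<otimes> b = \<one>" using assms by (simp add: tang_def)
  have "limitin T (\<lambda>t. a \<otimes> f t \<otimes> b) (a \<otimes> \<one> \<otimes> b) (at 0)"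
    by (intro limitin_mult limitin_const_T tang_limitin[OF assms(1)] assms)
  then show "\<forall>\<^sub>F t in at 0. a \<otimes> f t \<otimes> b \<in> V"
    using assms limitin_eventually_V by simp
  show "((\<lambda>t. \<phi> (a \<otimes> f t \<otimes> b)) has_vector_derivative
      frechet_derivative (\<lambda>p. \<phi> (a \<otimes> \<psi> p \<otimes> b)) (at e0) X) (at 0)"
    using chain_derivative[OF assms(1) one_chart(1) assms(2,3)] assms one_chart by simp
qed

lemma tang_conj:
  assumes "tang f X" "g \<in> carrier G"
  shows "tang (\<lambda>t. g \<otimes> f t \<otimes> inv g) (Ad G g X)"
  using tang_lrmult[OF assms(1,2), of "inv g"] assms by (simp add: Ad_def)

text \<open>Along each factor separately the product is the identity map in coordinates, so the
  derivative restricts to the identity on both summands; linearity then makes it addition.\<close>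

lemma m_derivative:
  "((\<lambda>(p, q). \<phi> (\<psi> p \<otimes> \<psi> q)) has_derivative (\<lambda>(v, w). v + w)) (at (e0, e0))"
proof -
  have "(\<lambda>(p, q). \<phi> (\<psi> p \<otimes> \<psi> q)) differentiable (at (e0, e0))"
    using mult_differentiable[OF one_chart(1) one_chart(1) one_chart(1) one_chart(2,2)] one_chart(2)
    by (simp add: \<psi>_def)
  then obtain D where D: "((\<lambda>(p, q). \<phi> (\<psi> p \<otimes> \<psi> q)) has_derivative D) (at (e0, e0))"
    by (auto simp: differentiable_def)
  have "((\<lambda>p::'e. (p, e0)) has_derivative (\<lambda>v. (v, 0))) (at e0)"
    by (intro has_derivative_Pair has_derivative_const has_derivative_ident)
  from has_derivative_compose[OF this D]
  have "((\<lambda>p. \<phi> (\<psi> p \<otimes> \<one>)) has_derivative (\<lambda>v. D (v, 0))) (at e0)" by simp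
  then have "((\<lambda>p. p) has_derivative (\<lambda>v. D (v, 0))) (at e0)"
    by (rule has_derivative_transform_within_open[OF _ open_\<phi>V e0_in])
      (use \<psi>_in V_carrier in auto)
  then have 1: "D (v, 0) = v" for v using has_derivative_unique has_derivative_ident by metis
  have "((\<lambda>p::'e. (e0, p)) has_derivative (\<lambda>v. (0, v))) (at e0)"
    by (intro has_derivative_Pair has_derivative_const has_derivative_ident)
  from has_derivative_compose[OF this D]
  have "((\<lambda>p. \<phi> (\<one> \<otimes> \<psi> p)) has_derivative (\<lambda>v. D (0, v))) (at e0)" by simp
  then have "((\<lambda>p. p) has_derivative (\<lambda>v. D (0, v))) (at e0)"
    by (rule has_derivative_transform_within_open[OF _ open_\<phi>V e0_in])
      (use \<psi>_in V_carrier in auto)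
  then have 2: "D (0, v) = v" for v using has_derivative_unique has_derivative_ident by metis
  have "D = (\<lambda>(v, w). v + w)"
  proof
    fix z :: "'e \<times> 'e"
    obtain v w where z: "z = (v, w)" by (cases z)
    have "linear D" using D has_derivative_linear by blast
    from linear_add[OF this, of "(v, 0)" "(0, w)"] show "D z = (case z of (v, w) \<Rightarrow> v + w)"
      using 1 2 z by simp
  qed
  with D show ?thesis by simp
qed

lemma tang_mult:
  assumes f: "tang f X" and g: "tang g Y"
  shows "tang (\<lambda>t. f t \<otimes> g t) (X + Y)"
  unfolding tang_def
proof (intro conjI)
  show "f 0 \<otimes> g 0 = \<one>" using assms by (simp add: tang_def)
  have "limitin T (\<lambda>t. f t \<otimes> g t) (\<one> \<otimes> \<one>) (at 0)"
    using limitin_mult tang_limitin assms by blast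
  then show "\<forall>\<^sub>F t in at 0. f t \<otimes> g t \<in> V" using limitin_eventually_V by simp
  have "((\<lambda>t. (\<phi> (f t), \<phi> (g t))) has_derivative (\<lambda>t. (t *\<^sub>R X, t *\<^sub>R Y))) (at 0)"
    using assms by (intro has_derivative_Pair) (auto simp: tang_def has_vector_derivative_def)
  from has_derivative_compose[OF this, of "\<lambda>(p, q). \<phi> (\<psi> p \<otimes> \<psi> q)" "\<lambda>(v, w). v + w"] m_derivative assms
  have 1: "((\<lambda>t. \<phi> (\<psi> (\<phi> (f t)) \<otimes> \<psi> (\<phi> (g t)))) has_derivative (\<lambda>t. t *\<^sub>R X + t *\<^sub>R Y)) (at 0)"
    by (simp add: tang_def)
  have "\<forall>\<^sub>F t in at 0. f t \<in> V" "\<forall>\<^sub>F t in at 0. g t \<in> V" using assms by (auto simp: tang_def)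
  then have "\<forall>\<^sub>F t in at 0. \<phi> (\<psi> (\<phi> (f t)) \<otimes> \<psi> (\<phi> (g t))) = \<phi> (f t \<otimes> g t)"
    by eventually_elim simp
  from has_derivative_transform_eventually[OF 1 this]
  show "((\<lambda>t. \<phi> (f t \<otimes> g t)) has_vector_derivative X + Y) (at 0)"
    using assms one_chart by (simp add: tang_def has_vector_derivative_def scaleR_add_right)
qed

end

section \<open>The adjoint representation and logarithmic derivatives\<close>

context lie begin

lemma tang_one: "tang (\<lambda>t. \<one>) 0"
  using one_chart by (simp add: tang_def)

lemma tang_unique: "tang f X \<Longrightarrow> tang f Y \<Longrightarrow> X = Y"
  unfolding tang_def using vector_derivative_unique_at by blast

lemma tang_cong:
  assumes "tang f X" "g 0 = \<one>" "\<forall>\<^sub>F t in at 0. f t = g t"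
  shows "tang g X"
  unfolding tang_def
proof (intro conjI)
  show "\<forall>\<^sub>F t in at 0. g t \<in> V"
    using assms(1,3) unfolding tang_def by (auto elim: eventually_elim2)
  have "((\<lambda>t. \<phi> (f t)) has_derivative (\<lambda>t. t *\<^sub>R X)) (at 0)"
    using assms(1) by (simp add: tang_def has_vector_derivative_def)
  moreover have "\<forall>\<^sub>F t in at 0. \<phi> (f t) = \<phi> (g t)"
    using assms(3) by eventually_elim simp
  ultimately show "((\<lambda>t. \<phi> (g t)) has_vector_derivative X) (at 0)"
    using assms(1,2) unfolding has_vector_derivative_def
    by (auto intro: has_derivative_transform_eventually simp: tang_def)
qed fact

text \<open>Supplies a curve with prescribed velocity before the exponential map is available. The
  rules for \<open>Ad\<close> then follow from uniqueness of velocities.\<close>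

lemma tang_line: "tang (\<lambda>t. \<psi> (e0 + t *\<^sub>R X)) X"
proof -
  have "((\<lambda>t::real. e0 + t *\<^sub>R X) \<longlongrightarrow> e0 + 0 *\<^sub>R X) (at 0)" by (intro tendsto_intros)
  then have ev: "\<forall>\<^sub>F t in at 0. e0 + t *\<^sub>R X \<in> \<phi> ` V"
    using topological_tendstoD[OF _ open_\<phi>V] e0_in by simp
  have "((\<lambda>t. e0 + t *\<^sub>R X) has_derivative (\<lambda>t. t *\<^sub>R X)) (at 0)"
    by (auto intro!: derivative_eq_intros)
  moreover have "\<forall>\<^sub>F t in at 0. e0 + t *\<^sub>R X = \<phi> (\<psi> (e0 + t *\<^sub>R X))"
    using ev by eventually_elim simp
  ultimately have "((\<lambda>t. \<phi> (\<psi> (e0 + t *\<^sub>R X))) has_derivative (\<lambda>t. t *\<^sub>R X)) (at 0)"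
    by (rule has_derivative_transform_eventually) auto
  with ev show ?thesis by (auto simp: tang_def has_vector_derivative_def \<psi>_in elim: eventually_mono)
qed

lemma Ad_has_derivative:
  assumes "g \<in> carrier G"
  shows "((\<lambda>p. \<phi> (g \<otimes> \<psi> p \<otimes> inv g)) has_derivative Ad G g) (at e0)"
  using lrmult_differentiable[OF one_chart(1), of g "inv g"] assms one_chart
  unfolding Ad_def by (simp add: frechet_derivative_works)

lemma linear_Ad: "g \<in> carrier G \<Longrightarrow> linear (Ad G g)"
  using Ad_has_derivative has_derivative_linear by blast

lemma Ad_mult: assumes "g \<in> carrier G" "h \<in> carrier G"
  shows "Ad G (g \<otimes> h) X = Ad G g (Ad G h X)"
proof -
  let ?f = "\<lambda>t. \<psi> (e0 + t *\<^sub>R X)"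
  have "tang (\<lambda>t. g \<otimes> (h \<otimes> ?f t \<otimes> inv h) \<otimes> inv g) (Ad G g (Ad G h X))"
    by (intro tang_conj tang_line assms)
  then have "tang (\<lambda>t. g \<otimes> h \<otimes> ?f t \<otimes> inv (g \<otimes> h)) (Ad G g (Ad G h X))"
  proof (rule tang_cong)
    show "\<forall>\<^sub>F t in at 0. g \<otimes> (h \<otimes> ?f t \<otimes> inv h) \<otimes> inv g = g \<otimes> h \<otimes> ?f t \<otimes> inv (g \<otimes> h)"
    using tang_limitin[OF tang_line[of X], THEN limitin_eventually_carrier]
    by eventually_elim (use assms in \<open>simp add: m_assoc inv_mult_group\<close>)
  qed (use assms in simp)
  moreover have "tang (\<lambda>t. g \<otimes> h \<otimes> ?f t \<otimes> inv (g \<otimes> h)) (Ad G (g \<otimes> h) X)"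
    by (intro tang_conj tang_line) (use assms in auto)
  ultimately show ?thesis using tang_unique by blast
qed

lemma Ad_one: "Ad G \<one> X = X"
proof -
  have "tang (\<lambda>t. \<one> \<otimes> \<psi> (e0 + t *\<^sub>R X) \<otimes> inv \<one>) (Ad G \<one> X)"
    by (intro tang_conj tang_line) auto
  moreover have "\<forall>\<^sub>F t in at 0. \<one> \<otimes> \<psi> (e0 + t *\<^sub>R X) \<otimes> inv \<one> = \<psi> (e0 + t *\<^sub>R X)"
    using tang_limitin[OF tang_line[of X], THEN limitin_eventually_carrier]
    by eventually_elim simp
  ultimately have "tang (\<lambda>t. \<psi> (e0 + t *\<^sub>R X)) (Ad G \<one> X)"
    using tang_cong by fastforce
  then show ?thesis using tang_unique tang_line by blast
qed

lemma Ad_inv [simp]: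
  assumes "g \<in> carrier G"
  shows "Ad G g (Ad G (inv g) X) = X" "Ad G (inv g) (Ad G g X) = X"
  using assms by (simp_all flip: Ad_mult add: Ad_one)

lemma Ad_add: "g \<in> carrier G \<Longrightarrow> Ad G g (X + Y) = Ad G g X + Ad G g Y"
  by (simp add: linear_Ad linear_add)

lemma Ad_minus: "g \<in> carrier G \<Longrightarrow> Ad G g (- X) = - Ad G g X"
  by (simp add: linear_Ad linear_neg)

lemma Ad_diff: "g \<in> carrier G \<Longrightarrow> Ad G g (X - Y) = Ad G g X - Ad G g Y"
  by (simp add: linear_Ad linear_diff)

lemma Ad_scale: "g \<in> carrier G \<Longrightarrow> Ad G g (c *\<^sub>R X) = c *\<^sub>R Ad G g X"
  by (simp add: linear_Ad linear_cmul)

lemma Ad_zero [simp]: "g \<in> carrier G \<Longrightarrow> Ad G g 0 = 0"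
  by (simp add: linear_Ad linear_0)

lemma Ck_inv:
  assumes "(U1, f1) \<in> atlas G" "(U2, f2) \<in> atlas G"
  shows "Ck_on k {f1 x | x. x \<in> U1 \<and> inv x \<in> U2} (\<lambda>p. f2 (inv (inv_into U1 f1 p)))"
proof -
  have "\<forall>(V, \<phi>)\<in>atlas G. \<forall>(V', \<phi>')\<in>atlas G.
       smooth_on {\<phi> x | x. x \<in> V \<and> inv x \<in> V'} (\<lambda>p. \<phi>' (inv (inv_into V \<phi> p)))"
    using lie unfolding lie_group_def by (elim conjE)
  from this[THEN bspec, OF assms(1), simplified, THEN bspec, OF assms(2), simplified]
  show ?thesis by (simp add: smooth_on_def)
qed

definition \<iota> :: "'e \<Rightarrow> 'e" where "\<iota> p = \<phi> (inv (\<psi> p))"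

lemma \<iota>_differentiable: "\<iota> differentiable (at e0)"
proof -
  have "e0 \<in> {\<phi> x | x. x \<in> V \<and> inv x \<in> V}" using one_chart by force
  then show ?thesis
    using Ck_inv[OF one_chart(1) one_chart(1), of 1]
    by (simp only: One_nat_def Ck_on.simps flip: \<psi>_def \<iota>_def)
qed

text \<open>Smoothness of inversion yields some velocity \<open>D X\<close>; its value follows
  because the product of the two curves is constant.\<close>

lemma tang_inv: assumes "tang f X" shows "tang (\<lambda>t. inv (f t)) (- X)"
proof -
  have f0: "f 0 = \<one>" and fV: "\<forall>\<^sub>F t in at 0. f t \<in> V"
    and fd: "((\<lambda>t. \<phi> (f t)) has_derivative (\<lambda>t. t *\<^sub>R X)) (at 0)"
    using assms by (auto simp: tang_def has_vector_derivative_def)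
  obtain D where D: "(\<iota> has_derivative D) (at e0)"
    using \<iota>_differentiable by (auto simp: differentiable_def)
  have lD: "linear D" using D has_derivative_linear by blast
  have "((\<lambda>t. \<iota> (\<phi> (f t))) has_derivative (\<lambda>t. D (t *\<^sub>R X))) (at 0)"
    using has_derivative_compose[OF fd] D f0 by simp
  moreover have "\<forall>\<^sub>F t in at 0. \<iota> (\<phi> (f t)) = \<phi> (inv (f t))"
    using fV by eventually_elim (simp add: \<iota>_def)
  ultimately have d: "((\<lambda>t. \<phi> (inv (f t))) has_derivative (\<lambda>t. D (t *\<^sub>R X))) (at 0)"
    by (rule has_derivative_transform_eventually) (use f0 one_chart in \<open>auto simp: \<iota>_def\<close>)
  have "limitin T (\<lambda>t. inv (f t)) (inv \<one>) (at 0)"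
    by (rule limitin_inv[OF tang_limitin[OF assms]])
  then have t: "tang (\<lambda>t. inv (f t)) (D X)"
    using d f0 limitin_eventually_V
    by (simp add: tang_def has_vector_derivative_def linear_cmul[OF lD])
  have "tang (\<lambda>t. \<one>) (X + D X)"
  proof (rule tang_cong[OF tang_mult[OF assms t]])
    show "\<forall>\<^sub>F t in at 0. f t \<otimes> inv (f t) = \<one>"
      using fV by eventually_elim (simp add: V_carrier)
  qed simp
  then have "X + D X = 0" using tang_unique tang_one by blast
  then have "D X = - X" by (simp add: eq_neg_iff_add_eq_0 add.commute)
  then show ?thesis using t by simp
qed

lemma tang_reparam:
  assumes "tang f X" "k 0 = 0" "(k has_real_derivative c) (at 0)"
  shows "tang (\<lambda>t. f (k t)) (c *\<^sub>R X)"
  unfolding tang_def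
proof (intro conjI)
  have f0: "f 0 = \<one>" and fd: "((\<lambda>t. \<phi> (f t)) has_derivative (\<lambda>t. t *\<^sub>R X)) (at 0)"
    using assms by (auto simp: tang_def has_vector_derivative_def)
  show "f (k 0) = \<one>" using f0 assms by simp
  have "\<forall>\<^sub>F t in nhds 0. f t \<in> V"
    using assms(1) f0 one_chart by (simp add: tang_def eventually_nhds_conv_at)
  moreover have "(k \<longlongrightarrow> 0) (at 0)"
    using DERIV_isCont[OF assms(3)] assms(2) by (simp add: isCont_def)
  ultimately show "\<forall>\<^sub>F t in at 0. f (k t) \<in> V"
    using eventually_compose_filterlim by blast
  have "(k has_derivative (\<lambda>t. c * t)) (at 0)"
    using assms(3) by (simp add: has_field_derivative_def)
  from has_derivative_compose[OF this, of "\<lambda>t. \<phi> (f t)"] fd assms(2)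
  show "((\<lambda>t. \<phi> (f (k t))) has_vector_derivative c *\<^sub>R X) (at 0)"
    by (simp add: has_vector_derivative_def mult.commute)
qed

text \<open>The left logarithmic derivative \<open>\<delta>\<inverse> \<delta>'\<close> at \<open>t\<close>, read in the chart at \<open>\<one>\<close>.\<close>

definition ldiff :: "(real \<Rightarrow> 'g) \<Rightarrow> real \<Rightarrow> 'e \<Rightarrow> bool" where
  "ldiff \<delta> t X \<longleftrightarrow> (\<forall>s. \<delta> s \<in> carrier G) \<and> tang (\<lambda>h. inv (\<delta> t) \<otimes> \<delta> (t + h)) X"

lemma ldiff_const: "g \<in> carrier G \<Longrightarrow> ldiff (\<lambda>t. g) t 0"
  by (simp add: ldiff_def tang_one)

lemma inv_cancel: "a \<in> carrier G \<Longrightarrow> b \<in> carrier G \<Longrightarrow> inv a \<otimes> (a \<otimes> b) = b"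
  "a \<in> carrier G \<Longrightarrow> b \<in> carrier G \<Longrightarrow> a \<otimes> (inv a \<otimes> b) = b"
  by (simp_all flip: m_assoc)

text \<open>The increment of a product is the increment of the left factor, conjugated by the
  inverse of the right factor, times the increment of the right factor.\<close>

lemma ldiff_mult:
  assumes "ldiff f t X" "ldiff g t Y"
  shows "ldiff (\<lambda>t. f t \<otimes> g t) t (Ad G (inv (g t)) X + Y)"
proof -
  have c: "f s \<in> carrier G" "g s \<in> carrier G" for s using assms by (auto simp: ldiff_def)
  have "tang (\<lambda>h. inv (g t) \<otimes> (inv (f t) \<otimes> f (t + h)) \<otimes> inv (inv (g t)))
        (Ad G (inv (g t)) X)"
    using assms by (intro tang_conj) (auto simp: ldiff_def)
  from tang_mult[OF this] assms(2)
  have "tang (\<lambda>h. inv (g t) \<otimes> (inv (f t) \<otimes> f (t + h)) \<otimes> inv (inv (g t))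
      \<otimes> (inv (g t) \<otimes> g (t + h))) (Ad G (inv (g t)) X + Y)"
    by (simp add: ldiff_def)
  moreover have "inv (g t) \<otimes> (inv (f t) \<otimes> f (t + h)) \<otimes> inv (inv (g t))
      \<otimes> (inv (g t) \<otimes> g (t + h)) = inv (f t \<otimes> g t) \<otimes> (f (t + h) \<otimes> g (t + h))" for h
    using c by (simp add: m_assoc inv_mult_group inv_cancel)
  ultimately show ?thesis using c by (simp add: ldiff_def)
qed

lemma ldiff_inv:
  assumes "ldiff f t X"
  shows "ldiff (\<lambda>t. inv (f t)) t (- Ad G (f t) X)"
proof -
  have c: "f s \<in> carrier G" for s using assms by (auto simp: ldiff_def)
  have "tang (\<lambda>h. f t \<otimes> inv (inv (f t) \<otimes> f (t + h)) \<otimes> inv (f t)) (Ad G (f t) (- X))"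
    using assms by (intro tang_conj tang_inv) (auto simp: ldiff_def)
  moreover have "f t \<otimes> inv (inv (f t) \<otimes> f (t + h)) \<otimes> inv (f t) =
      inv (inv (f t)) \<otimes> inv (f (t + h))" for h
    using c by (simp add: m_assoc inv_mult_group)
  ultimately show ?thesis using c by (simp add: ldiff_def Ad_minus)
qed

lemma ldiff_compose:
  assumes "ldiff f (k t) X" "(k has_real_derivative c) (at t)"
  shows "ldiff (\<lambda>s. f (k s)) t (c *\<^sub>R X)"
proof -
  have "((\<lambda>h. k (t + h) - k t) has_real_derivative c) (at 0)"
    using DERIV_at_within_shift[of k c t 0 UNIV] assms(2)
    by (auto intro!: derivative_eq_intros simp: add.commute)
  then have "tang (\<lambda>h. inv (f (k t)) \<otimes> f (k t + (k (t + h) - k t))) (c *\<^sub>R X)"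
    using tang_reparam[of "\<lambda>h. inv (f (k t)) \<otimes> f (k t + h)" X "\<lambda>h. k (t + h) - k t" c] assms(1)
    by (simp add: ldiff_def)
  then show ?thesis using assms(1) by (simp add: ldiff_def)
qed

lemma ldiff_limitin: assumes "ldiff f t X" shows "limitin T f (f t) (at t)"
proof -
  have c: "f s \<in> carrier G" for s using assms by (auto simp: ldiff_def)
  have "limitin T (\<lambda>h. f t \<otimes> (inv (f t) \<otimes> f (t + h))) (f t \<otimes> \<one>) (at 0)"
    using assms c by (intro limitin_mult limitin_const_T tang_limitin) (auto simp: ldiff_def)
  then have "limitin T (\<lambda>h. f (t + h)) (f t) (at 0)"
    using c by (simp add: inv_cancel)
  then show ?thesis
    unfolding limitin_def by (simp add: eventually_at_to_0[of _ t] add.commute)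
qed

lemma ldiff_chart_derivative:
  assumes "ldiff f t X" "(U, u) \<in> atlas G" "f t \<in> U"
  shows "((\<lambda>s. u (f s)) has_vector_derivative
     frechet_derivative (\<lambda>p. u (f t \<otimes> \<psi> p \<otimes> \<one>)) (at e0) X) (at t)" (is "(_ has_vector_derivative ?D) _")
proof -
  have c: "f s \<in> carrier G" for s using assms by (auto simp: ldiff_def)
  have "((\<lambda>h. u (f t \<otimes> (inv (f t) \<otimes> f (t + h)) \<otimes> \<one>)) has_vector_derivative ?D) (at 0)"
    using assms c by (intro chain_derivative) (auto simp: ldiff_def)
  then have "((\<lambda>h. u (f (t + h))) has_vector_derivative ?D) (at (t - t))"
    using c by (simp add: inv_cancel)
  moreover have "((\<lambda>s. s - t) has_vector_derivative 1) (at t)"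
    by (auto simp: has_vector_derivative_def intro!: derivative_eq_intros)
  ultimately have "((\<lambda>s. u (f (t + (s - t)))) has_vector_derivative 1 *\<^sub>R ?D) (at t)"
    using vector_diff_chain_at[of "\<lambda>s. s - t" 1 t "\<lambda>h. u (f (t + h))" ?D]
    by (auto simp: comp_def)
  then show ?thesis by simp
qed

text \<open>In a chart the ordinary derivative vanishes too, so the curve is locally constant, and
  the interval is connected.\<close>

lemma ldiff_zero_constant:
  assumes "open I" "connected I" "\<And>t. t \<in> I \<Longrightarrow> ldiff f t 0" "s \<in> I" "t \<in> I"
  shows "f s = f t"
proof (rule connected_local_const[OF assms(2,4,5)], intro ballI)
  fix t0 assume t0: "t0 \<in> I"
  have c: "f s \<in> carrier G" for s using assms by (auto simp: ldiff_def)
  obtain U u where U: "(U, u) \<in> atlas G" "f t0 \<in> U" using chart_at c by blast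
  have "\<forall>\<^sub>F t in nhds t0. f t \<in> U"
    using limitin_chartD(1)[OF U ldiff_limitin[OF assms(3)[OF t0]]] U by (simp add: eventually_nhds_conv_at)
  moreover have "\<forall>\<^sub>F t in nhds t0. t \<in> I" using assms(1) t0 eventually_nhds by blast
  ultimately have "\<forall>\<^sub>F t in nhds t0. f t \<in> U \<and> t \<in> I" by eventually_elim simp
  then obtain d where d: "d > 0" "\<And>t. dist t t0 < d \<Longrightarrow> f t \<in> U \<and> t \<in> I"
    by (auto simp: eventually_nhds_metric)
  have "((\<lambda>s. u (f s)) has_derivative (\<lambda>h. 0)) (at t within ball t0 d)" if "t \<in> ball t0 d" for t
  proof -
    have t: "f t \<in> U" "t \<in> I" using that d by (auto simp: dist_commute)
    have "linear (frechet_derivative (\<lambda>p. u (f t \<otimes> \<psi> p \<otimes> \<one>)) (at e0))"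
      using lrmult_differentiable[OF U(1), of "f t" \<one>] c t by (auto intro!: has_derivative_linear simp: frechet_derivative_works)
    then show ?thesis
      using ldiff_chart_derivative[OF assms(3)[OF t(2)] U(1) t(1)]
      by (auto simp: has_vector_derivative_def linear_0 intro: has_derivative_at_withinI)
  qed
  then obtain v where v: "\<And>t. t \<in> ball t0 d \<Longrightarrow> u (f t) = v"
    using has_derivative_zero_constant[OF convex_ball] by blast
  have "f t0 = f t" if "dist t t0 < d" for t
    using inj_onD[OF chart_inj[OF U(1)], of "f t0" "f t"] v[of t0] v[of t] d(2)[OF that] U(2) that d(1)
    by (simp add: dist_commute)
  then show "\<forall>\<^sub>F b in at t0 within I. f t0 = f b"
    using d(1) unfolding eventually_at by blast
qed

text \<open>The curve \<open>f t \<otimes> inv (g t)\<close> has vanishing logarithmic derivative.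
  This is the means by which identities between curves in the group are proved.\<close>

lemma ldiff_unique:
  assumes "open I" "connected I" "\<And>t. t \<in> I \<Longrightarrow> ldiff f t (X t)" "\<And>t. t \<in> I \<Longrightarrow> ldiff g t (X t)"
    and "t0 \<in> I" "f t0 = g t0" "t \<in> I"
  shows "f t = g t"
proof -
  have c: "f s \<in> carrier G" "g s \<in> carrier G" for s
    using assms(3)[OF assms(5)] assms(4)[OF assms(5)] by (auto simp: ldiff_def)
  have "ldiff (\<lambda>t. f t \<otimes> inv (g t)) t 0" if "t \<in> I" for t
    using ldiff_mult[OF assms(3)[OF that] ldiff_inv[OF assms(4)[OF that]]] c by simp
  from ldiff_zero_constant[OF assms(1,2) this assms(7,5)]
  have "f t \<otimes> inv (g t) = \<one>" using assms(6) c by simp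
  then show ?thesis using c inv_equality by (metis inv_closed inv_inv)
qed

end

section \<open>Smooth solutions of differential equations\<close>

lemma Ck_on_local:
  fixes f :: "'a::real_normed_vector \<Rightarrow> 'b::real_normed_vector"
  assumes "open S" "\<And>x. x \<in> S \<Longrightarrow> \<exists>W. open W \<and> x \<in> W \<and> Ck_on k W f"
  shows "Ck_on k S f"
  using assms(2)
proof (induction k arbitrary: f)
  case 0
  have "isCont f x" if "x \<in> S" for x
    using 0[OF that] by (auto simp: continuous_on_eq_continuous_at)
  then show ?case by (simp add: continuous_at_imp_continuous_on)
next
  case (Suc k)
  have "f differentiable (at x)" if "x \<in> S" for x using Suc.prems[OF that] by auto
  moreover have "Ck_on k S (\<lambda>x. frechet_derivative f (at x) v)" for v
    by (rule Suc.IH) (metis Suc.prems Ck_on.simps(2))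
  ultimately show ?case by simp
qed

lemma Ck_on_shift:
  fixes f :: "real \<Rightarrow> 'b::real_normed_vector"
  assumes "open S" "Ck_on k S f"
  shows "Ck_on k ((\<lambda>t. t + c) ` S) (\<lambda>t. f (t - c))"
proof (rule Ck_on_compose[OF _ assms(1) _ assms(2)])
  show o: "open ((\<lambda>t. t + c) ` S)"
    using open_translation[OF assms(1), of c] by (simp add: add.commute)
  show "Ck_on k ((\<lambda>t. t + c) ` S) (\<lambda>t. t - c)"
    using Ck_on_add[OF o Ck_on_bounded_linear[OF o bounded_linear_ident] Ck_on_const[OF o, of k "- c"]]
    by simp
qed auto

text \<open>On a compact ball the partial derivatives are bounded by continuity; the sum of their
  bounds is a Lipschitz constant.\<close>

lemma Ck_on_locally_Lipschitz:
  fixes f :: "'a::euclidean_space \<Rightarrow> 'b::real_normed_vector"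
  assumes "open S" "Ck_on 1 S f" "x0 \<in> S"
  obtains r L where "r > 0" "L \<ge> 0" "cball x0 r \<subseteq> S"
    "\<And>p q. p \<in> cball x0 r \<Longrightarrow> q \<in> cball x0 r \<Longrightarrow> norm (f p - f q) \<le> L * norm (p - q)"
proof -
  obtain r where r: "r > 0" "cball x0 r \<subseteq> S" using assms open_contains_cball by blast
  define D where "D p = frechet_derivative f (at p)" for p
  have D: "(f has_derivative D p) (at p)" if "p \<in> S" for p
    using Ck_on_SucD[of 0 S f p] assms(2) that by (simp add: D_def)
  have c: "continuous_on (cball x0 r) (\<lambda>p. D p b)" for b
    using assms(2) by (intro continuous_on_subset[OF _ r(2)]) (simp add: D_def)
  have "\<exists>B. \<forall>p\<in>cball x0 r. norm (D p b) \<le> B" for b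
    using compact_imp_bounded[OF compact_continuous_image[OF c compact_cball, of b]]
    by (auto simp: bounded_iff)
  then obtain B where B: "\<And>b p. p \<in> cball x0 r \<Longrightarrow> norm (D p b) \<le> B b" by metis
  have B0: "0 \<le> B b" for b using order_trans[OF norm_ge_zero B[of x0 b]] r by simp
  define L where "L = (\<Sum>b\<in>Basis. B b)"
  have L: "norm (D p v) \<le> L * norm v" if "p \<in> cball x0 r" for p v
  proof -
    have l: "linear (D p)" using D r(2) that has_derivative_linear by blast
    have "D p v = D p (\<Sum>b\<in>Basis. (v \<bullet> b) *\<^sub>R b)" by (simp add: euclidean_representation)
    also have "\<dots> = (\<Sum>b\<in>Basis. (v \<bullet> b) *\<^sub>R D p b)"
      by (simp add: linear_sum[OF l] linear_cmul[OF l])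
    finally have "norm (D p v) \<le> (\<Sum>b\<in>Basis. norm ((v \<bullet> b) *\<^sub>R D p b))"
      using norm_sum by metis
    also have "\<dots> \<le> (\<Sum>b\<in>Basis. B b * norm v)"
      by (intro sum_mono) (simp add: mult.commute[of "B _"] mult_mono Basis_le_norm B[OF that] B0)
    finally show ?thesis by (simp add: L_def sum_distrib_right)
  qed
  show ?thesis
  proof (rule that[of r L])
    show "L \<ge> 0" by (simp add: L_def B0 sum_nonneg)
    fix p q assume pq: "p \<in> cball x0 r" "q \<in> cball x0 r"
    show "norm (f p - f q) \<le> L * norm (p - q)"
    proof (rule differentiable_bound[OF convex_cball _ _ pq])
      fix x assume x: "x \<in> cball x0 r"
      show "(f has_derivative D x) (at x within cball x0 r)"
        using D x r(2) has_derivative_at_withinI by blast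
      show "onorm (D x) \<le> L" by (rule onorm_le) (rule L[OF x])
    qed
  qed (use r in auto)
qed

text \<open>Integrals start at \<open>-e\<close>, so that negative \<open>t\<close> causes no
  orientation problem; the difference is, up to sign, an integral over an interval of length at most
  \<open>e\<close>.\<close>

lemma norm_integral_diff_le:
  fixes g :: "real \<Rightarrow> 'b::euclidean_space"
  assumes "continuous_on {-e..e} g" "\<And>s. s \<in> {-e..e} \<Longrightarrow> norm (g s) \<le> B" "t \<in> {-e..e}" "e > 0"
  shows "norm (integral {-e..t} g - integral {-e..0} g) \<le> B * e"
proof -
  have B: "B \<ge> 0" using order_trans[OF norm_ge_zero assms(2)[of 0]] assms(4) by simp
  have i: "g integrable_on {a..b}" if "- e \<le> a" "b \<le> e" for a b
    using assms(1) that by (intro integrable_continuous_real continuous_on_subset[OF assms(1)]) auto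
  show ?thesis
  proof (cases "t \<ge> 0")
    case True
    have "integral {-e..0} g + integral {0..t} g = integral {-e..t} g"
      using True assms(3,4) i by (intro Henstock_Kurzweil_Integration.integral_combine) auto
    then have "norm (integral {-e..t} g - integral {-e..0} g) = norm (integral {0..t} g)"
      by (metis add_diff_cancel_left')
    also have "\<dots> \<le> B * (t - 0)"
      by (rule integral_bound) (use True assms continuous_on_subset[OF assms(1)] in auto)
    also have "\<dots> \<le> B * e" using B assms(3) by (simp add: mult_left_mono)
    finally show ?thesis .
  next
    case False
    have "integral {-e..t} g + integral {t..0} g = integral {-e..0} g"
      using False assms(3,4) i by (intro Henstock_Kurzweil_Integration.integral_combine) auto
    then have "norm (integral {-e..t} g - integral {-e..0} g) = norm (integral {t..0} g)"
      by (metis add_diff_cancel_left' norm_minus_commute)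
    also have "\<dots> \<le> B * (0 - t)"
      by (rule integral_bound) (use False assms continuous_on_subset[OF assms(1)] in auto)
    also have "\<dots> \<le> B * e" using B assms(3) by (intro mult_left_mono) auto
    finally show ?thesis .
  qed
qed

text \<open>Picard iteration by the Banach fixed point theorem in the space of bounded continuous
  functions with values in the ball.\<close>

lemma autonomous_ode_local_solution:
  fixes F :: "'e::euclidean_space \<Rightarrow> 'e"
  assumes r: "r > 0" and L: "L \<ge> 0"
    and lip: "\<And>p q. p \<in> cball x0 r \<Longrightarrow> q \<in> cball x0 r \<Longrightarrow> norm (F p - F q) \<le> L * norm (p - q)"
  obtains x e where "e > 0" "x 0 = x0"
    "\<And>t. \<bar>t\<bar> < e \<Longrightarrow> x t \<in> cball x0 r \<and> (x has_vector_derivative F (x t)) (at t)"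
proof -
  define M where "M = norm (F x0) + L * r"
  have M: "norm (F p) \<le> M" if "p \<in> cball x0 r" for p
  proof -
    have "norm (F p) \<le> norm (F x0) + norm (F p - F x0)" by (metis add.commute norm_triangle_sub)
    also have "norm (F p - F x0) \<le> L * norm (p - x0)" using lip that r by auto
    also have "L * norm (p - x0) \<le> L * r" using that L
      by (intro mult_left_mono) (auto simp: dist_norm norm_minus_commute)
    finally show ?thesis by (simp add: M_def)
  qed
  have M0: "M \<ge> 0" using r L by (simp add: M_def)
  \<comment> \<open>The first bound keeps the iterates inside the ball, the second makes the
    iteration a contraction with factor \<open>1/2\<close>.\<close>
  define e where "e = min (r / (M + 1)) (1 / (2 * (L + 1)))"
  have e: "e > 0" "M * e \<le> r" "L * e \<le> 1/2"
  proof -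
    show "e > 0" using r M0 L by (simp add: e_def)
    have "M * e \<le> M * (r / (M + 1))" using M0 by (intro mult_left_mono) (auto simp: e_def)
    also have "\<dots> \<le> r" using M0 r by (simp add: field_simps)
    finally show "M * e \<le> r" .
    have "L * e \<le> L * (1 / (2 * (L + 1)))" using L by (intro mult_left_mono) (auto simp: e_def)
    also have "\<dots> \<le> 1/2" using L by (simp add: field_simps)
    finally show "L * e \<le> 1/2" .
  qed
  have cF: "continuous_on (cball x0 r) F"
    by (rule lipschitz_on_continuous_on[of L], rule lipschitz_onI)
      (use lip L in \<open>auto simp: dist_norm\<close>)
  define S :: "(real \<Rightarrow>\<^sub>C 'e) set" where "S = PiC UNIV (\<lambda>_. cball x0 r)"
  have S: "f \<in> S \<longleftrightarrow> (\<forall>t. apply_bcontfun f t \<in> cball x0 r)" for f by (auto simp: S_def mem_PiC_iff)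
  have cFf: "continuous_on A (\<lambda>s. F (apply_bcontfun f s))" if "f \<in> S" for f A
    using that S by (intro continuous_on_compose2[OF cF]) auto
  \<comment> \<open>Clamping the time to \<open>{-e..e}\<close> extends the iterates to the whole
    line, as the function space demands.\<close>
  define cl where "cl t = max (-e) (min e t)" for t :: real
  have cl: "cl t \<in> {-e..e}" for t using e by (auto simp: cl_def)
  define J where "J f t = x0 + (integral {-e..t} (\<lambda>s. F (apply_bcontfun f s))
      - integral {-e..0} (\<lambda>s. F (apply_bcontfun f s)))" for f :: "real \<Rightarrow>\<^sub>C 'e" and t
  have Jin: "J f (cl t) \<in> cball x0 r" if "f \<in> S" for f t
  proof -
    have "norm (J f (cl t) - x0) \<le> M * e"
      unfolding J_def using norm_integral_diff_le[OF cFf[OF that] _ cl e(1), of M] M that S by auto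
    then show ?thesis using e(2) by (auto simp: dist_norm norm_minus_commute)
  qed
  have Jb: "(\<lambda>t. J f (cl t)) \<in> bcontfun" if "f \<in> S" for f
  proof (rule bcontfun_normI)
    have "continuous_on {-e..e} (J f)"
      unfolding J_def
      by (intro continuous_intros indefinite_integral_continuous_1 integrable_continuous_real cFf that)
    moreover have "continuous_on UNIV cl" unfolding cl_def by (intro continuous_intros)
    ultimately show "continuous_on UNIV (\<lambda>t. J f (cl t))"
      using cl by (intro continuous_on_compose2[of _ "J f" UNIV cl]) auto
    show "norm (J f (cl t)) \<le> norm x0 + r" for t
      using Jin[OF that, of t] norm_triangle_sub[of "J f (cl t)" x0]
      by (auto simp: dist_norm norm_minus_commute)
  qed
  define P where "P f = Bcontfun (\<lambda>t. J f (cl t))" for f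
  have P: "apply_bcontfun (P f) t = J f (cl t)" if "f \<in> S" for f t
    using Jb[OF that] by (simp add: P_def Bcontfun_inverse)
  have "\<exists>!f\<in>S. P f = f"
  proof (rule Banach_fix[of S "1/2"])
    show "complete S" unfolding S_def complete_eq_closed by (rule closed_PiC) auto
    have "const_bcontfun x0 \<in> S" using r by (auto simp: S)
    then show "S \<noteq> {}" by blast
    show "P ` S \<subseteq> S" using P Jin S by auto
    fix f g assume fg: "f \<in> S" "g \<in> S"
    show "dist (P f) (P g) \<le> 1 / 2 * dist f g"
    proof (rule dist_bound)
      fix t
      let ?f = "\<lambda>s. F (apply_bcontfun f s)" and ?g = "\<lambda>s. F (apply_bcontfun g s)"
      have i: "?f integrable_on {-e..b}" "?g integrable_on {-e..b}" for b
        by (intro integrable_continuous_real cFf fg)+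
      have "J f (cl t) - J g (cl t) = integral {-e..cl t} (\<lambda>s. ?f s - ?g s)
          - integral {-e..0} (\<lambda>s. ?f s - ?g s)"
        unfolding J_def using i by (simp add: integral_diff)
      moreover have "norm (?f s - ?g s) \<le> L * dist f g" for s
      proof -
        have "norm (?f s - ?g s) \<le> L * dist (apply_bcontfun f s) (apply_bcontfun g s)"
          using lip fg S by (simp add: dist_norm)
        also have "\<dots> \<le> L * dist f g" using L by (intro mult_left_mono dist_bounded)
        finally show ?thesis .
      qed
      ultimately have "norm (J f (cl t) - J g (cl t)) \<le> L * dist f g * e"
        using norm_integral_diff_le[OF continuous_on_diff[OF cFf[OF fg(1)] cFf[OF fg(2)]] _ cl e(1)]
        by simp
      also have "\<dots> = (L * e) * dist f g" by simp
      also have "\<dots> \<le> 1/2 * dist f g" using e(3) by (intro mult_right_mono) auto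
      finally show "dist (apply_bcontfun (P f) t) (apply_bcontfun (P g) t) \<le> 1 / 2 * dist f g"
        using P fg by (simp add: dist_norm)
    qed
  qed auto
  then obtain f where f: "f \<in> S" "P f = f" by blast
  define x where "x = apply_bcontfun f"
  have x: "x t = J f (cl t)" for t using P[OF f(1), of t] f(2) by (simp add: x_def)
  show ?thesis
  proof (rule that[OF e(1)])
    show "x 0 = x0" using e(1) by (simp add: x cl_def J_def)
    fix t assume t: "\<bar>t\<bar> < e"
    have "((\<lambda>u. integral {-e..u} (\<lambda>s. F (x s))) has_vector_derivative F (x t)) (at t within {-e..e})"
      unfolding x_def by (rule integral_has_vector_derivative[OF cFf[OF f(1)]]) (use t in auto)
    then have "((\<lambda>u. integral {-e..u} (\<lambda>s. F (x s))) has_vector_derivative F (x t)) (at t)"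
      using t by (subst (asm) at_within_interior) auto
    then have "(J f has_vector_derivative F (x t)) (at t)"
      unfolding J_def x_def[symmetric] by (auto intro!: derivative_eq_intros)
    then have "(x has_vector_derivative F (x t)) (at t)"
    proof (rule has_vector_derivative_transform_within_open[where S = "{-e<..<e}"])
      show "J f u = x u" if "u \<in> {-e<..<e}" for u using that by (simp add: x cl_def)
    qed (use t in auto)
    moreover have "x t \<in> cball x0 r" using f(1) S by (simp add: x_def)
    ultimately show "x t \<in> cball x0 r \<and> (x has_vector_derivative F (x t)) (at t)" by simp
  qed
qed

section \<open>Homomorphisms with given logarithmic derivative\<close>

context lie begin

abbreviation "mdom \<equiv> {(\<phi> x, \<phi> y) | x y. x \<in> V \<and> y \<in> V \<and> x \<otimes> y \<in> V}"
abbreviation "mloc \<equiv> (\<lambda>(p, q). \<phi> (\<psi> p \<otimes> \<psi> q))"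

lemma Ck_mloc: "Ck_on k mdom mloc"
  using Ck_mult[OF one_chart(1) one_chart(1) one_chart(1)] by (simp add: \<psi>_def)

lemma open_mdom: "open mdom"
  using open_mult_dom[OF one_chart(1) one_chart(1) one_chart(1)] .

lemma mdom_left: "p \<in> \<phi> ` V \<Longrightarrow> (p, e0) \<in> mdom"
  using one_chart V_carrier by fastforce

lemma mloc_has_derivative:
  "z \<in> mdom \<Longrightarrow> (mloc has_derivative frechet_derivative mloc (at z)) (at z)"
  using Ck_on_SucD[OF Ck_mloc] by blast

text \<open>The left-invariant vector field with value \<open>X\<close> at \<open>\<one>\<close>, in
  coordinates.\<close>

definition vfield :: "'e \<Rightarrow> 'e \<Rightarrow> 'e" where
  "vfield X p = frechet_derivative mloc (at (p, e0)) (0, X)"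

lemma Ck_Pair_const: "open S \<Longrightarrow> Ck_on k S (\<lambda>p::'a::real_normed_vector. (p, c::'b::real_normed_vector))"
  using Ck_on_add[OF _ Ck_on_bounded_linear[of S "\<lambda>p. (p, 0)" k] Ck_on_const[of S k "(0, c)"]]
  by (simp add: bounded_linear_Pair bounded_linear_ident bounded_linear_zero)

lemma Ck_const_Pair: "open S \<Longrightarrow> Ck_on k S (\<lambda>p::'a::real_normed_vector. (c::'b::real_normed_vector, p))"
  using Ck_on_add[OF _ Ck_on_bounded_linear[of S "\<lambda>p. (0, p)" k] Ck_on_const[of S k "(c, 0)"]]
  by (simp add: bounded_linear_Pair bounded_linear_ident bounded_linear_zero)

lemma Ck_vfield: "Ck_on k (\<phi> ` V) (vfield X)"
  unfolding vfield_def
proof (rule Ck_on_compose[OF open_\<phi>V open_mdom, where g = "\<lambda>p. (p, e0)"])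
  show "Ck_on k mdom (\<lambda>z. frechet_derivative mloc (at z) (0, X))"
    using Ck_mloc[of "Suc k"] by (simp only: Ck_on.simps)
qed (use mdom_left Ck_Pair_const[OF open_\<phi>V] in auto)

lemma vfield_has_derivative:
  assumes "p \<in> \<phi> ` V"
  shows "((\<lambda>q. \<phi> (\<psi> p \<otimes> \<psi> q)) has_derivative (\<lambda>v. vfield v p)) (at e0)"
proof -
  have "((\<lambda>q. (p, q)) has_derivative (\<lambda>v. (0, v))) (at e0)"
    by (rule has_derivative_Pair) (rule has_derivative_const has_derivative_ident)+
  from has_derivative_compose[OF this mloc_has_derivative[OF mdom_left[OF assms]]]
  show ?thesis by (simp add: vfield_def)
qed

lemma ldiff_from_chart:
  assumes c: "\<And>s. \<gamma> s \<in> carrier G" and "d > 0"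
    and x: "\<And>s. \<bar>s - t\<bar> < d \<Longrightarrow> x s \<in> \<phi> ` V \<and> \<gamma> s = \<psi> (x s)"
    and dx: "(x has_vector_derivative vfield X (x t)) (at t)"
  shows "ldiff \<gamma> t X"
proof -
  have xt: "x t \<in> \<phi> ` V" "\<gamma> t = \<psi> (x t)" using x[of t] \<open>d > 0\<close> by auto
  let ?g = "\<psi> (x t)"
  have gV: "?g \<in> V" and gc: "?g \<in> carrier G" using xt \<psi>_in V_carrier by auto
  have "(\<lambda>p. \<phi> (inv ?g \<otimes> inv_into V \<phi> p)) differentiable (at (\<phi> ?g))"
    by (rule lmult_differentiable[OF one_chart(1) one_chart(1)]) (use gV gc one_chart in auto)
  then obtain D where D: "((\<lambda>p. \<phi> (inv ?g \<otimes> \<psi> p)) has_derivative D) (at (x t))"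
    by (simp only: differentiable_def \<psi>_def[symmetric] \<phi>\<psi>[OF xt(1)]) blast
  \<comment> \<open>Translating by \<open>?g\<close> and then by \<open>inv ?g\<close> is the
    identity near \<open>e0\<close>, so \<open>D\<close> undoes \<open>vfield\<close> at
    \<open>x t\<close>.\<close>
  have Dv: "D (vfield v (x t)) = v" for v
  proof -
    have "((\<lambda>q. \<phi> (inv ?g \<otimes> \<psi> (\<phi> (?g \<otimes> \<psi> q)))) has_derivative (\<lambda>v. D (vfield v (x t)))) (at e0)"
      by (rule has_derivative_compose[OF vfield_has_derivative[OF xt(1)]])
        (use D gc xt in auto)
    then have "((\<lambda>q. q) has_derivative (\<lambda>v. D (vfield v (x t)))) (at e0)"
    proof (rule has_derivative_transform_within_open)
      show "open {q\<in>\<phi> ` V. ?g \<otimes> inv_into V \<phi> q \<in> V}"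
        by (rule open_chart_preimage[OF one_chart(1) chart_openin[OF one_chart(1)]
              continuous_map_lmult[OF gc]])
      show "e0 \<in> {q\<in>\<phi> ` V. ?g \<otimes> inv_into V \<phi> q \<in> V}"
        using gV gc e0_in by (simp flip: \<psi>_def)
    qed (use gc \<psi>_in V_carrier in \<open>auto simp: inv_cancel simp flip: \<psi>_def\<close>)
    then show ?thesis using has_derivative_unique has_derivative_ident by metis
  qed
  have s: "\<forall>\<^sub>F h in at 0. \<bar>t + h - t\<bar> < d"
    unfolding eventually_at using \<open>d > 0\<close> by (auto simp: dist_norm)
  have "continuous (at t) x" using dx has_vector_derivative_continuous by blast
  then have xl: "((\<lambda>h. x (t + h)) \<longlongrightarrow> x t) (at 0)"
    unfolding isCont_def by (rule LIM_offset_zero)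
  have "limitin T (\<lambda>h. \<gamma> (t + h)) ?g (at 0)"
  proof (rule limitin_chart[OF one_chart(1) gV])
    show "\<forall>\<^sub>F h in at 0. \<gamma> (t + h) \<in> V"
      using s by eventually_elim (use x \<psi>_in in auto)
    have "\<forall>\<^sub>F h in at 0. x (t + h) = \<phi> (\<gamma> (t + h))"
      using s by eventually_elim (use x in auto)
    then show "((\<lambda>h. \<phi> (\<gamma> (t + h))) \<longlongrightarrow> \<phi> ?g) (at 0)"
      using xl xt tendsto_cong by fastforce
  qed
  from limitin_mult[OF limitin_const_T[of "inv ?g"] this] gc
  have ev: "\<forall>\<^sub>F h in at 0. inv ?g \<otimes> \<gamma> (t + h) \<in> V" by (simp add: limitin_eventually_V)
  have "((\<lambda>h. x (t + h)) has_derivative (\<lambda>h. h *\<^sub>R vfield X (x t))) (at 0)"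
    using has_derivative_compose[of "\<lambda>h. t + h" "\<lambda>h. h" 0 UNIV x "\<lambda>h. h *\<^sub>R vfield X (x t)"] dx
      has_derivative_add[OF has_derivative_const has_derivative_ident, of t "at 0"]
    by (simp add: has_vector_derivative_def)
  from has_derivative_compose[OF this] D
  have "((\<lambda>h. \<phi> (inv ?g \<otimes> \<psi> (x (t + h)))) has_derivative (\<lambda>h. D (h *\<^sub>R vfield X (x t)))) (at 0)"
    by simp
  moreover have "linear D" using D has_derivative_linear by blast
  ultimately have 1: "((\<lambda>h. \<phi> (inv ?g \<otimes> \<psi> (x (t + h)))) has_derivative (\<lambda>h. h *\<^sub>R X)) (at 0)"
    by (simp add: linear_cmul Dv)
  have "((\<lambda>h. \<phi> (inv ?g \<otimes> \<gamma> (t + h))) has_derivative (\<lambda>h. h *\<^sub>R X)) (at 0)"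
  proof (rule has_derivative_transform_eventually[OF 1])
    show "\<forall>\<^sub>F h in at 0. \<phi> (inv ?g \<otimes> \<psi> (x (t + h))) = \<phi> (inv ?g \<otimes> \<gamma> (t + h))"
      using s by eventually_elim (use x in auto)
  qed (use xt in auto)
  then show ?thesis
    using c ev gc xt by (simp add: ldiff_def tang_def has_vector_derivative_def)
qed

lemma local_one_parameter:
  obtains \<gamma> x e where "e > 0" "\<gamma> 0 = \<one>" "\<And>t. \<bar>t\<bar> < e \<Longrightarrow> ldiff \<gamma> t X"
    "\<And>t. \<bar>t\<bar> < e \<Longrightarrow> x t \<in> \<phi> ` V \<and> \<gamma> t = \<psi> (x t)" "\<And>k. Ck_on k {-e<..<e} x"
proof -
  obtain r L where rL: "r > 0" "L \<ge> 0" "cball e0 r \<subseteq> \<phi> ` V"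
    "\<And>p q. p \<in> cball e0 r \<Longrightarrow> q \<in> cball e0 r \<Longrightarrow> norm (vfield X p - vfield X q) \<le> L * norm (p - q)"
    using Ck_on_locally_Lipschitz[OF open_\<phi>V Ck_vfield e0_in] by metis
  obtain x e where x: "e > 0" "x 0 = e0"
    "\<And>t. \<bar>t\<bar> < e \<Longrightarrow> x t \<in> cball e0 r \<and> (x has_vector_derivative vfield X (x t)) (at t)"
    using autonomous_ode_local_solution[OF rL(1,2,4)] by metis
  define \<gamma> where "\<gamma> t = (if \<bar>t\<bar> < e then \<psi> (x t) else \<one>)" for t
  have xV: "x t \<in> \<phi> ` V" if "\<bar>t\<bar> < e" for t using x(3)[OF that] rL(3) by auto
  have c: "\<gamma> t \<in> carrier G" for t using xV \<psi>_in V_carrier by (auto simp: \<gamma>_def)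
  have "ldiff \<gamma> t X" if "\<bar>t\<bar> < e" for t
    by (rule ldiff_from_chart[OF c, of "e - \<bar>t\<bar>" _ x]) (use that x xV in \<open>auto simp: \<gamma>_def\<close>)
  \<comment> \<open>Bootstrapping: the derivative of \<open>x\<close> is a smooth function of
    \<open>x\<close>, so each order of smoothness yields the next.\<close>
  moreover have "Ck_on k {-e<..<e} x" for k
  proof (induction k)
    case 0
    show ?case
    proof (simp, rule continuous_at_imp_continuous_on, rule ballI)
      fix t assume "t \<in> {-e<..<e}"
      then have "(x has_vector_derivative vfield X (x t)) (at t)" using x(3)[of t] by auto
      then show "isCont x t" by (rule has_vector_derivative_continuous)
    qed
  next
    case (Suc k)
    have "Ck_on k {-e<..<e} (\<lambda>t. v *\<^sub>R vfield X (x t))" for v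
      by (intro Ck_on_scaleR Ck_on_const Ck_on_compose[OF _ open_\<phi>V _ Ck_vfield Suc])
        (use xV in auto)
    then show ?case
      by (intro Ck_on_SucI[where f' = "\<lambda>t v. v *\<^sub>R vfield X (x t)"])
        (use x(3) in \<open>auto simp: has_vector_derivative_def\<close>)
  qed
  ultimately show ?thesis
    using that[of e \<gamma> x] x xV by (simp add: \<gamma>_def)
qed

lemma ldiff_continuous_map:
  assumes "\<And>t. ldiff f t (X t)"
  shows "continuous_map euclidean T f"
  unfolding continuous_map_def
proof (intro conjI allI impI)
  show "f \<in> topspace euclidean \<rightarrow> topspace T"
    using assms by (auto simp: ldiff_def topspace_T)
  fix U assume U: "openin T U"
  have "open {t. f t \<in> U}"
    unfolding open_dist
  proof safe
    fix t assume "f t \<in> U"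
    then have "\<forall>\<^sub>F s in at t. f s \<in> U"
      using ldiff_limitin[OF assms[of t]] U by (simp add: limitin_def)
    then have "\<forall>\<^sub>F s in nhds t. f s \<in> U"
      using \<open>f t \<in> U\<close> by (simp add: eventually_nhds_conv_at)
    then show "\<exists>e>0. \<forall>s. dist s t < e \<longrightarrow> s \<in> {t. f t \<in> U}"
      by (simp add: eventually_nhds_metric)
  qed
  then show "openin euclidean {t \<in> topspace euclidean. f t \<in> U}" by simp
qed

text \<open>The local solution is additive near \<open>0\<close> by uniqueness. The global
  homomorphism is \<open>\<gamma> (t / 2^k)\<close> raised to the power \<open>2^k\<close>, which no
  longer depends on \<open>k\<close> once \<open>k\<close> is large.\<close>

lemma exists_hom_ldiff:
  obtains \<Gamma> where "\<And>s t. \<Gamma> (s + t) = \<Gamma> s \<otimes> \<Gamma> t" "\<And>t. ldiff \<Gamma> t X"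
    "\<And>U u k. (U, u) \<in> atlas G \<Longrightarrow> Ck_on k {t. \<Gamma> t \<in> U} (u \<circ> \<Gamma>)"
proof -
  obtain \<gamma> x e where e: "e > 0" and g0: "\<gamma> 0 = \<one>" and gd: "\<And>t. \<bar>t\<bar> < e \<Longrightarrow> ldiff \<gamma> t X"
    and gx: "\<And>t. \<bar>t\<bar> < e \<Longrightarrow> x t \<in> \<phi> ` V \<and> \<gamma> t = \<psi> (x t)" and Cx: "\<And>k. Ck_on k {-e<..<e} x"
    using local_one_parameter by metis
  have c: "\<gamma> t \<in> carrier G" for t using gd[of 0] e by (auto simp: ldiff_def)
  have add: "\<gamma> (s + t) = \<gamma> s \<otimes> \<gamma> t" if "\<bar>s\<bar> < e/2" "\<bar>t\<bar> < e/2" for s t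
  proof (rule ldiff_unique[of "{-e/2<..<e/2}" _ "\<lambda>_. X" _ 0])
    fix u assume u: "u \<in> {-e/2<..<e/2}"
    show "ldiff (\<lambda>t. \<gamma> (s + t)) u X"
      using ldiff_compose[of \<gamma> "\<lambda>t. s + t" u X 1] gd[of "s + u"] u that
        DERIV_add[OF DERIV_const DERIV_ident, of s u UNIV] by auto
    show "ldiff (\<lambda>t. \<gamma> s \<otimes> \<gamma> t) u X"
      using ldiff_mult[OF ldiff_const[OF c[of s]] gd[of u]] u e c by auto
  qed (use that e g0 c in auto)
  have comm: "\<gamma> s \<otimes> \<gamma> t = \<gamma> t \<otimes> \<gamma> s" if "\<bar>s\<bar> < e/2" "\<bar>t\<bar> < e/2" for s t
    using add[of s t] add[of t s] that by (simp add: add.commute)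
  define P where "P t k = \<gamma> (t / 2^k) [^] (2^k :: nat)" for t :: real and k :: nat
  have Pstep: "P t (Suc k) = P t k" if "\<bar>t\<bar> / 2^k < e/2" for t k
  proof -
    have 1: "\<bar>t / 2^Suc k\<bar> < e/2" using that e by (simp add: field_simps)
    have "\<gamma> (t / 2^k) = \<gamma> (t / 2^Suc k) \<otimes> \<gamma> (t / 2^Suc k)"
      using add[OF 1 1] by (simp add: field_simps)
    also have "\<dots> = \<gamma> (t / 2^Suc k) [^] (2::nat)"
      using c by (simp add: numeral_2_eq_2)
    finally show ?thesis using c by (simp add: P_def nat_pow_pow)
  qed
  have Pconst: "P t j = P t k" if "\<bar>t\<bar> / 2^k < e/2" "k \<le> j" for t k j
    using that(2)
  proof (induction j rule: dec_induct)
    case (step j)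
    have "\<bar>t\<bar> / 2^j \<le> \<bar>t\<bar> / 2^k" using step by (intro divide_left_mono) auto
    then have "\<bar>t\<bar> / 2^j < e/2" using that(1) by linarith
    then show ?case using Pstep[of t j] step by simp
  qed simp
  have ex: "\<exists>k. \<bar>t\<bar> / 2^k < e/2" for t
  proof -
    obtain k :: nat where "\<bar>t\<bar> / (e/2) < 2^k" using real_arch_pow[of 2 "\<bar>t\<bar> / (e/2)"] by auto
    then show ?thesis using e by (intro exI[of _ k]) (simp add: field_simps)
  qed
  \<comment> \<open>From this exponent on the value of \<open>P t\<close> is stable, so finitely
    many arguments can share one common exponent.\<close>
  define K where "K t = (LEAST k. \<bar>t\<bar> / 2^k < e/2)" for t
  have K: "\<bar>t\<bar> / 2^K t < e/2" for t unfolding K_def using ex LeastI_ex by metis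
  have Kle: "\<bar>t\<bar> / 2^k < e/2" if "K t \<le> k" for t k
  proof -
    have "\<bar>t\<bar> / 2^k \<le> \<bar>t\<bar> / 2^K t" using that by (intro divide_left_mono) auto
    then show ?thesis using K[of t] by linarith
  qed
  define \<Gamma> where "\<Gamma> t = P t (K t)" for t
  have \<Gamma>: "\<Gamma> t = P t k" if "K t \<le> k" for t k
    using Pconst[OF K that] by (simp add: \<Gamma>_def)
  have hom: "\<Gamma> (s + t) = \<Gamma> s \<otimes> \<Gamma> t" for s t
  proof -
    define k where "k = Max {K s, K t, K (s + t)}"
    have k: "K s \<le> k" "K t \<le> k" "K (s + t) \<le> k" by (auto simp: k_def)
    have s: "\<bar>s / 2^k\<bar> < e/2" "\<bar>t / 2^k\<bar> < e/2" using Kle[OF k(1)] Kle[OF k(2)] by auto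
    have "\<gamma> ((s + t) / 2^k) = \<gamma> (s / 2^k) \<otimes> \<gamma> (t / 2^k)"
      using add[OF s] by (simp add: add_divide_distrib)
    then show ?thesis
      using k c pow_mult_distrib[OF comm[OF s]] by (simp add: \<Gamma> P_def)
  qed
  have \<Gamma>c: "\<Gamma> t \<in> carrier G" for t using c by (simp add: \<Gamma>_def P_def)
  have \<Gamma>\<gamma>: "\<Gamma> t = \<gamma> t" if "\<bar>t\<bar> < e/2" for t
  proof -
    have "K t = 0" unfolding K_def by (rule Least_equality) (use that in auto)
    then show ?thesis using c by (simp add: \<Gamma>_def P_def)
  qed
  have tg: "tang \<Gamma> X"
  proof (rule tang_cong[of \<gamma>])
    show "tang \<gamma> X" using gd[of 0] e c g0 by (simp add: ldiff_def)
    show "\<Gamma> 0 = \<one>" using \<Gamma>\<gamma>[of 0] e g0 by simp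
    have "\<forall>\<^sub>F t in at 0. \<bar>t\<bar> < e/2" using e unfolding eventually_at
      by (intro exI[of _ "e/2"]) (auto simp: dist_norm)
    then show "\<forall>\<^sub>F t in at 0. \<gamma> t = \<Gamma> t" by eventually_elim (simp add: \<Gamma>\<gamma>)
  qed
  have d: "ldiff \<Gamma> t X" for t using tg \<Gamma>c by (simp add: ldiff_def hom inv_cancel)
  show ?thesis
  proof (rule that[OF hom d])
    fix U u k assume U: "(U, u) \<in> atlas G"
    have oU: "open {t. \<Gamma> t \<in> U}"
      using ldiff_continuous_map[OF d] chart_openin[OF U] unfolding continuous_map_def by auto
    show "Ck_on k {t. \<Gamma> t \<in> U} (u \<circ> \<Gamma>)"
    proof (rule Ck_on_local[OF oU])
      fix t0 assume t0: "t0 \<in> {t. \<Gamma> t \<in> U}"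
      \<comment> \<open>Near \<open>t0\<close> the homomorphism is the left translate by
        \<open>\<Gamma> t0\<close> of the local solution, so its smoothness comes from that of the
        product.\<close>
      obtain U0 u0 where U0: "(U0, u0) \<in> atlas G" "\<Gamma> t0 \<in> U0" using chart_at \<Gamma>c by blast
      let ?Q = "{p. (u0 (\<Gamma> t0), p) \<in> {(u0 x, \<phi> y) | x y. x \<in> U0 \<and> y \<in> V \<and> x \<otimes> y \<in> U}}"
      have oQ: "open ?Q"
        using open_vimage[OF open_mult_dom[OF U0(1) one_chart(1) U], of "\<lambda>p. (u0 (\<Gamma> t0), p)"]
        by (simp add: vimage_def continuous_on_Pair)
      have "Ck_on k ?Q (\<lambda>p. (\<lambda>(p, q). u (inv_into U0 u0 p \<otimes> inv_into V \<phi> q)) (u0 (\<Gamma> t0), p))"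
        by (rule Ck_on_compose[OF oQ open_mult_dom[OF U0(1) one_chart(1) U] _
              Ck_mult[OF U0(1) one_chart(1) U] Ck_const_Pair[OF oQ]]) auto
      then have CQ: "Ck_on k ?Q (\<lambda>p. u (\<Gamma> t0 \<otimes> \<psi> p))" using U0 by (simp flip: \<psi>_def)
      let ?I = "(\<lambda>t. t + t0) ` {-e/2<..<e/2} \<inter> {t. \<Gamma> t \<in> U}"
      have oI: "open ?I"
        using open_translation[of "{-e/2<..<e/2}" t0] oU by (simp add: add.commute open_Int)
      have eq: "\<Gamma> t0 \<otimes> \<psi> (x (t - t0)) = \<Gamma> t" "x (t - t0) \<in> ?Q" if "t \<in> ?I" for t
      proof -
        have a: "\<bar>t - t0\<bar> < e/2" using that by auto
        have x: "x (t - t0) \<in> \<phi> ` V" "\<gamma> (t - t0) = \<psi> (x (t - t0))" using gx[of "t - t0"] a e by auto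
        show 1: "\<Gamma> t0 \<otimes> \<psi> (x (t - t0)) = \<Gamma> t"
          using hom[of t0 "t - t0"] \<Gamma>\<gamma>[OF a] x by simp
        show "x (t - t0) \<in> ?Q" using 1 x that U0 by (auto simp: image_iff) (metis \<psi>\<phi> )
      qed
      have "Ck_on k ?I (\<lambda>t. x (t - t0))"
        by (rule Ck_on_subset[OF Ck_on_shift[of "{-e/2<..<e/2}" k x t0]])
          (use e in \<open>auto intro: Ck_on_subset[OF Cx]\<close>)
      then have "Ck_on k ?I (\<lambda>t. u (\<Gamma> t0 \<otimes> \<psi> (x (t - t0))))"
        using eq(2) by (intro Ck_on_compose[OF oI oQ _ CQ]) auto
      then have "Ck_on k ?I (u \<circ> \<Gamma>)"
        by (rule Ck_on_cong[OF oI, rotated]) (use eq in auto)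
      moreover have "t0 \<in> ?I" using t0 e by (auto simp: image_iff)
      ultimately show "\<exists>W. open W \<and> t0 \<in> W \<and> Ck_on k W (u \<circ> \<Gamma>)" using oI by blast
    qed
  qed
qed

end

section \<open>The exponential map and the bracket\<close>

context lie begin

lemma one_parameter_subgroup_ldiff:
  assumes "one_parameter_subgroup G \<gamma>" "((\<lambda>t. \<phi> (\<gamma> t)) has_vector_derivative X) (at 0)"
  shows "ldiff \<gamma> t X" "\<gamma> 0 = \<one>"
proof -
  have cont: "continuous_map euclidean T \<gamma>" and hom: "\<And>s t. \<gamma> (s + t) = \<gamma> s \<otimes> \<gamma> t"
    using assms(1) unfolding one_parameter_subgroup_def by auto
  have c: "\<gamma> s \<in> carrier G" for s
    using cont by (auto simp: continuous_map_def topspace_T)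
  show 0: "\<gamma> 0 = \<one>" using hom[of 0 0] c[of 0] by simp
  have "limitin T \<gamma> (\<gamma> 0) (at 0)"
    using continuous_map_limit[OF cont, of "\<lambda>t. t" 0 "at 0"] by (simp add: comp_def)
  then have "tang \<gamma> X" using 0 assms(2) limitin_eventually_V by (simp add: tang_def)
  then show "ldiff \<gamma> t X" using c by (simp add: ldiff_def hom inv_cancel)
qed

text \<open>Resolves the definite description in \<open>lexp\<close>: existence is the homomorphism
  just built, uniqueness is that of curves with given logarithmic derivative. Rescaling time relates
  the generators \<open>X\<close> and \<open>t *\<^sub>R X\<close>.\<close>

lemma ldiff_eq_lexp:
  assumes "\<And>t. ldiff f t X" "f 0 = \<one>"
  shows "f t = lexp G (t *\<^sub>R X)"
proof -
  obtain \<Gamma> where \<Gamma>: "\<And>s t. \<Gamma> (s + t) = \<Gamma> s \<otimes> \<Gamma> t" "\<And>u. ldiff \<Gamma> u (t *\<^sub>R X)"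
    "\<And>U u k. (U, u) \<in> atlas G \<Longrightarrow> Ck_on k {t. \<Gamma> t \<in> U} (u \<circ> \<Gamma>)"
    using exists_hom_ldiff by metis
  have \<Gamma>c: "\<Gamma> s \<in> carrier G" for s using \<Gamma>(2)[of 0] by (simp add: ldiff_def)
  have \<Gamma>0: "\<Gamma> 0 = \<one>" using \<Gamma>(1)[of 0 0] \<Gamma>c[of 0] by simp
  have "tang \<Gamma> (t *\<^sub>R X)" using \<Gamma>(2)[of 0] \<Gamma>0 \<Gamma>c by (simp add: ldiff_def)
  then have d: "((\<lambda>t. \<phi> (\<Gamma> t)) has_vector_derivative t *\<^sub>R X) (at 0)" by (simp add: tang_def)
  have "one_parameter_subgroup G \<Gamma>"
    using \<Gamma> ldiff_continuous_map[OF \<Gamma>(2)] by (auto simp: one_parameter_subgroup_def smooth_on_def)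
  moreover have "\<gamma> = \<Gamma>" if "one_parameter_subgroup G \<gamma>"
    "((\<lambda>s. \<phi> (\<gamma> s)) has_vector_derivative t *\<^sub>R X) (at 0)" for \<gamma>
  proof
    fix s
    show "\<gamma> s = \<Gamma> s"
      by (rule ldiff_unique[of UNIV _ "\<lambda>_. t *\<^sub>R X" _ 0])
        (use one_parameter_subgroup_ldiff[OF that] \<Gamma>(2) \<Gamma>0 in auto)
  qed
  ultimately have "(THE \<gamma>. one_parameter_subgroup G \<gamma> \<and>
      ((\<lambda>s. \<phi> (\<gamma> s)) has_vector_derivative t *\<^sub>R X) (at 0)) = \<Gamma>"
    using d by (intro the_equality) blast+
  then have "lexp G (t *\<^sub>R X) = \<Gamma> 1" by (simp add: lexp_def)
  also have "\<Gamma> 1 = f (t * 1)"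
  proof (rule ldiff_unique[of UNIV \<Gamma> "\<lambda>_. t *\<^sub>R X" "\<lambda>s. f (t * s)" 0 1])
    fix s
    show "ldiff (\<lambda>s. f (t * s)) s (t *\<^sub>R X)"
      by (rule ldiff_compose[OF assms(1)]) (auto intro!: derivative_eq_intros)
  qed (use \<Gamma>(2) \<Gamma>0 assms(2) in auto)
  finally show ?thesis by simp
qed

lemma lexp_props:
  shows ldiff_lexp: "ldiff (\<lambda>t. lexp G (t *\<^sub>R X)) t X"
    and lexp_add: "lexp G ((r + s) *\<^sub>R X) = lexp G (r *\<^sub>R X) \<otimes> lexp G (s *\<^sub>R X)"
proof -
  obtain \<Gamma> where \<Gamma>: "\<And>s t. \<Gamma> (s + t) = \<Gamma> s \<otimes> \<Gamma> t" "\<And>u. ldiff \<Gamma> u X"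
    using exists_hom_ldiff by metis
  have "\<Gamma> s \<in> carrier G" for s using \<Gamma>(2)[of 0] by (simp add: ldiff_def)
  then have "\<Gamma> 0 = \<one>" using \<Gamma>(1)[of 0 0] by simp
  then have *: "\<Gamma> = (\<lambda>t. lexp G (t *\<^sub>R X))" using ldiff_eq_lexp[OF \<Gamma>(2)] by auto
  show "ldiff (\<lambda>t. lexp G (t *\<^sub>R X)) t X" using \<Gamma>(2)[of t] by (simp add: *)
  show "lexp G ((r + s) *\<^sub>R X) = lexp G (r *\<^sub>R X) \<otimes> lexp G (s *\<^sub>R X)"
    using \<Gamma>(1)[of r s] by (simp add: *)
qed

lemma lexp_closed [simp]: "lexp G X \<in> carrier G"
  using ldiff_lexp[of X 0] unfolding ldiff_def by (metis scaleR_one)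

lemma lexp_zero [simp]: "lexp G 0 = \<one>"
  using lexp_add[of 0 0 0] by simp

lemma lexp_minus: "lexp G (- X) = inv (lexp G X)"
proof -
  have "lexp G (- X) \<otimes> lexp G X = \<one>" using lexp_add[of "-1" 1 X] by simp
  then show ?thesis using inv_equality by auto
qed

lemma tang_lexp: "tang (\<lambda>t. lexp G (t *\<^sub>R X)) X"
  using ldiff_lexp[of X 0] by (simp add: ldiff_def)

lemma lexp_continuous: "continuous_map euclidean T (\<lambda>t. lexp G (t *\<^sub>R X))"
  by (rule ldiff_continuous_map) (rule ldiff_lexp)

lemma lexp_conj:
  assumes "g \<in> carrier G"
  shows "g \<otimes> lexp G X \<otimes> inv g = lexp G (Ad G g X)"
proof -
  have "ldiff (\<lambda>t. g \<otimes> lexp G (t *\<^sub>R X) \<otimes> inv g) t (Ad G g X)" for t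
    using ldiff_mult[OF ldiff_mult[OF ldiff_const[OF assms] ldiff_lexp]
        ldiff_const[OF inv_closed[OF assms]], of X t] assms by simp
  from ldiff_eq_lexp[OF this, of 1] assms show ?thesis by simp
qed

text \<open>A one-parameter group is commutative, so conjugation by one of its elements fixes the
  group and therefore its velocity.\<close>

lemma Ad_lexp_self [simp]: "Ad G (lexp G (t *\<^sub>R X)) X = X"
proof -
  have "lexp G (s *\<^sub>R Ad G (lexp G (t *\<^sub>R X)) X) = lexp G (s *\<^sub>R X)" for s
  proof -
    have "lexp G (s *\<^sub>R Ad G (lexp G (t *\<^sub>R X)) X)
        = lexp G (t *\<^sub>R X) \<otimes> lexp G (s *\<^sub>R X) \<otimes> inv (lexp G (t *\<^sub>R X))"
      using lexp_conj[of "lexp G (t *\<^sub>R X)" "s *\<^sub>R X"] by (simp add: Ad_scale)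
    also have "lexp G (t *\<^sub>R X) \<otimes> lexp G (s *\<^sub>R X) = lexp G (s *\<^sub>R X) \<otimes> lexp G (t *\<^sub>R X)"
      by (simp flip: lexp_add add: add.commute)
    finally show ?thesis by (simp add: m_assoc)
  qed
  then show ?thesis
    using tang_lexp[of X] tang_lexp[of "Ad G (lexp G (t *\<^sub>R X)) X"] tang_unique by simp
qed

text \<open>Near \<open>e0\<close>, \<open>Ad\<close> is written through the derivative of the
  product map at \<open>(p, \<iota> p)\<close> applied to a left-invariant field; in this formula
  the dependence on \<open>p\<close> is visibly differentiable.\<close>

lemma Ad_differentiable: "(\<lambda>p. Ad G (\<psi> p) Y) differentiable (at e0)"
proof -
  let ?W = "{p\<in>\<phi> ` V. inv (inv_into V \<phi> p) \<in> V}"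
  have W: "open ?W"
    by (rule open_chart_preimage[OF one_chart(1) chart_openin[OF one_chart(1)] inv_continuous])
  have e0W: "e0 \<in> ?W" using e0_in one_chart by (simp flip: \<psi>_def)
  have eq: "Ad G (\<psi> p) Y = (\<Sum>b\<in>Basis. (vfield Y p \<bullet> b) *\<^sub>R
      frechet_derivative mloc (at (p, \<iota> p)) (b, 0))" if p: "p \<in> ?W" for p
  proof -
    let ?D = "frechet_derivative mloc (at (p, \<iota> p))"
    have pV: "p \<in> \<phi> ` V" and iV: "inv (\<psi> p) \<in> V" using p by (auto simp: \<psi>_def)
    have gV: "\<psi> p \<in> V" and gc: "\<psi> p \<in> carrier G" using pV \<psi>_in V_carrier by auto
    have "(\<phi> (\<psi> p), \<phi> (inv (\<psi> p))) \<in> mdom"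
      using gV iV gc one_chart(2) by (intro CollectI exI[of _ "\<psi> p"] exI[of _ "inv (\<psi> p)"]) simp
    then have "(p, \<iota> p) \<in> mdom" using pV by (simp add: \<iota>_def)
    then have D: "(mloc has_derivative ?D) (at (p, \<iota> p))" by (rule mloc_has_derivative)
    have "((\<lambda>q. (\<phi> (\<psi> p \<otimes> \<psi> q), \<iota> p)) has_derivative (\<lambda>v. (vfield v p, 0))) (at e0)"
      by (intro has_derivative_Pair vfield_has_derivative[OF pV] has_derivative_const)
    then have "((\<lambda>q. mloc (\<phi> (\<psi> p \<otimes> \<psi> q), \<iota> p)) has_derivative (\<lambda>v. ?D (vfield v p, 0))) (at e0)"
      by (rule has_derivative_compose) (use D gc pV in simp)
    then have "((\<lambda>q. \<phi> (\<psi> p \<otimes> \<psi> q \<otimes> inv (\<psi> p))) has_derivative (\<lambda>v. ?D (vfield v p, 0))) (at e0)"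
    proof (rule has_derivative_transform_within_open)
      show "open {q\<in>\<phi> ` V. \<psi> p \<otimes> inv_into V \<phi> q \<in> V}"
        by (rule open_chart_preimage[OF one_chart(1) chart_openin[OF one_chart(1)]
              continuous_map_lmult[OF gc]])
      show "e0 \<in> {q\<in>\<phi> ` V. \<psi> p \<otimes> inv_into V \<phi> q \<in> V}"
        using gV gc e0_in by (simp flip: \<psi>_def)
    qed (use iV in \<open>auto simp: \<iota>_def simp flip: \<psi>_def\<close>)
    then have "Ad G (\<psi> p) = (\<lambda>v. ?D (vfield v p, 0))"
      using Ad_has_derivative[OF gc] has_derivative_unique by blast
    then have "Ad G (\<psi> p) Y = ?D (vfield Y p, 0)" by simp
    also have "\<dots> = ?D (\<Sum>b\<in>Basis. (vfield Y p \<bullet> b) *\<^sub>R b, 0)" by (simp add: euclidean_representation)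
    also have "(\<Sum>b\<in>Basis. (vfield Y p \<bullet> b) *\<^sub>R b, 0::'e) = (\<Sum>b\<in>Basis. (vfield Y p \<bullet> b) *\<^sub>R (b, 0))"
      by (simp add: prod_eq_iff fst_sum snd_sum)
    also have "?D \<dots> = (\<Sum>b\<in>Basis. (vfield Y p \<bullet> b) *\<^sub>R ?D (b, 0))"
      using has_derivative_linear[OF D] by (simp add: linear_sum linear_cmul del: scaleR_Pair)
    finally show ?thesis .
  qed
  have "(\<lambda>p. \<Sum>b\<in>Basis. (vfield Y p \<bullet> b) *\<^sub>R frechet_derivative mloc (at (p, \<iota> p)) (b, 0))
      differentiable (at e0)"
  proof (intro differentiable_sum differentiable_scaleR differentiable_inner differentiable_const ballI finite_Basis)
    show "vfield Y differentiable at e0"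
      using Ck_vfield[of 1 Y] e0_in by (simp only: One_nat_def Ck_on.simps)
    fix b
    have "(e0, \<iota> e0) \<in> mdom" using mdom_left[OF e0_in] by (simp add: \<iota>_def)
    then have 1: "(\<lambda>z. frechet_derivative mloc (at z) (b, 0)) differentiable (at (e0, \<iota> e0))"
      using Ck_mloc[of "Suc 1"] by (simp only: One_nat_def Ck_on.simps)
    obtain D where "(\<iota> has_derivative D) (at e0)"
      using \<iota>_differentiable by (auto simp: differentiable_def)
    then have "(\<lambda>p. (p, \<iota> p)) differentiable (at e0)"
      using has_derivative_Pair[OF has_derivative_ident] differentiableI by blast
    from differentiable_compose[OF 1 this]
    show "(\<lambda>p. frechet_derivative mloc (at (p, \<iota> p)) (b, 0)) differentiable at e0" .
  qed
  then obtain D where "((\<lambda>p. \<Sum>b\<in>Basis. (vfield Y p \<bullet> b) *\<^sub>R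
      frechet_derivative mloc (at (p, \<iota> p)) (b, 0)) has_derivative D) (at e0)"
    by (auto simp: differentiable_def)
  then have "((\<lambda>p. Ad G (\<psi> p) Y) has_derivative D) (at e0)"
    by (rule has_derivative_transform_within_open[OF _ W e0W]) (use eq in auto)
  then show ?thesis by (auto simp: differentiable_def)
qed

lemma tang_Ad_derivative:
  assumes "tang f X"
  shows "((\<lambda>t. Ad G (f t) Y) has_vector_derivative
    frechet_derivative (\<lambda>p. Ad G (\<psi> p) Y) (at e0) X) (at 0)"
proof -
  let ?D = "frechet_derivative (\<lambda>p. Ad G (\<psi> p) Y) (at e0)"
  have f: "f 0 = \<one>" "\<forall>\<^sub>F t in at 0. f t \<in> V" and fd: "((\<lambda>t. \<phi> (f t)) has_derivative (\<lambda>t. t *\<^sub>R X)) (at 0)"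
    using assms by (auto simp: tang_def has_vector_derivative_def)
  have D: "((\<lambda>p. Ad G (\<psi> p) Y) has_derivative ?D) (at e0)"
    using Ad_differentiable frechet_derivative_works by blast
  have "((\<lambda>t. Ad G (\<psi> (\<phi> (f t))) Y) has_derivative (\<lambda>t. ?D (t *\<^sub>R X))) (at 0)"
    by (rule has_derivative_compose[OF fd]) (use D f in simp)
  moreover have "\<forall>\<^sub>F t in at 0. Ad G (\<psi> (\<phi> (f t))) Y = Ad G (f t) Y"
    using f(2) by eventually_elim simp
  ultimately have "((\<lambda>t. Ad G (f t) Y) has_derivative (\<lambda>t. ?D (t *\<^sub>R X))) (at 0)"
    by (rule has_derivative_transform_eventually) (use f in auto)
  then show ?thesis
    using has_derivative_linear[OF D] by (simp add: has_vector_derivative_def linear_cmul)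
qed

abbreviation br :: "'e \<Rightarrow> 'e \<Rightarrow> 'e" where "br \<equiv> bracket G"

lemma bracket_eq: "br X Y = frechet_derivative (\<lambda>p. Ad G (\<psi> p) Y) (at e0) X"
  unfolding bracket_def using tang_Ad_derivative[OF tang_lexp] by (rule vector_derivative_at)

text \<open>The bracket is defined along a one-parameter group. By the chain rule every curve with
  the same velocity gives the same derivative.\<close>

lemma tang_Ad: "tang f X \<Longrightarrow> ((\<lambda>t. Ad G (f t) Y) has_vector_derivative br X Y) (at 0)"
  using tang_Ad_derivative by (simp add: bracket_eq)

lemma linear_bracket_left: "linear (\<lambda>X. br X Y)"
  unfolding bracket_eq using Ad_differentiable frechet_derivative_works has_derivative_linear by blast

lemma linear_bracket_right: "linear (br X)"
proof (rule linearI)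
  fix Y Z c
  have "((\<lambda>t. Ad G (lexp G (t *\<^sub>R X)) Y + Ad G (lexp G (t *\<^sub>R X)) Z) has_vector_derivative br X Y + br X Z) (at 0)"
    by (intro has_vector_derivative_add tang_Ad tang_lexp)
  then show "br X (Y + Z) = br X Y + br X Z"
    using tang_Ad[OF tang_lexp, of X "Y + Z"] vector_derivative_unique_at by (simp add: Ad_add) blast
  have "((\<lambda>t. c *\<^sub>R Ad G (lexp G (t *\<^sub>R X)) Y) has_vector_derivative c *\<^sub>R br X Y) (at 0)"
    using has_vector_derivative_scaleR[OF DERIV_const tang_Ad[OF tang_lexp, of X Y], of c] by simp
  then show "br X (c *\<^sub>R Y) = c *\<^sub>R br X Y"
    using tang_Ad[OF tang_lexp, of X "c *\<^sub>R Y"] vector_derivative_unique_at by (simp add: Ad_scale) blast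
qed

lemma bounded_bilinear_br: "bounded_bilinear br"
  using linear_bracket_left linear_bracket_right
  by (simp add: bilinear_def flip: bilinear_conv_bounded_bilinear)

sublocale br: bounded_bilinear br by (rule bounded_bilinear_br)

lemma br_self [simp]: "br X X = 0"
  using tang_Ad[OF tang_lexp, of X X] vector_derivative_unique_at[OF _ has_vector_derivative_const]
  by simp

lemma br_anti: "br X Y = - br Y X"
proof -
  have "br (X + Y) (X + Y) = br X Y + br Y X" by (simp add: br.add_left br.add_right del: br_self) simp
  then have "br X Y + br Y X = 0" by simp
  then show ?thesis by (simp add: eq_neg_iff_add_eq_0)
qed

lemma Ad_br: assumes g: "g \<in> carrier G" shows "Ad G g (br X Y) = br (Ad G g X) (Ad G g Y)"
proof -
  let ?f = "\<lambda>t. lexp G (t *\<^sub>R X)"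
  have "((\<lambda>t. Ad G (g \<otimes> ?f t \<otimes> inv g) (Ad G g Y)) has_vector_derivative br (Ad G g X) (Ad G g Y)) (at 0)"
    by (rule tang_Ad[OF tang_conj[OF tang_lexp g]])
  then have "((\<lambda>t. Ad G g (Ad G (?f t) Y)) has_vector_derivative br (Ad G g X) (Ad G g Y)) (at 0)"
    using g by (simp add: Ad_mult)
  moreover have "((\<lambda>t. Ad G g (Ad G (?f t) Y)) has_vector_derivative Ad G g (br X Y)) (at 0)"
    using bounded_linear.has_vector_derivative[OF linear_conv_bounded_linear[THEN iffD1, OF linear_Ad[OF g]]
        tang_Ad[OF tang_lexp]] .
  ultimately show ?thesis using vector_derivative_unique_at by blast
qed

lemma ldiff_Ad:
  assumes "ldiff f t X"
  shows "((\<lambda>s. Ad G (f s) Y) has_vector_derivative Ad G (f t) (br X Y)) (at t)"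
proof -
  have c: "f s \<in> carrier G" for s using assms by (auto simp: ldiff_def)
  have "((\<lambda>h. Ad G (inv (f t) \<otimes> f (t + h)) Y) has_vector_derivative br X Y) (at 0)"
    using assms by (intro tang_Ad) (auto simp: ldiff_def)
  from bounded_linear.has_vector_derivative[OF linear_conv_bounded_linear[THEN iffD1, OF linear_Ad[OF c]] this]
  have "((\<lambda>h. Ad G (f t) (Ad G (inv (f t) \<otimes> f (t + h)) Y)) has_vector_derivative Ad G (f t) (br X Y)) (at 0)" .
  then have "((\<lambda>h. Ad G (f (t + h)) Y) has_vector_derivative Ad G (f t) (br X Y)) (at (t - t))"
    using c by (simp flip: Ad_mult add: inv_cancel)
  moreover have "((\<lambda>s. s - t) has_vector_derivative 1) (at t)"
    by (auto simp: has_vector_derivative_def intro!: derivative_eq_intros)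
  ultimately show ?thesis
    using vector_diff_chain_at[of "\<lambda>s. s - t" 1 t "\<lambda>h. Ad G (f (t + h)) Y"] by (auto simp: comp_def)
qed

lemma Ad_expand: assumes "g \<in> carrier G"
  shows "Ad G g Y = (\<Sum>b\<in>Basis. (Y \<bullet> b) *\<^sub>R Ad G g b)"
proof -
  have "Ad G g Y = Ad G g (\<Sum>b\<in>Basis. (Y \<bullet> b) *\<^sub>R b)" by (simp add: euclidean_representation)
  then show ?thesis using linear_Ad[OF assms] by (simp add: linear_sum linear_cmul)
qed

lemma ldiff_Ad_curve:
  assumes "ldiff k t X" "(f has_vector_derivative f') (at t)"
  shows "((\<lambda>s. Ad G (k s) (f s)) has_vector_derivative Ad G (k t) (br X (f t) + f')) (at t)"
proof -
  have c: "k s \<in> carrier G" for s using assms by (auto simp: ldiff_def)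
  have "((\<lambda>s. \<Sum>b\<in>Basis. (f s \<bullet> b) *\<^sub>R Ad G (k s) b) has_vector_derivative
      (\<Sum>b\<in>Basis. (f t \<bullet> b) *\<^sub>R Ad G (k t) (br X b) + (f' \<bullet> b) *\<^sub>R Ad G (k t) b)) (at t)"
  proof (intro has_vector_derivative_sum has_vector_derivative_scaleR ldiff_Ad assms(1))
    fix b
    show "((\<lambda>s. f s \<bullet> b) has_real_derivative f' \<bullet> b) (at t)"
      using bounded_linear.has_vector_derivative[OF bounded_linear_inner_left assms(2)]
      by (simp add: has_real_derivative_iff_has_vector_derivative)
  qed
  moreover have "(\<Sum>b\<in>Basis. (f t \<bullet> b) *\<^sub>R Ad G (k t) (br X b) + (f' \<bullet> b) *\<^sub>R Ad G (k t) b) =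
      Ad G (k t) (br X (f t) + f')"
  proof -
    have "br X (f t) = (\<Sum>b\<in>Basis. (f t \<bullet> b) *\<^sub>R br X b)"
      by (subst euclidean_representation[of "f t", symmetric])
        (simp add: linear_sum[OF linear_bracket_right] linear_cmul[OF linear_bracket_right])
    then show ?thesis
      using linear_Ad[OF c] Ad_expand[OF c, of t f']
      by (simp add: linear_sum linear_cmul linear_add sum.distrib)
  qed
  ultimately show ?thesis by (simp flip: Ad_expand[OF c])
qed

lemma Ad_lexp_derivative:
  "((\<lambda>s. Ad G (lexp G (s *\<^sub>R X)) Y) has_vector_derivative br X (Ad G (lexp G (t *\<^sub>R X)) Y)) (at t)"
  using ldiff_Ad[OF ldiff_lexp, of X Y t] by (simp add: Ad_br)

text \<open>Uniqueness for the linear equation \<open>f' = br X f\<close>: transporting the solution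
  back by \<open>exp (- t X)\<close> makes it constant. The explicit formulas for \<open>Ad\<close>
  below are guessed and verified by this rule.\<close>

lemma Ad_lexp_eqI:
  assumes "\<And>t. (f has_vector_derivative br X (f t)) (at t)"
  shows "Ad G (lexp G (t *\<^sub>R X)) (f 0) = f t"
proof -
  let ?k = "\<lambda>s. lexp G (s *\<^sub>R (- X))"
  have "((\<lambda>s. Ad G (?k s) (f s)) has_vector_derivative 0) (at s within UNIV)" for s
    using ldiff_Ad_curve[OF ldiff_lexp assms, of "- X" s] br.minus_left by simp
  then obtain c where c: "\<And>s. s \<in> UNIV \<Longrightarrow> Ad G (?k s) (f s) = c"
    by (rule has_vector_derivative_zero_constant[OF convex_UNIV]) (rule that)
  have "Ad G (lexp G (t *\<^sub>R X)) (f 0) = Ad G (lexp G (t *\<^sub>R X)) (Ad G (?k t) (f t))"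
    using c[of t] c[of 0] by (simp add: Ad_one)
  also have "\<dots> = f t" using lexp_minus[of "t *\<^sub>R X"] by simp
  finally show ?thesis .
qed

text \<open>The derivative at \<open>0\<close> of the fact that \<open>Ad (exp (t X))\<close>
  respects brackets.\<close>

lemma jacobi: "br X (br Y Z) = br (br X Y) Z + br Y (br X Z)"
proof -
  let ?A = "\<lambda>t. Ad G (lexp G (t *\<^sub>R X))"
  have 1: "((\<lambda>t. br (?A t Y) (?A t Z)) has_vector_derivative (br (?A 0 Y) (br X Z) + br (br X Y) (?A 0 Z))) (at 0)"
    by (rule br.has_vector_derivative) (rule tang_Ad[OF tang_lexp])+
  have "((\<lambda>t. ?A t (br Y Z)) has_vector_derivative br X (br Y Z)) (at 0)"
    by (rule tang_Ad[OF tang_lexp])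
  then have "((\<lambda>t. br (?A t Y) (?A t Z)) has_vector_derivative br X (br Y Z)) (at 0)"
    by (simp add: Ad_br)
  from vector_derivative_unique_at[OF this 1] show ?thesis
    by (simp add: Ad_one add.commute)
qed

end

section \<open>Generating a connected Lie group\<close>

context lie begin

text \<open>The analogue of \<open>tang\<close> for several parameters, needed for coordinates
  around \<open>\<one>\<close>.\<close>

definition vtang :: "('v::real_normed_vector \<Rightarrow> 'g) \<Rightarrow> ('v \<Rightarrow> 'e) \<Rightarrow> bool" where
  "vtang f D \<longleftrightarrow> f 0 = \<one> \<and> (\<forall>\<^sub>F y in at 0. f y \<in> V) \<and> ((\<lambda>y. \<phi> (f y)) has_derivative D) (at 0)"

lemma vtang_limitin: assumes "vtang f D" shows "limitin T f \<one> (at 0)"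
proof -
  have "((\<lambda>y. \<phi> (f y)) \<longlongrightarrow> \<phi> \<one>) (at 0)"
    using assms has_derivative_continuous[of "\<lambda>y. \<phi> (f y)" D 0] by (simp add: continuous_within vtang_def)
  then show ?thesis using limitin_chart[OF one_chart, of f "at 0"] assms by (simp add: vtang_def)
qed

lemma vtang_mult:
  assumes f: "vtang f D" and g: "vtang g E"
  shows "vtang (\<lambda>y. f y \<otimes> g y) (\<lambda>v. D v + E v)"
  unfolding vtang_def
proof (intro conjI)
  have f': "f 0 = \<one>" "\<forall>\<^sub>F y in at 0. f y \<in> V" "((\<lambda>y. \<phi> (f y)) has_derivative D) (at 0)"
    and g': "g 0 = \<one>" "\<forall>\<^sub>F y in at 0. g y \<in> V" "((\<lambda>y. \<phi> (g y)) has_derivative E) (at 0)"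
    using assms by (auto simp: vtang_def)
  show "f 0 \<otimes> g 0 = \<one>" using f' g' by simp
  have "limitin T (\<lambda>t. f t \<otimes> g t) (\<one> \<otimes> \<one>) (at 0)"
    using limitin_mult vtang_limitin assms by blast
  then show "\<forall>\<^sub>F t in at 0. f t \<otimes> g t \<in> V" using limitin_eventually_V by simp
  have "((\<lambda>y. (\<phi> (f y), \<phi> (g y))) has_derivative (\<lambda>v. (D v, E v))) (at 0)"
    using f' g' by (intro has_derivative_Pair) auto
  from has_derivative_compose[OF this, of mloc "\<lambda>(v, w). v + w"] m_derivative f' g'
  have 1: "((\<lambda>y. \<phi> (\<psi> (\<phi> (f y)) \<otimes> \<psi> (\<phi> (g y)))) has_derivative (\<lambda>v. D v + E v)) (at 0)"
    by simp
  have "\<forall>\<^sub>F y in at 0. \<phi> (\<psi> (\<phi> (f y)) \<otimes> \<psi> (\<phi> (g y))) = \<phi> (f y \<otimes> g y)"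
    using f'(2) g'(2) by eventually_elim simp
  from has_derivative_transform_eventually[OF 1 this]
  show "((\<lambda>y. \<phi> (f y \<otimes> g y)) has_derivative (\<lambda>v. D v + E v)) (at 0)"
    using f' g' one_chart by simp
qed

lemma vtang_one: "vtang (\<lambda>y. \<one>) (\<lambda>v. 0)"
  using one_chart by (simp add: vtang_def)

lemma vtang_tang:
  assumes "tang f X" "bounded_linear c"
  shows "vtang (\<lambda>y. f (c y)) (\<lambda>v. c v *\<^sub>R X)"
  unfolding vtang_def
proof (intro conjI)
  interpret c: bounded_linear c by fact
  have f: "f 0 = \<one>" "\<forall>\<^sub>F t in at 0. f t \<in> V" and fd: "((\<lambda>t. \<phi> (f t)) has_derivative (\<lambda>t. t *\<^sub>R X)) (at 0)"
    using assms by (auto simp: tang_def has_vector_derivative_def)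
  show "f (c 0) = \<one>" using f by (simp add: c.zero)
  have "\<forall>\<^sub>F t in nhds 0. f t \<in> V"
    using f one_chart by (simp add: eventually_nhds_conv_at)
  moreover have "(c \<longlongrightarrow> 0) (at 0)" using c.tendsto[of "\<lambda>x. x" 0 "at 0"] by (simp add: c.zero)
  ultimately show "\<forall>\<^sub>F y in at 0. f (c y) \<in> V" using eventually_compose_filterlim by blast
  show "((\<lambda>y. \<phi> (f (c y))) has_derivative (\<lambda>v. c v *\<^sub>R X)) (at 0)"
    by (rule has_derivative_compose[OF bounded_linear_imp_has_derivative[OF assms(2)]])
      (use fd in \<open>simp add: c.zero\<close>)
qed

lemma continuous_map_mult:
  assumes "continuous_map X T f" "continuous_map X T g"
  shows "continuous_map X T (\<lambda>x. f x \<otimes> g x)"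
  using continuous_map_compose[OF continuous_map_pairedI[OF assms] mult_continuous]
  by (simp add: comp_def)

text \<open>Products of exponentials of basis vectors are coordinates of the second kind near \<open>1\<close>, so that
  they fill a neighbourhood of \<open>1\<close>.\<close>

lemma subgroup_eq_carrier:
  assumes "connected_space T" "subgroup H G" "span S = UNIV"
    and H: "\<And>X t. X \<in> S \<Longrightarrow> lexp G (t *\<^sub>R X) \<in> H"
  shows "H = carrier G"
proof -
  interpret H: subgroup H G by fact
  obtain B where B: "B \<subseteq> S" "independent B" "S \<subseteq> span B" using maximal_independent_subset by blast
  then have sB: "span B = UNIV" using span_mono span_span assms(3) by (metis top.extremum_uniqueI)
  have fB: "finite B" using B(2) independent_bound by blast
  then obtain bs where bs: "set bs = B" "distinct bs" using finite_distinct_list by blast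
  define c where "c b y = representation B y b" for b y
  have c: "bounded_linear (c b)" for b
    unfolding c_def linear_conv_bounded_linear[symmetric]
    by (rule linearI) (simp_all add: representation_add representation_scale B sB)
  define P where "P l y = foldr (\<lambda>b g. lexp G (c b y *\<^sub>R b) \<otimes> g) l \<one>" for l y
  have P: "(\<forall>y. P l y \<in> H) \<and> continuous_map euclidean T (P l) \<and>
      vtang (P l) (\<lambda>v. \<Sum>b\<leftarrow>l. c b v *\<^sub>R b)" if "set l \<subseteq> B" for l
    using that
  proof (induction l)
    case Nil
    then show ?case by (simp add: P_def vtang_one topspace_T)
  next
    case (Cons b l)
    have P: "P (b # l) = (\<lambda>y. lexp G (c b y *\<^sub>R b) \<otimes> P l y)" by (auto simp: P_def)
    have "continuous_map euclidean euclidean (c b)"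
      using linear_continuous_on[OF c] by (simp add: continuous_map_iff_continuous2)
    from continuous_map_compose[OF this lexp_continuous[of b]]
    have "continuous_map euclidean T (\<lambda>y. lexp G (c b y *\<^sub>R b))" by (simp add: comp_def)
    then show ?case
      unfolding P using Cons H B(1) vtang_mult[OF vtang_tang[OF tang_lexp c]]
      by (auto intro!: continuous_map_mult)
  qed
  define F where "F y = \<phi> (P bs y)" for y
  have Pb: "P bs y \<in> H" "continuous_map euclidean T (P bs)" for y using P bs by auto
  have "(\<lambda>v. \<Sum>b\<leftarrow>bs. c b v *\<^sub>R b) = (\<lambda>v. v)"
  proof
    fix v
    have "(\<Sum>b\<leftarrow>bs. c b v *\<^sub>R b) = (\<Sum>b\<in>B. c b v *\<^sub>R b)"
      using bs by (simp add: sum_list_distinct_conv_sum_set)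
    also have "\<dots> = v" unfolding c_def
      by (rule sum_representation_eq[OF B(2) _ fB]) (auto simp: sB)
    finally show "(\<Sum>b\<leftarrow>bs. c b v *\<^sub>R b) = v" .
  qed
  then have vt: "vtang (P bs) (\<lambda>v. v)" using P[of bs] bs by simp
  have P0: "P bs 0 = \<one>" using vt by (simp add: vtang_def)
  let ?W = "{y. P bs y \<in> V}"
  have oW: "open ?W"
    using openin_continuous_map_preimage[OF Pb(2) chart_openin[OF one_chart(1)]] by simp
  have "continuous_map (subtopology euclidean ?W) (subtopology T V) (P bs)"
    using Pb(2) by (auto simp: continuous_map_in_subtopology continuous_map_from_subtopology)
  from continuous_map_compose[OF this chart_continuous[OF one_chart(1)]]
  have "continuous_on ?W F" by (simp add: comp_def F_def)
  \<comment> \<open>Continuity near \<open>0\<close> together with a derivative at \<open>0\<close>,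
    here the identity, already forces the image to contain a neighbourhood.\<close>
  then have "F 0 \<in> interior (F ` ?W)"
  proof (rule sussmann_open_mapping[OF oW])
    show "(F has_derivative (\<lambda>v. v)) (at 0)" using vt unfolding F_def vtang_def by simp
    show "bounded_linear (\<lambda>v::'e. v)" by (rule bounded_linear_ident)
    show "0 \<in> interior ?W" using oW P0 one_chart by (simp add: interior_open)
  qed (use P0 one_chart in auto)
  then obtain Q where Q: "open Q" "e0 \<in> Q" "Q \<subseteq> F ` ?W" using P0 by (auto simp: F_def interior_def)
  let ?N = "{x \<in> V. \<phi> x \<in> Q}"
  have "openin (subtopology T V) {x \<in> topspace (subtopology T V). \<phi> x \<in> Q}"
    by (rule openin_continuous_map_preimage[OF chart_continuous[OF one_chart(1)]]) (use Q in simp)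
  also have "{x \<in> topspace (subtopology T V). \<phi> x \<in> Q} = ?N"
    using V_carrier by (auto simp: topspace_T)
  finally have N: "openin T ?N"
    using openin_trans_full[OF _ chart_openin[OF one_chart(1)]] by simp
  have NH: "?N \<subseteq> H"
  proof
    fix x assume x: "x \<in> ?N"
    then obtain y where y: "P bs y \<in> V" "\<phi> x = \<phi> (P bs y)" using Q(3) by (auto simp: F_def)
    then have "x = P bs y" using x inj_onD[OF chart_inj[OF one_chart(1)]] by auto
    then show "x \<in> H" using Pb by simp
  qed
  have coset: "openin T {y \<in> carrier G. inv g \<otimes> y \<in> ?N}" if "g \<in> carrier G" for g
    using openin_continuous_map_preimage[OF continuous_map_lmult[OF inv_closed[OF that]] N]
    by (simp add: topspace_T)
  have oH: "openin T H"
  proof (subst openin_subopen, intro ballI)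
    fix h assume h: "h \<in> H"
    have "{y \<in> carrier G. inv h \<otimes> y \<in> ?N} \<subseteq> H"
    proof safe
      fix y assume y: "y \<in> carrier G" "inv h \<otimes> y \<in> V" "\<phi> (inv h \<otimes> y) \<in> Q"
      then have "h \<otimes> (inv h \<otimes> y) \<in> H" using NH h by blast
      then show "y \<in> H" using h y by (simp add: inv_cancel)
    qed
    moreover have "h \<in> {y \<in> carrier G. inv h \<otimes> y \<in> ?N}" using h one_chart Q by simp
    ultimately show "\<exists>W. openin T W \<and> h \<in> W \<and> W \<subseteq> H" using coset[of h] h by blast
  qed
  \<comment> \<open>The complement is a union of translates of the same neighbourhood, so
    \<open>H\<close> is closed as well as open.\<close>
  have "openin T (carrier G - H)"
  proof (subst openin_subopen, intro ballI)
    fix g assume g: "g \<in> carrier G - H"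
    have "{y \<in> carrier G. inv g \<otimes> y \<in> ?N} \<subseteq> carrier G - H"
    proof safe
      fix y assume y: "y \<in> carrier G" "inv g \<otimes> y \<in> V" "\<phi> (inv g \<otimes> y) \<in> Q" "y \<in> H"
      then have "inv g \<otimes> y \<in> H" using NH by blast
      then have "inv g \<otimes> y \<otimes> inv y \<in> H" using y by simp
      then have "inv g \<in> H" using y g by (simp add: m_assoc)
      then have "inv (inv g) \<in> H" by (rule H.m_inv_closed)
      then show False using g by simp
    qed
    moreover have "g \<in> {y \<in> carrier G. inv g \<otimes> y \<in> ?N}" using g one_chart Q by simp
    ultimately show "\<exists>W. openin T W \<and> g \<in> W \<and> W \<subseteq> carrier G - H" using coset[of g] g by blast
  qed
  then have "closedin T H" using H.subset by (simp add: closedin_def topspace_T)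
  with oH have "H = {} \<or> H = carrier G"
    using assms(1)[unfolded connected_space_clopen_in, rule_format, of H] by (simp add: topspace_T)
  then show ?thesis using H.one_closed by blast
qed

text \<open>The centralizer of \<open>z\<close> is a subgroup containing all one-parameter groups,
  hence everything by connectedness.\<close>

lemma Ad_trivial_center:
  assumes "connected_space T" "z \<in> carrier G" "\<And>X. Ad G z X = X"
  shows "z \<in> group_center G"
proof -
  let ?H = "{g \<in> carrier G. z \<otimes> g = g \<otimes> z}"
  have "subgroup ?H G"
  proof
    fix x y assume "x \<in> ?H" "y \<in> ?H"
    then have x: "x \<in> carrier G" "z \<otimes> x = x \<otimes> z" and y: "y \<in> carrier G" "z \<otimes> y = y \<otimes> z" by auto
    have "z \<otimes> (x \<otimes> y) = (x \<otimes> z) \<otimes> y" using x y assms(2) by (simp flip: m_assoc)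
    also have "\<dots> = x \<otimes> y \<otimes> z" using x y assms(2) by (simp add: m_assoc)
    finally show "x \<otimes> y \<in> ?H" using x y by simp
  next
    fix x assume "x \<in> ?H"
    then have x: "x \<in> carrier G" "z \<otimes> x = x \<otimes> z" by auto
    have "inv x \<otimes> (x \<otimes> z) \<otimes> inv x = inv x \<otimes> (z \<otimes> x) \<otimes> inv x" using x by simp
    then have "z \<otimes> inv x = inv x \<otimes> z" using x(1) assms(2) by (simp add: m_assoc inv_cancel)
    then show "inv x \<in> ?H" using x by simp
  qed (use assms in auto)
  moreover have "lexp G (t *\<^sub>R X) \<in> ?H" for X t
  proof -
    have "z \<otimes> lexp G (t *\<^sub>R X) \<otimes> inv z \<otimes> z = lexp G (t *\<^sub>R X) \<otimes> z"
      using lexp_conj[OF assms(2), of "t *\<^sub>R X"] assms by simp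
    then show ?thesis using assms(2) by (simp add: m_assoc)
  qed
  ultimately have "?H = carrier G"
    using subgroup_eq_carrier[OF assms(1), of ?H UNIV] by simp
  then show ?thesis using assms(2) by (auto simp: group_center_def)
qed

text \<open>Points are closed and the set is finite, so the fibres of the path are open. It is
  applied to paths in the finite center.\<close>

lemma finite_valued_path_constant:
  assumes "continuous_map euclidean T (f :: real \<Rightarrow> 'g)" "finite Z" "\<And>t. f t \<in> Z" "Z \<subseteq> carrier G"
  shows "f s = f t"
proof (rule connected_local_const[OF connected_UNIV UNIV_I UNIV_I])
  show "\<forall>a\<in>UNIV. \<forall>\<^sub>F b in at a within UNIV. f a = f b"
  proof
    fix a
    have "closedin T (Z - {f a})"
      using Hausdorff_imp_t1_space[OF Hausdorff_T] assms t1_space_closedin_finite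
      by (metis Diff_subset finite_Diff subset_trans topspace_T)
    then have "openin T (carrier G - (Z - {f a}))" by (simp add: closedin_def topspace_T)
    from openin_continuous_map_preimage[OF assms(1) this]
    have "open {t. f t \<in> carrier G - (Z - {f a})}" by simp
    also have "{t. f t \<in> carrier G - (Z - {f a})} = {t. f t = f a}" using assms(3,4) by auto
    finally have "open {t. f t = f a}" .
    then show "\<forall>\<^sub>F b in at a within UNIV. f a = f b"
      unfolding eventually_at_topological by (intro exI[of _ "{t. f t = f a}"]) auto
  qed
qed

section \<open>Continuity of the adjoint action\<close>

lemma Ad_tendsto:
  assumes "limitin T k g F" "(f \<longlongrightarrow> Y) F"
  shows "((\<lambda>t. Ad G (k t) (f t)) \<longlongrightarrow> Ad G g Y) F"
proof -
  have g: "g \<in> carrier G" using assms(1) topspace_T by (simp add: limitin_def)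
  have "((\<lambda>t. Ad G (k t) X) \<longlongrightarrow> Ad G g X) F" for X
  proof -
    have l: "limitin T (\<lambda>t. inv g \<otimes> k t) (inv g \<otimes> g) F"
      using g by (intro limitin_mult limitin_const_T assms) auto
    then have l: "limitin T (\<lambda>t. inv g \<otimes> k t) \<one> F" using g by simp
    have "isCont (\<lambda>p. Ad G (\<psi> p) X) e0"
      by (rule differentiable_imp_continuous_within[OF Ad_differentiable])
    moreover have "((\<lambda>t. \<phi> (inv g \<otimes> k t)) \<longlongrightarrow> e0) F" using limitin_chartD(2)[OF one_chart l] .
    ultimately have "((\<lambda>t. Ad G (\<psi> (\<phi> (inv g \<otimes> k t))) X) \<longlongrightarrow> Ad G (\<psi> e0) X) F"
      by (rule isCont_tendsto_compose)
    moreover have "\<forall>\<^sub>F t in F. Ad G (\<psi> (\<phi> (inv g \<otimes> k t))) X = Ad G (inv g \<otimes> k t) X"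
      using limitin_eventually_V[OF l] by eventually_elim simp
    ultimately have "((\<lambda>t. Ad G (inv g \<otimes> k t) X) \<longlongrightarrow> Ad G (\<psi> e0) X) F"
      by (rule Lim_transform_eventually)
    then have "((\<lambda>t. Ad G (inv g \<otimes> k t) X) \<longlongrightarrow> X) F" by (simp add: Ad_one)
    then have "((\<lambda>t. Ad G g (Ad G (inv g \<otimes> k t) X)) \<longlongrightarrow> Ad G g X) F"
      using linear_conv_bounded_linear[THEN iffD1, OF linear_Ad[OF g]] bounded_linear.tendsto by blast
    moreover have "\<forall>\<^sub>F t in F. Ad G g (Ad G (inv g \<otimes> k t) X) = Ad G (k t) X"
      using limitin_eventually_carrier[OF assms(1)]
      by eventually_elim (use g in \<open>simp flip: Ad_mult add: inv_cancel\<close>)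
    ultimately show ?thesis by (rule Lim_transform_eventually)
  qed
  then have "((\<lambda>t. \<Sum>b\<in>Basis. (f t \<bullet> b) *\<^sub>R Ad G (k t) b) \<longlongrightarrow> (\<Sum>b\<in>Basis. (Y \<bullet> b) *\<^sub>R Ad G g b)) F"
    using assms(2) by (intro tendsto_intros) auto
  moreover have "\<forall>\<^sub>F t in F. (\<Sum>b\<in>Basis. (f t \<bullet> b) *\<^sub>R Ad G (k t) b) = Ad G (k t) (f t)"
    using limitin_eventually_carrier[OF assms(1)] by eventually_elim (simp flip: Ad_expand)
  ultimately have "((\<lambda>t. Ad G (k t) (f t)) \<longlongrightarrow> (\<Sum>b\<in>Basis. (Y \<bullet> b) *\<^sub>R Ad G g b)) F"
    by (rule Lim_transform_eventually)
  then show ?thesis by (simp flip: Ad_expand[OF g])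
qed

lemma continuous_Ad_curve:
  assumes "continuous_map euclidean T (k :: 'a::topological_space \<Rightarrow> 'g)" "continuous_on UNIV f"
  shows "continuous_on UNIV (\<lambda>t. Ad G (k t) (f t))"
  unfolding continuous_on_def
proof
  fix x
  have "limitin T k (k x) (at x)"
    using continuous_map_limit[OF assms(1), of "\<lambda>t. t" x "at x"] by (simp add: comp_def)
  then show "((\<lambda>t. Ad G (k t) (f t)) \<longlongrightarrow> Ad G (k x) (f x)) (at x within UNIV)"
    by (rule Ad_tendsto) (use assms(2) in \<open>simp add: continuous_on_def\<close>)
qed

end

section \<open>The Killing form\<close>

definition tr :: "('e::euclidean_space \<Rightarrow> 'e) \<Rightarrow> real" where
  "tr f = (\<Sum>b\<in>Basis. f b \<bullet> b)"

lemma tr_commute: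
  fixes f g :: "'e::euclidean_space \<Rightarrow> 'e"
  assumes "linear f" "linear g"
  shows "tr (\<lambda>x. f (g x)) = tr (\<lambda>x. g (f x))"
proof -
  have ex: "f (g b) \<bullet> b = (\<Sum>c\<in>Basis. (g b \<bullet> c) * (f c \<bullet> b))" if "linear f" for f g :: "'e \<Rightarrow> 'e" and b
  proof -
    have "f (g b) = f (\<Sum>c\<in>Basis. (g b \<bullet> c) *\<^sub>R c)" by (simp add: euclidean_representation)
    then show ?thesis using that by (simp add: linear_sum linear_cmul inner_sum_left)
  qed
  have "tr (\<lambda>x. f (g x)) = (\<Sum>b\<in>Basis. \<Sum>c\<in>Basis. (g b \<bullet> c) * (f c \<bullet> b))"
    unfolding tr_def using ex[OF assms(1)] by simp
  also have "\<dots> = (\<Sum>c\<in>Basis. \<Sum>b\<in>Basis. (f c \<bullet> b) * (g b \<bullet> c))"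
    by (subst sum.swap) (simp add: mult.commute)
  also have "\<dots> = tr (\<lambda>x. g (f x))" unfolding tr_def using ex[OF assms(2)] by simp
  finally show ?thesis .
qed

text \<open>Basis independence of the trace, so that the Killing form can be computed in a basis of
  eigenvectors.\<close>

lemma tr_basis:
  fixes f :: "'e::euclidean_space \<Rightarrow> 'e"
  assumes "linear f" "independent B" "span B = UNIV"
  shows "tr f = (\<Sum>b\<in>B. representation B (f b) b)"
proof -
  have fB: "finite B" using assms(2) independent_bound by blast
  have ex: "v = (\<Sum>b\<in>B. representation B v b *\<^sub>R b)" for v
    using sum_representation_eq[OF assms(2) _ fB subset_refl, of v] assms(3) by simp
  have r: "representation B (\<Sum>i\<in>I. h i *\<^sub>R g i) b = (\<Sum>i\<in>I. h i * representation B (g i) b)"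
    for I b and h :: "'i \<Rightarrow> real" and g
    using assms(2,3) by (simp add: representation_sum representation_scale)
  have "tr f = (\<Sum>e\<in>Basis. \<Sum>b\<in>B. representation B e b * (f b \<bullet> e))"
    unfolding tr_def
  proof (intro sum.cong refl)
    fix e :: 'e
    have "f e = (\<Sum>b\<in>B. representation B e b *\<^sub>R f b)"
      by (subst ex[of e]) (simp add: linear_sum linear_cmul assms(1))
    then show "f e \<bullet> e = (\<Sum>b\<in>B. representation B e b * (f b \<bullet> e))" by (simp add: inner_sum_left)
  qed
  also have "\<dots> = (\<Sum>b\<in>B. \<Sum>e\<in>Basis. (f b \<bullet> e) * representation B e b)"
    by (subst sum.swap) (simp add: mult.commute)
  also have "\<dots> = (\<Sum>b\<in>B. representation B (\<Sum>e\<in>Basis. (f b \<bullet> e) *\<^sub>R e) b)"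
    by (simp add: r)
  finally show ?thesis by (simp add: euclidean_representation)
qed

section \<open>The Killing form and the Cartan inner product in the split setting\<close>

locale split =
  fixes G :: "('g, 'e::euclidean_space) cartan_data" (structure)
  assumes split: "split_setting G"

sublocale split \<subseteq> lie G
  using split by unfold_locales (simp add: split_setting_def)

context split begin

lemmas br_zero [simp] = br.zero_left br.zero_right

abbreviation "kil \<equiv> killing G"
abbreviation "\<theta> \<equiv> cinv G"
abbreviation "ip \<equiv> cip G"

lemma connected_T: "connected_space T" and finite_center: "finite (group_center G)"
  and maxab: "maximal_abelian G" and wchamber: "weyl_chamber G" and split_form: "split_real_form G"
  using split by (auto simp: split_setting_def)

lemma linear_\<theta>: "linear \<theta>" and \<theta>\<theta> [simp]: "\<theta> (\<theta> X) = X"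
  and \<theta>_br: "\<theta> (br X Y) = br (\<theta> X) (\<theta> Y)" and ip_pos: "X \<noteq> 0 \<Longrightarrow> ip X X > 0"
  using split by (auto simp: split_setting_def cartan_involution_def)

lemma \<theta>_simps [simp]: "\<theta> 0 = 0" "\<theta> (- X) = - \<theta> X"
  "\<theta> (X + Y) = \<theta> X + \<theta> Y" "\<theta> (X - Y) = \<theta> X - \<theta> Y" "\<theta> (c *\<^sub>R X) = c *\<^sub>R \<theta> X"
  by (simp_all add: linear_\<theta> linear_0 linear_neg linear_add linear_diff linear_cmul)

lemma kil_tr: "kil X Y = tr (\<lambda>Z. br X (br Y Z))"
  by (simp add: killing_def tr_def)

lemma kil_sym: "kil X Y = kil Y X"
  unfolding kil_tr by (rule tr_commute[OF linear_bracket_right linear_bracket_right])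

lemma bilinear_kil: "bilinear kil"
  unfolding bilinear_def killing_def
  by (auto intro!: linearI simp: br.add_left br.add_right br.scaleR_left br.scaleR_right inner_add_left
      sum.distrib sum_distrib_left)

lemma kil_invariant: "kil (br X Y) Z = kil X (br Y Z)"
proof -
  have l: "linear (br A)" "linear (\<lambda>W. br A (br B W))" for A B
    using linear_compose[OF linear_bracket_right linear_bracket_right, of A B]
    by (auto simp: comp_def linear_bracket_right)
  have 1: "br (br X Y) W = br X (br Y W) - br Y (br X W)" for X Y W
    using jacobi[of X Y W] by simp
  have "kil (br X Y) Z = tr (\<lambda>W. br X (br Y (br Z W))) - tr (\<lambda>W. br Y (br X (br Z W)))"
    unfolding kil_tr 1 by (simp add: tr_def inner_diff_left sum_subtractf)
  also have "tr (\<lambda>W. br Y (br X (br Z W))) = tr (\<lambda>W. br X (br Z (br Y W)))"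
    using tr_commute[OF l(1) l(2), of Y X Z] .
  also have "tr (\<lambda>W. br X (br Y (br Z W))) - \<dots> = kil X (br Y Z)"
    unfolding kil_tr 1 by (simp add: tr_def inner_diff_left sum_subtractf br.diff_right)
  finally show ?thesis .
qed

lemma kil_automorphism:
  assumes "linear A" "linear B" "\<And>X. A (B X) = X" "\<And>X. B (A X) = X" "\<And>X Y. A (br X Y) = br (A X) (A Y)"
  shows "kil (A X) (A Y) = kil X Y"
proof -
  have e: "br (A X) W = A (br X (B W))" for X W using assms by metis
  have l: "linear (\<lambda>W. br X (br Y (B W)))"
    using linear_compose[OF assms(2) linear_compose[OF linear_bracket_right linear_bracket_right, of X Y]]
    by (simp add: comp_def)
  have "kil (A X) (A Y) = tr (\<lambda>W. A (br X (br Y (B W))))"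
    unfolding kil_tr e using assms by simp
  also have "\<dots> = tr (\<lambda>W. br X (br Y (B (A W))))" by (rule tr_commute[OF assms(1) l])
  finally show ?thesis using assms(4) by (simp add: kil_tr)
qed

lemma kil_Ad: "g \<in> carrier G \<Longrightarrow> kil (Ad G g X) (Ad G g Y) = kil X Y"
  by (rule kil_automorphism[where B = "Ad G (inv g)"]) (auto simp: linear_Ad Ad_br)

lemma kil_\<theta>: "kil (\<theta> X) (\<theta> Y) = kil X Y"
  by (rule kil_automorphism[where B = \<theta>]) (auto simp: linear_\<theta> \<theta>_br)

lemma ip_sym: "ip X Y = ip Y X"
  unfolding cip_def using kil_\<theta>[of X "\<theta> Y"] kil_sym by simp

lemma bilinear_ip: "bilinear ip"
  unfolding bilinear_def cip_def using bilinear_kil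
  by (auto intro!: linearI simp: bilinear_ladd bilinear_radd bilinear_lmul bilinear_rmul)

lemma bounded_bilinear_ip: "bounded_bilinear ip"
  using bilinear_ip by (simp add: bilinear_conv_bounded_bilinear)

sublocale ip: bounded_bilinear ip by (rule bounded_bilinear_ip)

lemma ip_\<theta>: "ip (\<theta> X) (\<theta> Y) = ip X Y"
  using kil_\<theta>[of X "\<theta> Y"] by (simp add: cip_def)

lemmas ip_zero [simp] = ip.zero_left ip.zero_right

lemma ip_zero_iff [simp]: "ip X X = 0 \<longleftrightarrow> X = 0"
  using ip_pos[of X] by (cases "X = 0") (auto simp: ip.zero_left)

text \<open>Invariance of the Killing form, with \<open>\<theta>\<close> moved across the bracket.
  Hence \<open>ad\<close> of an element of \<open>\<ss>\<close> is symmetric and \<open>ad\<close>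
  of an element of \<open>\<kk>\<close> is skew.\<close>

lemma ip_adjoint: "ip (br X Y) Z = - ip Y (br (\<theta> X) Z)"
proof -
  have "ip (br X Y) Z = kil (br Y X) (\<theta> Z)"
    using br_anti[of X Y] bilinear_lneg[OF bilinear_kil] by (simp add: cip_def)
  also have "\<dots> = kil Y (br X (\<theta> Z))" by (rule kil_invariant)
  also have "br X (\<theta> Z) = \<theta> (br (\<theta> X) Z)" by (simp add: \<theta>_br)
  finally show ?thesis by (simp add: cip_def)
qed

text \<open>If \<open>ad X\<close> vanishes, the Killing form of \<open>X\<close> with any vector is
  \<open>0\<close>, against positivity of \<open>ip X X\<close>.\<close>

lemma ad_injective: assumes "\<And>Y. br X Y = 0" shows "X = 0"
proof (rule ccontr)
  assume "X \<noteq> 0"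
  then have "ip X X > 0" by (rule ip_pos)
  then show False using assms by (simp add: cip_def killing_def)
qed

abbreviation "\<kk> \<equiv> kalg G"
abbreviation "\<ss> \<equiv> ssub G"
abbreviation "\<aa> \<equiv> asub G"

lemma kalg_iff: "X \<in> \<kk> \<longleftrightarrow> \<theta> X = X" by (simp add: kalg_def)
text \<open>For \<open>F\<close> fixed by \<open>\<theta>\<close>, applying \<open>\<theta>\<close>
  to a solution of \<open>f' = br F f\<close> gives another solution, so \<open>\<theta>\<close>
  commutes with \<open>Ad (exp F)\<close>; the generated group inherits this.\<close>

lemma Kgrp_props: assumes "k \<in> Kgrp G"
  shows Kgrp_carrier: "k \<in> carrier G" and Ad_\<theta>: "\<theta> (Ad G k X) = Ad G k (\<theta> X)"
proof -
  have "k \<in> carrier G \<and> (\<forall>X. \<theta> (Ad G k X) = Ad G k (\<theta> X))"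
    using assms unfolding Kgrp_def
  proof (induction rule: generate.induct)
    case one
    then show ?case by (simp add: Ad_one)
  next
    case (incl h)
    then obtain F where F: "\<theta> F = F" "h = lexp G F" by (auto simp: kalg_def)
    have "Ad G (lexp G (1 *\<^sub>R F)) (\<theta> (Ad G (lexp G (0 *\<^sub>R F)) X)) = \<theta> (Ad G (lexp G (1 *\<^sub>R F)) X)" for X
    proof (rule Ad_lexp_eqI)
      fix t
      show "((\<lambda>a. \<theta> (Ad G (lexp G (a *\<^sub>R F)) X)) has_vector_derivative
          br F (\<theta> (Ad G (lexp G (t *\<^sub>R F)) X))) (at t)"
        using bounded_linear.has_vector_derivative[OF linear_conv_bounded_linear[THEN iffD1, OF linear_\<theta>]
            Ad_lexp_derivative[of F X t]] F by (simp add: \<theta>_br)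
    qed
    then show ?case using F by (simp add: Ad_one)
  next
    case (inv h)
    then obtain F where F: "\<theta> F = F" "h = lexp G F" by (auto simp: kalg_def)
    have "Ad G (lexp G ((-1) *\<^sub>R F)) (\<theta> (Ad G (lexp G (0 *\<^sub>R F)) X)) = \<theta> (Ad G (lexp G ((-1) *\<^sub>R F)) X)" for X
    proof (rule Ad_lexp_eqI)
      fix t
      show "((\<lambda>a. \<theta> (Ad G (lexp G (a *\<^sub>R F)) X)) has_vector_derivative
          br F (\<theta> (Ad G (lexp G (t *\<^sub>R F)) X))) (at t)"
        using bounded_linear.has_vector_derivative[OF linear_conv_bounded_linear[THEN iffD1, OF linear_\<theta>]
            Ad_lexp_derivative[of F X t]] F by (simp add: \<theta>_br)
    qed
    then show ?case using F by (simp add: Ad_one lexp_minus)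
  next
    case (eng h1 h2)
    then show ?case by (simp add: Ad_mult)
  qed
  then show "k \<in> carrier G" "\<theta> (Ad G k X) = Ad G k (\<theta> X)" by auto
qed

lemma ip_Ad: "k \<in> Kgrp G \<Longrightarrow> ip (Ad G k X) (Ad G k Y) = ip X Y"
  by (simp add: cip_def Ad_\<theta> kil_Ad Kgrp_carrier)

lemma subgroup_Kgrp: "subgroup (Kgrp G) G"
  unfolding Kgrp_def by (rule generate_is_subgroup) auto

lemma lexp_Kgrp: "F \<in> \<kk> \<Longrightarrow> lexp G F \<in> Kgrp G"
  unfolding Kgrp_def by (rule generate.incl) simp

text \<open>The minimum of \<open>ip X X\<close> on the Euclidean unit sphere is positive. The bound
  turns \<open>ip\<close>-bounded sets into bounded ones for compactness arguments.\<close>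

lemma ip_norm_bound: obtains m where "m > 0" "\<And>X. ip X X \<ge> m * (norm X)\<^sup>2"
proof -
  have "sphere (0::'e) 1 \<noteq> {}" by (simp add: sphere_eq_empty)
  moreover have "continuous_on (sphere 0 1) (\<lambda>X. ip X X)" by (intro ip.continuous_on continuous_intros)
  ultimately obtain x where x: "x \<in> sphere 0 1" "\<forall>y\<in>sphere 0 1. ip x x \<le> ip y y"
    using continuous_attains_inf[OF compact_sphere] by blast
  show ?thesis
  proof (rule that[of "ip x x"])
    show "ip x x > 0" using x(1) by (intro ip_pos) auto
    fix X :: 'e
    show "ip X X \<ge> ip x x * (norm X)\<^sup>2"
    proof (cases "X = 0")
      case False
      have "ip x x \<le> ip (X /\<^sub>R norm X) (X /\<^sub>R norm X)" using x(2) False by simp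
      also have "\<dots> = ip X X / (norm X)\<^sup>2"
        by (simp add: ip.scaleR_left ip.scaleR_right power2_eq_square divide_inverse)
      finally show ?thesis using False by (simp add: field_simps)
    qed (simp add: ip.zero_left)
  qed
qed

end

section \<open>Split Cartan subalgebras\<close>

lemma eigenbasis:
  fixes A :: "'e::euclidean_space \<Rightarrow> 'e"
  assumes "linear A" "span {X. \<exists>c. A X = c *\<^sub>R X} = UNIV"
  obtains B l where "independent B" "span B = UNIV" "finite B" "\<And>b. b \<in> B \<Longrightarrow> A b = l b *\<^sub>R b"
    "\<And>X b. b \<in> B \<Longrightarrow> representation B (A X) b = l b * representation B X b"
proof -
  define S where "S = {X. \<exists>c. A X = c *\<^sub>R X}"
  obtain B where B: "B \<subseteq> S" "independent B" "S \<subseteq> span B"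
    using maximal_independent_subset by blast
  have "span S = UNIV" using assms(2) by (simp add: S_def)
  with B have sB: "span B = UNIV" using span_mono span_span by (metis top.extremum_uniqueI)
  have fB: "finite B" using B(2) independent_bound by blast
  from B(1) have "\<forall>b\<in>B. \<exists>c. A b = c *\<^sub>R b" by (auto simp: S_def)
  then obtain l where l: "\<And>b. b \<in> B \<Longrightarrow> A b = l b *\<^sub>R b" by metis
  have "representation B (A X) b = l b * representation B X b" if "b \<in> B" for X b
  proof -
    have "X = (\<Sum>c\<in>B. representation B X c *\<^sub>R c)"
      using sum_representation_eq[OF B(2) _ fB subset_refl, of X] sB by simp
    then have "A X = A (\<Sum>c\<in>B. representation B X c *\<^sub>R c)" by (rule arg_cong)
    also have "\<dots> = (\<Sum>c\<in>B. representation B X c *\<^sub>R (l c *\<^sub>R c))"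
      using assms(1) l by (simp add: linear_sum linear_cmul)
    finally have "A X = (\<Sum>c\<in>B. representation B X c *\<^sub>R (l c *\<^sub>R c))" .
    then have "representation B (A X) b = (\<Sum>c\<in>B. representation B X c * (l c * representation B c b))"
      using B(2) sB by (simp add: representation_sum representation_scale mult.assoc)
    also have "\<dots> = (\<Sum>c\<in>B. if c = b then l b * representation B X b else 0)"
      by (intro sum.cong refl) (simp add: representation_basis[OF B(2)] mult.commute)
    also have "\<dots> = l b * representation B X b" using that fB by simp
    finally show ?thesis .
  qed
  with that B sB fB l show ?thesis by blast
qed

text \<open>In a basis of eigenvectors, a coordinate killed by the square of its eigenvalue is
  killed by the eigenvalue.\<close>

lemma semisimple_kernel:
  fixes A :: "'e::euclidean_space \<Rightarrow> 'e"
  assumes "linear A" "span {X. \<exists>c. A X = c *\<^sub>R X} = UNIV" "A (A X) = 0"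
  shows "A X = 0"
proof -
  obtain B l where B: "independent B" "span B = UNIV" "finite B"
    "\<And>X b. b \<in> B \<Longrightarrow> representation B (A X) b = l b * representation B X b"
    using eigenbasis[OF assms(1,2)] by metis
  have "representation B (A X) b = 0" if "b \<in> B" for b
  proof -
    have "l b * (l b * representation B X b) = representation B (A (A X)) b"
      using B(4)[OF that] by simp
    then show ?thesis using B(4)[OF that] by (auto simp: assms(3) representation_zero)
  qed
  then have "(\<Sum>b\<in>B. representation B (A X) b *\<^sub>R b) = 0" by simp
  then show ?thesis using sum_representation_eq[OF B(1) _ B(3) subset_refl, of "A X"] B(2) by simp
qed

text \<open>For small \<open>t\<close> the map \<open>A + t B\<close> is injective on the range of \<open>A\<close>, so its kernel can only be smaller
  than that of \<open>A\<close>.\<close>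

lemma minimal_kernel:
  fixes A B :: "'e::euclidean_space \<Rightarrow> 'e"
  assumes A: "linear A" and B: "linear B" and AB: "\<And>X. A (B X) = B (A X)"
    and ss: "\<And>X. A (A X) = 0 \<Longrightarrow> A X = 0"
    and min: "\<And>t. dim {X. A X = 0} \<le> dim {X. A X + t *\<^sub>R B X = 0}"
    and "A Z = 0"
  shows "B Z = 0"
proof -
  have sR: "subspace (range A)" using linear_subspace_image[OF A subspace_UNIV] .
  have inj: "\<forall>x\<in>range A. A x = 0 \<longrightarrow> x = 0" using ss by auto
  obtain e where e: "e > 0" "\<And>x. x \<in> range A \<Longrightarrow> norm (A x) \<ge> e * norm x"
    using injective_imp_isometric[OF closed_subspace[OF sR] sR _ inj] A
    by (auto simp: linear_conv_bounded_linear)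
  obtain M where M: "M > 0" "\<And>x. norm (B x) \<le> M * norm x"
    using B linear_bounded_pos by blast
  \<comment> \<open>On its range \<open>A\<close> expands vectors by at least \<open>e\<close>,
    while \<open>t B\<close> stretches them by at most \<open>e / 2\<close>.\<close>
  define t where "t = e / (2 * M)"
  have t: "t > 0" using e M by (simp add: t_def)
  have injR: "inj_on A (range A)"
    using inj sR by (auto simp: linear_inj_on_iff_eq_0[OF A sR])
  \<comment> \<open>Splits every vector into one of the kernel of \<open>A\<close> and one of its
    range.\<close>
  have "A ` range A = range A"
  proof (rule subspace_dim_equal)
    show "subspace (A ` range A)" using linear_subspace_image[OF A sR] .
    show "dim (A ` range A) \<ge> dim (range A)" using dim_image_eq[OF A, of "range A"] injR span_eq_iff[THEN iffD2, OF sR] by simp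
  qed (use sR in auto)
  have sub: "{X. A X + t *\<^sub>R B X = 0} \<subseteq> {X. A X = 0 \<and> B X = 0}"
  proof safe
    fix X assume X: "A X + t *\<^sub>R B X = 0"
    have "A X \<in> A ` range A" using \<open>A ` range A = range A\<close> by blast
    then obtain W where W: "A X = A (A W)" by blast
    let ?Z = "X - A W"
    have Z: "A ?Z = 0" using W A by (simp add: linear_diff)
    have 1: "A (A W) + t *\<^sub>R B (A W) = - t *\<^sub>R B ?Z"
      using X Z W B by (simp add: linear_diff algebra_simps)
    have "A (A (A W) + t *\<^sub>R B (A W)) = 0"
      unfolding 1 using A Z AB B by (simp add: linear_cmul linear_neg linear_0)
    moreover have "A (A W) + t *\<^sub>R B (A W) = A (A W + t *\<^sub>R B W)"
      using A AB by (simp add: linear_add linear_cmul)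
    ultimately have 0: "A (A W) + t *\<^sub>R B (A W) = 0" using ss by metis
    have "e * norm (A W) \<le> norm (A (A W))" using e by blast
    also have "A (A W) = - (t *\<^sub>R B (A W))" using 0 by (simp add: eq_neg_iff_add_eq_0)
    also have "norm \<dots> \<le> t * (M * norm (A W))" using M t by (simp add: mult_left_mono)
    also have "\<dots> = e / 2 * norm (A W)" using M by (simp add: t_def)
    finally have "A W = 0" using e by simp
    then show "A X = 0" using W A by (simp add: linear_0)
    then show "B X = 0" using X t by simp
  qed
  have "{X. A X + t *\<^sub>R B X = 0} = {X. A X = 0}"
  proof (rule subspace_dim_equal)
    show "subspace {X. A X + t *\<^sub>R B X = 0}"
      by (rule linear_subspace_kernel[OF linear_compose_add[OF A linear_compose_scale_right[OF B]]])
    show "subspace {X. A X = 0}" by (rule linear_subspace_kernel[OF A])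
  qed (use sub min in auto)
  then show ?thesis using sub assms(6) by auto
qed

context split begin

lemma ad_commute: "br X Y = 0 \<Longrightarrow> br X (br Y Z) = br Y (br X Z)"
  using jacobi[of X Y Z] by simp

text \<open>\<open>X\<close> is chosen with kernel of \<open>ad X\<close> of least dimension; then
  \<open>minimal_kernel\<close> applies to \<open>ad X\<close> and every \<open>ad Y\<close>. It
  serves both the split Cartan subalgebra and \<open>\<aa>\<close>.\<close>

lemma regular_element:
  assumes h: "subspace h" "\<And>X Y. X \<in> h \<Longrightarrow> Y \<in> h \<Longrightarrow> br X Y = 0"
    and ss: "\<And>X Y. X \<in> h \<Longrightarrow> br X (br X Y) = 0 \<Longrightarrow> br X Y = 0"
  obtains X where "X \<in> h" "\<And>Y Z. Y \<in> h \<Longrightarrow> br X Z = 0 \<Longrightarrow> br Y Z = 0"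
proof -
  have "0 \<in> h" using h(1) by (simp add: subspace_0)
  then obtain X where X: "X \<in> h" "\<And>Y. Y \<in> h \<Longrightarrow> dim {Z. br X Z = 0} \<le> dim {Z. br Y Z = 0}"
    using ex_has_least_nat[of "\<lambda>X. X \<in> h" 0 "\<lambda>X. dim {Z. br X Z = 0}"] by blast
  have "br Y Z = 0" if "Y \<in> h" "br X Z = 0" for Y Z
  proof (rule minimal_kernel[OF linear_bracket_right linear_bracket_right _ _ _ that(2)])
    show "br X (br Y W) = br Y (br X W)" for W using ad_commute h(2)[OF X(1) that(1)] by blast
    show "dim {W. br X W = 0} \<le> dim {W. br X W + t *\<^sub>R br Y W = 0}" for t
      using X(2)[of "X + t *\<^sub>R Y"] X(1) that(1) h(1)
      by (simp add: subspace_add subspace_scale br.add_left br.scaleR_left)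
  qed (use ss X in auto)
  with that X show ?thesis by blast
qed

text \<open>The centralizer of a regular element is the Cartan subalgebra itself, whose elements
  have real eigenvalues, so that their Killing squares are sums of squares. The list
  \<open>qs\<close> encodes a polynomial in \<open>ad X\<close> with real roots; being annihilated
  by it is a condition that passes to limits.\<close>

lemma split_regular:
  obtains X qs where "\<And>Y. br X (foldr (\<lambda>c Z. br X Z - c *\<^sub>R Z) qs Y) = 0"
    "\<And>M. br X M = 0 \<Longrightarrow> kil M M \<ge> 0" "0 \<notin> set qs"
proof -
  obtain h where ca: "cartan_subalgebra G h"
    and diag: "\<And>H. H \<in> h \<Longrightarrow> span {X. \<exists>c. br H X = c *\<^sub>R X} = UNIV"
    using split_form by (auto simp: split_real_form_def)
  have h: "subspace h" "\<And>X Y. X \<in> h \<Longrightarrow> Y \<in> h \<Longrightarrow> br X Y \<in> h"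
    and nil: "\<exists>k. lower_central_series G h k = {0}" and norm: "{X. \<forall>Y\<in>h. br X Y \<in> h} = h"
    using ca by (auto simp: cartan_subalgebra_def)
  obtain k where k: "lower_central_series G h k = {0}" using nil by blast
  have ss: "br X Y = 0" if "X \<in> h" "br X (br X Y) = 0" for X Y
    using semisimple_kernel[OF linear_bracket_right diag[OF that(1)] that(2)] .
  \<comment> \<open>Nilpotency makes a power of \<open>ad X\<close> vanish on \<open>h\<close>; as
    \<open>ad X\<close> is diagonalizable, it then vanishes there itself.\<close>
  have ab: "br X Y = 0" if X: "X \<in> h" and Y: "Y \<in> h" for X Y
  proof -
    have "((br X) ^^ j) Y \<in> lower_central_series G h j" for j
    proof (induction j)
      case (Suc j)
      then show ?case using X by (auto simp: bracket_span_def intro: span_base)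
    qed (use Y in simp)
    then have "((br X) ^^ k) Y = 0" using k by blast
    moreover have "br X Y = 0" if "((br X) ^^ (Suc j)) Y = 0" for j
      using that
    proof (induction j)
      case (Suc j)
      then have "br X (br X (((br X) ^^ j) Y)) = 0" by simp
      then have "((br X) ^^ (Suc j)) Y = 0" using ss[OF X] by simp
      then show ?case by (rule Suc.IH)
    qed simp
    ultimately show ?thesis by (cases k) (simp, metis)
  qed
  obtain X where X: "X \<in> h" "\<And>Y Z. Y \<in> h \<Longrightarrow> br X Z = 0 \<Longrightarrow> br Y Z = 0"
    using regular_element[OF h(1) ab ss] by metis
  \<comment> \<open>What commutes with the regular element commutes with \<open>h\<close>, hence
    normalizes \<open>h\<close>, hence lies in \<open>h\<close>.\<close>
  have ker: "M \<in> h" if "br X M = 0" for M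
  proof -
    have "br M Y = 0" if "Y \<in> h" for Y using X(2)[OF that \<open>br X M = 0\<close>] br_anti[of M Y] by simp
    then have "M \<in> {X. \<forall>Y\<in>h. br X Y \<in> h}" using h(1) by (simp add: subspace_0)
    then show ?thesis using norm by simp
  qed
  have pos: "kil M M \<ge> 0" if M: "br X M = 0" for M
  proof -
    obtain B l where B: "independent B" "span B = UNIV" "finite B" "\<And>b. b \<in> B \<Longrightarrow> br M b = l b *\<^sub>R b"
      using eigenbasis[OF linear_bracket_right diag[OF ker[OF M]]] by metis
    have "linear (\<lambda>Z. br M (br M Z))"
      using linear_compose[OF linear_bracket_right linear_bracket_right, of M M] by (simp add: comp_def)
    then have "kil M M = (\<Sum>b\<in>B. representation B (br M (br M b)) b)"
      unfolding kil_tr by (rule tr_basis[OF _ B(1,2)])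
    also have "\<dots> = (\<Sum>b\<in>B. l b * l b)"
      using B by (intro sum.cong refl) (simp add: br.scaleR_right representation_scale representation_basis)
    also have "\<dots> \<ge> 0" by (intro sum_nonneg) auto
    finally show ?thesis .
  qed
  obtain B l where B: "independent B" "span B = UNIV" "finite B" "\<And>b. b \<in> B \<Longrightarrow> br X b = l b *\<^sub>R b"
    using eigenbasis[OF linear_bracket_right diag[OF X(1)]] by metis
  \<comment> \<open>The nonzero eigenvalues; applying all factors \<open>ad X - c\<close> and then
    \<open>ad X\<close> kills each eigenvector.\<close>
  obtain qs where qs: "set qs = l ` B - {0}" using B(3) finite_list[of "l ` B - {0}"] by blast
  have lin: "linear (foldr (\<lambda>c Z. br X Z - c *\<^sub>R Z) cs)" for cs
    by (induction cs) (auto intro!: linearI simp: linear_add linear_cmul br.add_right br.scaleR_right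
        scaleR_diff_right scaleR_add_right linear_ident[unfolded id_def] mult.commute)
  have eig: "\<exists>r. foldr (\<lambda>c Z. br X Z - c *\<^sub>R Z) cs b = r *\<^sub>R b \<and> (l b \<in> set cs \<longrightarrow> r = 0)" if "b \<in> B" for cs b
  proof (induction cs)
    case Nil
    show ?case by (intro exI[of _ 1]) simp
  next
    case (Cons c cs)
    then obtain r where "foldr (\<lambda>c Z. br X Z - c *\<^sub>R Z) cs b = r *\<^sub>R b" "l b \<in> set cs \<longrightarrow> r = 0" by blast
    then show ?case using B(4)[OF that]
      by (intro exI[of _ "r * (l b - c)"]) (auto simp: br.scaleR_right algebra_simps)
  qed
  have "br X (foldr (\<lambda>c Z. br X Z - c *\<^sub>R Z) qs Y) = 0" for Y
  proof -
    let ?f = "\<lambda>Y. br X (foldr (\<lambda>c Z. br X Z - c *\<^sub>R Z) qs Y)"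
    have "linear ?f" using linear_compose[OF lin linear_bracket_right] by (simp add: comp_def)
    moreover have "?f b = 0" if b: "b \<in> B" for b
    proof -
      obtain r where "foldr (\<lambda>c Z. br X Z - c *\<^sub>R Z) (0 # qs) b = r *\<^sub>R b" "l b \<in> set (0 # qs) \<longrightarrow> r = 0"
        using eig[OF b] by blast
      then show ?thesis using qs b by auto
    qed
    ultimately show ?thesis using linear_eq_0_on_span[of ?f B Y] B(2) by simp
  qed
  with that[of X qs] pos qs show ?thesis by blast
qed

abbreviation pol :: "real list \<Rightarrow> 'e \<Rightarrow> 'e \<Rightarrow> 'e" where
  "pol cs X Y \<equiv> foldr (\<lambda>c Z. br X Z - c *\<^sub>R Z) cs Y"

lemma pol_Ad: "g \<in> carrier G \<Longrightarrow> pol cs (Ad G g X) (Ad G g Y) = Ad G g (pol cs X Y)"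
  by (induction cs) (auto simp: Ad_br Ad_diff Ad_scale)

lemma continuous_pol: "continuous_on UNIV (\<lambda>X. pol cs X Y)"
  by (induction cs) (auto intro!: continuous_intros br.continuous_on)

lemma pol_comm: "pol cs X (br X v - c *\<^sub>R v) = br X (pol cs X v) - c *\<^sub>R pol cs X v"
proof (induction cs)
  case (Cons a cs)
  show ?case
    by (simp only: foldr_Cons comp_apply Cons.IH br.diff_right br.scaleR_right) (simp add: algebra_simps)
qed simp

text \<open>By \<open>ip_adjoint\<close>, \<open>ad (\<theta> X)\<close> is minus the adjoint of
  \<open>ad X\<close>. So \<open>ad X\<close> is normal; where it has real spectrum it is symmetric,
  which says that \<open>ad (X + \<theta> X)\<close> vanishes. The induction removes one linear
  factor at a time.\<close>

lemma normal_real_symmetric: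
  assumes n: "br X (\<theta> X) = 0" and z: "pol cs X v = 0"
  shows "br (X + \<theta> X) v = 0"
  using z
proof (induction cs arbitrary: v)
  case Nil
  then show ?case by (simp add: br.zero_right)
next
  case (Cons c cs)
  let ?S = "X + \<theta> X" and ?w = "br X v - c *\<^sub>R v"
  have comm: "br ?S X = 0" "br X ?S = 0"
    using n br_anti[of "\<theta> X" X] by (auto simp: br.add_left br.add_right)
  have "br ?S ?w = 0" using Cons.prems by (intro Cons.IH) (simp add: pol_comm)
  then have u: "br X (br ?S v) = c *\<^sub>R br ?S v"
    using ad_commute[OF comm(1)] by (simp add: br.diff_right br.scaleR_right)
  let ?u = "br ?S v"
  have c: "br (\<theta> X) (br X ?u) = br X (br (\<theta> X) ?u)" using ad_commute[OF n] by metis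
  \<comment> \<open>\<open>?u\<close> is an eigenvector of \<open>ad X\<close> for \<open>c\<close>.
    For a normal operator it is also one of the adjoint, that is, \<open>?y = 0\<close>. Then
    \<open>ad ?S\<close> kills \<open>?u = br ?S v\<close>, and \<open>ad ?S\<close> is skew, so
    \<open>?u = 0\<close>.\<close>
  let ?y = "br (\<theta> X) ?u + c *\<^sub>R ?u"
  have "ip ?y ?y = ip (br (\<theta> X) ?u) ?y + c * ip ?u ?y"
    by (simp add: ip.add_left ip.scaleR_left)
  also have "ip (br (\<theta> X) ?u) ?y = - ip ?u (br X ?y)" using ip_adjoint[of "\<theta> X" ?u ?y] by simp
  also have "br X ?y = c *\<^sub>R ?y"
    using c u by (simp add: br.add_right br.scaleR_right algebra_simps)
  finally have "ip ?y ?y = 0" by (simp add: ip.scaleR_right)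
  then have "br (\<theta> X) ?u = - c *\<^sub>R ?u" by (simp add: eq_neg_iff_add_eq_0)
  then have "br ?S ?u = 0" using u by (simp add: br.add_left)
  then have "ip ?u ?u = 0" using ip_adjoint[of ?S v ?u] by (simp add: add.commute ip.zero_right)
  then show ?case by simp
qed

lemma Ad_path_derivative_ip:
  "((\<lambda>t. ip (Ad G (lexp G (t *\<^sub>R Y)) X) Z) has_real_derivative ip (br Y X) Z) (at 0)"
  using bounded_linear.has_vector_derivative[OF ip.bounded_linear_left tang_Ad[OF tang_lexp, of Y X]]
  by (simp add: has_real_derivative_iff_has_vector_derivative)

text \<open>A vector of minimal length in a closed invariant set of semisimple elements with real eigenvalues
  commutes with its image under \<open>\<theta>\<close>, hence lies in \<open>\<ss>\<close>.\<close>

lemma split_element_in_s: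
  obtains X where "\<theta> X = - X" "\<And>M. br X M = 0 \<Longrightarrow> kil M M \<ge> 0"
proof -
  obtain Xh qs where Xh: "\<And>Y. br Xh (pol qs Xh Y) = 0"
    "\<And>M. br Xh M = 0 \<Longrightarrow> kil M M \<ge> 0" and qs: "0 \<notin> set qs"
    using split_regular by metis
  \<comment> \<open>Nonnegativity on the centralizer is not visibly closed in \<open>X\<close>,
    since kernels may jump. It is imposed instead on the range of \<open>pol qs X\<close>: by the
    first condition this range lies in the centralizer, and on the centralizer
    \<open>pol qs X\<close> is a nonzero scalar.\<close>
  define Q where "Q = {X. (\<forall>Y. pol (0 # qs) X Y = 0) \<and> (\<forall>Y. 0 \<le> kil (pol qs X Y) (pol qs X Y))}"
  have XhQ: "Xh \<in> Q" using Xh by (simp add: Q_def)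
  have bk: "bounded_bilinear kil" using bilinear_kil bilinear_conv_bounded_bilinear by blast
  have cQ: "closed Q"
    unfolding Q_def
    by (intro closed_Collect_conj closed_Collect_all closed_Collect_eq closed_Collect_le continuous_pol
        continuous_on_const bounded_bilinear.continuous_on[OF bk])
  have AdQ: "Ad G g X \<in> Q" if "X \<in> Q" "g \<in> carrier G" for g X
  proof -
    have "pol cs (Ad G g X) Y = Ad G g (pol cs X (Ad G (inv g) Y))" for cs Y
      using pol_Ad[OF that(2), where cs = cs and X = X and Y = "Ad G (inv g) Y"] that(2) by simp
    then show ?thesis
      using that unfolding Q_def mem_Collect_eq by (simp only: kil_Ad Ad_zero) auto
  qed
  obtain m where m: "m > 0" "\<And>X. ip X X \<ge> m * (norm X)\<^sup>2" using ip_norm_bound by metis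
  let ?S = "Q \<inter> {X. ip X X \<le> ip Xh Xh}"
  have cont: "continuous_on A (\<lambda>X. ip X X)" for A by (intro ip.continuous_on continuous_intros)
  have "compact ?S"
  proof (subst compact_eq_bounded_closed, intro conjI)
    have "norm X \<le> sqrt (ip Xh Xh / m)" if "X \<in> ?S" for X
      using m(2)[of X] that m(1) by (intro real_le_rsqrt) (simp add: field_simps)
    then show "bounded ?S" by (auto simp: bounded_iff)
    show "closed ?S" by (intro closed_Int cQ closed_Collect_le cont continuous_on_const)
  qed
  then obtain X where X: "X \<in> ?S" "\<And>Y. Y \<in> ?S \<Longrightarrow> ip X X \<le> ip Y Y"
    using continuous_attains_inf[OF _ _ cont, of ?S] XhQ by blast
  have min: "ip X X \<le> ip Y Y" if "Y \<in> Q" for Y using X(2)[of Y] X(1) that by force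
  \<comment> \<open>First variation of the length of \<open>X\<close> along the orbit of the
    group.\<close>
  have stat: "ip (br Y X) X = 0" for Y
  proof -
    let ?f = "\<lambda>t. Ad G (lexp G (t *\<^sub>R Y)) X"
    have "((\<lambda>t. ip (?f t) (?f t)) has_vector_derivative ip (?f 0) (br Y X) + ip (br Y X) (?f 0)) (at 0)"
      by (rule ip.has_vector_derivative) (rule tang_Ad[OF tang_lexp])+
    then have d: "((\<lambda>t. ip (?f t) (?f t)) has_real_derivative 2 * ip (br Y X) X) (at 0)"
      by (simp add: has_real_derivative_iff_has_vector_derivative Ad_one ip_sym[of X])
    have "2 * ip (br Y X) X = 0"
      by (rule DERIV_local_min[OF d, of 1]) (use AdQ X(1) min in \<open>auto simp: Ad_one\<close>)
    then show ?thesis by simp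
  qed
  have "ip Y (br (\<theta> X) X) = 0" for Y
  proof -
    have "ip (br Y X) X = - ip (br X Y) X" using br_anti[of Y X] by (simp add: ip.minus_left)
    then show ?thesis using stat[of Y] ip_adjoint[of X Y X] by simp
  qed
  then have "br (\<theta> X) X = 0" using ip_zero_iff by blast
  then have n: "br X (\<theta> X) = 0" using br_anti[of X "\<theta> X"] by simp
  have "br (X + \<theta> X) v = 0" for v
    by (rule normal_real_symmetric[OF n, of "0 # qs"]) (use X(1) in \<open>simp add: Q_def\<close>)
  then have "X + \<theta> X = 0" by (rule ad_injective)
  then have 1: "\<theta> X = - X" by (simp add: eq_neg_iff_add_eq_0 add.commute)
  have "kil M M \<ge> 0" if M: "br X M = 0" for M
  proof -
    have "\<exists>r. pol cs X M = r *\<^sub>R M \<and> (0 \<notin> set cs \<longrightarrow> r \<noteq> 0)" for cs :: "real list"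
    proof (induction cs)
      case Nil
      show ?case by (intro exI[of _ 1]) simp
    next
      case (Cons c cs)
      then obtain r where "pol cs X M = r *\<^sub>R M" "0 \<notin> set cs \<longrightarrow> r \<noteq> 0" by blast
      then show ?case using M by (intro exI[of _ "- c * r"]) (auto simp: br.scaleR_right)
    qed
    then obtain r where r: "pol qs X M = r *\<^sub>R M" "r \<noteq> 0" using qs by blast
    have "0 \<le> kil (pol qs X M) (pol qs X M)" using X(1) by (simp add: Q_def)
    then have "0 \<le> r * r * kil M M"
      unfolding r(1) using bilinear_lmul[OF bilinear_kil] bilinear_rmul[OF bilinear_kil] by (simp add: mult.assoc)
    moreover have "r * r > 0" using r(2) by (metis not_real_square_gt_zero)
    ultimately show ?thesis by (auto simp: zero_le_mult_iff)
  qed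
  with that 1 show ?thesis by blast
qed

end

section \<open>The centralizer of the maximal abelian subspace\<close>

context split begin

lemma a_props: "subspace \<aa>" "\<aa> \<subseteq> \<ss>" "X \<in> \<aa> \<Longrightarrow> Y \<in> \<aa> \<Longrightarrow> br X Y = 0"
  using maxab by (auto simp: maximal_abelian_def abelian_in_s_def)

lemma a_theta: "X \<in> \<aa> \<Longrightarrow> \<theta> X = - X"
  using a_props(2) by (auto simp: ssub_def)

lemma a_maximal: assumes "\<theta> X = - X" "\<And>H. H \<in> \<aa> \<Longrightarrow> br H X = 0" shows "X \<in> \<aa>"
proof -
  let ?V = "span (insert X \<aa>)"
  have c: "br Y Z = 0" if "Y \<in> ?V" "Z \<in> ?V" for Y Z
  proof -
    have "br Y Z = 0" if "Y \<in> insert X \<aa>" "Z \<in> insert X \<aa>" for Y Z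
      using that a_props(3) assms(2) br_anti[of X Z] by auto
    then have "br Y Z = 0" if "Z \<in> ?V" "Y \<in> insert X \<aa>" for Y Z
      using linear_eq_0_on_span[OF linear_bracket_right _ that(1)] that(2) by blast
    then show ?thesis
      using linear_eq_0_on_span[OF linear_bracket_left[of Z] _ that(1)] that(2) by blast
  qed
  have "abelian_in_s G ?V"
  proof -
    have "?V \<subseteq> \<ss>"
    proof (rule span_minimal)
      show "subspace \<ss>" by (auto simp: subspace_def ssub_def)
    qed (use assms a_props(2) in \<open>auto simp: ssub_def\<close>)
    then show ?thesis using c by (auto simp: abelian_in_s_def)
  qed
  moreover have "\<aa> \<subseteq> ?V" by (meson span_superset subset_insertI subset_trans)
  ultimately have "?V = \<aa>" using maxab by (simp add: maximal_abelian_def)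
  then show ?thesis by (metis insertI1 span_base)
qed

lemma ad_symmetric: "\<theta> X = - X \<Longrightarrow> ip (br X Y) Z = ip Y (br X Z)"
  by (simp add: ip_adjoint br.minus_left ip.minus_right)

lemma ad_s_semisimple: assumes "\<theta> X = - X" "br X (br X Y) = 0" shows "br X Y = 0"
  using ad_symmetric[OF assms(1), of Y "br X Y"] assms(2) by simp

lemma regular_in_a:
  obtains H where "H \<in> \<aa>" "\<And>H' Z. H' \<in> \<aa> \<Longrightarrow> br H Z = 0 \<Longrightarrow> br H' Z = 0"
  using regular_element[OF a_props(1,3) ad_s_semisimple[OF a_theta]] by metis

lemma Ad_Kgrp_bound: obtains C where "\<And>k X. k \<in> Kgrp G \<Longrightarrow> norm (Ad G k X) \<le> C * norm X"
proof -
  obtain m where m: "m > 0" "\<And>X. ip X X \<ge> m * (norm X)\<^sup>2" using ip_norm_bound by metis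
  obtain K where K: "K > 0" "\<And>X Y. norm (ip X Y) \<le> norm X * norm Y * K" using ip.pos_bounded by blast
  show ?thesis
  proof (rule that[of "sqrt (K / m)"])
    fix k X assume "k \<in> Kgrp G"
    then have "m * (norm (Ad G k X))\<^sup>2 \<le> ip X X" using m(2)[of "Ad G k X"] by (simp add: ip_Ad)
    also have "\<dots> \<le> K * (norm X)\<^sup>2" using K(2)[of X X] by (simp add: power2_eq_square mult.commute)
    finally have "(norm (Ad G k X))\<^sup>2 \<le> (K / m) * (norm X)\<^sup>2" using m(1) by (simp add: field_simps)
    then have "norm (Ad G k X) \<le> sqrt ((K / m) * (norm X)\<^sup>2)" by (rule real_le_rsqrt)
    then show "norm (Ad G k X) \<le> sqrt (K / m) * norm X" using real_sqrt_mult[of "K / m" "(norm X)\<^sup>2"] by simp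
  qed
qed

text \<open>The closure of \<open>Ad K\<close> is compact, so some limit \<open>T\<close> of elements of \<open>Ad K\<close> minimises
  \<open>ip (T H) X\<close>; the minimality makes \<open>T H\<close> commute with \<open>X\<close>.\<close>

lemma conjugate_into_centralizer:
  assumes H: "\<theta> H = - H" and X: "\<theta> X = - X"
  obtains T where "linear T" "\<And>Y Z. T (br Y Z) = br (T Y) (T Z)" "\<And>Y. \<theta> (T Y) = T (\<theta> Y)"
    "\<And>Y Z. ip (T Y) (T Z) = ip Y Z" "br (T H) X = 0"
proof -
  obtain C where C: "\<And>k X. k \<in> Kgrp G \<Longrightarrow> norm (Ad G k X) \<le> C * norm X" using Ad_Kgrp_bound by metis
  define L where "L k = Blinfun (Ad G k)" for k
  have L: "blinfun_apply (L k) = Ad G k" if "k \<in> Kgrp G" for k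
    unfolding L_def using linear_Ad Kgrp_carrier that
    by (intro bounded_linear_Blinfun_apply) (auto simp flip: linear_conv_bounded_linear)
  define S where "S = closure (L ` Kgrp G)"
  have "norm (L k) \<le> \<bar>C\<bar>" if "k \<in> Kgrp G" for k
  proof (rule norm_blinfun_bound)
    fix x
    show "norm (blinfun_apply (L k) x) \<le> \<bar>C\<bar> * norm x"
      using C[OF that, of x] L[OF that] by (simp add: order_trans[OF _ mult_right_mono])
  qed simp
  then have "bounded S" unfolding S_def by (intro bounded_closure) (auto simp: bounded_iff)
  then have "compact S" by (simp add: S_def compact_eq_bounded_closed)
  moreover have "S \<noteq> {}" using subgroup.one_closed[OF subgroup_Kgrp] by (auto simp: S_def)
  moreover have "continuous_on S (\<lambda>T. ip (blinfun_apply T H) X)"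
    by (intro ip.continuous_on continuous_intros)
  ultimately obtain T where T: "T \<in> S" "\<And>T'. T' \<in> S \<Longrightarrow> ip (blinfun_apply T H) X \<le> ip (blinfun_apply T' H) X"
    using continuous_attains_inf by metis
  \<comment> \<open>Membership in the closure of \<open>Ad K\<close> is all that is known of
    \<open>T\<close>; each property it inherits from \<open>Ad K\<close> is a closed
    condition.\<close>
  have closedI: "P T" if "closed {T. P T}" "\<And>k. k \<in> Kgrp G \<Longrightarrow> P (L k)" for P
  proof -
    have "S \<subseteq> {T. P T}" unfolding S_def by (rule closure_minimal) (use that in auto)
    then show ?thesis using T(1) by auto
  qed
  have t1: "blinfun_apply T (br Y Z) = br (blinfun_apply T Y) (blinfun_apply T Z)" for Y Z
    by (rule closedI[of "\<lambda>T. blinfun_apply T (br Y Z) = br (blinfun_apply T Y) (blinfun_apply T Z)"])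
      (auto intro!: closed_Collect_eq br.continuous_on continuous_intros simp: L Ad_br Kgrp_carrier)
  have t2: "\<theta> (blinfun_apply T Y) = blinfun_apply T (\<theta> Y)" for Y
    by (rule closedI[of "\<lambda>T. \<theta> (blinfun_apply T Y) = blinfun_apply T (\<theta> Y)"])
      (auto intro!: closed_Collect_eq continuous_intros
        continuous_on_compose2[OF linear_continuous_on[OF linear_conv_bounded_linear[THEN iffD1, OF linear_\<theta>]]]
        simp: L Ad_\<theta>)
  have t3: "ip (blinfun_apply T Y) (blinfun_apply T Z) = ip Y Z" for Y Z
    by (rule closedI[of "\<lambda>T. ip (blinfun_apply T Y) (blinfun_apply T Z) = ip Y Z"])
      (auto intro!: closed_Collect_eq ip.continuous_on continuous_intros simp: L ip_Ad)
  let ?Y = "blinfun_apply T H"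
  have Y: "\<theta> ?Y = - ?Y" using t2[of H] H by (simp add: blinfun.minus_right)
  have stat: "ip (br Z ?Y) X = 0" if Z: "\<theta> Z = Z" for Z
  proof -
    have k: "lexp G (t *\<^sub>R Z) \<in> Kgrp G" for t by (rule lexp_Kgrp) (use Z in \<open>simp add: kalg_iff\<close>)
    \<comment> \<open>Left multiplication by \<open>Ad k\<close> is continuous and preserves
      \<open>Ad K\<close>, hence its closure, so the comparison curve through the minimizer stays in
      \<open>S\<close>.\<close>
    have inS: "L k o\<^sub>L T \<in> S" if "k \<in> Kgrp G" for k
    proof -
      have "L k o\<^sub>L L k' \<in> L ` Kgrp G" if "k' \<in> Kgrp G" for k'
      proof -
        have "k \<otimes> k' \<in> Kgrp G" using \<open>k \<in> Kgrp G\<close> that subgroup.m_closed[OF subgroup_Kgrp] by blast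
        moreover have "L k o\<^sub>L L k' = L (k \<otimes> k')"
          using \<open>k \<in> Kgrp G\<close> that L calculation by (intro blinfun_eqI) (simp add: Ad_mult Kgrp_carrier)
        ultimately show ?thesis by blast
      qed
      then have "(\<lambda>T. L k o\<^sub>L T) ` (L ` Kgrp G) \<subseteq> L ` Kgrp G"
        by (intro image_subsetI) (metis (no_types, lifting) imageE)
      then have "(\<lambda>T. L k o\<^sub>L T) ` (L ` Kgrp G) \<subseteq> closure (L ` Kgrp G)"
        by (rule order_trans[OF _ closure_subset])
      then have "(\<lambda>T. L k o\<^sub>L T) ` closure (L ` Kgrp G) \<subseteq> closure (L ` Kgrp G)"
        by (intro image_closure_subset closed_closure continuous_intros)
      then show ?thesis using T(1) by (auto simp: S_def)
    qed
    have "ip ?Y X \<le> ip (Ad G (lexp G (t *\<^sub>R Z)) ?Y) X" for t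
      using T(2)[OF inS[OF k[of t]]] L[OF k] by simp
    then show ?thesis
      by (intro DERIV_local_min[OF Ad_path_derivative_ip, of 1]) (auto simp: Ad_one)
  qed
  \<comment> \<open>The bracket of \<open>T H\<close> and \<open>X\<close>, both in
    \<open>\<ss>\<close>, lies in \<open>\<kk>\<close> and may itself be used as test vector;
    stationarity then says that its length is \<open>0\<close>.\<close>
  have "ip (br ?Y X) (br ?Y X) = 0"
  proof -
    let ?Z = "br ?Y X"
    have Z: "\<theta> ?Z = ?Z" using Y X by (simp add: \<theta>_br br.minus_left br.minus_right)
    have "0 = ip (br ?Z ?Y) X" using stat[OF Z] by simp
    also have "\<dots> = - ip (br ?Y ?Z) X" using br_anti[of ?Z ?Y] by (simp add: ip.minus_left)
    also have "\<dots> = - ip ?Z (br ?Y X)" using ad_symmetric[OF Y] by simp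
    finally show ?thesis by simp
  qed
  then have "br ?Y X = 0" by simp
  moreover have "linear (blinfun_apply T)"
    using blinfun.bounded_linear_right linear_conv_bounded_linear by blast
  ultimately show ?thesis using that[of "blinfun_apply T"] t1 t2 t3 by blast
qed

lemma kil_neg_k: "\<theta> M = M \<Longrightarrow> kil M M = - ip M M"
  by (simp add: cip_def)

text \<open>With \<open>H\<close> regular in \<open>\<aa>\<close> and \<open>T H\<close> commuting
  with \<open>X\<close>, the vector \<open>W\<close> with \<open>T W = X\<close> lies in
  \<open>\<aa>\<close>. So \<open>M\<close> commutes with \<open>W\<close> and \<open>T M\<close>
  with \<open>X\<close>, whence \<open>kil (T M) (T M) \<ge> 0\<close>; but the Killing form is
  negative definite on \<open>\<kk>\<close>.\<close>

lemma centralizer_in_k: assumes M: "\<theta> M = M" "\<And>H. H \<in> \<aa> \<Longrightarrow> br H M = 0" shows "M = 0"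
proof -
  obtain X where X: "\<theta> X = - X" "\<And>M. br X M = 0 \<Longrightarrow> kil M M \<ge> 0" using split_element_in_s by metis
  obtain H where H: "H \<in> \<aa>" "\<And>H' Z. H' \<in> \<aa> \<Longrightarrow> br H Z = 0 \<Longrightarrow> br H' Z = 0"
    using regular_in_a by metis
  obtain T where T: "linear T" "\<And>Y Z. T (br Y Z) = br (T Y) (T Z)" "\<And>Y. \<theta> (T Y) = T (\<theta> Y)"
    "\<And>Y Z. ip (T Y) (T Z) = ip Y Z" "br (T H) X = 0"
    using conjugate_into_centralizer[OF a_theta[OF H(1)] X(1)] by metis
  have T0: "T Y = 0 \<longleftrightarrow> Y = 0" for Y using T(4)[of Y Y] linear_0[OF T(1)] by auto
  then have "inj T" using T(1) by (simp add: linear_injective_0)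
  then have "surj T" using T(1) by (simp add: linear_injective_imp_surjective)
  then obtain W where W: "X = T W" by (metis surjD)
  have "br H W = 0" using T(2)[of H W] T(5) W T0 by simp
  then have cW: "br H' W = 0" if "H' \<in> \<aa>" for H' using H(2) that by blast
  have "T (\<theta> W + W) = 0" using T(1,3) X(1) W by (metis add.commute linear_add right_minus)
  then have "\<theta> W = - W" using T0 by (simp add: eq_neg_iff_add_eq_0)
  then have "W \<in> \<aa>" using a_maximal cW by blast
  then have "br W M = 0" using M by blast
  then have "br X (T M) = 0" using T(2)[of W M] W linear_0[OF T(1)] by simp
  then have "kil (T M) (T M) \<ge> 0" by (rule X(2))
  moreover have "\<theta> (T M) = T M" using T(3) M by simp
  ultimately have "ip (T M) (T M) \<le> 0" using kil_neg_k by simp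
  then have "ip M M \<le> 0" by (simp add: T(4))
  then show ?thesis using ip_pos[of M] by fastforce
qed

text \<open>The centralizer of \<open>\<aa>\<close> is \<open>\<theta>\<close>-stable. The
  \<open>\<kk>\<close>-part of an element vanishes by \<open>centralizer_in_k\<close>, and the rest
  lies in \<open>\<aa>\<close> by maximality.\<close>

lemma centralizer_a: assumes "\<And>H. H \<in> \<aa> \<Longrightarrow> br H Y = 0" shows "Y \<in> \<aa>"
proof -
  have "br H (\<theta> Y) = 0" if "H \<in> \<aa>" for H
  proof -
    have "\<theta> (br H Y) = - br H (\<theta> Y)" by (simp add: \<theta>_br a_theta[OF that] br.minus_left)
    then show ?thesis by (simp add: assms[OF that])
  qed
  then have 2: "br H (Y + \<theta> Y) = 0" if "H \<in> \<aa>" for H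
    using that assms[OF that] by (simp add: br.add_right)
  have "\<theta> (Y + \<theta> Y) = \<theta> Y + Y" by simp
  then have "\<theta> (Y + \<theta> Y) = Y + \<theta> Y" by (subst add.commute)
  then have "Y + \<theta> Y = 0" using 2 by (rule centralizer_in_k)
  then have "\<theta> Y = - Y" using add_eq_0_iff by blast
  then show ?thesis using assms by (rule a_maximal)
qed

end

section \<open>Roots\<close>

context split begin

text \<open>Maximizes the Rayleigh quotient on the \<open>ip\<close>-unit sphere of
  \<open>U\<close>. At a maximum \<open>A v - c v\<close> is orthogonal to \<open>U\<close>, and by
  invariance it lies in \<open>U\<close>.\<close>

lemma symmetric_eigenvector:
  assumes U: "subspace U" "U \<noteq> {0}" and A: "linear A" "A ` U \<subseteq> U"
    and sym: "\<And>x y. ip (A x) y = ip x (A y)"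
  obtains v c where "v \<in> U" "v \<noteq> 0" "A v = c *\<^sub>R v"
proof -
  obtain m where m: "m > 0" "\<And>X. ip X X \<ge> m * (norm X)\<^sup>2" using ip_norm_bound by metis
  let ?S = "U \<inter> {x. ip x x = 1}"
  have cA: "continuous_on S A" for S
    using A(1) linear_continuous_on linear_conv_bounded_linear by blast
  have "compact ?S"
  proof (subst compact_eq_bounded_closed, intro conjI)
    have "norm x \<le> sqrt (1 / m)" if "x \<in> ?S" for x
      using m(2)[of x] that m(1) by (intro real_le_rsqrt) (simp add: field_simps)
    then show "bounded ?S" by (auto simp: bounded_iff)
    show "closed ?S"
      by (intro closed_Int closed_subspace U closed_Collect_eq ip.continuous_on continuous_intros)
  qed
  moreover have "?S \<noteq> {}"
  proof -
    obtain x where x: "x \<in> U" "x \<noteq> 0" using U subspace_0 by blast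
    then have "(1 / sqrt (ip x x)) *\<^sub>R x \<in> ?S"
      using U(1) ip_pos[OF x(2)] x(2) by (simp add: x(2) subspace_scale ip.scaleR_left ip.scaleR_right)
    then show ?thesis by blast
  qed
  ultimately obtain v where v: "v \<in> ?S" "\<And>x. x \<in> ?S \<Longrightarrow> ip (A x) x \<le> ip (A v) v"
    using continuous_attains_sup[of ?S "\<lambda>x. ip (A x) x", OF _ _ ip.continuous_on[OF cA continuous_on_id]] by blast
  define c where "c = ip (A v) v"
  have le: "ip (A x) x \<le> c * ip x x" if "x \<in> U" for x
  proof (cases "x = 0")
    case True
    then show ?thesis by simp
  next
    case False
    let ?r = "1 / sqrt (ip x x)"
    have p: "ip x x > 0" using False by (rule ip_pos)
    then have "?r *\<^sub>R x \<in> ?S"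
      using U(1) that False by (simp add: subspace_scale ip.scaleR_left ip.scaleR_right)
    from v(2)[OF this] have "ip (A x) x / ip x x \<le> c"
      using A(1) p by (simp add: linear_cmul ip.scaleR_left ip.scaleR_right c_def)
    then show ?thesis using p by (simp add: field_simps)
  qed
  have stat: "ip (A v - c *\<^sub>R v) w = 0" if w: "w \<in> U" for w
  proof -
    let ?f = "\<lambda>t. ip (A (v + t *\<^sub>R w)) (v + t *\<^sub>R w) - c * ip (v + t *\<^sub>R w) (v + t *\<^sub>R w)"
    have e: "?f t = (ip (A v) v - c * ip v v) + t * (2 * ip (A v) w - 2 * c * ip v w) + t * t * (ip (A w) w - c * ip w w)" for t
      using A(1) sym[of w v] ip_sym[of w v] ip_sym[of w "A v"]
      by (simp add: linear_add linear_cmul ip.add_left ip.add_right ip.scaleR_left ip.scaleR_right algebra_simps)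
    have d: "(?f has_real_derivative 2 * ip (A v) w - 2 * c * ip v w) (at 0)"
      unfolding e by (auto intro!: derivative_eq_intros)
    have "2 * ip (A v) w - 2 * c * ip v w = 0"
    proof (rule DERIV_local_max[OF d, of 1])
      show "\<forall>y. \<bar>0 - y\<bar> < 1 \<longrightarrow> ?f y \<le> ?f 0"
      proof (intro allI impI)
        fix y
        have "?f y \<le> 0" using le[of "v + y *\<^sub>R w"] U(1) v(1) w by (simp add: subspace_add subspace_scale)
        moreover have "?f 0 = 0" using v(1) by (simp add: c_def)
        ultimately show "?f y \<le> ?f 0" by simp
      qed
    qed simp
    then show ?thesis by (simp add: ip.diff_left ip.scaleR_left)
  qed
  have "A v - c *\<^sub>R v \<in> U" using A(2) U(1) v(1) by (auto intro: subspace_diff subspace_scale)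
  from stat[OF this] have "A v = c *\<^sub>R v" by simp
  moreover have "v \<noteq> 0" using v(1) by auto
  ultimately show ?thesis using that v(1) by blast
qed

text \<open>If some \<open>ad H\<close> is not scalar on \<open>U\<close>, take an eigenvalue
  \<open>c\<close> of it. The kernel and the range of \<open>ad H - c\<close> on \<open>U\<close>
  are invariant under \<open>\<aa>\<close>, of smaller dimension, and together they span
  \<open>U\<close>.\<close>

lemma joint_eigenvectors_span:
  assumes "subspace U" "\<And>H X. H \<in> \<aa> \<Longrightarrow> X \<in> U \<Longrightarrow> br H X \<in> U"
  shows "U \<subseteq> span {X. \<exists>l. \<forall>H\<in>\<aa>. br H X = l H *\<^sub>R X}" (is "_ \<subseteq> span ?J")
  using assms
proof (induction "dim U" arbitrary: U rule: less_induct)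
  case less
  show ?case
  proof (cases "\<forall>H\<in>\<aa>. \<exists>c. \<forall>X\<in>U. br H X = c *\<^sub>R X")
    case True
    then obtain l where "\<And>H X. H \<in> \<aa> \<Longrightarrow> X \<in> U \<Longrightarrow> br H X = l H *\<^sub>R X" by metis
    then have "U \<subseteq> ?J" by auto
    then show ?thesis using span_superset by blast
  next
    case False
    then obtain H where H: "H \<in> \<aa>" "\<And>c. \<exists>X\<in>U. br H X \<noteq> c *\<^sub>R X" by blast
    then have "U \<noteq> {0}" by force
    then obtain v c where v: "v \<in> U" "v \<noteq> 0" "br H v = c *\<^sub>R v"
      using symmetric_eigenvector[OF less.prems(1) _ linear_bracket_right, of H]
        less.prems(2)[OF H(1)] ad_symmetric[OF a_theta[OF H(1)]] by blast
    define B where "B X = br H X - c *\<^sub>R X" for X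
    have B: "linear B" unfolding B_def
      by (rule linearI) (auto simp: br.add_right br.scaleR_right algebra_simps)
    have symB: "ip (B x) y = ip x (B y)" for x y
      by (simp add: B_def ip.diff_left ip.diff_right ip.scaleR_left ip.scaleR_right ad_symmetric[OF a_theta[OF H(1)]])
    have BV: "B ` U \<subseteq> U" using less.prems H(1) by (auto simp: B_def intro: subspace_diff subspace_scale)
    have sBV: "subspace (B ` U)" using linear_subspace_image[OF B less.prems(1)] .
    have BH': "br H' (B X) = B (br H' X)" if "H' \<in> \<aa>" for H' X
      using ad_commute[OF a_props(3)[OF that H(1)], of X] by (simp add: B_def br.diff_right br.scaleR_right)
    have ss: "B X = 0" if "B (B X) = 0" for X using symB[of X "B X"] that by simp
    let ?E = "{X \<in> U. B X = 0}"
    have sE: "subspace ?E" using subspace_inter[OF less.prems(1) linear_subspace_kernel[OF B]]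
      by (simp add: Int_def)
    have d1: "dim ?E < dim U"
    proof (rule ccontr)
      assume "\<not> dim ?E < dim U"
      then have "?E = U" by (intro subspace_dim_equal sE less.prems(1)) auto
      then have "\<forall>X\<in>U. br H X = c *\<^sub>R X" by (auto simp: B_def)
      then show False using H(2)[of c] by blast
    qed
    have injB: "inj_on B (B ` U)"
      unfolding linear_inj_on_iff_eq_0[OF B sBV] using ss by auto
    have BB: "B ` B ` U = B ` U"
    proof (rule subspace_dim_equal)
      show "subspace (B ` B ` U)" using linear_subspace_image[OF B sBV] .
      show "dim (B ` B ` U) \<ge> dim (B ` U)"
        using dim_image_eq[OF B, of "B ` U"] injB span_eq_iff[THEN iffD2, OF sBV] by simp
    qed (use sBV BV in auto)
    have d2: "dim (B ` U) < dim U"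
    proof (rule ccontr)
      assume "\<not> dim (B ` U) < dim U"
      then have "B ` U = U" by (intro subspace_dim_equal sBV less.prems(1) BV) auto
      then have "inj_on B U" using injB by simp
      moreover have "B v = 0" "B 0 = 0" using v linear_0[OF B] by (auto simp: B_def)
      ultimately show False using v less.prems(1) subspace_0 inj_onD by metis
    qed
    have 1: "?E \<subseteq> span ?J"
    proof (rule less.hyps[OF d1 sE])
      fix H' X assume "H' \<in> \<aa>" "X \<in> ?E"
      then show "br H' X \<in> ?E" using less.prems(2) BH'[of H' X] by simp
    qed
    have 2: "B ` U \<subseteq> span ?J"
    proof (rule less.hyps[OF d2 sBV])
      fix H' X assume "H' \<in> \<aa>" "X \<in> B ` U"
      then show "br H' X \<in> B ` U" using less.prems(2) BH' by auto
    qed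
    show ?thesis
    proof
      fix x assume x: "x \<in> U"
      then have "B x \<in> B ` B ` U" using BB by blast
      then obtain w where w: "w \<in> U" "B x = B (B w)" by blast
      have "x - B w \<in> ?E" using x w BV less.prems(1) B by (auto simp: linear_diff intro: subspace_diff)
      then have "x - B w + B w \<in> span ?J" using 1 2 w(1) span_add by blast
      then show "x \<in> span ?J" by simp
    qed
  qed
qed

section \<open>Weight spaces of \<open>\<aa>\<close>\<close>

abbreviation "\<Delta> \<equiv> roots G"
abbreviation "rs \<equiv> root_space G"

lemma rs_iff: "X \<in> rs \<alpha> \<longleftrightarrow> (\<forall>H\<in>\<aa>. br H X = \<alpha> H *\<^sub>R X)"
  by (simp add: root_space_def)

lemma subspace_rs: "subspace (rs \<alpha>)"
  by (auto simp: subspace_def rs_iff br.add_right br.scaleR_right scaleR_add_right mult.commute)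

lemma rs_zero [simp]: "0 \<in> rs \<alpha>" using subspace_0[OF subspace_rs] .

lemma adual_linear:
  assumes "\<alpha> \<in> adual G"
  shows "X \<in> \<aa> \<Longrightarrow> Y \<in> \<aa> \<Longrightarrow> \<alpha> (X + Y) = \<alpha> X + \<alpha> Y" "X \<in> \<aa> \<Longrightarrow> \<alpha> (c *\<^sub>R X) = c * \<alpha> X"
    "X \<notin> \<aa> \<Longrightarrow> \<alpha> X = 0"
  using assms by (auto simp: adual_def)

lemma adual_simps [simp]: "(\<lambda>_. 0) \<in> adual G"
  "\<alpha> \<in> adual G \<Longrightarrow> \<beta> \<in> adual G \<Longrightarrow> (\<lambda>H. \<alpha> H + \<beta> H) \<in> adual G"
  "\<alpha> \<in> adual G \<Longrightarrow> (\<lambda>H. - \<alpha> H) \<in> adual G"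
  "\<alpha> \<in> adual G \<Longrightarrow> (\<lambda>H. r * \<alpha> H) \<in> adual G"
  "\<alpha> \<in> adual G \<Longrightarrow> \<beta> \<in> adual G \<Longrightarrow> (\<lambda>H. \<alpha> H - r * \<beta> H) \<in> adual G"
  by (auto simp: adual_def algebra_simps)

lemma roots_adual: "\<alpha> \<in> \<Delta> \<Longrightarrow> \<alpha> \<in> adual G" by (simp add: roots_def)

lemma rs_bracket: "X \<in> rs \<alpha> \<Longrightarrow> Y \<in> rs \<beta> \<Longrightarrow> br X Y \<in> rs (\<lambda>H. \<alpha> H + \<beta> H)"
  using jacobi[of _ X Y] by (auto simp: rs_iff br.scaleR_left br.scaleR_right scaleR_add_left)

lemma rs_\<theta>: assumes "X \<in> rs \<alpha>" shows "\<theta> X \<in> rs (\<lambda>H. - \<alpha> H)"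
  unfolding rs_iff
proof
  fix H assume H: "H \<in> \<aa>"
  have "\<theta> (br H X) = - br H (\<theta> X)" by (simp add: \<theta>_br a_theta[OF H] br.minus_left)
  then have "br H (\<theta> X) = - \<theta> (br H X)" by simp
  then show "br H (\<theta> X) = - \<alpha> H *\<^sub>R \<theta> X" using assms H by (simp add: rs_iff)
qed

text \<open>Here splitness takes effect: in general the zero weight space also contains the
  centralizer of \<open>\<aa>\<close> in \<open>\<kk>\<close>.\<close>

lemma rs_0: "rs (\<lambda>_. 0) = \<aa>"
  using centralizer_a a_props(3) by (auto simp: rs_iff)

lemma rs_orthogonal:
  assumes "X \<in> rs \<alpha>" "Y \<in> rs \<beta>" "\<alpha> \<in> adual G" "\<beta> \<in> adual G" "\<alpha> \<noteq> \<beta>"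
  shows "ip X Y = 0"
proof -
  obtain H where H: "\<alpha> H \<noteq> \<beta> H" using assms(5) by blast
  then have Ha: "H \<in> \<aa>" using adual_linear(3)[OF assms(3)] adual_linear(3)[OF assms(4)] by metis
  have "\<alpha> H * ip X Y = \<beta> H * ip X Y"
    using ad_symmetric[OF a_theta[OF Ha], of X Y] assms(1,2) Ha
    by (simp add: rs_iff ip.scaleR_left ip.scaleR_right)
  then show ?thesis using H by simp
qed

lemma rs_nonzero_cases:
  assumes "\<alpha> \<in> adual G" "X \<in> rs \<alpha>" "X \<noteq> 0"
  shows "\<alpha> = (\<lambda>_. 0) \<or> \<alpha> \<in> \<Delta>"
  using assms by (auto simp: roots_def)

lemma root_decomposition: "span (\<aa> \<union> (\<Union>\<alpha>\<in>\<Delta>. rs \<alpha>)) = UNIV"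
proof -
  have "{X. \<exists>l. \<forall>H\<in>\<aa>. br H X = l H *\<^sub>R X} \<subseteq> \<aa> \<union> (\<Union>\<alpha>\<in>\<Delta>. rs \<alpha>)"
  proof safe
    fix X l assume l: "\<forall>H\<in>\<aa>. br H X = l H *\<^sub>R X" and n: "X \<notin> (\<Union>\<alpha>\<in>\<Delta>. rs \<alpha>)"
    show "X \<in> \<aa>"
    proof (cases "X = 0")
      case True
      then show ?thesis using a_props(1) subspace_0 by blast
    next
      case False
      \<comment> \<open>Eigenvalues are only determined on \<open>\<aa>\<close>; the extension by
        \<open>0\<close> is the convention of \<open>adual\<close>.\<close>
      define \<alpha> where "\<alpha> H = (if H \<in> \<aa> then l H else 0)" for H
      have "\<alpha> \<in> adual G"
        unfolding adual_def
      proof (safe)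
        fix Y Z assume YZ: "Y \<in> \<aa>" "Z \<in> \<aa>"
        then have "br (Y + Z) X = (l Y + l Z) *\<^sub>R X" using l by (simp add: br.add_left scaleR_add_left)
        moreover have "br (Y + Z) X = l (Y + Z) *\<^sub>R X" using l YZ a_props(1) by (simp add: subspace_add)
        ultimately show "\<alpha> (Y + Z) = \<alpha> Y + \<alpha> Z"
          using False YZ a_props(1) by (simp add: \<alpha>_def subspace_add)
      next
        fix c Y assume Y: "Y \<in> \<aa>"
        then have "br (c *\<^sub>R Y) X = (c * l Y) *\<^sub>R X" using l by (simp add: br.scaleR_left)
        moreover have "br (c *\<^sub>R Y) X = l (c *\<^sub>R Y) *\<^sub>R X" using l Y a_props(1) by (simp add: subspace_scale)
        ultimately show "\<alpha> (c *\<^sub>R Y) = c * \<alpha> Y"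
          using False Y a_props(1) by (simp add: \<alpha>_def subspace_scale)
      qed (simp add: \<alpha>_def)
      moreover have X: "X \<in> rs \<alpha>" using l by (simp add: rs_iff \<alpha>_def)
      ultimately have "\<alpha> = (\<lambda>_. 0) \<or> \<alpha> \<in> \<Delta>" using rs_nonzero_cases False by blast
      then show ?thesis using n X rs_0 by auto
    qed
  qed
  from span_mono[OF this] joint_eigenvectors_span[OF subspace_UNIV] show ?thesis by blast
qed

text \<open>Root vectors of distinct roots are orthogonal, hence independent, and the dimension
  bounds their number.\<close>

lemma finite_roots: "finite \<Delta>"
proof -
  have "\<exists>X. X \<in> rs \<alpha> \<and> X \<noteq> 0" if "\<alpha> \<in> \<Delta>" for \<alpha> using that by (auto simp: roots_def)
  then obtain f where f: "\<And>\<alpha>. \<alpha> \<in> \<Delta> \<Longrightarrow> f \<alpha> \<in> rs \<alpha> \<and> f \<alpha> \<noteq> 0" by metis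
  have o: "ip (f \<alpha>) (f \<beta>) = 0" if "\<alpha> \<in> \<Delta>" "\<beta> \<in> \<Delta>" "\<alpha> \<noteq> \<beta>" for \<alpha> \<beta>
    using rs_orthogonal f that roots_adual by blast
  have inj: "inj_on f \<Delta>"
  proof (rule inj_onI, rule ccontr)
    fix \<alpha> \<beta> assume a: "\<alpha> \<in> \<Delta>" "\<beta> \<in> \<Delta>" "f \<alpha> = f \<beta>" "\<alpha> \<noteq> \<beta>"
    then have "ip (f \<alpha>) (f \<alpha>) = 0" using o by metis
    then show False using f a(1) by simp
  qed
  have "independent (f ` \<Delta>)"
  proof
    assume "dependent (f ` \<Delta>)"
    then obtain S u v where S: "finite S" "S \<subseteq> f ` \<Delta>" "(\<Sum>w\<in>S. u w *\<^sub>R w) = 0" "v \<in> S" "u v \<noteq> 0"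
      unfolding dependent_explicit by blast
    have "0 = ip v (\<Sum>w\<in>S. u w *\<^sub>R w)" using S by simp
    also have "\<dots> = (\<Sum>w\<in>S. u w * ip v w)" by (simp add: ip.sum_right ip.scaleR_right)
    also have "\<dots> = (\<Sum>w\<in>S. if w = v then u v * ip v v else 0)"
    proof (intro sum.cong refl)
      fix w assume w: "w \<in> S"
      show "u w * ip v w = (if w = v then u v * ip v v else 0)"
      proof (cases "w = v")
        case False
        obtain \<alpha> \<beta> where "\<alpha> \<in> \<Delta>" "v = f \<alpha>" "\<beta> \<in> \<Delta>" "w = f \<beta>" using S(2,4) w by blast
        then show ?thesis using o[of \<alpha> \<beta>] False by auto
      qed simp
    qed
    also have "\<dots> = u v * ip v v" using S by simp
    finally have "u v = 0" using f S by auto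
    then show False using S by simp
  qed
  then have "finite (f ` \<Delta>)" using independent_bound by blast
  then show ?thesis using finite_image_iff[OF inj] by blast
qed

end

section \<open>Root vectors and simple roots\<close>

context split begin

lemma root_vector_exists: "\<alpha> \<in> \<Delta> \<Longrightarrow> \<exists>E. E \<in> rs \<alpha> \<and> E \<noteq> 0"
  by (auto simp: roots_def)

lemma br_root_opposite:
  assumes "\<alpha> \<in> \<Delta>" "E \<in> rs \<alpha>" "E' \<in> rs \<alpha>"
  shows "br E (\<theta> E') \<in> \<aa>" "H \<in> \<aa> \<Longrightarrow> ip (br E (\<theta> E')) H = - \<alpha> H * ip E E'"
proof -
  have "br E (\<theta> E') \<in> rs (\<lambda>H. \<alpha> H + - \<alpha> H)" using rs_bracket rs_\<theta> assms by blast
  then show "br E (\<theta> E') \<in> \<aa>" using rs_0 by simp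
  assume H: "H \<in> \<aa>"
  have "ip (br E (\<theta> E')) H = - ip (\<theta> E') (br (\<theta> E) H)" by (rule ip_adjoint)
  also have "\<dots> = ip (\<theta> E') (br H (\<theta> E))" using br_anti[of "\<theta> E" H] by (simp add: ip.minus_right)
  also have "br H (\<theta> E) = - \<alpha> H *\<^sub>R \<theta> E" using rs_\<theta>[OF assms(2)] H by (simp add: rs_iff)
  also have "ip (\<theta> E') (- \<alpha> H *\<^sub>R \<theta> E) = - \<alpha> H * ip E E'"
    using ip_sym[of E' E] by (simp add: ip.scaleR_right ip.minus_right ip_\<theta>)
  finally show "ip (br E (\<theta> E')) H = - \<alpha> H * ip E E'" .
qed

lemma Hvec_unique:
  assumes "H \<in> \<aa>" "\<And>H'. H' \<in> \<aa> \<Longrightarrow> ip H H' = \<alpha> H'"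
  shows "Hvec G \<alpha> = H"
  unfolding Hvec_def
proof (rule the_equality)
  fix H2 assume H2: "H2 \<in> \<aa> \<and> (\<forall>H'\<in>\<aa>. ip H2 H' = \<alpha> H')"
  have "H2 - H \<in> \<aa>" using H2 assms(1) a_props(1) by (simp add: subspace_diff)
  then have "ip (H2 - H) (H2 - H) = 0" using H2 assms by (simp add: ip.diff_left)
  then show "H2 = H" by simp
qed (use assms in auto)

text \<open>The representing vector is exhibited as a multiple of \<open>br E (\<theta> E)\<close>,
  which resolves the definite description in \<open>Hvec\<close>.\<close>

lemma Hvec_props:
  assumes "\<alpha> \<in> \<Delta>"
  shows Hvec_in: "Hvec G \<alpha> \<in> \<aa>" and Hvec_ip: "H \<in> \<aa> \<Longrightarrow> ip (Hvec G \<alpha>) H = \<alpha> H"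
proof -
  obtain E where E: "E \<in> rs \<alpha>" "E \<noteq> 0" using root_vector_exists assms by blast
  let ?H = "(- 1 / ip E E) *\<^sub>R br E (\<theta> E)"
  have 1: "?H \<in> \<aa>" using br_root_opposite(1)[OF assms E(1) E(1)] a_props(1) by (simp add: subspace_scale subspace_neg)
  have 2: "ip ?H H = \<alpha> H" if "H \<in> \<aa>" for H
    using br_root_opposite(2)[OF assms E(1) E(1) that] E(2) by (simp add: ip.scaleR_left ip.minus_left)
  have "Hvec G \<alpha> = ?H" using Hvec_unique 1 2 by blast
  then show "Hvec G \<alpha> \<in> \<aa>" "H \<in> \<aa> \<Longrightarrow> ip (Hvec G \<alpha>) H = \<alpha> H" using 1 2 by auto
qed

lemma br_opposite_Hvec:
  assumes "\<alpha> \<in> \<Delta>" "E \<in> rs \<alpha>" "E' \<in> rs \<alpha>"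
  shows "br E (\<theta> E') = - ip E E' *\<^sub>R Hvec G \<alpha>"
proof -
  let ?D = "br E (\<theta> E') + ip E E' *\<^sub>R Hvec G \<alpha>"
  have D: "?D \<in> \<aa>" using br_root_opposite(1)[OF assms] Hvec_in[OF assms(1)] a_props(1)
    by (simp add: subspace_add subspace_scale)
  then have "ip ?D ?D = 0"
    using br_root_opposite(2)[OF assms D] Hvec_ip[OF assms(1) D] by (simp add: ip.add_left ip.scaleR_left)
  then show ?thesis by (simp add: eq_neg_iff_add_eq_0)
qed

lemma Hvec_pairing: "\<alpha> \<in> \<Delta> \<Longrightarrow> \<beta> \<in> \<Delta> \<Longrightarrow> \<alpha> (Hvec G \<beta>) = \<beta> (Hvec G \<alpha>)"
  using Hvec_ip[of \<alpha> "Hvec G \<beta>"] Hvec_ip[of \<beta> "Hvec G \<alpha>"] Hvec_in ip_sym by metis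

lemma Hvec_norm: "\<alpha> \<in> \<Delta> \<Longrightarrow> ip (Hvec G \<alpha>) (Hvec G \<alpha>) = \<alpha> (Hvec G \<alpha>)"
  using Hvec_ip Hvec_in by blast

lemma Hvec_pos: assumes "\<alpha> \<in> \<Delta>" shows "\<alpha> (Hvec G \<alpha>) > 0"
proof -
  have "Hvec G \<alpha> \<noteq> 0"
  proof
    assume "Hvec G \<alpha> = 0"
    then have "\<alpha> H = 0" if "H \<in> \<aa>" for H using Hvec_ip[OF assms that] by simp
    then have "\<alpha> = (\<lambda>_. 0)" using adual_linear(3)[OF roots_adual[OF assms]] by blast
    then show False using assms by (simp add: roots_def)
  qed
  then show ?thesis using Hvec_norm[OF assms] ip_pos by metis
qed

text \<open>A vector killed by the lowering operator \<open>\<theta> E\<close> whose weight is positive would generate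
  infinitely many weight spaces.\<close>

lemma lowering_nonzero:
  assumes \<alpha>: "\<alpha> \<in> \<Delta>" and E: "E \<in> rs \<alpha>" "E \<noteq> 0" and \<beta>: "\<beta> \<in> adual G"
    and v: "v \<in> rs \<beta>" "v \<noteq> 0" and pos: "\<beta> (Hvec G \<alpha>) > 0"
  shows "br (\<theta> E) v \<noteq> 0"
proof
  assume f0: "br (\<theta> E) v = 0"
  let ?H = "Hvec G \<alpha>"
  define w where "w n = ((br E) ^^ n) v" for n
  define b where "b n = (\<lambda>H. \<beta> H + real n * \<alpha> H)" for n
  have bd: "b n \<in> adual G" for n using \<beta> roots_adual[OF \<alpha>] by (simp add: b_def)
  have w: "w n \<in> rs (b n)" for n
  proof (induction n)
    case 0
    then show ?case using v by (simp add: w_def b_def)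
  next
    case (Suc n)
    then have "w (Suc n) \<in> rs (\<lambda>H. \<alpha> H + b n H)" using rs_bracket[OF E(1)] by (simp add: w_def)
    then show ?case by (simp add: b_def algebra_simps)
  qed
  have step: "br (\<theta> E) (br E (w n)) = (ip E E * b n ?H) *\<^sub>R w n + br E (br (\<theta> E) (w n))" for n
  proof -
    have "br (\<theta> E) E = ip E E *\<^sub>R ?H"
      using br_opposite_Hvec[OF \<alpha> E(1) E(1)] br_anti[of "\<theta> E" E] by simp
    then show ?thesis
      using jacobi[of "\<theta> E" E "w n"] w[of n] Hvec_in[OF \<alpha>] by (simp add: rs_iff br.scaleR_left)
  qed
  have bp: "ip E E * b n ?H > 0" for n
    using pos Hvec_pos[OF \<alpha>] ip_pos[OF E(2)] by (auto simp: b_def intro!: mult_pos_pos add_pos_nonneg)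
  have c: "\<exists>c>0. br (\<theta> E) (w (Suc n)) = c *\<^sub>R w n" for n
  proof (induction n)
    case 0
    show ?case using step[of 0] f0 bp[of 0] by (auto simp: w_def)
  next
    case (Suc n)
    then obtain c where c: "c > 0" "br (\<theta> E) (w (Suc n)) = c *\<^sub>R w n" by blast
    have "br (\<theta> E) (w (Suc (Suc n))) = (ip E E * b (Suc n) ?H + c) *\<^sub>R w (Suc n)"
      using step[of "Suc n"] c(2) by (simp add: w_def br.scaleR_right scaleR_add_left)
    moreover have "0 < ip E E * b (Suc n) ?H + c" using bp[of "Suc n"] c(1) by (rule add_pos_pos)
    ultimately show ?case by blast
  qed
  have wn: "w n \<noteq> 0" for n
  proof (induction n)
    case (Suc n)
    obtain c where "c > 0" "br (\<theta> E) (w (Suc n)) = c *\<^sub>R w n" using c by blast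
    then show ?case using Suc by auto
  qed (use v in \<open>simp add: w_def\<close>)
  have "b n \<in> insert (\<lambda>_. 0) \<Delta>" for n using rs_nonzero_cases[OF bd w wn] by blast
  then have "finite (range b)" using finite_roots by (meson finite_insert finite_subset image_subsetI)
  moreover have "inj b"
  proof (rule injI)
    fix m n assume "b m = b n"
    then have "b m ?H = b n ?H" by simp
    then show "m = n" using Hvec_pos[OF \<alpha>] by (simp add: b_def)
  qed
  ultimately show False using finite_imageD by blast
qed

text \<open>The component of \<open>E'\<close> orthogonal to \<open>E\<close> is killed by
  \<open>ad (\<theta> E)\<close>, while its weight \<open>\<alpha>\<close> is positive on
  \<open>Hvec G \<alpha>\<close>; so it vanishes by \<open>lowering_nonzero\<close>.\<close>

lemma rs_one_dim:
  assumes "\<alpha> \<in> \<Delta>" "E \<in> rs \<alpha>" "E \<noteq> 0" "E' \<in> rs \<alpha>"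
  shows "E' = (ip E E' / ip E E) *\<^sub>R E"
proof -
  let ?D = "E' - (ip E E' / ip E E) *\<^sub>R E"
  have D: "?D \<in> rs \<alpha>" using assms subspace_rs by (simp add: subspace_diff subspace_scale)
  have "br (\<theta> E) ?D = - br ?D (\<theta> E)" by (rule br_anti)
  also have "\<dots> = ip ?D E *\<^sub>R Hvec G \<alpha>" using br_opposite_Hvec[OF assms(1) D assms(2)] by simp
  also have "ip ?D E = 0" using assms(3) by (simp add: ip.diff_left ip.scaleR_left ip_sym[of E'])
  finally have "br (\<theta> E) ?D = 0" by simp
  then have "?D = 0"
    using lowering_nonzero[OF assms(1-3) roots_adual[OF assms(1)] D _ Hvec_pos[OF assms(1)]] by blast
  then show ?thesis by simp
qed

text \<open>Lowering is injective on the weights \<open>n \<alpha>\<close>, which reduces to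
  \<open>n = 2\<close>. There a lowered vector is a multiple of \<open>E\<close> orthogonal to
  \<open>E\<close>, since \<open>br E E = 0\<close>.\<close>

lemma multiple_not_root:
  assumes "\<alpha> \<in> \<Delta>" "n \<ge> 2"
  shows "(\<lambda>H. real n * \<alpha> H) \<notin> \<Delta>"
proof -
  obtain E where E: "E \<in> rs \<alpha>" "E \<noteq> 0" using root_vector_exists assms by blast
  have "v = 0" if "v \<in> rs (\<lambda>H. real n * \<alpha> H)" for v
    using assms(2) that
  proof (induction n arbitrary: v rule: dec_induct)
    case base
    have "br (\<theta> E) v \<in> rs (\<lambda>H. - \<alpha> H + 2 * \<alpha> H)" using rs_bracket[OF rs_\<theta>[OF E(1)] base] by simp
    then have b: "br (\<theta> E) v \<in> rs \<alpha>" by simp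
    have "ip E (br (\<theta> E) v) = ip (br (\<theta> E) v) E" by (rule ip_sym)
    also have "\<dots> = 0" by (simp add: ip_adjoint)
    finally have "br (\<theta> E) v = 0" using rs_one_dim[OF assms(1) E b] by simp
    then show ?case
      using lowering_nonzero[OF assms(1) E _ base] Hvec_pos[OF assms(1)] roots_adual[OF assms(1)] by auto
  next
    case (step n)
    have "br (\<theta> E) v \<in> rs (\<lambda>H. - \<alpha> H + real (Suc n) * \<alpha> H)" using rs_bracket[OF rs_\<theta>[OF E(1)] step(4)] .
    then have "br (\<theta> E) v \<in> rs (\<lambda>H. real n * \<alpha> H)" by (simp add: algebra_simps)
    then have "br (\<theta> E) v = 0" by (rule step.IH)
    then show ?case
      using lowering_nonzero[OF assms(1) E _ step(4)] Hvec_pos[OF assms(1)] roots_adual[OF assms(1)] by auto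
  qed
  then show ?thesis using root_vector_exists by blast
qed

text \<open>A fixed point of the chamber. The numbers \<open>\<gamma> H0\<close> are the heights
  used in all inductions over roots, and \<open>N\<close> is studied through its orbit of this
  point.\<close>

definition H0 :: 'e where "H0 = (SOME H. H \<in> chamber G)"

section \<open>Positive and simple roots\<close>

abbreviation "\<Delta>p \<equiv> pos_roots G"
abbreviation "\<Sigma> \<equiv> simple_roots G"

lemma chamber_props: "chamber G \<noteq> {}" "connected (chamber G)"
  "H \<in> chamber G \<Longrightarrow> H \<in> \<aa> \<and> (\<forall>\<alpha>\<in>\<Delta>. \<alpha> H \<noteq> 0)"
  using wchamber in_components_nonempty in_components_connected in_components_subset
  unfolding weyl_chamber_def by blast+

lemma H0_in: "H0 \<in> chamber G" "H0 \<in> \<aa>" "\<alpha> \<in> \<Delta> \<Longrightarrow> \<alpha> H0 \<noteq> 0"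
proof -
  show 1: "H0 \<in> chamber G" using chamber_props(1) someI_ex[of "\<lambda>H. H \<in> chamber G"] by (auto simp: H0_def)
  show "H0 \<in> \<aa>" "\<alpha> \<in> \<Delta> \<Longrightarrow> \<alpha> H0 \<noteq> 0" using chamber_props(3)[OF 1] by auto
qed

text \<open>A root has no zero on the connected chamber, so its sign there may be tested at one
  point.\<close>

lemma pos_roots_iff: "\<alpha> \<in> \<Delta>p \<longleftrightarrow> \<alpha> \<in> \<Delta> \<and> \<alpha> H0 > 0"
proof
  assume "\<alpha> \<in> \<Delta>p"
  then show "\<alpha> \<in> \<Delta> \<and> \<alpha> H0 > 0" using H0_in(1) by (simp add: pos_roots_def)
next
  assume a: "\<alpha> \<in> \<Delta> \<and> \<alpha> H0 > 0"
  have c: "continuous_on (chamber G) \<alpha>"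
  proof (rule continuous_on_eq)
    show "continuous_on (chamber G) (ip (Hvec G \<alpha>))" by (intro ip.continuous_on continuous_intros)
  qed (use Hvec_ip a chamber_props(3) in auto)
  have "\<alpha> H > 0" if H: "H \<in> chamber G" for H
  proof (rule ccontr)
    assume "\<not> \<alpha> H > 0"
    then have "0 \<in> \<alpha> ` chamber G"
      using connectedD_interval[OF connected_continuous_image[OF c chamber_props(2)], of "\<alpha> H" "\<alpha> H0" 0]
        H H0_in(1) a by auto
    then show False using chamber_props(3) a by auto
  qed
  then show "\<alpha> \<in> \<Delta>p" using a by (simp add: pos_roots_def)
qed

lemma neg_root: assumes "\<alpha> \<in> \<Delta>" shows "(\<lambda>H. - \<alpha> H) \<in> \<Delta>"
proof -
  obtain E where E: "E \<in> rs \<alpha>" "E \<noteq> 0" using root_vector_exists assms by blast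
  have "\<theta> E \<noteq> 0" using E(2) \<theta>\<theta>[of E] by (metis \<theta>_simps(1))
  moreover have "(\<lambda>H. - \<alpha> H) \<noteq> (\<lambda>_. 0)" using Hvec_pos[OF assms] by (metis less_irrefl neg_equal_0_iff_equal)
  ultimately show ?thesis using rs_nonzero_cases[OF _ rs_\<theta>[OF E(1)]] roots_adual[OF assms] by auto
qed

lemma pos_or_neg: "\<alpha> \<in> \<Delta> \<Longrightarrow> \<alpha> \<notin> \<Delta>p \<Longrightarrow> (\<lambda>H. - \<alpha> H) \<in> \<Delta>p"
  using neg_root H0_in(3)[of \<alpha>] by (auto simp: pos_roots_iff)

lemma pos_not_neg: "\<alpha> \<in> \<Delta>p \<Longrightarrow> (\<lambda>H. - \<alpha> H) \<notin> \<Delta>p"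
  by (auto simp: pos_roots_iff)

lemma pos_root: "\<alpha> \<in> \<Delta>p \<Longrightarrow> \<alpha> \<in> \<Delta>" by (simp add: pos_roots_def)
lemma simple_pos: "\<alpha> \<in> \<Sigma> \<Longrightarrow> \<alpha> \<in> \<Delta>p" by (simp add: simple_roots_def)
lemma simple_root: "\<alpha> \<in> \<Sigma> \<Longrightarrow> \<alpha> \<in> \<Delta>" using simple_pos pos_root by blast
lemma finite_pos: "finite \<Delta>p" using finite_roots pos_root finite_subset by (metis subsetI)

lemma simple_indecomposable: "\<alpha> \<in> \<Sigma> \<Longrightarrow> \<beta> \<in> \<Delta>p \<Longrightarrow> \<gamma> \<in> \<Delta>p \<Longrightarrow> \<alpha> \<noteq> (\<lambda>H. \<beta> H + \<gamma> H)"
  by (auto simp: simple_roots_def)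

text \<open>Heights are real numbers; induction along them is well-founded because there are
  finitely many roots.\<close>

lemma pos_root_induct [consumes 1, case_names step]:
  assumes "\<beta> \<in> \<Delta>p" "\<And>\<beta>. \<beta> \<in> \<Delta>p \<Longrightarrow> (\<And>\<gamma>. \<gamma> \<in> \<Delta>p \<Longrightarrow> \<gamma> H0 < \<beta> H0 \<Longrightarrow> P \<gamma>) \<Longrightarrow> P \<beta>"
  shows "P \<beta>"
  using assms(1)
proof (induction "card {\<gamma> \<in> \<Delta>p. \<gamma> H0 < \<beta> H0}" arbitrary: \<beta> rule: less_induct)
  case less
  show ?case
  proof (rule assms(2)[OF less.prems])
    fix \<gamma> assume g: "\<gamma> \<in> \<Delta>p" "\<gamma> H0 < \<beta> H0"
    have "{\<delta> \<in> \<Delta>p. \<delta> H0 < \<gamma> H0} \<subset> {\<gamma> \<in> \<Delta>p. \<gamma> H0 < \<beta> H0}" using g by auto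
    then have "card {\<delta> \<in> \<Delta>p. \<delta> H0 < \<gamma> H0} < card {\<gamma> \<in> \<Delta>p. \<gamma> H0 < \<beta> H0}"
      using finite_pos by (intro psubset_card_mono) auto
    then show "P \<gamma>" using less.hyps g(1) by blast
  qed
qed

lemma pos_root_cases:
  assumes "\<beta> \<in> \<Delta>p" "\<beta> \<notin> \<Sigma>"
  obtains \<gamma> \<delta> where "\<gamma> \<in> \<Delta>p" "\<delta> \<in> \<Delta>p" "\<beta> = (\<lambda>H. \<gamma> H + \<delta> H)" "\<gamma> H0 < \<beta> H0" "\<delta> H0 < \<beta> H0"
proof -
  obtain \<gamma> \<delta> where "\<gamma> \<in> \<Delta>p" "\<delta> \<in> \<Delta>p" "\<beta> = (\<lambda>H. \<gamma> H + \<delta> H)"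
    using assms by (auto simp: simple_roots_def)
  with that show ?thesis by (auto simp: pos_roots_iff)
qed

text \<open>Otherwise all simple roots, hence all positive roots as sums of them, would be
  nonpositive on \<open>Hvec G \<beta>\<close>; but \<open>\<beta>\<close> itself is positive
  there.\<close>

lemma simple_acute:
  assumes "\<beta> \<in> \<Delta>p"
  obtains \<alpha> where "\<alpha> \<in> \<Sigma>" "\<beta> (Hvec G \<alpha>) > 0"
proof -
  have "\<exists>\<alpha>\<in>\<Sigma>. \<beta> (Hvec G \<alpha>) > 0"
  proof (rule ccontr)
    assume n: "\<not> (\<exists>\<alpha>\<in>\<Sigma>. \<beta> (Hvec G \<alpha>) > 0)"
    have s: "\<alpha> (Hvec G \<beta>) \<le> 0" if a: "\<alpha> \<in> \<Sigma>" for \<alpha>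
    proof -
      have "\<not> \<beta> (Hvec G \<alpha>) > 0" using n a by blast
      then show ?thesis using Hvec_pairing[OF simple_root[OF a] pos_root[OF assms]] by linarith
    qed
    have "\<gamma> (Hvec G \<beta>) \<le> 0" if "\<gamma> \<in> \<Delta>p" for \<gamma>
      using that
    proof (induction \<gamma> rule: pos_root_induct)
      case (step \<gamma>)
      show ?case
      proof (cases "\<gamma> \<in> \<Sigma>")
        case False
        obtain \<delta> \<epsilon> where d: "\<delta> \<in> \<Delta>p" "\<epsilon> \<in> \<Delta>p" "\<gamma> = (\<lambda>H. \<delta> H + \<epsilon> H)" "\<delta> H0 < \<gamma> H0" "\<epsilon> H0 < \<gamma> H0"
          by (rule pos_root_cases[OF step(1) False])
        have "\<delta> (Hvec G \<beta>) + \<epsilon> (Hvec G \<beta>) \<le> 0"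
          using step(2)[OF d(1,4)] step(2)[OF d(2,5)] by linarith
        then show ?thesis using d(3) by simp
      qed (rule s)
    qed
    from this[OF assms] show False using Hvec_pos[OF pos_root[OF assms]] by linarith
  qed
  with that show ?thesis by blast
qed

end

section \<open>Simple reflections\<close>

context split begin

abbreviation "Evec \<alpha> \<equiv> rootvec G \<alpha>"
text \<open>Up to a factor \<open>2\<close>, \<open>Fvec\<close> and \<open>Pvec\<close> are the
  components of the root vector in \<open>\<kk>\<close> and in \<open>\<ss>\<close>.\<close>

definition "Fvec \<alpha> = Evec \<alpha> + \<theta> (Evec \<alpha>)"
definition "Pvec \<alpha> = Evec \<alpha> - \<theta> (Evec \<alpha>)"
definition "rot \<alpha> t = lexp G (t *\<^sub>R Fvec \<alpha>)"
abbreviation "se \<equiv> s_elt G"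

lemma se_rot: "se \<alpha> = rot \<alpha> (1/2)" by (simp add: s_elt_def rot_def Fvec_def)

lemma Evec_props: assumes "\<alpha> \<in> \<Sigma>"
  shows Evec_rs: "Evec \<alpha> \<in> rs \<alpha>" and Evec_norm: "ip (Evec \<alpha>) (Evec \<alpha>) = 2 * pi\<^sup>2 / \<alpha> (Hvec G \<alpha>)"
    and Evec_nz: "Evec \<alpha> \<noteq> 0"
proof -
  show 1: "Evec \<alpha> \<in> rs \<alpha>" "ip (Evec \<alpha>) (Evec \<alpha>) = 2 * pi\<^sup>2 / \<alpha> (Hvec G \<alpha>)"
    using split assms Hvec_norm[OF simple_root[OF assms]] by (auto simp: split_setting_def)
  then show "Evec \<alpha> \<noteq> 0" using Hvec_pos[OF simple_root[OF assms]] by auto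
qed

lemma Fvec_k: "\<theta> (Fvec \<alpha>) = Fvec \<alpha>" by (simp add: Fvec_def add.commute)

lemma rot_Kgrp: "rot \<alpha> t \<in> Kgrp G"
  unfolding rot_def by (rule lexp_Kgrp) (simp add: kalg_iff Fvec_k)

lemma rot_carrier [simp]: "rot \<alpha> t \<in> carrier G" by (simp add: rot_def)
lemma se_carrier [simp]: "se \<alpha> \<in> carrier G" by (simp add: se_rot)

lemma rot_add: "rot \<alpha> (s + t) = rot \<alpha> s \<otimes> rot \<alpha> t" by (simp add: rot_def lexp_add)
lemma rot_0 [simp]: "rot \<alpha> 0 = \<one>" by (simp add: rot_def)
lemma br_F_H: assumes "\<alpha> \<in> \<Sigma>" "H \<in> \<aa>" shows "br (Fvec \<alpha>) H = - \<alpha> H *\<^sub>R Pvec \<alpha>"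
proof -
  have "br H (Evec \<alpha>) = \<alpha> H *\<^sub>R Evec \<alpha>" "br H (\<theta> (Evec \<alpha>)) = - \<alpha> H *\<^sub>R \<theta> (Evec \<alpha>)"
    using Evec_rs[OF assms(1)] rs_\<theta>[OF Evec_rs[OF assms(1)]] assms(2) by (auto simp: rs_iff)
  then have "br H (Fvec \<alpha>) = \<alpha> H *\<^sub>R Pvec \<alpha>"
    by (simp add: Fvec_def Pvec_def br.add_right scaleR_diff_right)
  then show ?thesis using br_anti[of "Fvec \<alpha>" H] by simp
qed

lemma br_E_thetaE: assumes "\<alpha> \<in> \<Sigma>"
  shows "br (Evec \<alpha>) (\<theta> (Evec \<alpha>)) = - (2 * pi\<^sup>2 / \<alpha> (Hvec G \<alpha>)) *\<^sub>R Hvec G \<alpha>"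
  using br_opposite_Hvec[OF simple_root[OF assms] Evec_rs[OF assms] Evec_rs[OF assms]]
  by (simp add: Evec_norm[OF assms])

lemma br_F_P: assumes "\<alpha> \<in> \<Sigma>"
  shows "br (Fvec \<alpha>) (Pvec \<alpha>) = (4 * pi\<^sup>2 / \<alpha> (Hvec G \<alpha>)) *\<^sub>R Hvec G \<alpha>"
proof -
  let ?E = "Evec \<alpha>"
  have "br (Fvec \<alpha>) (Pvec \<alpha>) = br (\<theta> ?E) ?E - br ?E (\<theta> ?E)"
    by (simp add: Fvec_def Pvec_def br.add_left br.diff_right)
  also have "\<dots> = - 2 *\<^sub>R br ?E (\<theta> ?E)" using br_anti[of "\<theta> ?E" ?E] by (simp add: scaleR_2)
  finally show ?thesis by (simp add: br_E_thetaE[OF assms])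
qed

lemma has_vector_derivative_scaleR_const:
  "(f has_real_derivative f') (at t) \<Longrightarrow> ((\<lambda>t. f t *\<^sub>R v) has_vector_derivative f' *\<^sub>R v) (at t)"
  using has_vector_derivative_scaleR[OF _ has_vector_derivative_const, of f f' t UNIV v] by simp

text \<open>In the plane of \<open>Hvec G \<alpha>\<close> and \<open>Pvec \<alpha>\<close> the
  square of \<open>ad (Fvec \<alpha>)\<close> is \<open>- 4 pi^2\<close>: the normalization of the
  root vector is chosen so that the rotation has period \<open>1\<close> and \<open>t = 1/2\<close>
  is a half turn.\<close>

lemma Ad_rot_H:
  assumes "\<alpha> \<in> \<Sigma>" "H \<in> \<aa>"
  shows "Ad G (rot \<alpha> t) H = H + (\<alpha> H / \<alpha> (Hvec G \<alpha>) * (cos (2 * pi * t) - 1)) *\<^sub>R Hvec G \<alpha>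
    - (\<alpha> H / (2 * pi) * sin (2 * pi * t)) *\<^sub>R Pvec \<alpha>" (is "_ = ?f t")
proof -
  let ?a = "\<alpha> (Hvec G \<alpha>)"
  have a: "?a > 0" by (rule Hvec_pos[OF simple_root[OF assms(1)]])
  have "Ad G (lexp G (t *\<^sub>R Fvec \<alpha>)) (?f 0) = ?f t"
  proof (rule Ad_lexp_eqI)
    fix t
    have "(?f has_vector_derivative 0 + (\<alpha> H / ?a * (- sin (2 * pi * t) * (2 * pi))) *\<^sub>R Hvec G \<alpha>
       - (\<alpha> H / (2 * pi) * (cos (2 * pi * t) * (2 * pi))) *\<^sub>R Pvec \<alpha>) (at t)"
      by (intro has_vector_derivative_diff has_vector_derivative_add has_vector_derivative_const
          has_vector_derivative_scaleR_const) (use a in \<open>auto intro!: derivative_eq_intros\<close>)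
    moreover have "br (Fvec \<alpha>) (?f t) = 0 + (\<alpha> H / ?a * (- sin (2 * pi * t) * (2 * pi))) *\<^sub>R Hvec G \<alpha>
       - (\<alpha> H / (2 * pi) * (cos (2 * pi * t) * (2 * pi))) *\<^sub>R Pvec \<alpha>"
      using a br_F_H[OF assms] br_F_H[OF assms(1) Hvec_in[OF simple_root[OF assms(1)]]] br_F_P[OF assms(1)]
      by (simp add: br.add_right br.diff_right br.scaleR_right algebra_simps power2_eq_square)
    ultimately show "(?f has_vector_derivative br (Fvec \<alpha>) (?f t)) (at t)" by simp
  qed
  then show ?thesis by (simp add: rot_def)
qed

lemma Ad_rot_P:
  assumes "\<alpha> \<in> \<Sigma>"
  shows "Ad G (rot \<alpha> t) (Pvec \<alpha>) = cos (2 * pi * t) *\<^sub>R Pvec \<alpha>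
    + (2 * pi / \<alpha> (Hvec G \<alpha>) * sin (2 * pi * t)) *\<^sub>R Hvec G \<alpha>" (is "_ = ?f t")
proof -
  let ?a = "\<alpha> (Hvec G \<alpha>)"
  have a: "?a > 0" by (rule Hvec_pos[OF simple_root[OF assms(1)]])
  have "Ad G (lexp G (t *\<^sub>R Fvec \<alpha>)) (?f 0) = ?f t"
  proof (rule Ad_lexp_eqI)
    fix t
    have "(?f has_vector_derivative (- sin (2 * pi * t) * (2 * pi)) *\<^sub>R Pvec \<alpha>
       + (2 * pi / ?a * (cos (2 * pi * t) * (2 * pi))) *\<^sub>R Hvec G \<alpha>) (at t)"
      by (intro has_vector_derivative_add has_vector_derivative_scaleR_const) (use a in \<open>auto intro!: derivative_eq_intros\<close>)
    moreover have "br (Fvec \<alpha>) (?f t) = (- sin (2 * pi * t) * (2 * pi)) *\<^sub>R Pvec \<alpha>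
       + (2 * pi / ?a * (cos (2 * pi * t) * (2 * pi))) *\<^sub>R Hvec G \<alpha>"
      using a br_F_H[OF assms(1) Hvec_in[OF simple_root[OF assms(1)]]] br_F_P[OF assms(1)]
      by (simp add: br.add_right br.scaleR_right algebra_simps power2_eq_square)
    ultimately show "(?f has_vector_derivative br (Fvec \<alpha>) (?f t)) (at t)" by simp
  qed
  then show ?thesis by (simp add: rot_def)
qed

lemma Ad_rot_F: "Ad G (rot \<alpha> t) (Fvec \<alpha>) = Fvec \<alpha>"
  by (simp add: rot_def)

lemma Ad_se_H: assumes "\<alpha> \<in> \<Sigma>" "H \<in> \<aa>"
  shows "Ad G (se \<alpha>) H = H - (2 * \<alpha> H / \<alpha> (Hvec G \<alpha>)) *\<^sub>R Hvec G \<alpha>"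
  unfolding se_rot Ad_rot_H[OF assms] by simp

lemma Ad_se_E: assumes "\<alpha> \<in> \<Sigma>"
  shows "Ad G (se \<alpha>) (Evec \<alpha>) = \<theta> (Evec \<alpha>)" "Ad G (se \<alpha>) (\<theta> (Evec \<alpha>)) = Evec \<alpha>"
proof -
  have P: "Ad G (se \<alpha>) (Pvec \<alpha>) = - Pvec \<alpha>" unfolding se_rot Ad_rot_P[OF assms] by simp
  have F: "Ad G (se \<alpha>) (Fvec \<alpha>) = Fvec \<alpha>" unfolding se_rot by (rule Ad_rot_F)
  have E: "Evec \<alpha> = (1/2) *\<^sub>R (Fvec \<alpha> + Pvec \<alpha>)" "\<theta> (Evec \<alpha>) = (1/2) *\<^sub>R (Fvec \<alpha> - Pvec \<alpha>)"
    by (simp_all add: Fvec_def Pvec_def flip: scaleR_2)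
  have "Ad G (se \<alpha>) ((1/2) *\<^sub>R (Fvec \<alpha> + Pvec \<alpha>)) = (1/2) *\<^sub>R (Fvec \<alpha> - Pvec \<alpha>)"
    "Ad G (se \<alpha>) ((1/2) *\<^sub>R (Fvec \<alpha> - Pvec \<alpha>)) = (1/2) *\<^sub>R (Fvec \<alpha> + Pvec \<alpha>)"
    by (simp_all add: Ad_scale Ad_add Ad_diff P F)
  then show "Ad G (se \<alpha>) (Evec \<alpha>) = \<theta> (Evec \<alpha>)" "Ad G (se \<alpha>) (\<theta> (Evec \<alpha>)) = Evec \<alpha>"
    by (simp_all only: E[symmetric])
qed

section \<open>The normalizer \<open>U\<close> and its action on the roots\<close>

abbreviation "UU \<equiv> Ugrp G"
abbreviation "CC \<equiv> Cgrp G"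

lemma U_props: assumes "u \<in> UU"
  shows U_K: "u \<in> Kgrp G" and U_carrier: "u \<in> carrier G" and Ad_U_a: "H \<in> \<aa> \<Longrightarrow> Ad G u H \<in> \<aa>"
    and Ad_inv_U_a: "H \<in> \<aa> \<Longrightarrow> Ad G (inv u) H \<in> \<aa>"
proof -
  have i: "Ad G u ` \<aa> = \<aa>" and k: "u \<in> Kgrp G" using assms by (auto simp: Ugrp_def)
  show "u \<in> Kgrp G" by (rule k)
  show c: "u \<in> carrier G" using Kgrp_carrier k by blast
  show "H \<in> \<aa> \<Longrightarrow> Ad G u H \<in> \<aa>" using i by blast
  assume "H \<in> \<aa>"
  then obtain H' where "H' \<in> \<aa>" "H = Ad G u H'" using i by blast
  then show "Ad G (inv u) H \<in> \<aa>" using c by simp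
qed

lemma UI: assumes "u \<in> Kgrp G" "\<And>H. H \<in> \<aa> \<Longrightarrow> Ad G u H \<in> \<aa>" "\<And>H. H \<in> \<aa> \<Longrightarrow> Ad G (inv u) H \<in> \<aa>"
  shows "u \<in> UU"
proof -
  have c: "u \<in> carrier G" using Kgrp_carrier assms by blast
  have "H \<in> Ad G u ` \<aa>" if "H \<in> \<aa>" for H
    using assms(3)[OF that] c Ad_inv(1)[OF c, of H] by (metis image_eqI)
  then show ?thesis using assms by (auto simp: Ugrp_def)
qed

lemma subgroup_U: "subgroup UU G"
proof
  show "UU \<subseteq> carrier G" using U_carrier by blast
  show "\<one> \<in> UU" using subgroup.one_closed[OF subgroup_Kgrp] by (intro UI) (auto simp: Ad_one)
  fix x y assume "x \<in> UU" "y \<in> UU"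
  then show "x \<otimes> y \<in> UU" using subgroup.m_closed[OF subgroup_Kgrp]
    by (intro UI) (auto simp: U_K U_carrier Ad_mult Ad_U_a Ad_inv_U_a inv_mult_group)
next
  fix x assume "x \<in> UU"
  then show "inv x \<in> UU" using subgroup.m_inv_closed[OF subgroup_Kgrp]
    by (intro UI) (auto simp: U_K U_carrier Ad_U_a Ad_inv_U_a)
qed

lemma Ad_se_se: assumes "\<alpha> \<in> \<Sigma>" "H \<in> \<aa>" shows "Ad G (se \<alpha>) (Ad G (se \<alpha>) H) = H"
proof -
  note Ha = Hvec_in[OF simple_root[OF assms(1)]]
  have a: "\<alpha> (Hvec G \<alpha>) > 0" using Hvec_pos[OF simple_root[OF assms(1)]] .
  show ?thesis
    unfolding Ad_se_H[OF assms] using a Ad_se_H[OF assms] Ad_se_H[OF assms(1) Ha]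
    by (simp add: Ad_diff Ad_scale scaleR_2)
qed

lemma Ad_inv_se_H: assumes "\<alpha> \<in> \<Sigma>" "H \<in> \<aa>" shows "Ad G (inv (se \<alpha>)) H = Ad G (se \<alpha>) H"
  using Ad_se_se[OF assms] Ad_inv(2)[OF se_carrier, of \<alpha> "Ad G (se \<alpha>) H"] by simp

lemma se_U: assumes "\<alpha> \<in> \<Sigma>" shows "se \<alpha> \<in> UU"
proof -
  have "Ad G (se \<alpha>) H \<in> \<aa>" if "H \<in> \<aa>" for H
    unfolding Ad_se_H[OF assms that] using that Hvec_in[OF simple_root[OF assms]] a_props(1)
    by (simp add: subspace_diff subspace_scale)
  then show ?thesis using Ad_inv_se_H[OF assms] rot_Kgrp[of \<alpha> "1/2"] by (intro UI) (auto simp: se_rot)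
qed

definition act :: "'g \<Rightarrow> ('e \<Rightarrow> real) \<Rightarrow> ('e \<Rightarrow> real)" where
  "act u \<beta> = (\<lambda>H. \<beta> (Ad G (inv u) H))"

lemma act_adual: assumes "u \<in> UU" "\<beta> \<in> adual G" shows "act u \<beta> \<in> adual G"
proof -
  have c: "inv u \<in> carrier G" using U_carrier assms(1) by simp
  have "Ad G (inv u) H \<notin> \<aa>" if "H \<notin> \<aa>" for H
    using that Ad_U_a[OF assms(1), of "Ad G (inv u) H"] U_carrier[OF assms(1)] by auto
  then show ?thesis
    using assms adual_linear[OF assms(2)] Ad_inv_U_a[OF assms(1)] c
    by (simp add: adual_def[of G] act_def Ad_add Ad_scale)
qed

lemma rs_act: assumes "u \<in> UU" "X \<in> rs \<beta>" shows "Ad G u X \<in> rs (act u \<beta>)"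
  unfolding rs_iff
proof
  fix H assume H: "H \<in> \<aa>"
  have c: "u \<in> carrier G" using U_carrier assms(1) .
  have "br H (Ad G u X) = Ad G u (br (Ad G (inv u) H) X)" using c by (simp add: Ad_br)
  also have "br (Ad G (inv u) H) X = \<beta> (Ad G (inv u) H) *\<^sub>R X"
    using Ad_inv_U_a[OF assms(1) H] assms(2) by (simp add: rs_iff)
  finally show "br H (Ad G u X) = act u \<beta> H *\<^sub>R Ad G u X" using c by (simp add: act_def Ad_scale)
qed

lemma Ad_eq_0_iff: "u \<in> carrier G \<Longrightarrow> Ad G u X = 0 \<longleftrightarrow> X = 0"
  using Ad_inv(2)[of u X] by (metis Ad_zero inv_closed)

lemma act_mult: "u \<in> UU \<Longrightarrow> v \<in> UU \<Longrightarrow> act (u \<otimes> v) \<beta> = act u (act v \<beta>)"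
  by (simp add: act_def U_carrier inv_mult_group Ad_mult fun_eq_iff)

lemma act_one: "act \<one> \<beta> = \<beta>" by (simp add: act_def Ad_one)

lemma act_inv: "u \<in> UU \<Longrightarrow> act (inv u) (act u \<beta>) = \<beta>" "u \<in> UU \<Longrightarrow> act u (act (inv u) \<beta>) = \<beta>"
  by (simp_all add: act_def U_carrier)

lemma act_root: assumes "u \<in> UU" "\<beta> \<in> \<Delta>" shows "act u \<beta> \<in> \<Delta>"
proof -
  obtain E where E: "E \<in> rs \<beta>" "E \<noteq> 0" using root_vector_exists assms by blast
  have "act u \<beta> \<noteq> (\<lambda>_. 0)"
  proof
    assume "act u \<beta> = (\<lambda>_. 0)"
    then have "act (inv u) (act u \<beta>) = (\<lambda>_. 0)" by (simp add: act_def)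
    then show False using act_inv(1)[OF assms(1)] assms(2) by (simp add: roots_def)
  qed
  then show ?thesis
    using rs_nonzero_cases[OF act_adual[OF assms(1) roots_adual[OF assms(2)]] rs_act[OF assms(1) E(1)]]
      E(2) Ad_eq_0_iff[OF U_carrier[OF assms(1)]] by blast
qed

lemma act_minus: "act u (\<lambda>H. - \<beta> H) = (\<lambda>H. - act u \<beta> H)" by (simp add: act_def)

lemma act_se: assumes "\<alpha> \<in> \<Sigma>" "\<beta> \<in> adual G"
  shows "act (se \<alpha>) \<beta> = (\<lambda>H. \<beta> H - 2 * \<beta> (Hvec G \<alpha>) / \<alpha> (Hvec G \<alpha>) * \<alpha> H)"
proof
  fix H
  note Ha = Hvec_in[OF simple_root[OF assms(1)]]
  show "act (se \<alpha>) \<beta> H = \<beta> H - 2 * \<beta> (Hvec G \<alpha>) / \<alpha> (Hvec G \<alpha>) * \<alpha> H"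
  proof (cases "H \<in> \<aa>")
    case True
    have "act (se \<alpha>) \<beta> H = \<beta> (H + (- (2 * \<alpha> H / \<alpha> (Hvec G \<alpha>))) *\<^sub>R Hvec G \<alpha>)"
      by (simp add: act_def Ad_inv_se_H[OF assms(1) True] Ad_se_H[OF assms(1) True])
    also have "\<dots> = \<beta> H + (- (2 * \<alpha> H / \<alpha> (Hvec G \<alpha>))) * \<beta> (Hvec G \<alpha>)"
      by (subst adual_linear(1)[OF assms(2) True subspace_scale[OF a_props(1) Ha]])
        (simp only: adual_linear(2)[OF assms(2) Ha])
    finally show ?thesis by simp
  next
    case False
    then show ?thesis
      using adual_linear(3)[OF act_adual[OF se_U[OF assms(1)] assms(2)]] adual_linear(3)[OF assms(2)]
        adual_linear(3)[OF roots_adual[OF simple_root[OF assms(1)]]] by simp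
  qed
qed

lemma act_se_se: assumes "\<alpha> \<in> \<Sigma>" "\<beta> \<in> adual G" shows "act (se \<alpha>) (act (se \<alpha>) \<beta>) = \<beta>"
proof -
  have "act (se \<alpha>) \<beta> (Hvec G \<alpha>) = - \<beta> (Hvec G \<alpha>)"
    using act_se[OF assms] Hvec_pos[OF simple_root[OF assms(1)]] by simp
  then show ?thesis
    using act_se[OF assms(1) act_adual[OF se_U[OF assms(1)] assms(2)]] act_se[OF assms] by auto
qed

lemma act_se_self: assumes "\<alpha> \<in> \<Sigma>" shows "act (se \<alpha>) \<alpha> = (\<lambda>H. - \<alpha> H)"
  using act_se[OF assms roots_adual[OF simple_root[OF assms]]] Hvec_pos[OF simple_root[OF assms]] by simp

text \<open>While the pairing with \<open>Hvec G \<alpha>\<close> is positive, lowering stays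
  nonzero, so the string consists of weights. The next one is not \<open>0\<close>, as
  \<open>\<beta>\<close> is not a multiple of \<open>\<alpha>\<close>; and if it were negative,
  \<open>\<alpha>\<close> would be a sum of two positive roots.\<close>

lemma root_string_positive:
  assumes \<alpha>: "\<alpha> \<in> \<Sigma>" and \<beta>: "\<beta> \<in> \<Delta>p" "\<beta> \<noteq> \<alpha>"
    and "\<And>i. i < j \<Longrightarrow> \<beta> (Hvec G \<alpha>) - real i * \<alpha> (Hvec G \<alpha>) > 0"
  shows "(\<lambda>H. \<beta> H - real j * \<alpha> H) \<in> \<Delta>p"
  using assms(4)
proof (induction j)
  case 0
  then show ?case using \<beta> by simp
next
  case (Suc j)
  let ?b = "\<lambda>H. \<beta> H - real j * \<alpha> H" and ?b' = "\<lambda>H. \<beta> H - real (Suc j) * \<alpha> H"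
  have b: "?b \<in> \<Delta>p" using Suc by simp
  obtain v where v: "v \<in> rs ?b" "v \<noteq> 0" using root_vector_exists[OF pos_root[OF b]] by blast
  note E = Evec_rs[OF \<alpha>] Evec_nz[OF \<alpha>]
  have "br (\<theta> (Evec \<alpha>)) v \<noteq> 0"
    by (rule lowering_nonzero[OF simple_root[OF \<alpha>] E roots_adual[OF pos_root[OF b]] v]) (use Suc.prems[of j] in simp)
  moreover have "br (\<theta> (Evec \<alpha>)) v \<in> rs (\<lambda>H. - \<alpha> H + ?b H)" by (rule rs_bracket[OF rs_\<theta>[OF E(1)] v(1)])
  then have "br (\<theta> (Evec \<alpha>)) v \<in> rs ?b'" by (simp add: algebra_simps)
  moreover have "?b' \<in> adual G" using roots_adual pos_root \<beta> \<alpha> simple_pos by simp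
  ultimately consider "?b' = (\<lambda>_. 0)" | "?b' \<in> \<Delta>" using rs_nonzero_cases by blast
  then show ?case
  proof cases
    case 1
    have e: "\<beta> = (\<lambda>H. real (Suc j) * \<alpha> H)"
    proof
      fix H
      show "\<beta> H = real (Suc j) * \<alpha> H" using fun_cong[OF 1, of H] by simp
    qed
    show ?thesis
    proof (cases "j = 0")
      case True
      then show ?thesis using e \<beta>(2) by simp
    next
      case False
      then show ?thesis using multiple_not_root[OF simple_root[OF \<alpha>], of "Suc j"] e pos_root[OF \<beta>(1)] by simp
    qed
  next
    case 2
    show ?thesis
    proof (rule ccontr)
      assume "?b' \<notin> \<Delta>p"
      then have n: "(\<lambda>H. - ?b' H) \<in> \<Delta>p" using pos_or_neg[OF 2] by blast
      have "\<alpha> = (\<lambda>H. ?b H + - ?b' H)" by (simp add: algebra_simps)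
      then show False using simple_indecomposable[OF \<alpha> b n] by blast
    qed
  qed
qed

text \<open>If both \<open>\<beta>\<close> and \<open>\<gamma> = - s\<^sub>\<alpha> \<beta>\<close> were positive, then descending the two \<open>\<alpha>\<close>-strings by the same
  number of steps would give positive roots whose sum is a nonpositive multiple of \<open>\<alpha>\<close>.\<close>

lemma simple_reflection_permutes:
  assumes \<alpha>: "\<alpha> \<in> \<Sigma>" and \<beta>: "\<beta> \<in> \<Delta>p" "\<beta> \<noteq> \<alpha>"
  shows "act (se \<alpha>) \<beta> \<in> \<Delta>p" "act (se \<alpha>) \<beta> \<noteq> \<alpha>"
proof -
  let ?a = "\<alpha> (Hvec G \<alpha>)" and ?b = "\<beta> (Hvec G \<alpha>)"
  have a: "?a > 0" by (rule Hvec_pos[OF simple_root[OF \<alpha>]])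
  have ad: "\<beta> \<in> adual G" "\<alpha> \<in> adual G" using roots_adual pos_root \<beta> \<alpha> simple_pos by auto
  have \<alpha>n: "(\<lambda>H. - \<alpha> H) \<notin> \<Delta>p" using pos_not_neg simple_pos[OF \<alpha>] by blast
  show ne: "act (se \<alpha>) \<beta> \<noteq> \<alpha>"
  proof
    assume "act (se \<alpha>) \<beta> = \<alpha>"
    then have "\<beta> = act (se \<alpha>) \<alpha>" using act_se_se[OF \<alpha> ad(1)] by simp
    then show False using act_se_self[OF \<alpha>] \<alpha>n \<beta>(1) by simp
  qed
  show "act (se \<alpha>) \<beta> \<in> \<Delta>p"
  proof (rule ccontr)
    assume n: "act (se \<alpha>) \<beta> \<notin> \<Delta>p"
    define \<gamma> where "\<gamma> = (\<lambda>H. - act (se \<alpha>) \<beta> H)"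
    have g: "\<gamma> \<in> \<Delta>p" unfolding \<gamma>_def
      by (rule pos_or_neg[OF act_root[OF se_U[OF \<alpha>] pos_root[OF \<beta>(1)]] n])
    have ge: "\<gamma> H = 2 * ?b / ?a * \<alpha> H - \<beta> H" for H
      by (simp add: \<gamma>_def act_se[OF \<alpha> ad(1)])
    have gb: "\<gamma> (Hvec G \<alpha>) = ?b" using a by (simp add: ge)
    have "\<gamma> \<noteq> \<alpha>"
    proof
      assume "\<gamma> = \<alpha>"
      then have "?b = ?a" using gb by simp
      then have "\<beta> H = \<alpha> H" for H using ge[of H] \<open>\<gamma> = \<alpha>\<close> a by simp
      then show False using \<beta>(2) by blast
    qed
    obtain N :: nat where N: "?b / ?a < real N" using reals_Archimedean2 by blast
    \<comment> \<open>The first step at which the pairing stops being positive. Both strings start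
      with the same pairing \<open>?b\<close>, so that the same \<open>J\<close> serves for
      both.\<close>
    define J where "J = (LEAST j. ?b - real j * ?a \<le> 0)"
    have "?b - real N * ?a \<le> 0" using N a by (simp add: field_simps)
    then have J: "?b - real J * ?a \<le> 0" unfolding J_def by (rule LeastI)
    have Jl: "?b - real i * ?a > 0" if "i < J" for i
      using not_less_Least[of i "\<lambda>j. ?b - real j * ?a \<le> 0"] that by (simp add: J_def)
    have 1: "(\<lambda>H. \<beta> H - real J * \<alpha> H) \<in> \<Delta>p" by (rule root_string_positive[OF \<alpha> \<beta> Jl])
    have 2: "(\<lambda>H. \<gamma> H - real J * \<alpha> H) \<in> \<Delta>p"
      by (rule root_string_positive[OF \<alpha> g \<open>\<gamma> \<noteq> \<alpha>\<close>]) (use Jl gb in simp)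
    have "\<beta> H0 - real J * \<alpha> H0 > 0" "\<gamma> H0 - real J * \<alpha> H0 > 0" using 1 2 by (auto simp: pos_roots_iff)
    then have "(2 * ?b / ?a - 2 * real J) * \<alpha> H0 > 0" by (simp add: ge algebra_simps)
    moreover have "2 * ?b / ?a - 2 * real J \<le> 0" using J a by (simp add: field_simps)
    moreover have "\<alpha> H0 > 0" using simple_pos[OF \<alpha>] by (simp add: pos_roots_iff)
    ultimately show False by (simp add: zero_less_mult_iff)
  qed
qed

text \<open>Reflecting a positive nonsimple root in a simple root with which it has positive pairing
  keeps it positive and lowers its height.\<close>

lemma roots_from_simple:
  assumes "\<Sigma> \<subseteq> \<Phi>" "\<And>\<alpha> \<beta>. \<alpha> \<in> \<Sigma> \<Longrightarrow> \<beta> \<in> \<Phi> \<Longrightarrow> act (se \<alpha>) \<beta> \<in> \<Phi>"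
  shows "\<Delta> \<subseteq> \<Phi>"
proof -
  have p: "\<beta> \<in> \<Phi> \<and> (\<lambda>H. - \<beta> H) \<in> \<Phi>" if "\<beta> \<in> \<Delta>p" for \<beta>
    using that
  proof (induction \<beta> rule: pos_root_induct)
    case (step \<beta>)
    show ?case
    proof (cases "\<beta> \<in> \<Sigma>")
      case True
      then have "\<beta> \<in> \<Phi>" using assms(1) by blast
      then show ?thesis using assms(2)[OF True] act_se_self[OF True] by force
    next
      case False
      obtain \<alpha> where \<alpha>: "\<alpha> \<in> \<Sigma>" "\<beta> (Hvec G \<alpha>) > 0" using simple_acute[OF step(1)] .
      have ad: "\<beta> \<in> adual G" using roots_adual pos_root step(1) by blast
      have "\<beta> \<noteq> \<alpha>" using False \<alpha> by blast
      then have p: "act (se \<alpha>) \<beta> \<in> \<Delta>p" using simple_reflection_permutes \<alpha> step(1) by blast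
      have "2 * \<beta> (Hvec G \<alpha>) / \<alpha> (Hvec G \<alpha>) * \<alpha> H0 > 0"
        using \<alpha> Hvec_pos[OF simple_root[OF \<alpha>(1)]] simple_pos[OF \<alpha>(1)] by (simp add: pos_roots_iff)
      then have "act (se \<alpha>) \<beta> H0 < \<beta> H0" by (simp add: act_se[OF \<alpha>(1) ad])
      then have i: "act (se \<alpha>) \<beta> \<in> \<Phi>" "(\<lambda>H. - act (se \<alpha>) \<beta> H) \<in> \<Phi>" using step(2)[OF p] by auto
      have "act (se \<alpha>) (\<lambda>H. - act (se \<alpha>) \<beta> H) = (\<lambda>H. - \<beta> H)"
        using act_se_se[OF \<alpha>(1) ad] by (simp add: act_minus)
      then show ?thesis using assms(2)[OF \<alpha>(1) i(1)] assms(2)[OF \<alpha>(1) i(2)] act_se_se[OF \<alpha>(1) ad] by simp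
    qed
  qed
  show ?thesis
  proof
    fix \<beta> assume b: "\<beta> \<in> \<Delta>"
    show "\<beta> \<in> \<Phi>"
    proof (cases "\<beta> \<in> \<Delta>p")
      case False
      then show ?thesis using p[OF pos_or_neg[OF b False]] by simp
    qed (use p in blast)
  qed
qed

end

section \<open>Sums of positive root spaces\<close>

text \<open>The inner product of the curve with a vector orthogonal to \<open>S\<close> is
  constant.\<close>

lemma curve_in_subspace:
  fixes f :: "real \<Rightarrow> 'e::euclidean_space"
  assumes S: "subspace S" and d: "\<And>t. (f has_vector_derivative f' t) (at t)" and "\<And>t. f' t \<in> S"
  shows "f t - f 0 \<in> S"
proof -
  have "(f t - f 0) \<bullet> w = 0" if w: "w \<in> S\<^sup>\<bottom>" for w
  proof -
    have "((\<lambda>t. f t \<bullet> w) has_vector_derivative f' t \<bullet> w) (at t within UNIV)" for t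
      using bounded_linear.has_vector_derivative[OF bounded_linear_inner_left d] by simp
    moreover have "f' t \<bullet> w = 0" for t
      using w assms(3)[of t] by (auto simp: orthogonal_comp_def orthogonal_def inner_commute)
    ultimately have "((\<lambda>t. f t \<bullet> w) has_vector_derivative 0) (at t within UNIV)" for t by metis
    then obtain c where "\<And>t. t \<in> UNIV \<Longrightarrow> f t \<bullet> w = c"
      by (rule has_vector_derivative_zero_constant[OF convex_UNIV]) (rule that)
    then show ?thesis by (simp add: inner_diff_left)
  qed
  then have "f t - f 0 \<in> S\<^sup>\<bottom>\<^sup>\<bottom>"
    by (auto simp: orthogonal_comp_def orthogonal_def inner_commute)
  then show ?thesis using orthogonal_comp_self[OF S] by simp
qed

context split begin

abbreviation "\<nn> \<equiv> nalg G"
definition "\<Omega> = insert (\<lambda>_. 0) \<Delta>"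
definition "wsp S = span (\<Union>\<gamma>\<in>S. rs \<gamma>)"
text \<open>The combinatorial condition that makes \<open>wsp S\<close> stable under
  \<open>ad \<nn>\<close>.\<close>

definition upclosed :: "('e \<Rightarrow> real) set \<Rightarrow> bool" where
  "upclosed S \<longleftrightarrow> S \<subseteq> \<Omega> \<and> (\<forall>\<gamma>\<in>S. \<forall>\<delta>\<in>\<Delta>p. (\<lambda>H. \<gamma> H + \<delta> H) \<in> \<Omega> \<longrightarrow> (\<lambda>H. \<gamma> H + \<delta> H) \<in> S)"

lemma n_eq: "\<nn> = wsp \<Delta>p" by (simp add: nalg_def wsp_def)

lemma subspace_wsp: "subspace (wsp S)" by (simp add: wsp_def)
lemma wsp_zero [simp]: "0 \<in> wsp S" using subspace_0[OF subspace_wsp] .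
lemma wsp_mono: "S \<subseteq> S' \<Longrightarrow> wsp S \<subseteq> wsp S'" unfolding wsp_def by (intro span_mono) blast
lemma rs_wsp: "\<gamma> \<in> S \<Longrightarrow> X \<in> rs \<gamma> \<Longrightarrow> X \<in> wsp S" unfolding wsp_def by (intro span_base) blast

lemma wsp_induct:
  assumes "X \<in> wsp S" "subspace Q" "\<And>\<gamma> X. \<gamma> \<in> S \<Longrightarrow> X \<in> rs \<gamma> \<Longrightarrow> X \<in> Q"
  shows "X \<in> Q"
  using assms span_minimal[of "\<Union>\<gamma>\<in>S. rs \<gamma>" Q] by (auto simp: wsp_def)

lemma subspace_vimage: "linear f \<Longrightarrow> subspace S \<Longrightarrow> subspace {X. f X \<in> S}"
  by (auto simp: subspace_def linear_0 linear_add linear_cmul)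

lemma \<Omega>_adual: "\<gamma> \<in> \<Omega> \<Longrightarrow> \<gamma> \<in> adual G" using roots_adual by (auto simp: \<Omega>_def)
lemma finite_\<Omega>: "finite \<Omega>" using finite_roots by (simp add: \<Omega>_def)
lemma pos_\<Omega>: "\<gamma> \<in> \<Delta>p \<Longrightarrow> \<gamma> \<in> \<Omega>" using pos_root by (simp add: \<Omega>_def)
lemma pos_H0: "\<gamma> \<in> \<Delta>p \<Longrightarrow> \<gamma> H0 > 0" by (simp add: pos_roots_iff)
lemma \<Omega>_pos: "\<gamma> \<in> \<Omega> \<Longrightarrow> \<gamma> H0 > 0 \<Longrightarrow> \<gamma> \<in> \<Delta>p" by (auto simp: \<Omega>_def pos_roots_iff)

lemma br_n_wsp:
  assumes "X \<in> \<nn>" "Y \<in> wsp S" "S \<subseteq> \<Omega>"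
    "\<And>\<gamma> \<delta>. \<gamma> \<in> S \<Longrightarrow> \<delta> \<in> \<Delta>p \<Longrightarrow> (\<lambda>H. \<gamma> H + \<delta> H) \<in> \<Omega> \<Longrightarrow> (\<lambda>H. \<gamma> H + \<delta> H) \<in> S'"
  shows "br X Y \<in> wsp S'"
proof -
  have 1: "br X Y \<in> wsp S'" if X: "\<delta> \<in> \<Delta>p" "X \<in> rs \<delta>" and Y: "\<gamma> \<in> S" "Y \<in> rs \<gamma>" for X Y \<gamma> \<delta>
  proof (cases "br X Y = 0")
    case False
    have b: "br X Y \<in> rs (\<lambda>H. \<gamma> H + \<delta> H)"
      using rs_bracket[OF X(2) Y(2)] by (simp add: add.commute)
    have "\<gamma> \<in> adual G" "\<delta> \<in> adual G" using \<Omega>_adual Y(1) assms(3) pos_\<Omega> X(1) by auto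
    then have "(\<lambda>H. \<gamma> H + \<delta> H) \<in> \<Omega>"
      using rs_nonzero_cases[OF _ b False] by (simp add: \<Omega>_def)
    then show ?thesis using rs_wsp[OF _ b] assms(4)[OF Y(1) X(1)] by blast
  qed simp
  have 2: "br X Y \<in> wsp S'" if "\<delta> \<in> \<Delta>p" "X \<in> rs \<delta>" for X \<delta>
  proof -
    have "Y \<in> {Y. br X Y \<in> wsp S'}"
      by (rule wsp_induct[OF assms(2) subspace_vimage[OF linear_bracket_right subspace_wsp]])
        (use 1 that in auto)
    then show ?thesis by simp
  qed
  have "X \<in> {X. br X Y \<in> wsp S'}"
    by (rule wsp_induct[OF assms(1)[unfolded n_eq] subspace_vimage[OF linear_bracket_left subspace_wsp]])
      (use 2 in auto)
  then show ?thesis by simp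
qed

lemma Ad_lexp_minus_in:
  assumes "subspace Q" "\<And>s. Ad G (lexp G (s *\<^sub>R X)) (br X Y) \<in> Q"
  shows "Ad G (lexp G (t *\<^sub>R X)) Y - Y \<in> Q"
proof -
  have "Ad G (lexp G (t *\<^sub>R X)) Y - Ad G (lexp G (0 *\<^sub>R X)) Y \<in> Q"
    by (rule curve_in_subspace[OF assms(1), of "\<lambda>t. Ad G (lexp G (t *\<^sub>R X)) Y"
          "\<lambda>s. Ad G (lexp G (s *\<^sub>R X)) (br X Y)"])
      (use ldiff_Ad[OF ldiff_lexp] assms(2) in auto)
  then show ?thesis by (simp add: Ad_one)
qed

text \<open>Bracketing with \<open>\<nn>\<close> raises heights, so \<open>br X Y\<close> misses a
  weight of least height. The curve therefore moves away from \<open>Y\<close> only inside the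
  smaller space treated by induction.\<close>

lemma Ad_n_invariant:
  assumes "upclosed S" "X \<in> \<nn>" "Y \<in> wsp S"
  shows "Ad G (lexp G (t *\<^sub>R X)) Y \<in> wsp S"
  using assms(1,3)
proof (induction "card S" arbitrary: S Y t rule: less_induct)
  case less
  have fS: "finite S" using less.prems(1) finite_\<Omega> finite_subset by (auto simp: upclosed_def)
  show ?case
  proof (cases "S = {}")
    case True
    then show ?thesis using less.prems by (simp add: wsp_def)
  next
    case False
    define m where "m = Min ((\<lambda>\<gamma>. \<gamma> H0) ` S)"
    have m: "m \<in> (\<lambda>\<gamma>. \<gamma> H0) ` S" "\<And>\<gamma>. \<gamma> \<in> S \<Longrightarrow> m \<le> \<gamma> H0"
      using Min_in[of "(\<lambda>\<gamma>. \<gamma> H0) ` S"] fS False by (auto simp: m_def)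
    then obtain \<beta> where \<beta>: "\<beta> \<in> S" "\<beta> H0 = m" by auto
    let ?S = "S - {\<beta>}"
    have key: "(\<lambda>H. \<gamma> H + \<delta> H) \<in> ?S" if "\<gamma> \<in> S" "\<delta> \<in> \<Delta>p" "(\<lambda>H. \<gamma> H + \<delta> H) \<in> \<Omega>" for \<gamma> \<delta>
    proof -
      have "(\<lambda>H. \<gamma> H + \<delta> H) \<noteq> \<beta>"
      proof
        assume "(\<lambda>H. \<gamma> H + \<delta> H) = \<beta>"
        from fun_cong[OF this, of H0] show False using m(2)[OF that(1)] pos_H0[OF that(2)] \<beta>(2) by linarith
      qed
      then show ?thesis using less.prems(1) that by (auto simp: upclosed_def)
    qed
    then have u: "upclosed ?S" using less.prems(1) by (auto simp: upclosed_def)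
    have "br X Y \<in> wsp ?S"
      by (rule br_n_wsp[OF assms(2) less.prems(2)]) (use key less.prems(1) in \<open>auto simp: upclosed_def\<close>)
    then have "Ad G (lexp G (s *\<^sub>R X)) (br X Y) \<in> wsp ?S" for s
      by (rule less.hyps[OF card_Diff1_less[OF fS \<beta>(1)] u])
    then have "Ad G (lexp G (t *\<^sub>R X)) Y - Y \<in> wsp ?S" by (rule Ad_lexp_minus_in[OF subspace_wsp])
    then have "Ad G (lexp G (t *\<^sub>R X)) Y - Y \<in> wsp S" using wsp_mono[of ?S S] by blast
    from subspace_add[OF subspace_wsp this less.prems(2)] show ?thesis by simp
  qed
qed

text \<open>The subgroup generated by \<open>exp \<nn>\<close>; \<open>NN_eq\<close> shows later
  that it is \<open>exp \<nn>\<close> itself.\<close>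

definition "NN = generate G (lexp G ` \<nn>)"

lemma subgroup_NN: "subgroup NN G" unfolding NN_def by (rule generate_is_subgroup) auto
lemma NN_carrier: "g \<in> NN \<Longrightarrow> g \<in> carrier G" using subgroup.subset[OF subgroup_NN] by blast
lemma lexp_NN: "X \<in> \<nn> \<Longrightarrow> lexp G X \<in> NN" unfolding NN_def by (rule generate.incl) simp
lemma subspace_n: "subspace \<nn>" by (simp add: n_eq subspace_wsp)

lemma NN_induct [consumes 1, case_names one lexp mult]:
  assumes "g \<in> NN" "Q \<one>" "\<And>X. X \<in> \<nn> \<Longrightarrow> Q (lexp G X)"
    "\<And>g h. g \<in> NN \<Longrightarrow> h \<in> NN \<Longrightarrow> Q g \<Longrightarrow> Q h \<Longrightarrow> Q (g \<otimes> h)"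
  shows "Q g"
  using assms(1) unfolding NN_def
proof (induction rule: generate.induct)
  case (inv h)
  then obtain X where "X \<in> \<nn>" "h = lexp G X" by blast
  then show ?case using assms(3)[of "- X"] subspace_n by (simp add: lexp_minus subspace_neg)
next
  case (eng h1 h2)
  then show ?case using assms(4) by (simp add: NN_def)
qed (use assms in auto)

lemma Ad_NN_invariant: "g \<in> NN \<Longrightarrow> upclosed S \<Longrightarrow> Y \<in> wsp S \<Longrightarrow> Ad G g Y \<in> wsp S"
proof (induction g arbitrary: Y rule: NN_induct)
  case (lexp X)
  then show ?case using Ad_n_invariant[of S X Y 1] by simp
qed (auto simp: Ad_one Ad_mult NN_carrier)

lemma Ad_NN_minus:
  assumes "g \<in> NN" "upclosed S" "\<And>X. X \<in> \<nn> \<Longrightarrow> br X Y \<in> wsp S"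
  shows "Ad G g Y - Y \<in> wsp S"
  using assms(1)
proof (induction g rule: NN_induct)
  case (lexp X)
  have "Ad G (lexp G (1 *\<^sub>R X)) Y - Y \<in> wsp S"
    by (rule Ad_lexp_minus_in[OF subspace_wsp]) (use Ad_n_invariant[OF assms(2)] assms(3) lexp in blast)
  then show ?case by simp
next
  case (mult g h)
  have "Ad G g (Ad G h Y - Y) + (Ad G g Y - Y) \<in> wsp S"
    using mult Ad_NN_invariant[OF mult(1) assms(2)] by (intro subspace_add[OF subspace_wsp]) auto
  then show ?case using mult by (simp add: Ad_mult NN_carrier Ad_diff)
qed (simp add: Ad_one)

lemma upclosed_pos: "upclosed \<Delta>p"
  unfolding upclosed_def
proof (intro conjI ballI impI)
  fix \<gamma> \<delta> assume "\<gamma> \<in> \<Delta>p" "\<delta> \<in> \<Delta>p" "(\<lambda>H. \<gamma> H + \<delta> H) \<in> \<Omega>"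
  then show "(\<lambda>H. \<gamma> H + \<delta> H) \<in> \<Delta>p" using pos_H0[of \<gamma>] pos_H0[of \<delta>] by (intro \<Omega>_pos) auto
qed (use pos_\<Omega> in auto)

lemma upclosed_level: "upclosed {\<gamma> \<in> \<Omega>. \<gamma> H0 > c}"
  unfolding upclosed_def using pos_H0 by fastforce

lemma br_wsp_a: assumes "X \<in> wsp S" "H \<in> \<aa>" shows "br X H \<in> wsp S"
proof -
  have "X \<in> {X. br X H \<in> wsp S}"
  proof (rule wsp_induct[OF assms(1) subspace_vimage[OF linear_bracket_left subspace_wsp]])
    fix \<gamma> X assume g: "\<gamma> \<in> S" "X \<in> rs \<gamma>"
    then have "br X H = - \<gamma> H *\<^sub>R X" using br_anti[of X H] assms(2) by (simp add: rs_iff)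
    then show "X \<in> {X. br X H \<in> wsp S}" using rs_wsp[OF g] subspace_wsp by (simp add: subspace_neg subspace_scale)
  qed
  then show ?thesis by simp
qed

lemma wsp_n: "S \<subseteq> \<Delta>p \<Longrightarrow> X \<in> wsp S \<Longrightarrow> X \<in> \<nn>" using wsp_mono n_eq by blast

lemma Ad_NN_a: assumes "g \<in> NN" "H \<in> \<aa>" shows "Ad G g H - H \<in> \<nn>"
  using Ad_NN_minus[OF assms(1) upclosed_pos] br_wsp_a[OF _ assms(2), of _ \<Delta>p] by (simp add: n_eq)

lemma wsp_orthogonal:
  assumes "S \<subseteq> \<Omega>" "\<beta> \<in> \<Omega>" "\<beta> \<notin> S" "X \<in> wsp S" "Y \<in> rs \<beta>" shows "ip X Y = 0"
proof -
  have "X \<in> {X. ip X Y \<in> {0}}"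
  proof (rule wsp_induct[OF assms(4) subspace_vimage])
    show "linear (\<lambda>X. ip X Y)" using bilinear_ip by (simp add: bilinear_def)
    fix \<gamma> X assume "\<gamma> \<in> S" "X \<in> rs \<gamma>"
    then show "X \<in> {X. ip X Y \<in> {0}}"
      using rs_orthogonal[of X \<gamma> Y \<beta>] \<Omega>_adual assms by auto
  qed simp
  then show ?thesis by simp
qed

lemma n_a_orthogonal: "X \<in> \<nn> \<Longrightarrow> H \<in> \<aa> \<Longrightarrow> ip X H = 0"
  using wsp_orthogonal[of \<Delta>p "\<lambda>_. 0" X H] pos_\<Omega> pos_H0[of "\<lambda>_. 0"] by (auto simp: \<Omega>_def rs_0 n_eq)

text \<open>For \<open>Y\<close> of weight \<open>\<beta>\<close>, the difference
  \<open>Ad G g Y - Y\<close> lies in weights of larger height. But \<open>g\<close> fixes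
  \<open>H0\<close>, so the difference is still an eigenvector of \<open>ad H0\<close> for
  \<open>\<beta> H0\<close>, and it vanishes by orthogonality.\<close>

lemma NN_stabilizer_trivial:
  assumes "g \<in> NN" "Ad G g H0 = H0" shows "Ad G g Y = Y"
proof -
  note c = NN_carrier[OF assms(1)]
  have 1: "Ad G g Y = Y" if b: "\<beta> \<in> \<Omega>" "Y \<in> rs \<beta>" for \<beta> Y
  proof -
    let ?S = "{\<gamma> \<in> \<Omega>. \<gamma> H0 > \<beta> H0}"
    let ?D = "Ad G g Y - Y"
    have D: "?D \<in> wsp ?S"
    proof (rule Ad_NN_minus[OF assms(1) upclosed_level])
      fix X assume X: "X \<in> \<nn>"
      show "br X Y \<in> wsp ?S"
        by (rule br_n_wsp[OF X rs_wsp[of \<beta> "{\<beta>}"]]) (use b pos_H0 in auto)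
    qed
    have "br H0 Y = \<beta> H0 *\<^sub>R Y" using b(2) H0_in(2) by (simp add: rs_iff)
    then have "br H0 (Ad G g Y) = \<beta> H0 *\<^sub>R Ad G g Y"
      using Ad_br[OF c, of H0 Y] assms(2) by (simp add: Ad_scale c)
    then have H: "br H0 ?D = \<beta> H0 *\<^sub>R ?D"
      using \<open>br H0 Y = \<beta> H0 *\<^sub>R Y\<close> by (simp add: br.diff_right scaleR_diff_right)
    have "?D \<in> {X. ip ?D X \<in> {0}}"
    proof (rule wsp_induct[OF D subspace_vimage])
      show "linear (ip ?D)" using bilinear_ip by (simp add: bilinear_def)
      fix \<gamma> X assume g: "\<gamma> \<in> ?S" "X \<in> rs \<gamma>"
      have "\<beta> H0 * ip ?D X = \<gamma> H0 * ip ?D X"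
        using ad_symmetric[OF a_theta[OF H0_in(2)], of ?D X] H g H0_in(2)
        by (simp add: rs_iff ip.scaleR_left ip.scaleR_right)
      then show "X \<in> {X. ip ?D X \<in> {0}}" using g by auto
    qed simp
    then show ?thesis by simp
  qed
  have l: "linear (\<lambda>Y. Ad G g Y - Y)" using linear_Ad[OF c] by (intro linear_compose_sub linear_ident[unfolded id_def])
  have "Ad G g Y - Y = 0"
    using linear_eq_0_on_span[OF l, of "\<aa> \<union> (\<Union>\<alpha>\<in>\<Delta>. rs \<alpha>)" Y] root_decomposition 1 rs_0 by (auto simp: \<Omega>_def)
  then show ?thesis by simp
qed

text \<open>Trivial adjoint action means values in the center, which is finite. This lifts
  identities between adjoint actions to the group.\<close>

lemma trivial_Ad_path_constant:
  assumes "continuous_map euclidean T (k :: real \<Rightarrow> 'g)" "\<And>t Y. Ad G (k t) Y = Y"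
  shows "k s = k t"
proof (rule finite_valued_path_constant[OF assms(1) finite_center])
  have "k t \<in> carrier G" for t using assms(1) by (auto simp: continuous_map_def topspace_T)
  then show "k t \<in> group_center G" for t using Ad_trivial_center[OF connected_T] assms(2) by blast
qed (auto simp: group_center_def)

section \<open>Root coordinates\<close>

definition "bv \<beta> = (SOME E. E \<in> rs \<beta> \<and> E \<noteq> 0)"
definition "cf \<beta> X = ip (bv \<beta>) X / ip (bv \<beta>) (bv \<beta>)"

lemma bv: "\<beta> \<in> \<Delta> \<Longrightarrow> bv \<beta> \<in> rs \<beta> \<and> bv \<beta> \<noteq> 0"
  unfolding bv_def using root_vector_exists by (rule someI_ex)

lemma cf_linear: "linear (cf \<beta>)"
  unfolding cf_def by (rule linearI) (simp_all add: ip.add_right ip.scaleR_right add_divide_distrib)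

lemma cf_bv: "\<beta> \<in> \<Delta> \<Longrightarrow> cf \<beta> (bv \<beta>) = 1" using bv by (simp add: cf_def)

lemma cf_wsp: "S \<subseteq> \<Omega> \<Longrightarrow> \<beta> \<in> \<Delta> \<Longrightarrow> \<beta> \<notin> S \<Longrightarrow> X \<in> wsp S \<Longrightarrow> cf \<beta> X = 0"
  using wsp_orthogonal[of S \<beta> X "bv \<beta>"] bv ip_sym[of X] by (simp add: cf_def \<Omega>_def)

lemma wsp_remove:
  assumes "S \<subseteq> \<Omega>" "\<beta> \<in> \<Delta>" "X \<in> wsp (insert \<beta> S)"
  shows "X - cf \<beta> X *\<^sub>R bv \<beta> \<in> wsp (S - {\<beta>})"
proof -
  have "X \<in> {X. X - cf \<beta> X *\<^sub>R bv \<beta> \<in> wsp (S - {\<beta>})}"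
  proof (rule wsp_induct[OF assms(3) subspace_vimage[OF _ subspace_wsp]])
    show "linear (\<lambda>X. X - cf \<beta> X *\<^sub>R bv \<beta>)"
      by (rule linearI) (simp_all add: linear_add[OF cf_linear] linear_cmul[OF cf_linear] algebra_simps)
    fix \<gamma> X assume g: "\<gamma> \<in> insert \<beta> S" "X \<in> rs \<gamma>"
    show "X \<in> {X. X - cf \<beta> X *\<^sub>R bv \<beta> \<in> wsp (S - {\<beta>})}"
    proof (cases "\<gamma> = \<beta>")
      case True
      then have "X = cf \<beta> X *\<^sub>R bv \<beta>" using rs_one_dim[OF assms(2), of "bv \<beta>" X] bv[OF assms(2)] g by (simp add: cf_def)
      then show ?thesis by simp
    next
      case False
      then have g': "\<gamma> \<in> S - {\<beta>}" using g by blast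
      have X: "X \<in> wsp (S - {\<beta>})" by (rule rs_wsp[OF g' g(2)])
      have "cf \<beta> X = 0" by (rule cf_wsp[OF _ assms(2) _ X]) (use assms in auto)
      then show ?thesis using X by simp
    qed
  qed
  then show ?thesis by simp
qed

end

section \<open>Coordinates on \<open>N\<close>\<close>

context split begin

text \<open>An enumeration of positive roots in which every tail is closed under adding positive
  roots. The tails thus span ideals of \<open>\<nn>\<close>, each of codimension one in the
  preceding one.\<close>

primrec ideal_list :: "('e \<Rightarrow> real) list \<Rightarrow> bool" where
  "ideal_list [] \<longleftrightarrow> True"
| "ideal_list (\<beta> # l) \<longleftrightarrow> \<beta> \<in> \<Delta>p \<and> \<beta> \<notin> set l \<and> ideal_list l \<and>
     (\<forall>\<delta>\<in>\<Delta>p. (\<lambda>H. \<beta> H + \<delta> H) \<in> \<Delta>p \<longrightarrow> (\<lambda>H. \<beta> H + \<delta> H) \<in> set l)"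

lemma ideal_list_pos: "ideal_list l \<Longrightarrow> set l \<subseteq> \<Delta>p" by (induction l) auto

lemma ideal_list_add:
  "ideal_list l \<Longrightarrow> \<gamma> \<in> set l \<Longrightarrow> \<delta> \<in> \<Delta>p \<Longrightarrow> (\<lambda>H. \<gamma> H + \<delta> H) \<in> \<Delta>p \<Longrightarrow> (\<lambda>H. \<gamma> H + \<delta> H) \<in> set l"
  by (induction l) auto

lemma pos_add: assumes "\<gamma> \<in> \<Delta>p" "\<delta> \<in> \<Delta>p" "(\<lambda>H. \<gamma> H + \<delta> H) \<in> \<Omega>" shows "(\<lambda>H. \<gamma> H + \<delta> H) \<in> \<Delta>p"
  using upclosed_pos assms unfolding upclosed_def by blast

lemma ideal_list_upclosed: assumes "ideal_list l" shows "upclosed (set l)"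
  unfolding upclosed_def
proof (intro conjI ballI impI)
  fix \<gamma> \<delta> assume "\<gamma> \<in> set l" "\<delta> \<in> \<Delta>p" "(\<lambda>H. \<gamma> H + \<delta> H) \<in> \<Omega>"
  then show "(\<lambda>H. \<gamma> H + \<delta> H) \<in> set l"
    using ideal_list_add[OF assms] pos_add ideal_list_pos[OF assms] by blast
qed (use ideal_list_pos[OF assms] pos_\<Omega> in blast)

lemma ideal_list_suffix: "ideal_list (l1 @ l2) \<Longrightarrow> ideal_list l2" by (induction l1) auto

lemma ideal_list_exists: obtains l where "ideal_list l" "set l = \<Delta>p"
proof -
  have "\<exists>l. ideal_list l \<and> set l = S" if "S \<subseteq> \<Delta>p"
    "\<And>\<gamma> \<delta>. \<gamma> \<in> S \<Longrightarrow> \<delta> \<in> \<Delta>p \<Longrightarrow> (\<lambda>H. \<gamma> H + \<delta> H) \<in> \<Delta>p \<Longrightarrow> (\<lambda>H. \<gamma> H + \<delta> H) \<in> S" for S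
    using that
  proof (induction "card S" arbitrary: S rule: less_induct)
    case less
    have fS: "finite S" using less.prems(1) finite_pos finite_subset by blast
    show ?case
    proof (cases "S = {}")
      case True
      then show ?thesis by (intro exI[of _ "[]"]) simp
    next
      case False
      define m where "m = Min ((\<lambda>\<gamma>. \<gamma> H0) ` S)"
      have m: "m \<in> (\<lambda>\<gamma>. \<gamma> H0) ` S" "\<And>\<gamma>. \<gamma> \<in> S \<Longrightarrow> m \<le> \<gamma> H0"
        using Min_in[of "(\<lambda>\<gamma>. \<gamma> H0) ` S"] fS False by (auto simp: m_def)
      then obtain \<beta> where \<beta>: "\<beta> \<in> S" "\<beta> H0 = m" by auto
      have key: "(\<lambda>H. \<gamma> H + \<delta> H) \<in> S - {\<beta>}" if "\<gamma> \<in> S" "\<delta> \<in> \<Delta>p" "(\<lambda>H. \<gamma> H + \<delta> H) \<in> \<Delta>p" for \<gamma> \<delta>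
      proof -
        have "(\<lambda>H. \<gamma> H + \<delta> H) \<noteq> \<beta>"
        proof
          assume "(\<lambda>H. \<gamma> H + \<delta> H) = \<beta>"
          from fun_cong[OF this, of H0] show False using m(2)[OF that(1)] pos_H0[OF that(2)] \<beta>(2) by linarith
        qed
        then show ?thesis using less.prems(2)[OF that] by blast
      qed
      have "\<exists>l. ideal_list l \<and> set l = S - {\<beta>}"
        by (rule less.hyps[OF card_Diff1_less[OF fS \<beta>(1)]]) (use less.prems(1) key in blast)+
      then obtain l where l: "ideal_list l" "set l = S - {\<beta>}" by blast
      then have "ideal_list (\<beta> # l)" using key[OF \<beta>(1)] \<beta>(1) less.prems(1) by auto
      moreover have "set (\<beta> # l) = S" using l \<beta> by auto
      ultimately show ?thesis by blast
    qed
  qed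
  from this[of \<Delta>p] that show ?thesis by blast
qed

lemma br_n_ideal:
  assumes "ideal_list (\<beta> # l)" "X \<in> \<nn>" "Y \<in> wsp (set (\<beta> # l))"
  shows "br X Y \<in> wsp (set l)"
proof (rule br_n_wsp[OF assms(2,3)])
  show "set (\<beta> # l) \<subseteq> \<Omega>" using ideal_list_pos[OF assms(1)] pos_\<Omega> by blast
  fix \<gamma> \<delta> assume g: "\<gamma> \<in> set (\<beta> # l)" "\<delta> \<in> \<Delta>p" "(\<lambda>H. \<gamma> H + \<delta> H) \<in> \<Omega>"
  then have "(\<lambda>H. \<gamma> H + \<delta> H) \<in> \<Delta>p" using pos_add ideal_list_pos[OF assms(1)] by blast
  then show "(\<lambda>H. \<gamma> H + \<delta> H) \<in> set l"
    using g assms(1) ideal_list_add[of l \<gamma> \<delta>] by auto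
qed

definition pr :: "('e \<Rightarrow> real) list \<Rightarrow> (('e \<Rightarrow> real) \<Rightarrow> real) \<Rightarrow> 'g" where
  "pr l x = foldr (\<lambda>\<beta> g. lexp G (x \<beta> *\<^sub>R bv \<beta>) \<otimes> g) l \<one>"

lemma pr_simps [simp]: "pr [] x = \<one>" "pr (\<beta> # l) x = lexp G (x \<beta> *\<^sub>R bv \<beta>) \<otimes> pr l x"
  by (simp_all add: pr_def)

lemma pr_carrier [simp]: "pr l x \<in> carrier G" by (induction l) auto

lemma bv_n: "\<beta> \<in> \<Delta>p \<Longrightarrow> c *\<^sub>R bv \<beta> \<in> \<nn>"
  using bv[OF pos_root] rs_wsp[of \<beta> \<Delta>p] subspace_n n_eq by (simp add: subspace_scale)

lemma pr_NN: "set l \<subseteq> \<Delta>p \<Longrightarrow> pr l x \<in> NN"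
proof (induction l)
  case Nil
  then show ?case using subgroup.one_closed[OF subgroup_NN] by simp
next
  case (Cons \<beta> l)
  then show ?case using lexp_NN[OF bv_n] subgroup.m_closed[OF subgroup_NN] by simp
qed

lemma Ad_bv_H0: assumes "\<beta> \<in> \<Delta>p" shows "Ad G (lexp G (c *\<^sub>R bv \<beta>)) H0 = H0 - (c * \<beta> H0) *\<^sub>R bv \<beta>"
proof -
  let ?f = "\<lambda>t. H0 + (t * (- c * \<beta> H0)) *\<^sub>R bv \<beta>"
  have b: "br (bv \<beta>) H0 = - \<beta> H0 *\<^sub>R bv \<beta>"
    using bv[OF pos_root[OF assms]] H0_in(2) br_anti[of "bv \<beta>" H0] by (simp add: rs_iff)
  have "Ad G (lexp G (1 *\<^sub>R (c *\<^sub>R bv \<beta>))) (?f 0) = ?f 1"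
  proof (rule Ad_lexp_eqI)
    fix t
    have "(?f has_vector_derivative 0 + (1 * (- c * \<beta> H0)) *\<^sub>R bv \<beta>) (at t)"
      by (intro has_vector_derivative_add has_vector_derivative_const has_vector_derivative_scaleR_const)
        (auto intro!: derivative_eq_intros)
    moreover have "br (c *\<^sub>R bv \<beta>) (?f t) = 0 + (1 * (- c * \<beta> H0)) *\<^sub>R bv \<beta>"
      by (simp add: br.add_right br.diff_right br.scaleR_left br.scaleR_right b)
    ultimately show "(?f has_vector_derivative br (c *\<^sub>R bv \<beta>) (?f t)) (at t)" by simp
  qed
  then show ?thesis by simp
qed

lemma ideal_tail_eq: assumes "ideal_list (\<beta> # l)" shows "set (\<beta> # l) - {\<beta>} = set l" "set l - {\<beta>} = set l"
  using assms by auto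

text \<open>Modulo the ideal of the tail, \<open>exp (c bv \<beta>)\<close> moves \<open>H0\<close>
  by \<open>- c \<beta> H0\<close> times \<open>bv \<beta>\<close> and fixes \<open>Y\<close>. The
  coefficient is chosen so that this cancels the \<open>\<beta>\<close>-component.\<close>

lemma peel_step:
  assumes i: "ideal_list (\<beta> # l)" and Y: "Y \<in> wsp (set (\<beta> # l))"
  shows "Ad G (lexp G ((cf \<beta> Y / \<beta> H0) *\<^sub>R bv \<beta>)) (H0 + Y) - H0 \<in> wsp (set l)"
proof -
  have b: "\<beta> \<in> \<Delta>p" using i by simp
  let ?c = "cf \<beta> Y / \<beta> H0" and ?g = "lexp G ((cf \<beta> Y / \<beta> H0) *\<^sub>R bv \<beta>)"
  have 1: "Ad G ?g Y - Y \<in> wsp (set l)"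
    by (rule Ad_NN_minus[OF lexp_NN[OF bv_n[OF b]] ideal_list_upclosed])
      (use i br_n_ideal[OF i _ Y] in auto)
  have 2: "Y - cf \<beta> Y *\<^sub>R bv \<beta> \<in> wsp (set l)"
    using wsp_remove[of "set l" \<beta> Y] Y ideal_tail_eq[OF i] ideal_list_pos[OF i] pos_\<Omega> pos_root[OF b] by auto
  have "Ad G ?g (H0 + Y) - H0 = (Ad G ?g Y - Y) + (Y - cf \<beta> Y *\<^sub>R bv \<beta>)"
    using pos_H0[OF b] by (simp add: Ad_add Ad_bv_H0[OF b])
  then show ?thesis using subspace_add[OF subspace_wsp 1 2] by simp
qed

lemma continuous_cf: "continuous_on UNIV f \<Longrightarrow> continuous_on UNIV (\<lambda>t. cf \<beta> (f t))"
  using continuous_on_compose2[OF linear_continuous_on[OF linear_conv_bounded_linear[THEN iffD1, OF cf_linear]],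
      where f = f] by auto

lemma lexp_scale_continuous:
  assumes "continuous_on UNIV (c :: real \<Rightarrow> real)"
  shows "continuous_map euclidean T (\<lambda>t. lexp G (c t *\<^sub>R X))"
  using continuous_map_compose[OF _ lexp_continuous[of X], of euclidean c] assms
  by (simp add: comp_def continuous_map_iff_continuous2)

text \<open>A continuous solution of \<open>Ad G (n t) H0 = H0 + Y t\<close>, obtained by
  eliminating one root coordinate at a time. It is normalized to \<open>\<one>\<close> where
  \<open>Y t = 0\<close>, which fixes the starting point of the path arguments below.\<close>

lemma peel:
  assumes "ideal_list l" "continuous_on UNIV (Y :: real \<Rightarrow> 'e)" "\<And>t. Y t \<in> wsp (set l)"
  shows "\<exists>x. continuous_map euclidean T (\<lambda>t. pr l (x t)) \<and> (\<forall>t. Y t = 0 \<longrightarrow> pr l (x t) = \<one>) \<and>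
    (\<forall>t. Ad G (pr l (x t)) H0 = H0 + Y t)"
  using assms
proof (induction l arbitrary: Y)
  case Nil
  then show ?case by (intro exI) (auto simp: topspace_T Ad_one wsp_def)
next
  case (Cons \<beta> l)
  have b: "\<beta> \<in> \<Delta>p" and il: "ideal_list l" and bl: "\<beta> \<notin> set l" using Cons.prems by auto
  define c where "c t = cf \<beta> (Y t) / \<beta> H0" for t
  have cc: "continuous_on UNIV c"
    unfolding c_def using pos_H0[OF b] by (intro continuous_intros continuous_cf Cons.prems) auto
  define Z where "Z t = Ad G (lexp G (c t *\<^sub>R bv \<beta>)) (H0 + Y t) - H0" for t
  have Zc: "continuous_on UNIV Z"
    unfolding Z_def by (intro continuous_intros continuous_Ad_curve lexp_scale_continuous cc Cons.prems)
  have Zl: "Z t \<in> wsp (set l)" for t unfolding Z_def c_def by (rule peel_step[OF Cons.prems(1,3)])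
  obtain x where x: "continuous_map euclidean T (\<lambda>t. pr l (x t))" "\<And>t. Z t = 0 \<Longrightarrow> pr l (x t) = \<one>"
    "\<And>t. Ad G (pr l (x t)) H0 = H0 + Z t"
    using Cons.IH[OF il Zc Zl] by blast
  define y where "y t = (x t)(\<beta> := - c t)" for t
  have prl: "pr l (y t) = pr l (x t)" for t
    using bl by (induction l) (auto simp: y_def)
  have p: "pr (\<beta> # l) (y t) = lexp G ((- c t) *\<^sub>R bv \<beta>) \<otimes> pr l (x t)" for t
    by (simp add: prl) (simp add: y_def)
  have "continuous_map euclidean T (\<lambda>t. pr (\<beta> # l) (y t))"
    unfolding p by (intro continuous_map_mult lexp_scale_continuous x continuous_intros cc)
  moreover have "pr (\<beta> # l) (y t) = \<one>" if "Y t = 0" for t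
  proof -
    have c0: "c t = 0" using that linear_0[OF cf_linear] by (simp add: c_def)
    then have "Z t = 0" using that by (simp add: Z_def Ad_one)
    then show ?thesis unfolding p using c0 x(2) by simp
  qed
  moreover have "Ad G (pr (\<beta> # l) (y t)) H0 = H0 + Y t" for t
  proof -
    have "Ad G (pr (\<beta> # l) (y t)) H0 = Ad G (inv (lexp G (c t *\<^sub>R bv \<beta>))) (H0 + Z t)"
      unfolding p using lexp_minus[of "c t *\<^sub>R bv \<beta>"] by (simp add: Ad_mult x(3))
    also have "\<dots> = H0 + Y t" by (simp add: Z_def)
    finally show ?thesis .
  qed
  ultimately show ?case by blast
qed

lemma pr_H0: "ideal_list l \<Longrightarrow> Ad G (pr l x) H0 - H0 \<in> wsp (set l)"
proof (induction l)
  case (Cons \<beta> l)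
  have b: "\<beta> \<in> \<Delta>p" and il: "ideal_list l" using Cons.prems by auto
  let ?g = "lexp G (x \<beta> *\<^sub>R bv \<beta>)"
  have m: "wsp (set l) \<subseteq> wsp (set (\<beta> # l))" by (rule wsp_mono) auto
  have 1: "Ad G ?g (Ad G (pr l x) H0 - H0) \<in> wsp (set (\<beta> # l))"
    by (rule Ad_NN_invariant[OF lexp_NN[OF bv_n[OF b]] ideal_list_upclosed[OF Cons.prems]])
      (use Cons.IH[OF il] m in blast)
  have "bv \<beta> \<in> wsp (set (\<beta> # l))" by (rule rs_wsp[of \<beta>]) (use bv[OF pos_root[OF b]] in auto)
  then have 2: "- (x \<beta> * \<beta> H0) *\<^sub>R bv \<beta> \<in> wsp (set (\<beta> # l))" by (rule subspace_scale[OF subspace_wsp])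
  have "Ad G (pr (\<beta> # l) x) H0 - H0 = Ad G ?g (Ad G (pr l x) H0 - H0) + - (x \<beta> * \<beta> H0) *\<^sub>R bv \<beta>"
    by (simp add: Ad_mult Ad_diff Ad_bv_H0[OF b])
  then show ?case using subspace_add[OF subspace_wsp 1 2] by simp
qed (simp add: Ad_one)

text \<open>The first coordinate must vanish, because the tail moves \<open>H0\<close> only inside
  the ideal of the tail. Since the coordinates themselves vanish, the conclusion is equality in the
  group and not merely modulo the center.\<close>

lemma pr_stabilizer: "ideal_list l \<Longrightarrow> Ad G (pr l x) H0 = H0 \<Longrightarrow> pr l x = \<one>"
proof (induction l)
  case (Cons \<beta> l)
  have b: "\<beta> \<in> \<Delta>p" and il: "ideal_list l" and bl: "\<beta> \<notin> set l" using Cons.prems by auto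
  let ?g = "lexp G (x \<beta> *\<^sub>R bv \<beta>)"
  have "Ad G (pr l x) H0 = Ad G (inv ?g) (Ad G (pr (\<beta> # l) x) H0)" by (simp add: Ad_mult)
  also have "\<dots> = Ad G (lexp G ((- x \<beta>) *\<^sub>R bv \<beta>)) H0"
    using Cons.prems(2) lexp_minus[of "x \<beta> *\<^sub>R bv \<beta>"] by simp
  also have "\<dots> = H0 + (x \<beta> * \<beta> H0) *\<^sub>R bv \<beta>" by (simp only: Ad_bv_H0[OF b]) simp
  finally have e: "Ad G (pr l x) H0 = H0 + (x \<beta> * \<beta> H0) *\<^sub>R bv \<beta>" .
  then have "(x \<beta> * \<beta> H0) *\<^sub>R bv \<beta> \<in> wsp (set l)" using pr_H0[OF il, of x] by simp
  then have "cf \<beta> ((x \<beta> * \<beta> H0) *\<^sub>R bv \<beta>) = 0"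
    by (intro cf_wsp[of "set l"]) (use ideal_list_pos[OF il] pos_\<Omega> pos_root[OF b] bl in auto)
  then have x0: "x \<beta> = 0"
    using cf_bv[OF pos_root[OF b]] pos_H0[OF b] by (simp add: linear_cmul[OF cf_linear])
  then have "Ad G (pr l x) H0 = H0" using e by simp
  then show ?case using Cons.IH[OF il] x0 by simp
qed simp

section \<open>Comparison of the generated group with \<open>exp \<nn>\<close>\<close>

lemma NN_path: assumes "g \<in> NN"
  obtains k :: "real \<Rightarrow> 'g" where "continuous_map euclidean T k" "k 0 = \<one>" "k 1 = g" "\<And>t. k t \<in> NN"
proof -
  have "\<exists>k :: real \<Rightarrow> 'g. continuous_map euclidean T k \<and> k 0 = \<one> \<and> k 1 = g \<and> (\<forall>t. k t \<in> NN)"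
    using assms
  proof (induction g rule: NN_induct)
    case one
    show ?case by (intro exI[of _ "\<lambda>_. \<one>"]) (use subgroup.one_closed[OF subgroup_NN] in \<open>auto simp: topspace_T\<close>)
  next
    case (lexp X)
    show ?case
      by (intro exI[of _ "\<lambda>t. lexp G (t *\<^sub>R X)"])
        (use lexp_continuous lexp_NN subspace_n lexp in \<open>auto simp: subspace_scale\<close>)
  next
    case (mult g h)
    then obtain k k' :: "real \<Rightarrow> 'g" where "continuous_map euclidean T k" "k 0 = \<one>" "k 1 = g" "\<And>t. k t \<in> NN"
      "continuous_map euclidean T k'" "k' 0 = \<one>" "k' 1 = h" "\<And>t. k' t \<in> NN" by blast
    then show ?case
      by (intro exI[of _ "\<lambda>t. k t \<otimes> k' t"]) (auto intro: continuous_map_mult subgroup.m_closed[OF subgroup_NN])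
  qed
  with that show ?thesis by blast
qed

lemma continuous_map_inv: "continuous_map X T f \<Longrightarrow> continuous_map X T (\<lambda>x. inv (f x))"
  using continuous_map_compose[OF _ inv_continuous] by (simp add: comp_def)

text \<open>Along a path from \<open>\<one>\<close> to \<open>g\<close>, \<open>peel\<close> gives
  products with the same effect on \<open>H0\<close>. The quotient path has trivial adjoint action
  and starts at \<open>\<one>\<close>, so it is constant.\<close>

lemma NN_coordinates:
  assumes "ideal_list l" "set l = \<Delta>p" "g \<in> NN" obtains x where "g = pr l x"
proof -
  obtain k :: "real \<Rightarrow> 'g" where k: "continuous_map euclidean T k" "k 0 = \<one>" "k 1 = g" "\<And>t. k t \<in> NN"
    using NN_path[OF assms(3)] by blast
  define Y where "Y t = Ad G (k t) H0 - H0" for t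
  have Yc: "continuous_on UNIV Y"
    unfolding Y_def by (intro continuous_intros continuous_Ad_curve k)
  have Yn: "Y t \<in> wsp (set l)" for t
    using Ad_NN_a[OF k(4) H0_in(2)] by (simp add: Y_def assms(2) n_eq)
  obtain x where x: "continuous_map euclidean T (\<lambda>t. pr l (x t))" "\<And>t. Y t = 0 \<Longrightarrow> pr l (x t) = \<one>"
    "\<And>t. Ad G (pr l (x t)) H0 = H0 + Y t"
    using peel[OF assms(1) Yc Yn] by blast
  define h where "h t = inv (pr l (x t)) \<otimes> k t" for t
  have c: "k t \<in> carrier G" for t using NN_carrier k(4) by blast
  have hN: "h t \<in> NN" for t
    unfolding h_def using pr_NN[of l] assms(2) k(4) subgroup_NN subgroup.m_closed subgroup.m_inv_closed by fast
  have "Ad G (h t) H0 = Ad G (inv (pr l (x t))) (Ad G (pr l (x t)) H0)" for t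
    using c by (simp add: h_def Ad_mult x(3) Y_def)
  then have "Ad G (h t) H0 = H0" for t by simp
  then have "Ad G (h t) Z = Z" for t Z using NN_stabilizer_trivial[OF hN] by blast
  moreover have "continuous_map euclidean T h"
    unfolding h_def by (intro continuous_map_mult continuous_map_inv x k)
  ultimately have "h 1 = h 0" using trivial_Ad_path_constant by blast
  also have "h 0 = \<one>" using x(2)[of 0] k(2) by (simp add: h_def Y_def Ad_one)
  finally have "inv (pr l (x 1)) \<otimes> g = \<one>" by (simp add: h_def k(3))
  then have "g = pr l (x 1)" using c[of 1] k(3) inv_equality inv_inv pr_carrier inv_closed by metis
  with that show ?thesis by blast
qed

lemma NN_stabilizer: assumes "g \<in> NN" "Ad G g H0 = H0" shows "g = \<one>"
proof -
  obtain l where l: "ideal_list l" "set l = \<Delta>p" using ideal_list_exists .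
  obtain x where "g = pr l x" using NN_coordinates[OF l assms(1)] .
  then show ?thesis using pr_stabilizer[OF l(1)] assms(2) by simp
qed

text \<open>Modulo the ideal of the tail, \<open>bv \<beta>\<close> commutes with
  \<open>\<nn>\<close>, so that adding \<open>c bv \<beta>\<close> to the exponent has only its
  first-order effect.\<close>

lemma Ad_lexp_add_bv:
  assumes i: "ideal_list (\<beta> # l)" and X: "X \<in> \<nn>"
  shows "Ad G (lexp G (X + c *\<^sub>R bv \<beta>)) H0 - (Ad G (lexp G X) H0 - (c * \<beta> H0) *\<^sub>R bv \<beta>) \<in> wsp (set l)"
proof -
  have b: "\<beta> \<in> \<Delta>p" using i by simp
  let ?Z = "X + c *\<^sub>R bv \<beta>" and ?d = "c * \<beta> H0"
  have Z: "?Z \<in> \<nn>" using X bv_n[OF b] subspace_n by (simp add: subspace_add)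
  have u: "upclosed (set l)" using i ideal_list_upclosed by simp
  define f where "f t = Ad G (lexp G (t *\<^sub>R X)) H0 - (t * ?d) *\<^sub>R bv \<beta>" for t
  have fd: "(f has_vector_derivative (br X (Ad G (lexp G (t *\<^sub>R X)) H0) - (1 * ?d) *\<^sub>R bv \<beta>)) (at t)" for t
    unfolding f_def
    by (intro has_vector_derivative_diff Ad_lexp_derivative has_vector_derivative_scaleR_const)
      (auto intro!: derivative_eq_intros)
  have bb: "bv \<beta> \<in> wsp (set (\<beta> # l))" by (rule rs_wsp[of \<beta>]) (use bv[OF pos_root[OF b]] in auto)
  \<comment> \<open>Variation of constants: \<open>f\<close> is an approximate solution for the
    exponent \<open>?Z\<close>, and after transport back its derivative lies in the ideal.\<close>
  define e where "e t = Ad G (lexp G (t *\<^sub>R (- ?Z))) (f t)" for t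
  have ed: "(e has_vector_derivative Ad G (lexp G (t *\<^sub>R (- ?Z)))
      (br (- ?Z) (f t) + (br X (Ad G (lexp G (t *\<^sub>R X)) H0) - (1 * ?d) *\<^sub>R bv \<beta>))) (at t)" for t
    unfolding e_def by (rule ldiff_Ad_curve[OF ldiff_lexp fd])
  have bH: "br (bv \<beta>) H0 = - \<beta> H0 *\<^sub>R bv \<beta>"
    using bv[OF pos_root[OF b]] H0_in(2) br_anti[of "bv \<beta>" H0] by (simp add: rs_iff)
  have small: "br (- ?Z) (f t) + (br X (Ad G (lexp G (t *\<^sub>R X)) H0) - (1 * ?d) *\<^sub>R bv \<beta>) \<in> wsp (set l)" for t
  proof -
    let ?W = "Ad G (lexp G (t *\<^sub>R X)) H0 - H0"
    have W: "?W \<in> \<nn>" by (rule Ad_NN_a[OF lexp_NN H0_in(2)]) (use X subspace_n in \<open>simp add: subspace_scale\<close>)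
    have "br (- ?Z) (f t) + (br X (Ad G (lexp G (t *\<^sub>R X)) H0) - (1 * ?d) *\<^sub>R bv \<beta>) =
       (t * ?d) *\<^sub>R br X (bv \<beta>) - c *\<^sub>R br (bv \<beta>) (H0 + ?W) - ?d *\<^sub>R bv \<beta>"
      by (simp add: f_def br.add_left br.minus_left br.diff_right br.scaleR_left br.scaleR_right br.diff_left)
    also have "\<dots> = (t * ?d) *\<^sub>R br X (bv \<beta>) + c *\<^sub>R br ?W (bv \<beta>)"
      using br_anti[of "bv \<beta>" ?W] by (simp only: br.add_right bH) (simp add: scaleR_add_right scaleR_diff_right)
    also have "\<dots> \<in> wsp (set l)"
      using br_n_ideal[OF i X bb] br_n_ideal[OF i W bb]
      by (intro subspace_add[OF subspace_wsp] subspace_scale[OF subspace_wsp])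
    finally show ?thesis .
  qed
  have "e 1 - e 0 \<in> wsp (set l)"
  proof (rule curve_in_subspace[OF subspace_wsp ed])
    fix t
    show "Ad G (lexp G (t *\<^sub>R (- ?Z)))
      (br (- ?Z) (f t) + (br X (Ad G (lexp G (t *\<^sub>R X)) H0) - (1 * ?d) *\<^sub>R bv \<beta>)) \<in> wsp (set l)"
      by (rule Ad_n_invariant[OF u _ small]) (use Z subspace_n subspace_neg in blast)
  qed
  moreover have "e 0 = H0" by (simp add: e_def f_def Ad_one)
  moreover have "e 1 = Ad G (inv (lexp G ?Z)) (f 1)" using lexp_minus[of ?Z] by (simp add: e_def)
  ultimately have "Ad G (inv (lexp G ?Z)) (f 1) - H0 \<in> wsp (set l)" by simp
  from Ad_NN_invariant[OF lexp_NN[OF Z] u this]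
  have "f 1 - Ad G (lexp G ?Z) H0 \<in> wsp (set l)" by (simp add: Ad_diff)
  then have "- (f 1 - Ad G (lexp G ?Z) H0) \<in> wsp (set l)" by (rule subspace_neg[OF subspace_wsp])
  then show ?thesis by (simp add: f_def)
qed

text \<open>The exponent is corrected one root at a time along an ideal list; each correction leaves
  an error in the next smaller ideal.\<close>

lemma lexp_H0_surjective:
  assumes "Y \<in> \<nn>" obtains X where "X \<in> \<nn>" "Ad G (lexp G X) H0 = H0 + Y"
proof -
  obtain l where l: "ideal_list l" "set l = \<Delta>p" using ideal_list_exists .
  have "\<exists>X\<in>\<nn>. Ad G (lexp G X) H0 - H0 - Y \<in> wsp (set l2)" if "l = l1 @ l2" for l1 l2
    using that
  proof (induction l1 arbitrary: l2 rule: rev_induct)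
    case Nil
    then have "wsp (set l2) = \<nn>" using l n_eq by simp
    then show ?case using assms subspace_n by (intro bexI[of _ 0]) (auto simp: Ad_one subspace_neg subspace_0)
  next
    case (snoc \<beta> l1)
    then obtain X where X: "X \<in> \<nn>" "Ad G (lexp G X) H0 - H0 - Y \<in> wsp (set (\<beta> # l2))"
      using snoc.IH[of "\<beta> # l2"] by auto
    have i: "ideal_list (\<beta> # l2)" using l(1) snoc.prems ideal_list_suffix[of l1 "\<beta> # l2"] by simp
    then have b: "\<beta> \<in> \<Delta>p" by simp
    let ?D = "Ad G (lexp G X) H0 - H0 - Y"
    let ?c = "cf \<beta> ?D / \<beta> H0"
    have 1: "?D - cf \<beta> ?D *\<^sub>R bv \<beta> \<in> wsp (set l2)"
      using wsp_remove[of "set l2" \<beta> ?D] X(2) ideal_tail_eq[OF i] ideal_list_pos[OF i] pos_\<Omega> pos_root[OF b] by auto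
    have "Ad G (lexp G (X + ?c *\<^sub>R bv \<beta>)) H0 - (Ad G (lexp G X) H0 - cf \<beta> ?D *\<^sub>R bv \<beta>) \<in> wsp (set l2)"
      using Ad_lexp_add_bv[OF i X(1), of ?c] pos_H0[OF b] by simp
    from subspace_add[OF subspace_wsp this 1]
    have "Ad G (lexp G (X + ?c *\<^sub>R bv \<beta>)) H0 - (Ad G (lexp G X) H0 - cf \<beta> ?D *\<^sub>R bv \<beta>)
        + (?D - cf \<beta> ?D *\<^sub>R bv \<beta>) \<in> wsp (set l2)" .
    also have "Ad G (lexp G (X + ?c *\<^sub>R bv \<beta>)) H0 - (Ad G (lexp G X) H0 - cf \<beta> ?D *\<^sub>R bv \<beta>)
        + (?D - cf \<beta> ?D *\<^sub>R bv \<beta>) = Ad G (lexp G (X + ?c *\<^sub>R bv \<beta>)) H0 - H0 - Y"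
      by (simp only: diff_conv_add_uminus minus_add_distrib minus_minus ac_simps) simp
    finally have "Ad G (lexp G (X + ?c *\<^sub>R bv \<beta>)) H0 - H0 - Y \<in> wsp (set l2)" .
    moreover have "X + ?c *\<^sub>R bv \<beta> \<in> \<nn>" using X(1) bv_n[OF b] subspace_n by (simp add: subspace_add)
    ultimately show ?case by blast
  qed
  from this[of l "[]"] that show ?thesis by (auto simp: wsp_def algebra_simps)
qed

text \<open>An element of the generated group and some exponential move \<open>H0\<close> to the
  same point, so they differ by an element of the stabilizer, which is trivial.\<close>

lemma NN_eq: "NN = Ngrp G"
proof
  show "Ngrp G \<subseteq> NN" using lexp_NN by (auto simp: Ngrp_def)
  show "NN \<subseteq> Ngrp G"
  proof
    fix g assume g: "g \<in> NN"
    obtain X where X: "X \<in> \<nn>" "Ad G (lexp G X) H0 = H0 + (Ad G g H0 - H0)"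
      using lexp_H0_surjective[OF Ad_NN_a[OF g H0_in(2)]] .
    have c: "g \<in> carrier G" using NN_carrier g .
    have "inv (lexp G X) \<otimes> g \<in> NN"
      using g lexp_NN[OF X(1)] subgroup_NN subgroup.m_closed subgroup.m_inv_closed by fast
    moreover have "Ad G (inv (lexp G X) \<otimes> g) H0 = H0"
      using X(2) Ad_inv(2)[OF lexp_closed, of X H0] c by (simp add: Ad_mult)
    ultimately have "inv (lexp G X) \<otimes> g = \<one>" by (rule NN_stabilizer)
    then have "g = lexp G X" using c inv_equality inv_inv lexp_closed inv_closed by metis
    then show "g \<in> Ngrp G" using X(1) by (simp add: Ngrp_def)
  qed
qed

end

section \<open>Double cosets of \<open>N\<close> and \<open>AN\<close>\<close>

context split begin

lemma Ad_A_rs: assumes "H \<in> \<aa>" "X \<in> rs \<gamma>" shows "Ad G (lexp G H) X = exp (\<gamma> H) *\<^sub>R X"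
proof -
  let ?f = "\<lambda>t. exp (t * \<gamma> H) *\<^sub>R X"
  have "Ad G (lexp G (1 *\<^sub>R H)) (?f 0) = ?f 1"
  proof (rule Ad_lexp_eqI)
    fix t
    have "(?f has_vector_derivative (exp (t * \<gamma> H) * \<gamma> H) *\<^sub>R X) (at t)"
      by (rule has_vector_derivative_scaleR_const) (auto intro!: derivative_eq_intros)
    then show "(?f has_vector_derivative br H (?f t)) (at t)"
      using assms by (simp add: rs_iff br.scaleR_right)
  qed
  then show ?thesis by simp
qed

lemma Ad_A_a: "H \<in> \<aa> \<Longrightarrow> H' \<in> \<aa> \<Longrightarrow> Ad G (lexp G H) H' = H'"
  using Ad_A_rs[of H H' "\<lambda>_. 0"] rs_0 by simp

lemma lexp_add_a: assumes "H \<in> \<aa>" "H' \<in> \<aa>" shows "lexp G (H + H') = lexp G H \<otimes> lexp G H'"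
proof -
  have "ldiff (\<lambda>t. lexp G (t *\<^sub>R H) \<otimes> lexp G (t *\<^sub>R H')) t (H + H')" for t
  proof -
    have "Ad G (inv (lexp G (t *\<^sub>R H'))) H = H"
      using Ad_A_a[of "- (t *\<^sub>R H')" H] assms a_props(1) by (simp add: lexp_minus subspace_neg subspace_scale)
    then show ?thesis using ldiff_mult[OF ldiff_lexp[of H t] ldiff_lexp[of H' t]] by simp
  qed
  from ldiff_eq_lexp[OF this, of 1] show ?thesis by simp
qed

lemma Ad_A_n: assumes "H \<in> \<aa>" "X \<in> \<nn>" shows "Ad G (lexp G H) X \<in> \<nn>"
proof -
  have "X \<in> {X. Ad G (lexp G H) X \<in> \<nn>}"
  proof (rule wsp_induct[OF assms(2)[unfolded n_eq] subspace_vimage[OF linear_Ad subspace_n]])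
    fix \<gamma> X assume g: "\<gamma> \<in> \<Delta>p" "X \<in> rs \<gamma>"
    then show "X \<in> {X. Ad G (lexp G H) X \<in> \<nn>}"
      using Ad_A_rs[OF assms(1) g(2)] rs_wsp[OF g] subspace_n by (simp add: n_eq subspace_wsp subspace_scale)
  qed simp
  then show ?thesis by simp
qed

section \<open>The group \<open>AN\<close>\<close>

abbreviation "AN \<equiv> base_coset G"
abbreviation "N \<equiv> Ngrp G"

lemma NI: "X \<in> \<nn> \<Longrightarrow> lexp G X \<in> N" by (simp add: Ngrp_def)
lemma subgroup_N: "subgroup N G" using subgroup_NN NN_eq by simp
lemma N_carrier: "n \<in> N \<Longrightarrow> n \<in> carrier G" using subgroup.subset[OF subgroup_N] by blast
lemma N_mult: "n \<in> N \<Longrightarrow> n' \<in> N \<Longrightarrow> n \<otimes> n' \<in> N" by (rule subgroup.m_closed[OF subgroup_N])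
lemma N_inv: "n \<in> N \<Longrightarrow> inv n \<in> N" by (rule subgroup.m_inv_closed[OF subgroup_N])
lemma N_one: "\<one> \<in> N" by (rule subgroup.one_closed[OF subgroup_N])

lemma N_conj: assumes "g \<in> carrier G" "\<And>X. X \<in> \<nn> \<Longrightarrow> Ad G g X \<in> \<nn>" "n \<in> N"
  shows "g \<otimes> n \<otimes> inv g \<in> N"
  using assms lexp_conj by (auto simp: Ngrp_def)

lemma A_conj_N: "H \<in> \<aa> \<Longrightarrow> n \<in> N \<Longrightarrow> lexp G H \<otimes> n \<otimes> inv (lexp G H) \<in> N"
  using N_conj Ad_A_n by simp

lemma AN_iff: "x \<in> AN \<longleftrightarrow> (\<exists>H\<in>\<aa>. \<exists>n\<in>N. x = lexp G H \<otimes> n)"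
  by (auto simp: base_coset_def Agrp_def set_mult_def)

lemma ANI: "H \<in> \<aa> \<Longrightarrow> n \<in> N \<Longrightarrow> lexp G H \<otimes> n \<in> AN" using AN_iff by blast

lemma AN_iff': "x \<in> AN \<longleftrightarrow> (\<exists>H\<in>\<aa>. \<exists>n\<in>N. x = n \<otimes> lexp G H)"
proof
  assume "x \<in> AN"
  then obtain H n where h: "H \<in> \<aa>" "n \<in> N" "x = lexp G H \<otimes> n" using AN_iff by blast
  then have "x = (lexp G H \<otimes> n \<otimes> inv (lexp G H)) \<otimes> lexp G H" by (simp add: m_assoc N_carrier)
  then show "\<exists>H\<in>\<aa>. \<exists>n\<in>N. x = n \<otimes> lexp G H" using A_conj_N[OF h(1,2)] h(1) by blast
next
  assume "\<exists>H\<in>\<aa>. \<exists>n\<in>N. x = n \<otimes> lexp G H"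
  then obtain H n where h: "H \<in> \<aa>" "n \<in> N" "x = n \<otimes> lexp G H" by blast
  have "lexp G (- H) \<otimes> n \<otimes> inv (lexp G (- H)) \<in> N"
    by (rule A_conj_N) (use h a_props(1) in \<open>auto simp: subspace_neg\<close>)
  moreover have "x = lexp G H \<otimes> (lexp G (- H) \<otimes> n \<otimes> inv (lexp G (- H)))"
    using h by (simp add: lexp_minus m_assoc N_carrier inv_cancel)
  ultimately show "x \<in> AN" using AN_iff h(1) by blast
qed

lemma A_AN: "H \<in> \<aa> \<Longrightarrow> lexp G H \<in> AN" using ANI[OF _ N_one] by simp
lemma N_AN: "n \<in> N \<Longrightarrow> n \<in> AN"
  using ANI[of 0 n] a_props(1) N_carrier by (simp add: subspace_0)

lemma subgroup_AN: "subgroup AN G"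
proof
  show "AN \<subseteq> carrier G" using AN_iff N_carrier by auto
  show "\<one> \<in> AN" using N_AN N_one .
  fix x y assume "x \<in> AN" "y \<in> AN"
  then obtain H n H' n' where x: "H \<in> \<aa>" "n \<in> N" "x = n \<otimes> lexp G H" and y: "H' \<in> \<aa>" "n' \<in> N" "y = lexp G H' \<otimes> n'"
    using AN_iff AN_iff' by metis
  have HH: "H + H' \<in> \<aa>" using x(1) y(1) a_props(1) by (simp add: subspace_add)
  let ?m = "lexp G (H + H') \<otimes> n' \<otimes> inv (lexp G (H + H'))"
  have "x \<otimes> y = (n \<otimes> ?m) \<otimes> lexp G (H + H')"
    using x y by (simp add: m_assoc N_carrier lexp_add_a)
  then show "x \<otimes> y \<in> AN" using AN_iff' HH N_mult[OF x(2) A_conj_N[OF HH y(2)]] by blast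
next
  fix x assume "x \<in> AN"
  then obtain H n where x: "H \<in> \<aa>" "n \<in> N" "x = lexp G H \<otimes> n" using AN_iff by blast
  have "inv x = inv n \<otimes> lexp G (- H)" using x by (simp add: inv_mult_group N_carrier lexp_minus)
  then show "inv x \<in> AN" using AN_iff' N_inv[OF x(2)] x(1) a_props(1) by (meson subspace_neg)
qed

lemma AN_carrier: "b \<in> AN \<Longrightarrow> b \<in> carrier G" using subgroup.subset[OF subgroup_AN] by blast
lemma AN_mult: "b \<in> AN \<Longrightarrow> b' \<in> AN \<Longrightarrow> b \<otimes> b' \<in> AN" by (rule subgroup.m_closed[OF subgroup_AN])
lemma AN_inv: "b \<in> AN \<Longrightarrow> inv b \<in> AN" by (rule subgroup.m_inv_closed[OF subgroup_AN])

lemma Ad_AN_a: assumes "b \<in> AN" "H \<in> \<aa>" shows "Ad G b H - H \<in> \<nn>"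
proof -
  obtain H' n where b: "H' \<in> \<aa>" "n \<in> N" "b = n \<otimes> lexp G H'" using AN_iff' assms(1) by blast
  then show ?thesis using Ad_NN_a[of n H] NN_eq assms(2) by (simp add: Ad_mult N_carrier Ad_A_a)
qed

lemma K_isometry_a_n:
  assumes "ip (H + W) (H + W) = ip H H" "H \<in> \<aa>" "W \<in> \<nn>" shows "W = 0"
  using assms n_a_orthogonal[OF assms(3,2)] ip_sym[of H W] by (simp add: ip.add_left ip.add_right)

text \<open>Elements of \<open>K\<close> act by isometries, while \<open>AN\<close> moves
  \<open>H0\<close> by a vector of \<open>\<nn>\<close>, orthogonal to it; so \<open>H0\<close> is
  fixed and the \<open>N\<close>-factor is trivial. The remaining \<open>exp H\<close> scales root
  vectors by positive factors that must be \<open>1\<close>.\<close>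

lemma K_AN_trivial: assumes "k \<in> Kgrp G" "k \<in> AN" shows "k = \<one>"
proof -
  obtain H n where b: "H \<in> \<aa>" "n \<in> N" "k = n \<otimes> lexp G H" using AN_iff' assms(2) by blast
  have "Ad G k H0 = Ad G n H0" using b H0_in(2) by (simp add: Ad_mult N_carrier Ad_A_a)
  moreover have "Ad G k H0 = H0 + (Ad G k H0 - H0)" by simp
  then have "Ad G k H0 - H0 = 0"
    using K_isometry_a_n[OF _ H0_in(2) Ad_AN_a[OF assms(2) H0_in(2)]] ip_Ad[OF assms(1), of H0 H0] by simp
  ultimately have "n = \<one>" using NN_stabilizer[of n] b(2) NN_eq by simp
  then have k: "k = lexp G H" using b by simp
  have g0: "br H X = 0" if "\<gamma> \<in> \<Delta>" "X \<in> rs \<gamma>" for \<gamma> X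
  proof (cases "X = 0")
    case False
    have "ip (exp (\<gamma> H) *\<^sub>R X) (exp (\<gamma> H) *\<^sub>R X) = ip X X"
      using ip_Ad[OF assms(1), of X X] Ad_A_rs[OF b(1) that(2)] k by simp
    then have "exp (\<gamma> H) * exp (\<gamma> H) = 1" using False by (simp add: ip.scaleR_left ip.scaleR_right)
    then have "exp (\<gamma> H + \<gamma> H) = 1" by (simp only: exp_add)
    then have "\<gamma> H = 0" by simp
    then show ?thesis using that b(1) by (simp add: rs_iff)
  qed simp
  have "br H Y = 0" for Y
    using linear_eq_0_on_span[OF linear_bracket_right, of "\<aa> \<union> (\<Union>\<alpha>\<in>\<Delta>. rs \<alpha>)" H Y]
      root_decomposition g0 a_props(3)[OF b(1)] by auto
  then have "H = 0" by (rule ad_injective)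
  then show ?thesis using k by simp
qed

text \<open>The double coset of \<open>u\<close> for \<open>N\<close> and \<open>AN\<close> in the
  whole group; its trace on \<open>K\<close> is the Bruhat cell. The arguments below multiply by
  elements outside \<open>K\<close>.\<close>

definition dc :: "'g \<Rightarrow> 'g set" where "dc u = {n \<otimes> u \<otimes> b | n b. n \<in> N \<and> b \<in> AN}"

lemma dcI: "n \<in> N \<Longrightarrow> b \<in> AN \<Longrightarrow> n \<otimes> u \<otimes> b \<in> dc u" by (auto simp: dc_def)

lemma dc_self: "u \<in> carrier G \<Longrightarrow> u \<in> dc u"
  using dcI[OF N_one subgroup.one_closed[OF subgroup_AN], of u] by simp

lemma dc_carrier: "u \<in> carrier G \<Longrightarrow> dc u \<subseteq> carrier G"
  using N_carrier AN_carrier by (auto simp: dc_def)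

lemma dc_right: assumes "u \<in> carrier G" "x \<in> dc u" "b \<in> AN" shows "x \<otimes> b \<in> dc u"
proof -
  obtain n b' where x: "n \<in> N" "b' \<in> AN" "x = n \<otimes> u \<otimes> b'" using assms by (auto simp: dc_def)
  then have "x \<otimes> b = n \<otimes> u \<otimes> (b' \<otimes> b)" using assms by (simp add: m_assoc N_carrier AN_carrier)
  then show ?thesis using dcI[OF x(1) AN_mult[OF x(2) assms(3)]] by simp
qed

lemma dc_left_N: assumes "u \<in> carrier G" "x \<in> dc u" "n \<in> N" shows "n \<otimes> x \<in> dc u"
proof -
  obtain n' b where x: "n' \<in> N" "b \<in> AN" "x = n' \<otimes> u \<otimes> b" using assms by (auto simp: dc_def)
  then have "n \<otimes> x = (n \<otimes> n') \<otimes> u \<otimes> b" using assms by (simp add: m_assoc N_carrier AN_carrier)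
  then show ?thesis using x N_mult[OF assms(3) x(1)] dcI by metis
qed

lemma U_conj_A: assumes "u \<in> UU" "H \<in> \<aa>" shows "inv u \<otimes> lexp G H \<otimes> u \<in> AN"
  using lexp_conj[of "inv u" H] A_AN[OF Ad_inv_U_a[OF assms]] U_carrier[OF assms(1)] by simp

lemma dc_left_A: assumes "u \<in> UU" "x \<in> dc u" "H \<in> \<aa>" shows "lexp G H \<otimes> x \<in> dc u"
proof -
  note c = U_carrier[OF assms(1)]
  obtain n b where x: "n \<in> N" "b \<in> AN" "x = n \<otimes> u \<otimes> b" using assms by (auto simp: dc_def)
  have "lexp G H \<otimes> x = (lexp G H \<otimes> n \<otimes> inv (lexp G H)) \<otimes> u \<otimes> ((inv u \<otimes> lexp G H \<otimes> u) \<otimes> b)"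
    using x c by (simp add: m_assoc N_carrier AN_carrier inv_cancel)
  then show ?thesis
    using dcI[OF A_conj_N[OF assms(3) x(1)] AN_mult[OF U_conj_A[OF assms(1,3)] x(2)]] by metis
qed

lemma dc_left_AN: assumes "u \<in> UU" "x \<in> dc u" "b \<in> AN" shows "b \<otimes> x \<in> dc u"
proof -
  obtain H n where b: "H \<in> \<aa>" "n \<in> N" "b = lexp G H \<otimes> n" using AN_iff assms(3) by blast
  have c: "x \<in> carrier G" using dc_carrier[OF U_carrier[OF assms(1)]] assms(2) by blast
  have "b \<otimes> x = lexp G H \<otimes> (n \<otimes> x)" using b c by (simp add: m_assoc N_carrier)
  then show ?thesis using dc_left_A[OF assms(1) dc_left_N[OF U_carrier[OF assms(1)] assms(2) b(2)] b(1)] by simp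
qed

lemma bruhat_cell_eq: assumes "u \<in> UU" shows "bruhat_cell G u = Kgrp G \<inter> dc u"
proof
  show "bruhat_cell G u \<subseteq> Kgrp G \<inter> dc u"
  proof
    fix k assume "k \<in> bruhat_cell G u"
    then obtain n where k: "k \<in> Kgrp G" "n \<in> N" "k <# AN = (n \<otimes> u) <# AN" by (auto simp: bruhat_cell_def)
    have "k \<otimes> \<one> \<in> k <# AN" unfolding l_coset_def using subgroup.one_closed[OF subgroup_AN] by blast
    then have "k \<in> (n \<otimes> u) <# AN" using k Kgrp_carrier by simp
    then show "k \<in> Kgrp G \<inter> dc u" using k by (auto simp: l_coset_def dc_def)
  qed
  show "Kgrp G \<inter> dc u \<subseteq> bruhat_cell G u"
  proof
    fix k assume "k \<in> Kgrp G \<inter> dc u"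
    then obtain n b where k: "k \<in> Kgrp G" "n \<in> N" "b \<in> AN" "k = n \<otimes> u \<otimes> b" by (auto simp: dc_def)
    have nu: "n \<otimes> u \<in> carrier G" using k(2) N_carrier U_carrier[OF assms] by blast
    have kb: "k = (n \<otimes> u) \<otimes> b" using k(4) .
    have "k <# AN = (n \<otimes> u) <# AN"
    proof
      show "k <# AN \<subseteq> (n \<otimes> u) <# AN"
      proof
        fix y assume "y \<in> k <# AN"
        then obtain b' where b': "b' \<in> AN" "y = k \<otimes> b'" by (auto simp: l_coset_def)
        then have "y = (n \<otimes> u) \<otimes> (b \<otimes> b')" using kb nu k(3) AN_carrier by (simp add: m_assoc)
        then show "y \<in> (n \<otimes> u) <# AN" using AN_mult[OF k(3) b'(1)] by (auto simp: l_coset_def)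
      qed
      show "(n \<otimes> u) <# AN \<subseteq> k <# AN"
      proof
        fix y assume "y \<in> (n \<otimes> u) <# AN"
        then obtain b' where b': "b' \<in> AN" "y = (n \<otimes> u) \<otimes> b'" by (auto simp: l_coset_def)
        then have "y = k \<otimes> (inv b \<otimes> b')" using kb nu k(3) AN_carrier by (simp add: m_assoc inv_cancel)
        then show "y \<in> k <# AN" using AN_mult[OF AN_inv[OF k(3)] b'(1)] by (auto simp: l_coset_def)
      qed
    qed
    then show "k \<in> bruhat_cell G u" using k by (auto simp: bruhat_cell_def)
  qed
qed

text \<open>The frame operator \<open>S\<close> is injective on \<open>\<aa>\<close> because an
  element killed by all roots is central; a left inverse of \<open>S\<close> produces the dual
  vectors.\<close>

lemma a_dual_family:
  obtains D where "\<And>\<gamma>. D \<gamma> \<in> \<aa>" "\<And>H. H \<in> \<aa> \<Longrightarrow> H = (\<Sum>\<gamma>\<in>\<Delta>. \<gamma> H *\<^sub>R D \<gamma>)"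
proof -
  define S where "S X = (\<Sum>\<gamma>\<in>\<Delta>. ip (Hvec G \<gamma>) X *\<^sub>R Hvec G \<gamma>)" for X
  have lS: "linear S" unfolding S_def
    by (rule linearI) (simp_all add: ip.add_right ip.scaleR_right scaleR_add_left sum.distrib scaleR_right.sum)
  have "inj_on S \<aa>"
    unfolding linear_inj_on_iff_eq_0[OF lS a_props(1)]
  proof (intro ballI impI)
    fix H assume H: "H \<in> \<aa>" "S H = 0"
    have "0 = ip (S H) H" using H by simp
    also have "\<dots> = (\<Sum>\<gamma>\<in>\<Delta>. (ip (Hvec G \<gamma>) H)\<^sup>2)"
      by (simp add: S_def ip.sum_left ip.scaleR_left power2_eq_square)
    finally have "\<forall>\<gamma>\<in>\<Delta>. (ip (Hvec G \<gamma>) H)\<^sup>2 = 0"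
      using sum_nonneg_eq_0_iff[OF finite_roots, of "\<lambda>\<gamma>. (ip (Hvec G \<gamma>) H)\<^sup>2"] by simp
    then have "\<gamma> H = 0" if "\<gamma> \<in> \<Delta>" for \<gamma> using Hvec_ip[OF that H(1)] that by simp
    then have g0: "br H X = 0" if "\<gamma> \<in> \<Delta>" "X \<in> rs \<gamma>" for \<gamma> X
      using that H(1) by (simp add: rs_iff)
    have "br H Y = 0" for Y
      using linear_eq_0_on_span[OF linear_bracket_right, of "\<aa> \<union> (\<Union>\<alpha>\<in>\<Delta>. rs \<alpha>)" H Y]
        root_decomposition g0 a_props(3)[OF H(1)] by auto
    then show "H = 0" by (rule ad_injective)
  qed
  then obtain g where g: "range g \<subseteq> \<aa>" "linear g" "\<forall>v\<in>\<aa>. g (S v) = v"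
    using linear_exists_left_inverse_on[OF lS a_props(1)] by blast
  show ?thesis
  proof (rule that[of "\<lambda>\<gamma>. g (Hvec G \<gamma>)"])
    fix H assume H: "H \<in> \<aa>"
    have "H = g (S H)" using g(3) H by simp
    also have "\<dots> = (\<Sum>\<gamma>\<in>\<Delta>. \<gamma> H *\<^sub>R g (Hvec G \<gamma>))"
      unfolding S_def using g(2) by (simp add: linear_sum linear_cmul Hvec_ip[OF _ H])
    finally show "H = (\<Sum>\<gamma>\<in>\<Delta>. \<gamma> H *\<^sub>R g (Hvec G \<gamma>))" .
  qed (use g in blast)
qed

lemma lexp_sum_a:
  assumes "\<And>\<gamma>. D \<gamma> \<in> \<aa>"
  shows "lexp G (\<Sum>\<gamma>\<leftarrow>l. c \<gamma> *\<^sub>R D \<gamma>) = foldr (\<lambda>\<gamma> g. lexp G (c \<gamma> *\<^sub>R D \<gamma>) \<otimes> g) l \<one>"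
proof (induction l)
  case (Cons \<gamma> l)
  have "(\<Sum>\<gamma>\<leftarrow>l. c \<gamma> *\<^sub>R D \<gamma>) \<in> \<aa>"
    by (induction l) (use a_props(1) assms in \<open>auto simp: subspace_0 subspace_add subspace_scale\<close>)
  then show ?case using Cons lexp_add_a[of "c \<gamma> *\<^sub>R D \<gamma>"] assms a_props(1) by (simp add: subspace_scale)
qed simp

text \<open>The logarithm of a path in \<open>A\<close> is recovered continuously from the eigenvalues of its adjoint
  action.\<close>

lemma A_path_limit:
  assumes a: "continuous_map euclidean T (a :: real \<Rightarrow> 'g)" "\<And>s. s \<noteq> 0 \<Longrightarrow> a s \<in> lexp G ` \<aa>"
    and w: "\<And>X. Ad G (a 0) X = X"
  shows "a 0 = \<one>"
proof -
  obtain D where D: "\<And>\<gamma>. D \<gamma> \<in> \<aa>" "\<And>H. H \<in> \<aa> \<Longrightarrow> H = (\<Sum>\<gamma>\<in>\<Delta>. \<gamma> H *\<^sub>R D \<gamma>)"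
    using a_dual_family by metis
  obtain l where l: "set l = \<Delta>" "distinct l" using finite_roots finite_distinct_list by blast
  \<comment> \<open>The eigenvalue of \<open>a s\<close> on the root line of
    \<open>\<gamma>\<close>. It is positive also at \<open>s = 0\<close>, where it equals
    \<open>1\<close>, so its logarithm is continuous there.\<close>
  define k where "k \<gamma> s = cf \<gamma> (Ad G (a s) (bv \<gamma>))" for \<gamma> s
  have kc: "continuous_on UNIV (k \<gamma>)" for \<gamma>
    unfolding k_def by (intro continuous_cf continuous_Ad_curve a(1) continuous_intros)
  have ks: "k \<gamma> s = exp (\<gamma> H)" if "\<gamma> \<in> \<Delta>" "H \<in> \<aa>" "a s = lexp G H" for \<gamma> s H
    using that bv[OF that(1)] Ad_A_rs[OF that(2), of "bv \<gamma>" \<gamma>] cf_bv[OF that(1)]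
    by (simp add: k_def linear_cmul[OF cf_linear])
  have k0: "k \<gamma> 0 = 1" if "\<gamma> \<in> \<Delta>" for \<gamma> using w cf_bv[OF that] by (simp add: k_def)
  have kp: "k \<gamma> s > 0" if "\<gamma> \<in> \<Delta>" for \<gamma> s
    using k0[OF that] ks[OF that] a(2)[of s] by (cases "s = 0") auto
  define e where "e s = foldr (\<lambda>\<gamma> g. lexp G (ln (k \<gamma> s) *\<^sub>R D \<gamma>) \<otimes> g) l \<one>" for s
  have ec: "continuous_map euclidean T (\<lambda>s. foldr (\<lambda>\<gamma> g. lexp G (ln (k \<gamma> s) *\<^sub>R D \<gamma>) \<otimes> g) l' \<one>)" if "set l' \<subseteq> \<Delta>" for l'
    using that
  proof (induction l')
    case (Cons \<gamma> l')
    have "continuous_on UNIV (\<lambda>s. ln (k \<gamma> s))"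
      by (intro continuous_on_ln kc) (use kp[of \<gamma>] Cons.prems in \<open>auto simp: less_imp_neq[symmetric]\<close>)
    then show ?case using Cons by (auto intro!: continuous_map_mult lexp_scale_continuous)
  qed (simp add: topspace_T)
  have es: "e s = a s" if s: "s \<noteq> 0" for s
  proof -
    obtain H where H: "H \<in> \<aa>" "a s = lexp G H" using a(2)[OF s] by blast
    have "e s = lexp G (\<Sum>\<gamma>\<leftarrow>l. ln (k \<gamma> s) *\<^sub>R D \<gamma>)"
      unfolding e_def using lexp_sum_a[of D "\<lambda>\<gamma>. ln (k \<gamma> s)" l] D(1) by simp
    also have "(\<Sum>\<gamma>\<leftarrow>l. ln (k \<gamma> s) *\<^sub>R D \<gamma>) = (\<Sum>\<gamma>\<in>\<Delta>. ln (k \<gamma> s) *\<^sub>R D \<gamma>)"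
      using l by (simp add: sum_list_distinct_conv_sum_set)
    also have "\<dots> = (\<Sum>\<gamma>\<in>\<Delta>. \<gamma> H *\<^sub>R D \<gamma>)" by (intro sum.cong refl) (simp add: ks[OF _ H])
    also have "\<dots> = H" using D(2)[OF H(1)] by simp
    finally show ?thesis using H by simp
  qed
  have e0: "e 0 = \<one>"
  proof -
    have "foldr (\<lambda>\<gamma> g. lexp G (ln (k \<gamma> 0) *\<^sub>R D \<gamma>) \<otimes> g) l' \<one> = \<one>" if "set l' \<subseteq> \<Delta>" for l'
      using that by (induction l') (auto simp: k0)
    then show ?thesis using l by (simp add: e_def)
  qed
  have la: "limitin T a (a 0) (at 0)"
    using continuous_map_limit[OF a(1), of "\<lambda>t. t" 0 "at 0"] by (simp add: comp_def)
  have "continuous_map euclidean T e" unfolding e_def using ec l by simp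
  from continuous_map_limit[OF this, of "\<lambda>t. t" 0 "at 0"]
  have le: "limitin T e \<one> (at 0)" by (simp add: comp_def e0)
  have "limitin T a \<one> (at 0)"
  proof (rule limitin_transform_eventually[OF _ le])
    show "\<forall>\<^sub>F s in at 0. e s = a s" using es by (simp add: eventually_at_filter)
  qed
  from limitin_Hausdorff_unique[OF la this _ Hausdorff_T] show ?thesis by simp
qed

end

section \<open>Disjointness of Bruhat cells\<close>

context split begin

lemma C_props: assumes "c \<in> CC"
  shows C_K: "c \<in> Kgrp G" and C_Ad: "H \<in> \<aa> \<Longrightarrow> Ad G c H = H" and C_U: "c \<in> UU"
    and C_carrier: "c \<in> carrier G"
proof -
  show 1: "c \<in> Kgrp G" "H \<in> \<aa> \<Longrightarrow> Ad G c H = H" for H using assms by (auto simp: Cgrp_def)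
  show c: "c \<in> carrier G" using Kgrp_carrier 1 by blast
  show "c \<in> UU"
  proof (rule UI[OF 1(1)])
    fix H assume H: "H \<in> \<aa>"
    show "Ad G c H \<in> \<aa>" using 1(2)[OF H] H by simp
    show "Ad G (inv c) H \<in> \<aa>" using Ad_inv(2)[OF c, of H] 1(2)[OF H] H by simp
  qed
qed

lemma CI: "c \<in> UU \<Longrightarrow> (\<And>H. H \<in> \<aa> \<Longrightarrow> Ad G c H = H) \<Longrightarrow> c \<in> CC"
  by (simp add: Cgrp_def U_K)

lemma subgroup_C: "subgroup CC G"
proof
  show "CC \<subseteq> carrier G" using C_carrier by blast
  show "\<one> \<in> CC" using subgroup.one_closed[OF subgroup_U] by (intro CI) (auto simp: Ad_one)
  fix x y assume "x \<in> CC" "y \<in> CC"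
  then show "x \<otimes> y \<in> CC" using subgroup.m_closed[OF subgroup_U]
    by (intro CI) (auto simp: C_U C_carrier Ad_mult C_Ad)
next
  fix x assume x: "x \<in> CC"
  have "Ad G (inv x) H = H" if "H \<in> \<aa>" for H
    using Ad_inv(2)[OF C_carrier[OF x], of H] C_Ad[OF x that] by simp
  then show "inv x \<in> CC" using subgroup.m_inv_closed[OF subgroup_U] x by (intro CI) (auto simp: C_U)
qed

lemma C_conj: assumes "u \<in> UU" "c \<in> CC" shows "inv u \<otimes> c \<otimes> u \<in> CC" "u \<otimes> c \<otimes> inv u \<in> CC"
proof -
  have 1: "inv u \<otimes> c \<otimes> u \<in> CC" if "u \<in> UU" for u
  proof (rule CI)
    show "inv u \<otimes> c \<otimes> u \<in> UU"
      using that C_U[OF assms(2)] subgroup_U subgroup.m_closed subgroup.m_inv_closed by metis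
    fix H assume "H \<in> \<aa>"
    then show "Ad G (inv u \<otimes> c \<otimes> u) H = H"
      using that assms(2) by (simp add: Ad_mult U_carrier C_carrier C_Ad Ad_U_a)
  qed
  show "inv u \<otimes> c \<otimes> u \<in> CC" using 1 assms by blast
  show "u \<otimes> c \<otimes> inv u \<in> CC"
    using 1[of "inv u"] subgroup.m_inv_closed[OF subgroup_U assms(1)] U_carrier[OF assms(1)] by simp
qed

lemma C_rs: assumes "c \<in> CC" "X \<in> rs \<gamma>" shows "Ad G c X \<in> rs \<gamma>"
  unfolding rs_iff
proof
  fix H assume H: "H \<in> \<aa>"
  have "br H (Ad G c X) = Ad G c (br H X)" using Ad_br[OF C_carrier[OF assms(1)], of H X] C_Ad[OF assms(1) H] by simp
  then show "br H (Ad G c X) = \<gamma> H *\<^sub>R Ad G c X"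
    using assms H by (simp add: rs_iff Ad_scale C_carrier)
qed

lemma C_act: assumes "c \<in> CC" "\<gamma> \<in> \<Delta>" shows "act c \<gamma> = \<gamma>"
proof -
  obtain E where E: "E \<in> rs \<gamma>" "E \<noteq> 0" using root_vector_exists assms by blast
  note c = C_carrier[OF assms(1)]
  show ?thesis
  proof (rule ccontr)
    assume "act c \<gamma> \<noteq> \<gamma>"
    then have "ip (Ad G c E) (Ad G c E) = 0"
      using rs_orthogonal[OF rs_act[OF C_U[OF assms(1)] E(1)] C_rs[OF assms(1) E(1)]]
        roots_adual[OF assms(2)] act_adual[OF C_U[OF assms(1)]] by blast
    then show False using Ad_eq_0_iff[OF c] E(2) by simp
  qed
qed

lemma Ad_n_from_rs:
  assumes "g \<in> carrier G" "\<And>\<gamma> X. \<gamma> \<in> S \<Longrightarrow> X \<in> rs \<gamma> \<Longrightarrow> Ad G g X \<in> wsp S'" "X \<in> wsp S"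
  shows "Ad G g X \<in> wsp S'"
proof -
  have "X \<in> {X. Ad G g X \<in> wsp S'}"
    by (rule wsp_induct[OF assms(3) subspace_vimage[OF linear_Ad[OF assms(1)] subspace_wsp]]) (use assms(2) in auto)
  then show ?thesis by simp
qed

lemma C_conj_N: assumes "c \<in> CC" "n \<in> N" shows "c \<otimes> n \<otimes> inv c \<in> N"
proof (rule N_conj[OF C_carrier[OF assms(1)] _ assms(2)])
  fix X assume "X \<in> \<nn>"
  then show "Ad G c X \<in> \<nn>"
    unfolding n_eq by (rule Ad_n_from_rs[OF C_carrier[OF assms(1)], rotated]) (use C_rs[OF assms(1)] rs_wsp in blast)
qed

lemma dc_left_C: assumes "c \<in> CC" "u \<in> UU" "x \<in> dc u" shows "c \<otimes> x \<in> dc (c \<otimes> u)"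
proof -
  note k = C_carrier[OF assms(1)] U_carrier[OF assms(2)]
  obtain n b where x: "n \<in> N" "b \<in> AN" "x = n \<otimes> u \<otimes> b" using assms by (auto simp: dc_def)
  have "c \<otimes> x = (c \<otimes> n \<otimes> inv c) \<otimes> (c \<otimes> u) \<otimes> b"
    using x k by (simp add: m_assoc N_carrier AN_carrier inv_cancel)
  then show ?thesis using dcI[OF C_conj_N[OF assms(1) x(1)] x(2)] by metis
qed

lemma ce_C: assumes "\<alpha> \<in> \<Sigma>" shows "c_elt G \<alpha> \<in> CC"
proof -
  have e: "c_elt G \<alpha> = se \<alpha> \<otimes> se \<alpha>" by (simp add: c_elt_def numeral_2_eq_2)
  show ?thesis unfolding e
  proof (rule CI)
    show "se \<alpha> \<otimes> se \<alpha> \<in> UU" using se_U[OF assms] subgroup.m_closed[OF subgroup_U] by blast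
  qed (simp add: Ad_mult Ad_se_se[OF assms])
qed

lemma ce_eq: "c_elt G \<alpha> = se \<alpha> \<otimes> se \<alpha>" by (simp add: c_elt_def numeral_2_eq_2)
lemma ce_rot: "c_elt G \<alpha> = rot \<alpha> 1" using rot_add[of \<alpha> "1/2" "1/2"] by (simp add: ce_eq se_rot)

lemma pr_conj_A:
  assumes "set l \<subseteq> \<Delta>" "H \<in> \<aa>"
  shows "lexp G H \<otimes> pr l x \<otimes> inv (lexp G H) = pr l (\<lambda>\<gamma>. exp (\<gamma> H) * x \<gamma>)"
  using assms(1)
proof (induction l)
  case (Cons \<gamma> l)
  let ?a = "lexp G H"
  have "?a \<otimes> pr (\<gamma> # l) x \<otimes> inv ?a = (?a \<otimes> lexp G (x \<gamma> *\<^sub>R bv \<gamma>) \<otimes> inv ?a) \<otimes> (?a \<otimes> pr l x \<otimes> inv ?a)"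
    by (simp add: m_assoc inv_cancel)
  also have "?a \<otimes> lexp G (x \<gamma> *\<^sub>R bv \<gamma>) \<otimes> inv ?a = lexp G ((exp (\<gamma> H) * x \<gamma>) *\<^sub>R bv \<gamma>)"
    using Cons.prems Ad_A_rs[OF assms(2), of "bv \<gamma>" \<gamma>] bv by (simp add: lexp_conj Ad_scale mult.commute)
  finally show ?case using Cons by simp
qed simp

lemma pr_continuous:
  assumes "\<And>\<gamma>. \<gamma> \<in> set l \<Longrightarrow> continuous_on UNIV (\<lambda>s :: real. x s \<gamma>)"
  shows "continuous_map euclidean T (\<lambda>s. pr l (x s))"
  using assms by (induction l) (auto intro!: continuous_map_mult lexp_scale_continuous simp: topspace_T)

lemma punctured_limit_closed:
  assumes "continuous_on UNIV (f :: real \<Rightarrow> 'e)" "closed S" "\<And>s. s \<noteq> 0 \<Longrightarrow> f s \<in> S"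
  shows "f 0 \<in> S"
proof (rule Lim_in_closed_set[OF assms(2), of f "at 0"])
  show "\<forall>\<^sub>F s in at 0. f s \<in> S" using assms(3) by (simp add: eventually_at_filter)
  show "(f \<longlongrightarrow> f 0) (at 0)" using assms(1) by (simp add: continuous_on_def)
qed simp

text \<open>From \<open>n \<otimes> u = v \<otimes> b\<close>, contract \<open>n\<close> to
  \<open>\<one>\<close> by conjugation with \<open>exp (ln s H0)\<close>; meanwhile
  \<open>inv v \<otimes> ns s \<otimes> u\<close> stays in \<open>AN\<close>. In the limit
  \<open>inv v \<otimes> u\<close> fixes \<open>\<aa>\<close> modulo \<open>\<nn>\<close>, hence
  lies in \<open>C\<close>. Stripping the \<open>N\<close>-part exhibits it as a limit of elements
  of \<open>A\<close>, which forces it to be \<open>\<one>\<close>.\<close>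

lemma dc_disjoint:
  assumes u: "u \<in> UU" and v: "v \<in> UU" and x: "x \<in> dc u" "x \<in> dc v"
  shows "u = v"
proof -
  note uc = U_carrier[OF u] and vc = U_carrier[OF v]
  obtain n1 b1 n2 b2 where 1: "n1 \<in> N" "b1 \<in> AN" "x = n1 \<otimes> u \<otimes> b1" "n2 \<in> N" "b2 \<in> AN" "x = n2 \<otimes> v \<otimes> b2"
    using x unfolding dc_def by blast
  define n where "n = inv n2 \<otimes> n1"
  define b where "b = b2 \<otimes> inv b1"
  have n: "n \<in> N" and b: "b \<in> AN" using 1 N_mult N_inv AN_mult AN_inv by (auto simp: n_def b_def)
  have cc: "n1 \<in> carrier G" "n2 \<in> carrier G" "b1 \<in> carrier G" "b2 \<in> carrier G" using 1 N_carrier AN_carrier by auto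
  have nu: "n \<otimes> u = v \<otimes> b"
  proof -
    have "inv n2 \<otimes> (n1 \<otimes> u \<otimes> b1) \<otimes> inv b1 = inv n2 \<otimes> (n2 \<otimes> v \<otimes> b2) \<otimes> inv b1" using 1 by simp
    then show ?thesis using cc uc vc by (simp add: n_def b_def m_assoc inv_cancel)
  qed
  obtain l where l: "ideal_list l" "set l = \<Delta>p" using ideal_list_exists .
  obtain y where y: "n = pr l y" using NN_coordinates[OF l] n NN_eq by metis
  \<comment> \<open>The exponents \<open>\<gamma> H0\<close> are positive on positive roots, so the
    contracted coordinates extend continuously by \<open>0\<close> to \<open>s = 0\<close>; the
    absolute value permits two-sided limits.\<close>
  define ns where "ns s = pr l (\<lambda>\<gamma>. \<bar>s\<bar> powr (\<gamma> H0) * y \<gamma>)" for s :: real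
  have nsc: "continuous_map euclidean T ns"
    unfolding ns_def
    by (rule pr_continuous) (use l pos_H0 in \<open>auto intro!: continuous_intros continuous_on_powr'\<close>)
  have "pr l' (\<lambda>\<gamma>. \<bar>0::real\<bar> powr (\<gamma> H0) * y \<gamma>) = \<one>" for l' by (induction l') auto
  then have ns0: "ns 0 = \<one>" by (simp add: ns_def)
  have nsA: "ns s = lexp G (ln \<bar>s\<bar> *\<^sub>R H0) \<otimes> n \<otimes> inv (lexp G (ln \<bar>s\<bar> *\<^sub>R H0))" if "s \<noteq> 0" for s
  proof -
    have H: "ln \<bar>s\<bar> *\<^sub>R H0 \<in> \<aa>" using H0_in(2) a_props(1) by (simp add: subspace_scale)
    have "exp (\<gamma> (ln \<bar>s\<bar> *\<^sub>R H0)) = \<bar>s\<bar> powr (\<gamma> H0)" if "\<gamma> \<in> \<Delta>" for \<gamma>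
      using adual_linear(2)[OF roots_adual[OF that] H0_in(2)] \<open>s \<noteq> 0\<close> by (simp add: powr_def mult.commute)
    then have "pr l' (\<lambda>\<gamma>. exp (\<gamma> (ln \<bar>s\<bar> *\<^sub>R H0)) * y \<gamma>) = pr l' (\<lambda>\<gamma>. \<bar>s\<bar> powr (\<gamma> H0) * y \<gamma>)" if "set l' \<subseteq> \<Delta>" for l'
      using that by (induction l') auto
    moreover have "set l \<subseteq> \<Delta>" using l pos_root by blast
    ultimately show ?thesis using pr_conj_A[OF _ H, of l y] y by (simp add: ns_def)
  qed
  define bs where "bs s = inv v \<otimes> ns s \<otimes> u" for s
  have bsc: "continuous_map euclidean T bs"
    unfolding bs_def by (intro continuous_map_mult nsc) (auto simp: topspace_T uc vc)
  have bsAN: "bs s \<in> AN" if "s \<noteq> 0" for s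
  proof -
    let ?H = "ln \<bar>s\<bar> *\<^sub>R H0"
    let ?a = "lexp G ?H"
    have H: "?H \<in> \<aa>" "- ?H \<in> \<aa>" using H0_in(2) a_props(1) by (auto simp: subspace_scale subspace_neg)
    have nc: "n \<in> carrier G" "b \<in> carrier G" using n b N_carrier AN_carrier by auto
    have "bs s = inv v \<otimes> ?a \<otimes> (n \<otimes> u) \<otimes> (inv u \<otimes> inv ?a \<otimes> u)"
      using nsA[OF that] nc uc vc by (simp add: bs_def m_assoc inv_cancel)
    also have "\<dots> = (inv v \<otimes> ?a \<otimes> v) \<otimes> b \<otimes> (inv u \<otimes> lexp G (- ?H) \<otimes> u)"
      using nc uc vc by (simp add: nu m_assoc lexp_minus)
    also have "\<dots> \<in> AN" by (intro AN_mult U_conj_A u v H b)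
    finally show ?thesis .
  qed
  let ?w = "inv v \<otimes> u"
  have bs0: "bs 0 = ?w" using uc vc by (simp add: bs_def ns0)
  have wU: "?w \<in> UU" using u v subgroup_U subgroup.m_closed subgroup.m_inv_closed by metis
  have wC: "?w \<in> CC"
  proof (rule CI[OF wU])
    fix H assume H: "H \<in> \<aa>"
    have "Ad G (bs 0) H - H \<in> \<nn>"
      by (rule punctured_limit_closed[of "\<lambda>s. Ad G (bs s) H - H"])
        (use Ad_AN_a[OF bsAN H] subspace_n closed_subspace in
          \<open>auto intro!: continuous_intros continuous_Ad_curve bsc\<close>)
    then have D: "Ad G ?w H - H \<in> \<nn>" by (simp add: bs0)
    have "Ad G ?w H - H \<in> \<aa>" using Ad_U_a[OF wU H] H a_props(1) by (simp add: subspace_diff)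
    then have "ip (Ad G ?w H - H) (Ad G ?w H - H) = 0" using n_a_orthogonal[OF D] by blast
    then show "Ad G ?w H = H" by simp
  qed
  \<comment> \<open>\<open>peel\<close> removes the \<open>N\<close>-part of \<open>bs s\<close>
    continuously, leaving \<open>as s\<close> in \<open>A\<close> for \<open>s\<close> nonzero and
    \<open>?w\<close> at \<open>s = 0\<close>.\<close>
  define W where "W s = Ad G (bs s) H0 - H0" for s
  have Wc: "continuous_on UNIV W" unfolding W_def by (intro continuous_intros continuous_Ad_curve bsc)
  have W0: "W 0 = 0" using C_Ad[OF wC H0_in(2)] by (simp add: W_def bs0)
  have Wn: "W s \<in> wsp (set l)" for s
    using Ad_AN_a[OF bsAN H0_in(2), of s] W0 l n_eq by (cases "s = 0") (auto simp: W_def)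
  obtain z where z: "continuous_map euclidean T (\<lambda>s. pr l (z s))" "\<And>s. W s = 0 \<Longrightarrow> pr l (z s) = \<one>"
    "\<And>s. Ad G (pr l (z s)) H0 = H0 + W s"
    using peel[OF l(1) Wc Wn] by blast
  define as where "as s = inv (pr l (z s)) \<otimes> bs s" for s
  have asc: "continuous_map euclidean T as"
    unfolding as_def by (intro continuous_map_mult continuous_map_inv z bsc)
  have as0: "as 0 = ?w" using z(2)[OF W0] uc vc by (simp add: as_def bs0)
  have asA: "as s \<in> lexp G ` \<aa>" if s: "s \<noteq> 0" for s
  proof -
    obtain H m where m: "H \<in> \<aa>" "m \<in> N" "bs s = m \<otimes> lexp G H" using AN_iff' bsAN[OF s] by blast
    have mc: "m \<in> carrier G" using N_carrier m(2) .
    have "Ad G m H0 = H0 + W s" using m mc by (simp add: W_def Ad_mult Ad_A_a H0_in(2))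
    then have e: "Ad G m H0 = Ad G (pr l (z s)) H0" using z(3) by simp
    have pN: "pr l (z s) \<in> N" using pr_NN[of l] l(2) NN_eq by simp
    have "inv (pr l (z s)) \<otimes> m = \<one>"
      by (rule NN_stabilizer) (use N_mult[OF N_inv[OF pN] m(2)] NN_eq mc in \<open>auto simp: Ad_mult e\<close>)
    moreover have "as s = (inv (pr l (z s)) \<otimes> m) \<otimes> lexp G H" using m(3) mc by (simp add: as_def m_assoc)
    ultimately have "as s = lexp G H" by simp
    then show ?thesis using m(1) by blast
  qed
  \<comment> \<open>On a root line \<open>?w\<close> acts by an isometry, that is by
    \<open>1\<close> or \<open>-1\<close>; as a limit of positive scalars the factor is
    nonnegative.\<close>
  have wX: "Ad G ?w X = X" if X: "\<gamma> \<in> \<Delta>" "X \<in> rs \<gamma>" for \<gamma> X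
  proof (cases "X = 0")
    case True
    then show ?thesis using C_carrier[OF wC] by simp
  next
    case False
    have pX: "ip X X > 0" using False by (rule ip_pos)
    obtain k where k: "Ad G ?w X = k *\<^sub>R X"
      using rs_one_dim[OF X(1,2) False C_rs[OF wC X(2)]] by blast
    have "ip X X = k * k * ip X X"
      using ip_Ad[OF C_K[OF wC], of X X] by (simp add: k ip.scaleR_left ip.scaleR_right)
    then have k2: "k * k = 1" using pX False by simp
    have "ip X (Ad G (as 0) X) \<ge> 0"
    proof (rule tendsto_lowerbound[of "\<lambda>s. ip X (Ad G (as s) X)" _ "at (0::real)"])
      have "continuous_on UNIV (\<lambda>s. ip X (Ad G (as s) X))"
        by (intro ip.continuous_on continuous_Ad_curve asc continuous_intros)
      then show "((\<lambda>s. ip X (Ad G (as s) X)) \<longlongrightarrow> ip X (Ad G (as 0) X)) (at 0)"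
        by (simp add: continuous_on_def)
      have "ip X (Ad G (as s) X) \<ge> 0" if s: "s \<noteq> 0" for s
      proof -
        obtain H where H: "H \<in> \<aa>" "as s = lexp G H" using asA[OF s] by blast
        then show ?thesis using Ad_A_rs[OF H(1) X(2)] pX by (simp add: ip.scaleR_right)
      qed
      then show "\<forall>\<^sub>F s in at 0. 0 \<le> ip X (Ad G (as s) X)" by (simp add: eventually_at_filter)
    qed simp
    then have "k * ip X X \<ge> 0" by (simp add: as0 k ip.scaleR_right)
    then have "k \<ge> 0" using pX by (simp add: zero_le_mult_iff)
    then have "k = 1" using k2 square_eq_1_iff[of k] by auto
    then show ?thesis using k by simp
  qed
  have "Ad G (as 0) X = X" for X
  proof -
    have wc: "?w \<in> carrier G" using C_carrier[OF wC] .
    have lin: "linear (\<lambda>Y. Ad G ?w Y - Y)" using linear_Ad[OF wc] by (intro linear_compose_sub linear_ident[unfolded id_def])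
    have "Ad G ?w X - X = 0"
      using linear_eq_0_on_span[OF lin, of "\<aa> \<union> (\<Union>\<alpha>\<in>\<Delta>. rs \<alpha>)" X] root_decomposition wX C_Ad[OF wC] by auto
    then show ?thesis by (simp add: as0)
  qed
  from A_path_limit[OF asc asA this] have "as 0 = \<one>" .
  then have "inv v \<otimes> u = \<one>" by (simp add: as0)
  then show ?thesis using uc vc by (metis inv_cancel(2) r_one)
qed

section \<open>The rank one computation\<close>

lemma Ad_E_thetaE:
  assumes "\<alpha> \<in> \<Sigma>"
  shows "Ad G (lexp G (t *\<^sub>R Evec \<alpha>)) (\<theta> (Evec \<alpha>)) = \<theta> (Evec \<alpha>)
    - (t * (2 * pi\<^sup>2 / \<alpha> (Hvec G \<alpha>))) *\<^sub>R Hvec G \<alpha> + (t\<^sup>2 * pi\<^sup>2) *\<^sub>R Evec \<alpha>" (is "_ = ?f t")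
    "Ad G (lexp G (t *\<^sub>R Evec \<alpha>)) (Hvec G \<alpha>) = Hvec G \<alpha> - (t * \<alpha> (Hvec G \<alpha>)) *\<^sub>R Evec \<alpha>" (is "_ = ?h t")
proof -
  let ?a = "\<alpha> (Hvec G \<alpha>)"
  have a: "?a > 0" by (rule Hvec_pos[OF simple_root[OF assms]])
  have EH: "br (Evec \<alpha>) (Hvec G \<alpha>) = - ?a *\<^sub>R Evec \<alpha>"
    using Evec_rs[OF assms] Hvec_in[OF simple_root[OF assms]] br_anti[of "Evec \<alpha>" "Hvec G \<alpha>"] by (simp add: rs_iff)
  have "Ad G (lexp G (t *\<^sub>R Evec \<alpha>)) (?f 0) = ?f t"
  proof (rule Ad_lexp_eqI)
    fix t
    have "(?f has_vector_derivative 0 - (2 * pi\<^sup>2 / ?a) *\<^sub>R Hvec G \<alpha> + (2 * t * pi\<^sup>2) *\<^sub>R Evec \<alpha>) (at t)"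
      by (intro has_vector_derivative_diff has_vector_derivative_add has_vector_derivative_const
          has_vector_derivative_scaleR_const) (use a in \<open>auto intro!: derivative_eq_intros\<close>)
    moreover have "br (Evec \<alpha>) (?f t) = 0 - (2 * pi\<^sup>2 / ?a) *\<^sub>R Hvec G \<alpha> + (2 * t * pi\<^sup>2) *\<^sub>R Evec \<alpha>"
      using a by (simp add: br.add_right br.diff_right br.scaleR_right EH br_E_thetaE[OF assms])
    ultimately show "(?f has_vector_derivative br (Evec \<alpha>) (?f t)) (at t)" by simp
  qed
  then show "Ad G (lexp G (t *\<^sub>R Evec \<alpha>)) (\<theta> (Evec \<alpha>)) = ?f t" by simp
  have "Ad G (lexp G (t *\<^sub>R Evec \<alpha>)) (?h 0) = ?h t"
  proof (rule Ad_lexp_eqI)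
    fix t
    have "(?h has_vector_derivative 0 - ?a *\<^sub>R Evec \<alpha>) (at t)"
      by (intro has_vector_derivative_diff has_vector_derivative_const
          has_vector_derivative_scaleR_const) (auto intro!: derivative_eq_intros)
    moreover have "br (Evec \<alpha>) (?h t) = 0 - ?a *\<^sub>R Evec \<alpha>"
      by (simp add: br.diff_right br.scaleR_right EH)
    ultimately show "(?h has_vector_derivative br (Evec \<alpha>) (?h t)) (at t)" by simp
  qed
  then show "Ad G (lexp G (t *\<^sub>R Evec \<alpha>)) (Hvec G \<alpha>) = ?h t" by simp
qed

lemma Ad_inv_lexp: "Ad G (inv (lexp G (t *\<^sub>R X))) = Ad G (lexp G ((- t) *\<^sub>R X))"
  using lexp_minus[of "t *\<^sub>R X"] by simp

text \<open>In \<open>SL\<^sub>2\<close> this is the factorisation of the rotation by the angle \<open>\<pi> t\<close> as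
  upper triangular times \<open>s\<^sub>\<alpha>\<close> times upper triangular.\<close>

lemma rank_one_factorization:
  assumes \<alpha>: "\<alpha> \<in> \<Sigma>" and t: "0 < t" "t < 1"
  defines "x \<equiv> \<lambda>t. - (cos (pi * t) / sin (pi * t)) / pi"
    and "h \<equiv> \<lambda>t. 2 / \<alpha> (Hvec G \<alpha>) * ln (sin (pi * t))"
  shows "rot \<alpha> t = lexp G (x t *\<^sub>R Evec \<alpha>) \<otimes> se \<alpha> \<otimes> lexp G (h t *\<^sub>R Hvec G \<alpha>) \<otimes> lexp G (x t *\<^sub>R Evec \<alpha>)"
proof (rule ldiff_unique[of "{0<..<1}" "rot \<alpha>" "\<lambda>_. Fvec \<alpha>" "\<lambda>t. lexp G (x t *\<^sub>R Evec \<alpha>) \<otimes> se \<alpha> \<otimes>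
    lexp G (h t *\<^sub>R Hvec G \<alpha>) \<otimes> lexp G (x t *\<^sub>R Evec \<alpha>)" "1/2"])
  let ?a = "\<alpha> (Hvec G \<alpha>)" and ?E = "Evec \<alpha>" and ?H = "Hvec G \<alpha>"
  have a: "?a > 0" by (rule Hvec_pos[OF simple_root[OF \<alpha>]])
  show "ldiff (rot \<alpha>) t (Fvec \<alpha>)" for t unfolding rot_def[abs_def] by (rule ldiff_lexp)
  \<comment> \<open>At the base point both \<open>x\<close> and \<open>h\<close> vanish. In
    \<open>SL_2\<close> with \<open>E = pi e_12\<close> and \<open>F = pi (e_12 - e_21)\<close>, the
    lower left entry \<open>- sin (pi t)\<close> of the rotation forces the diagonal factor and
    hence \<open>h\<close>; the entries \<open>cos (pi t)\<close> then force
    \<open>x = - cot (pi t) / pi\<close>.\<close>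
  show "rot \<alpha> (1/2) = lexp G (x (1/2) *\<^sub>R ?E) \<otimes> se \<alpha> \<otimes> lexp G (h (1/2) *\<^sub>R ?H) \<otimes> lexp G (x (1/2) *\<^sub>R ?E)"
    by (simp add: x_def h_def se_rot)
  fix t :: real assume "t \<in> {0<..<1}"
  then have t: "0 < t" "t < 1" by auto
  let ?s = "sin (pi * t)" and ?c = "cos (pi * t)"
  have s: "?s > 0" using t by (intro sin_gt_zero) auto
  have cs: "?c\<^sup>2 = 1 - ?s\<^sup>2" by (rule cos_squared_eq)
  have xd: "(x has_real_derivative 1 / ?s\<^sup>2) (at t)"
  proof -
    have "((\<lambda>t. cos (pi * t) / sin (pi * t)) has_real_derivative
        ((- (?s * pi)) * ?s - ?c * (?c * pi)) / (?s * ?s)) (at t)"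
      by (rule DERIV_divide) (use s in \<open>auto intro!: derivative_eq_intros\<close>)
    then have "(x has_real_derivative - (((- (?s * pi)) * ?s - ?c * (?c * pi)) / (?s * ?s)) / pi) (at t)"
      unfolding x_def by (intro DERIV_cdivide DERIV_minus)
    also have "(- (?s * pi)) * ?s - ?c * (?c * pi) = - pi * (?s\<^sup>2 + ?c\<^sup>2)"
      unfolding power2_eq_square by algebra
    also have "?s\<^sup>2 + ?c\<^sup>2 = 1" by (rule sin_cos_squared_add)
    finally show ?thesis by (simp add: power2_eq_square)
  qed
  have hd: "(h has_real_derivative 2 * pi / ?a * (?c / ?s)) (at t)"
    unfolding h_def using s a by (auto intro!: derivative_eq_intros simp: field_simps)
  have d1: "ldiff (\<lambda>t. lexp G (x t *\<^sub>R ?E)) t ((1 / ?s\<^sup>2) *\<^sub>R ?E)"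
    by (rule ldiff_compose[OF ldiff_lexp xd])
  have d3: "ldiff (\<lambda>t. lexp G (h t *\<^sub>R ?H)) t ((2 * pi / ?a * (?c / ?s)) *\<^sub>R ?H)"
    by (rule ldiff_compose[OF ldiff_lexp hd])
  have sE: "Ad G (inv (se \<alpha>)) ?E = \<theta> ?E"
    using Ad_inv(2)[OF se_carrier, of \<alpha> "\<theta> ?E"] Ad_se_E(2)[OF \<alpha>] by simp
  have hE: "Ad G (inv (lexp G (h t *\<^sub>R ?H))) (\<theta> ?E) = ?s\<^sup>2 *\<^sub>R \<theta> ?E"
  proof -
    have "Ad G (lexp G ((- h t) *\<^sub>R ?H)) (\<theta> ?E) = exp (- \<alpha> ((- h t) *\<^sub>R ?H)) *\<^sub>R \<theta> ?E"
      by (rule Ad_A_rs[OF _ rs_\<theta>[OF Evec_rs[OF \<alpha>]]])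
        (use Hvec_in[OF simple_root[OF \<alpha>]] a_props(1) in \<open>simp add: subspace_scale subspace_neg\<close>)
    also have "- \<alpha> ((- h t) *\<^sub>R ?H) = ln ?s + ln ?s"
      using adual_linear(2)[OF roots_adual[OF simple_root[OF \<alpha>]] Hvec_in[OF simple_root[OF \<alpha>]], of "- h t"] a
      by (simp add: h_def)
    also have "exp (ln ?s + ln ?s) = ?s\<^sup>2" using s by (simp only: exp_add) (simp add: power2_eq_square)
    finally show ?thesis by (simp only: Ad_inv_lexp)
  qed
  note d = ldiff_mult[OF ldiff_mult[OF ldiff_mult[OF d1 ldiff_const[OF se_carrier[of \<alpha>]]] d3] d1]
  have "Ad G (inv (lexp G (x t *\<^sub>R ?E))) (Ad G (inv (lexp G (h t *\<^sub>R ?H)))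
      (Ad G (inv (se \<alpha>)) ((1 / ?s\<^sup>2) *\<^sub>R ?E) + 0) + (2 * pi / ?a * (?c / ?s)) *\<^sub>R ?H) + (1 / ?s\<^sup>2) *\<^sub>R ?E
    = Ad G (lexp G ((- x t) *\<^sub>R ?E)) (\<theta> ?E + (2 * pi / ?a * (?c / ?s)) *\<^sub>R ?H) + (1 / ?s\<^sup>2) *\<^sub>R ?E"
    using s by (simp only: Ad_inv_lexp[symmetric]) (simp add: Ad_scale sE hE)
  also have "\<dots> = \<theta> ?E + (x t * (2 * pi\<^sup>2 / ?a) + 2 * pi / ?a * (?c / ?s)) *\<^sub>R ?H
      + ((x t)\<^sup>2 * pi\<^sup>2 + 2 * pi / ?a * (?c / ?s) * x t * ?a + 1 / ?s\<^sup>2) *\<^sub>R ?E"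
    by (simp only: Ad_add[OF lexp_closed] Ad_scale[OF lexp_closed] Ad_E_thetaE[OF \<alpha>]) (simp add: algebra_simps)
  also have "x t * (2 * pi\<^sup>2 / ?a) + 2 * pi / ?a * (?c / ?s) = 0"
    using s a by (simp add: x_def field_simps power2_eq_square)
  also have "(x t)\<^sup>2 * pi\<^sup>2 + 2 * pi / ?a * (?c / ?s) * x t * ?a + 1 / ?s\<^sup>2 = (1 - ?c\<^sup>2) / ?s\<^sup>2"
    using s a by (simp add: x_def power2_eq_square divide_simps)
  also have "(1 - ?c\<^sup>2) / ?s\<^sup>2 = 1" using s cs by simp
  finally show "ldiff (\<lambda>t. lexp G (x t *\<^sub>R ?E) \<otimes> se \<alpha> \<otimes> lexp G (h t *\<^sub>R ?H) \<otimes> lexp G (x t *\<^sub>R ?E)) t (Fvec \<alpha>)"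
    using d by (simp add: Fvec_def add.commute)
qed (use t in auto)

end

section \<open>Bruhat decomposition\<close>

context split begin

text \<open>A simple root is not a sum of two positive roots, so the other positive roots span an
  ideal of \<open>\<nn>\<close>.\<close>

lemma upclosed_minus_simple: assumes "\<alpha> \<in> \<Sigma>" shows "upclosed (\<Delta>p - {\<alpha>})"
  unfolding upclosed_def
proof (intro conjI ballI impI)
  fix \<gamma> \<delta> assume g: "\<gamma> \<in> \<Delta>p - {\<alpha>}" "\<delta> \<in> \<Delta>p" "(\<lambda>H. \<gamma> H + \<delta> H) \<in> \<Omega>"
  then have "(\<lambda>H. \<gamma> H + \<delta> H) \<in> \<Delta>p" using pos_add by blast
  moreover have "(\<lambda>H. \<gamma> H + \<delta> H) \<noteq> \<alpha>" using simple_indecomposable[OF assms, of \<gamma> \<delta>] g by auto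
  ultimately show "(\<lambda>H. \<gamma> H + \<delta> H) \<in> \<Delta>p - {\<alpha>}" by simp
qed (use pos_\<Omega> in blast)

lemma Evec_n: "\<alpha> \<in> \<Sigma> \<Longrightarrow> c *\<^sub>R Evec \<alpha> \<in> \<nn>"
  using rs_wsp[OF simple_pos Evec_rs] n_eq subspace_n by (simp add: subspace_scale)

lemma n_split_simple:
  assumes "\<alpha> \<in> \<Sigma>" "X \<in> \<nn>"
  obtains x Z where "Z \<in> wsp (\<Delta>p - {\<alpha>})" "X = x *\<^sub>R Evec \<alpha> + Z"
proof -
  note r = simple_root[OF assms(1)]
  obtain q where q: "bv \<alpha> = q *\<^sub>R Evec \<alpha>"
    using rs_one_dim[OF r Evec_rs[OF assms(1)] Evec_nz[OF assms(1)]] bv[OF r] by blast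
  have "insert \<alpha> \<Delta>p = \<Delta>p" using simple_pos[OF assms(1)] by blast
  then have "X - cf \<alpha> X *\<^sub>R bv \<alpha> \<in> wsp (\<Delta>p - {\<alpha>})"
    using wsp_remove[of \<Delta>p \<alpha> X] r assms(2) pos_\<Omega> n_eq by auto
  moreover have "X = (cf \<alpha> X * q) *\<^sub>R Evec \<alpha> + (X - cf \<alpha> X *\<^sub>R bv \<alpha>)" by (simp add: q)
  ultimately show ?thesis using that by blast
qed

lemma br_E_H: assumes "\<alpha> \<in> \<Sigma>" "H \<in> \<aa>" shows "br (Evec \<alpha>) H = - \<alpha> H *\<^sub>R Evec \<alpha>"
  using Evec_rs[OF assms(1)] assms(2) br_anti[of "Evec \<alpha>" H] by (simp add: rs_iff)

text \<open>Reads the coefficient of \<open>\<alpha>\<close> in a logarithm off the action on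
  \<open>H0\<close>, modulo the ideal of the other positive roots.\<close>

lemma Ad_n_H0_mod:
  assumes \<alpha>: "\<alpha> \<in> \<Sigma>" and Z: "Z \<in> wsp (\<Delta>p - {\<alpha>})"
  shows "Ad G (lexp G (x *\<^sub>R Evec \<alpha> + Z)) H0 - H0 + (x * \<alpha> H0) *\<^sub>R Evec \<alpha> \<in> wsp (\<Delta>p - {\<alpha>})"
proof -
  let ?S = "\<Delta>p - {\<alpha>}" and ?X = "x *\<^sub>R Evec \<alpha> + Z"
  note u = upclosed_minus_simple[OF \<alpha>]
  have X: "?X \<in> \<nn>" using Evec_n[OF \<alpha>] wsp_n[OF _ Z] subspace_n by (auto intro: subspace_add)
  define f where "f t = Ad G (lexp G (t *\<^sub>R ?X)) H0 + (t * (x * \<alpha> H0)) *\<^sub>R Evec \<alpha>" for t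
  have fd: "(f has_vector_derivative (Ad G (lexp G (t *\<^sub>R ?X)) (br ?X H0) + (1 * (x * \<alpha> H0)) *\<^sub>R Evec \<alpha>)) (at t)" for t
    unfolding f_def
    by (intro has_vector_derivative_add ldiff_Ad ldiff_lexp has_vector_derivative_scaleR_const)
      (auto intro!: derivative_eq_intros)
  have "f 1 - f 0 \<in> wsp ?S"
  proof (rule curve_in_subspace[OF subspace_wsp fd])
    fix t
    let ?g = "lexp G (t *\<^sub>R ?X)"
    have g: "?g \<in> NN" using X subspace_n by (intro lexp_NN) (simp add: subspace_scale)
    have 1: "Ad G ?g (Evec \<alpha>) - Evec \<alpha> \<in> wsp ?S"
    proof (rule Ad_NN_minus[OF g u])
      fix Y assume Y: "Y \<in> \<nn>"
      show "br Y (Evec \<alpha>) \<in> wsp ?S"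
      proof (rule br_n_wsp[OF Y rs_wsp[of \<alpha> "{\<alpha>}"]])
        fix \<gamma> \<delta> assume g: "\<gamma> \<in> {\<alpha>}" "\<delta> \<in> \<Delta>p" "(\<lambda>H. \<gamma> H + \<delta> H) \<in> \<Omega>"
        then have "(\<lambda>H. \<gamma> H + \<delta> H) \<in> \<Delta>p" using pos_add simple_pos[OF \<alpha>] by blast
        moreover have "(\<lambda>H. \<gamma> H + \<delta> H) \<noteq> \<alpha>"
          using fun_cong[of "\<lambda>H. \<gamma> H + \<delta> H" \<alpha> H0] g pos_H0[OF g(2)] by auto
        ultimately show "(\<lambda>H. \<gamma> H + \<delta> H) \<in> ?S" by simp
      qed (use Evec_rs[OF \<alpha>] simple_root[OF \<alpha>] in \<open>auto simp: \<Omega>_def\<close>)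
    qed
    have 2: "Ad G ?g (br Z H0) \<in> wsp ?S" by (rule Ad_NN_invariant[OF g u br_wsp_a[OF Z H0_in(2)]])
    have "Ad G ?g (br ?X H0) + (1 * (x * \<alpha> H0)) *\<^sub>R Evec \<alpha> =
        (- (x * \<alpha> H0)) *\<^sub>R (Ad G ?g (Evec \<alpha>) - Evec \<alpha>) + Ad G ?g (br Z H0)"
      by (simp add: br.add_left br.scaleR_left br_E_H[OF \<alpha> H0_in(2)] Ad_add Ad_diff Ad_minus Ad_scale algebra_simps)
    also have "\<dots> \<in> wsp ?S" using 1 2 subspace_wsp by (intro subspace_add subspace_scale) auto
    finally show "Ad G ?g (br ?X H0) + (1 * (x * \<alpha> H0)) *\<^sub>R Evec \<alpha> \<in> wsp ?S" .
  qed
  then show ?thesis by (simp add: f_def Ad_one algebra_simps)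
qed

text \<open>Modulo that ideal the coefficient of \<open>\<alpha>\<close> is additive under
  multiplication, so removing the factor \<open>exp (x E)\<close> leaves an element whose logarithm
  has no \<open>\<alpha>\<close>-component.\<close>

lemma N_split_simple:
  assumes \<alpha>: "\<alpha> \<in> \<Sigma>" and "n \<in> N"
  obtains y Z where "Z \<in> wsp (\<Delta>p - {\<alpha>})" "n = lexp G (y *\<^sub>R Evec \<alpha>) \<otimes> lexp G Z"
proof -
  let ?S = "\<Delta>p - {\<alpha>}" and ?E = "Evec \<alpha>"
  note u = upclosed_minus_simple[OF \<alpha>]
  obtain X where X: "X \<in> \<nn>" "n = lexp G X" using assms(2) by (auto simp: Ngrp_def)
  obtain x Z where Z: "Z \<in> wsp ?S" "X = x *\<^sub>R ?E + Z" using n_split_simple[OF \<alpha> X(1)] .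
  let ?g = "lexp G ((- x) *\<^sub>R ?E)"
  have gN: "?g \<in> N" by (rule NI[OF Evec_n[OF \<alpha>]])
  obtain X2 where X2: "X2 \<in> \<nn>" "?g \<otimes> n = lexp G X2" using N_mult[OF gN assms(2)] by (auto simp: Ngrp_def)
  obtain x2 Z2 where Z2: "Z2 \<in> wsp ?S" "X2 = x2 *\<^sub>R ?E + Z2" using n_split_simple[OF \<alpha> X2(1)] .
  let ?W = "Ad G n H0 - H0 + (x * \<alpha> H0) *\<^sub>R ?E"
  have W: "?W \<in> wsp ?S" using Ad_n_H0_mod[OF \<alpha> Z(1), of x] X(2) Z(2) by simp
  have W2: "Ad G (?g \<otimes> n) H0 - H0 + (x2 * \<alpha> H0) *\<^sub>R ?E \<in> wsp ?S" using Ad_n_H0_mod[OF \<alpha> Z2(1), of x2] X2(2) Z2(2) by simp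
  have gE: "Ad G ?g ?E = ?E" by (rule Ad_lexp_self)
  have g1: "Ad G ?g H0 - H0 + (- x * \<alpha> H0) *\<^sub>R ?E \<in> wsp ?S" using Ad_n_H0_mod[OF \<alpha> wsp_zero, of "- x"] by simp
  have g2: "Ad G ?g ?W \<in> wsp ?S" by (rule Ad_NN_invariant[OF _ u W]) (use gN NN_eq in simp)
  have "Ad G g ?W + (Ad G g H0 - H0 + (- x * \<alpha> H0) *\<^sub>R ?E) = Ad G (g \<otimes> n) H0 - H0"
    if "g \<in> carrier G" "Ad G g ?E = ?E" for g
    using N_carrier[OF assms(2)] that by (simp add: Ad_mult Ad_add Ad_diff Ad_scale)
  from this[OF lexp_closed gE] subspace_add[OF subspace_wsp g2 g1]
  have "Ad G (?g \<otimes> n) H0 - H0 \<in> wsp ?S" by argo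
  from subspace_diff[OF subspace_wsp W2 this]
  have "(x2 * \<alpha> H0) *\<^sub>R ?E \<in> wsp ?S" by simp
  then have "ip ((x2 * \<alpha> H0) *\<^sub>R ?E) ?E = 0"
    by (rule wsp_orthogonal[rotated 3, OF _ Evec_rs[OF \<alpha>]]) (use pos_\<Omega> simple_pos[OF \<alpha>] in auto)
  then have "x2 = 0" using Evec_nz[OF \<alpha>] pos_H0[OF simple_pos[OF \<alpha>]] by (simp add: ip.scaleR_left)
  then have e: "?g \<otimes> n = lexp G Z2" using X2(2) Z2(2) by simp
  have "?g = inv (lexp G (x *\<^sub>R ?E))" using lexp_minus[of "x *\<^sub>R ?E"] by simp
  then have "n = lexp G (x *\<^sub>R ?E) \<otimes> (?g \<otimes> n)" using N_carrier[OF assms(2)] by (simp add: inv_cancel)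
  then show ?thesis using that Z2(1) e by metis
qed

lemma act_inv_se: assumes "\<alpha> \<in> \<Sigma>" "\<beta> \<in> adual G" shows "act (inv (se \<alpha>)) \<beta> = act (se \<alpha>) \<beta>"
  using act_inv(1)[OF se_U[OF assms(1)], of "act (se \<alpha>) \<beta>"] act_se_se[OF assms] by simp

lemma U_inv: "u \<in> UU \<Longrightarrow> inv u \<in> UU" by (rule subgroup.m_inv_closed[OF subgroup_U])
lemma U_mult: "u \<in> UU \<Longrightarrow> v \<in> UU \<Longrightarrow> u \<otimes> v \<in> UU" by (rule subgroup.m_closed[OF subgroup_U])

lemma se_conj_wsp:
  assumes \<alpha>: "\<alpha> \<in> \<Sigma>" and Z: "Z \<in> wsp (\<Delta>p - {\<alpha>})"
  shows "se \<alpha> \<otimes> lexp G Z \<otimes> inv (se \<alpha>) \<in> N" "inv (se \<alpha>) \<otimes> lexp G Z \<otimes> se \<alpha> \<in> N"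
proof -
  note U = se_U[OF \<alpha>]
  have 1: "Ad G (se \<alpha>) Z \<in> wsp \<Delta>p"
    by (rule Ad_n_from_rs[OF se_carrier _ Z])
      (use rs_act[OF U] simple_reflection_permutes(1)[OF \<alpha>] rs_wsp in blast)
  have 2: "Ad G (inv (se \<alpha>)) Z \<in> wsp \<Delta>p"
  proof (rule Ad_n_from_rs[OF _ _ Z])
    fix \<gamma> X assume g: "\<gamma> \<in> \<Delta>p - {\<alpha>}" "X \<in> rs \<gamma>"
    have "act (inv (se \<alpha>)) \<gamma> \<in> \<Delta>p"
      using act_inv_se[OF \<alpha> roots_adual[OF pos_root]] simple_reflection_permutes(1)[OF \<alpha>] g by auto
    then show "Ad G (inv (se \<alpha>)) X \<in> wsp \<Delta>p" using rs_act[OF U_inv[OF U] g(2)] rs_wsp by blast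
  qed simp
  show "se \<alpha> \<otimes> lexp G Z \<otimes> inv (se \<alpha>) \<in> N" using NI[of "Ad G (se \<alpha>) Z"] 1 n_eq by (simp add: lexp_conj)
  show "inv (se \<alpha>) \<otimes> lexp G Z \<otimes> se \<alpha> \<in> N"
    using NI[of "Ad G (inv (se \<alpha>)) Z"] 2 n_eq lexp_conj[of "inv (se \<alpha>)" Z] by simp
qed

text \<open>The \<open>\<alpha>\<close>-factor of \<open>n\<close> is moved to the right through
  \<open>u\<close> and stays in \<open>N\<close>, because \<open>inv u\<close> sends
  \<open>\<alpha>\<close> to a positive root; the other factor stays in \<open>N\<close> when
  conjugated by \<open>se \<alpha>\<close>.\<close>

lemma se_dc_pos:
  assumes \<alpha>: "\<alpha> \<in> \<Sigma>" and u: "u \<in> UU" and p: "act (inv u) \<alpha> \<in> \<Delta>p" and x: "x \<in> dc u"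
  shows "se \<alpha> \<otimes> x \<in> dc (se \<alpha> \<otimes> u)"
proof -
  note uc = U_carrier[OF u]
  obtain n b where x: "n \<in> N" "b \<in> AN" "x = n \<otimes> u \<otimes> b" using x by (auto simp: dc_def)
  \<comment> \<open>Splitting \<open>inv n\<close> instead of \<open>n\<close> puts the
    \<open>\<alpha>\<close>-factor of \<open>n\<close> on the right.\<close>
  obtain y Z where Z: "Z \<in> wsp (\<Delta>p - {\<alpha>})" "inv n = lexp G (y *\<^sub>R Evec \<alpha>) \<otimes> lexp G Z"
    using N_split_simple[OF \<alpha> N_inv[OF x(1)]] .
  have "n = inv (inv n)" using N_carrier[OF x(1)] by simp
  also have "\<dots> = lexp G (- Z) \<otimes> lexp G (- (y *\<^sub>R Evec \<alpha>))"
    unfolding Z(2) lexp_minus by (simp add: inv_mult_group)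
  finally have n: "n = lexp G (- Z) \<otimes> lexp G (- (y *\<^sub>R Evec \<alpha>))" .
  have 1: "se \<alpha> \<otimes> lexp G (- Z) \<otimes> inv (se \<alpha>) \<in> N"
    by (rule se_conj_wsp[OF \<alpha>]) (rule subspace_neg[OF subspace_wsp Z(1)])
  have "Ad G (inv u) (- (y *\<^sub>R Evec \<alpha>)) \<in> \<nn>"
    using rs_wsp[OF p rs_act[OF U_inv[OF u] Evec_rs[OF \<alpha>]]] subspace_n uc
    by (simp add: Ad_minus Ad_scale subspace_neg subspace_scale n_eq)
  then have 2: "inv u \<otimes> lexp G (- (y *\<^sub>R Evec \<alpha>)) \<otimes> u \<in> N"
    using lexp_conj[of "inv u" "- (y *\<^sub>R Evec \<alpha>)"] uc NI by simp
  have "se \<alpha> \<otimes> x = (se \<alpha> \<otimes> lexp G (- Z) \<otimes> inv (se \<alpha>)) \<otimes> (se \<alpha> \<otimes> u) \<otimes>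
      ((inv u \<otimes> lexp G (- (y *\<^sub>R Evec \<alpha>)) \<otimes> u) \<otimes> b)"
    using x(3) n uc AN_carrier[OF x(2)] by (simp add: m_assoc inv_cancel)
  then show ?thesis using dcI[OF 1 AN_mult[OF N_AN[OF 2] x(2)]] by metis
qed

lemma rot_dc_pos:
  assumes \<alpha>: "\<alpha> \<in> \<Sigma>" and u: "u \<in> UU" and p: "act (inv u) \<alpha> \<in> \<Delta>p" and x: "x \<in> dc u"
    and t: "0 < t" "t < 1"
  shows "rot \<alpha> t \<otimes> x \<in> dc (se \<alpha> \<otimes> u)"
proof -
  note uc = U_carrier[OF u]
  have su: "se \<alpha> \<otimes> u \<in> UU" using se_U[OF \<alpha>] u U_mult by blast
  have xc: "x \<in> carrier G" using dc_carrier[OF uc] x by blast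
  obtain c h where f: "rot \<alpha> t = lexp G (c *\<^sub>R Evec \<alpha>) \<otimes> se \<alpha> \<otimes> lexp G (h *\<^sub>R Hvec G \<alpha>) \<otimes> lexp G (c *\<^sub>R Evec \<alpha>)"
    using rank_one_factorization[OF \<alpha> t] by blast
  have H: "h *\<^sub>R Hvec G \<alpha> \<in> \<aa>" using Hvec_in[OF simple_root[OF \<alpha>]] a_props(1) by (simp add: subspace_scale)
  have n: "lexp G (c *\<^sub>R Evec \<alpha>) \<in> N" by (rule NI[OF Evec_n[OF \<alpha>]])
  have "lexp G (c *\<^sub>R Evec \<alpha>) \<otimes> (se \<alpha> \<otimes> (lexp G (h *\<^sub>R Hvec G \<alpha>) \<otimes> (lexp G (c *\<^sub>R Evec \<alpha>) \<otimes> x))) \<in> dc (se \<alpha> \<otimes> u)"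
    by (intro dc_left_N[OF U_carrier[OF su]] se_dc_pos[OF \<alpha> u p] dc_left_A[OF u] dc_left_N[OF uc] x n H)
  then show ?thesis using xc by (simp add: f m_assoc)
qed

lemma rot_dc_pos_surj:
  assumes \<alpha>: "\<alpha> \<in> \<Sigma>" and u: "u \<in> UU" and z: "z \<in> dc (se \<alpha> \<otimes> u)"
  obtains t x where "0 < t" "t < 1" "x \<in> dc u" "z = rot \<alpha> t \<otimes> x"
proof -
  note uc = U_carrier[OF u]
  obtain n b where x: "n \<in> N" "b \<in> AN" "z = n \<otimes> (se \<alpha> \<otimes> u) \<otimes> b" using z by (auto simp: dc_def)
  obtain y Z where Z: "Z \<in> wsp (\<Delta>p - {\<alpha>})" "n = lexp G (y *\<^sub>R Evec \<alpha>) \<otimes> lexp G Z"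
    using N_split_simple[OF \<alpha> x(1)] .
  \<comment> \<open>The parameter solves \<open>- cot (pi t) / pi = y\<close>, so that the left
    unipotent factor of \<open>rot \<alpha> t\<close> is the \<open>\<alpha>\<close>-factor of
    \<open>n\<close>; the shift by \<open>1/2\<close> turns the cotangent into a tangent.\<close>
  define \<theta>' where "\<theta>' = arctan (pi * y)"
  define t where "t = 1/2 + \<theta>' / pi"
  have th: "- (pi / 2) < \<theta>'" "\<theta>' < pi / 2" using arctan_bounded[of "pi * y"] by (auto simp: \<theta>'_def)
  then have t: "0 < t" "t < 1" by (simp_all add: t_def field_simps)
  have pt: "pi * t = pi / 2 + \<theta>'" by (simp add: t_def field_simps)
  have ct: "cos (pi * t) = - sin \<theta>'" "sin (pi * t) = cos \<theta>'"
    unfolding pt by (simp_all add: cos_add sin_add)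
  have "- (cos (pi * t) / sin (pi * t)) / pi = tan \<theta>' / pi" by (simp add: ct tan_def)
  also have "\<dots> = y" by (simp add: \<theta>'_def tan_arctan)
  finally have cy: "- (cos (pi * t) / sin (pi * t)) / pi = y" .
  obtain h where f: "rot \<alpha> t = lexp G (y *\<^sub>R Evec \<alpha>) \<otimes> se \<alpha> \<otimes> lexp G (h *\<^sub>R Hvec G \<alpha>) \<otimes> lexp G (y *\<^sub>R Evec \<alpha>)"
    using rank_one_factorization[OF \<alpha> t] unfolding cy by blast
  have H: "h *\<^sub>R Hvec G \<alpha> \<in> \<aa>" using Hvec_in[OF simple_root[OF \<alpha>]] a_props(1) by (simp add: subspace_scale)
  let ?q = "lexp G (h *\<^sub>R Hvec G \<alpha>) \<otimes> lexp G (y *\<^sub>R Evec \<alpha>)"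
  have q: "?q \<in> AN" by (rule ANI[OF H NI[OF Evec_n[OF \<alpha>]]])
  let ?x0 = "(inv (se \<alpha>) \<otimes> lexp G Z \<otimes> se \<alpha>) \<otimes> u \<otimes> b"
  have x0: "?x0 \<in> dc u" by (rule dcI[OF se_conj_wsp(2)[OF \<alpha> Z(1)] x(2)])
  have "z = rot \<alpha> t \<otimes> (inv ?q \<otimes> ?x0)"
    using x Z(2) uc AN_carrier[OF x(2)] by (simp add: f m_assoc inv_cancel inv_mult_group)
  then show ?thesis using that[OF t dc_left_AN[OF u x0 AN_inv[OF q]]] by blast
qed

section \<open>Closed arcs\<close>

lemma ce_U: "\<alpha> \<in> \<Sigma> \<Longrightarrow> c_elt G \<alpha> \<in> UU" using ce_C C_U by blast
lemma ce_carrier: "\<alpha> \<in> \<Sigma> \<Longrightarrow> c_elt G \<alpha> \<in> carrier G" using ce_C C_carrier by blast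

lemma act_inv_mult: "u \<in> UU \<Longrightarrow> v \<in> UU \<Longrightarrow> act (inv (u \<otimes> v)) \<beta> = act (inv v) (act (inv u) \<beta>)"
  using act_mult[OF U_inv U_inv, of v u \<beta>] by (simp add: inv_mult_group U_carrier)

lemma act_inv_se_mult: assumes "\<alpha> \<in> \<Sigma>" "u \<in> UU"
  shows "act (inv (se \<alpha> \<otimes> u)) \<alpha> = (\<lambda>H. - act (inv u) \<alpha> H)"
  using act_inv_mult[OF se_U[OF assms(1)] assms(2), of \<alpha>]
    act_inv_se[OF assms(1) roots_adual[OF simple_root[OF assms(1)]]] act_se_self[OF assms(1)]
  by (simp add: act_minus)

text \<open>If \<open>inv u\<close> sends \<open>\<alpha>\<close> to a negative root, the cell of
  \<open>u\<close> is swept out by open arcs starting in the cell of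
  \<open>v = inv (se \<alpha>) \<otimes> u\<close>; arcs starting in the cell of \<open>u\<close>
  continue these.\<close>

lemma neg_case:
  assumes \<alpha>: "\<alpha> \<in> \<Sigma>" and u: "u \<in> UU" and n: "act (inv u) \<alpha> \<notin> \<Delta>p"
  obtains v where "v \<in> UU" "u = se \<alpha> \<otimes> v" "act (inv v) \<alpha> \<in> \<Delta>p" "c_elt G \<alpha> \<otimes> v = se \<alpha> \<otimes> u"
proof -
  let ?v = "inv (se \<alpha>) \<otimes> u"
  note uc = U_carrier[OF u]
  have v: "?v \<in> UU" using U_mult U_inv se_U[OF \<alpha>] u by blast
  have e: "u = se \<alpha> \<otimes> ?v" using uc by (simp add: inv_cancel)
  have r: "act (inv ?v) \<alpha> \<in> \<Delta>" by (rule act_root[OF U_inv[OF v] simple_root[OF \<alpha>]])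
  have "act (inv u) \<alpha> = (\<lambda>H. - act (inv ?v) \<alpha> H)" using act_inv_se_mult[OF \<alpha> v] unfolding e[symmetric] .
  then have "act (inv ?v) \<alpha> \<in> \<Delta>p" using n pos_or_neg[OF r] by auto
  moreover have "c_elt G \<alpha> \<otimes> ?v = se \<alpha> \<otimes> u" using uc by (simp add: ce_eq m_assoc inv_cancel)
  ultimately show ?thesis by (rule that[OF v e])
qed

text \<open>In the negative case \<open>x = rot \<alpha> t' \<otimes> y\<close> with
  \<open>y\<close> in the cell of \<open>v\<close>. Whether \<open>t + t'\<close> is below, at or
  beyond \<open>1\<close> decides between the cells of \<open>u\<close>,
  \<open>se \<alpha> \<otimes> u\<close> and \<open>c_elt G \<alpha> \<otimes> u\<close>.\<close>

lemma bar_subset: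
  assumes \<alpha>: "\<alpha> \<in> \<Sigma>" and u: "u \<in> UU" and x: "x \<in> dc u" and t: "0 \<le> t" "t \<le> 1"
  shows "rot \<alpha> t \<otimes> x \<in> dc u \<union> dc (se \<alpha> \<otimes> u) \<union> dc (c_elt G \<alpha> \<otimes> u)"
proof (cases "act (inv u) \<alpha> \<in> \<Delta>p")
  case True
  have xc: "x \<in> carrier G" using dc_carrier[OF U_carrier[OF u]] x by blast
  consider "t = 0" | "t = 1" | "0 < t" "t < 1" using t by linarith
  then show ?thesis
  proof cases
    case 1
    then show ?thesis using x xc by simp
  next
    case 2
    then show ?thesis using dc_left_C[OF ce_C[OF \<alpha>] u x] by (simp add: ce_rot)
  next
    case 3
    then show ?thesis using rot_dc_pos[OF \<alpha> u True x] by blast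
  qed
next
  case False
  obtain v where v: "v \<in> UU" "u = se \<alpha> \<otimes> v" "act (inv v) \<alpha> \<in> \<Delta>p" "c_elt G \<alpha> \<otimes> v = se \<alpha> \<otimes> u"
    using neg_case[OF \<alpha> u False] .
  obtain t' y where y: "0 < t'" "t' < 1" "y \<in> dc v" "x = rot \<alpha> t' \<otimes> y"
    using rot_dc_pos_surj[OF \<alpha> v(1)] x v(2) by metis
  have yc: "y \<in> carrier G" using dc_carrier[OF U_carrier[OF v(1)]] y by blast
  have e: "rot \<alpha> t \<otimes> x = rot \<alpha> (t + t') \<otimes> y" using y yc by (simp add: rot_add m_assoc)
  consider "t + t' < 1" | "t + t' = 1" | "t + t' > 1" by linarith
  then show ?thesis
  proof cases
    case 1
    then show ?thesis using rot_dc_pos[OF \<alpha> v(1,3) y(3), of "t + t'"] t y e v(2) by simp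
  next
    case 2
    have "c_elt G \<alpha> \<otimes> y \<in> dc (se \<alpha> \<otimes> u)" using dc_left_C[OF ce_C[OF \<alpha>] v(1) y(3)] v(4) by simp
    then show ?thesis using e by (simp add: 2 ce_rot)
  next
    case 3
    have "rot \<alpha> (t + t' - 1) \<otimes> y \<in> dc u" using rot_dc_pos[OF \<alpha> v(1,3) y(3), of "t + t' - 1"] t y 3 v(2) by simp
    then have "c_elt G \<alpha> \<otimes> (rot \<alpha> (t + t' - 1) \<otimes> y) \<in> dc (c_elt G \<alpha> \<otimes> u)" by (rule dc_left_C[OF ce_C[OF \<alpha>] u])
    moreover have "rot \<alpha> (t + t') = rot \<alpha> 1 \<otimes> rot \<alpha> (t + t' - 1)" by (simp flip: rot_add)
    ultimately show ?thesis using e yc by (simp add: ce_rot m_assoc)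
  qed
qed

lemma dc_left_C_inv: assumes "c \<in> CC" "u \<in> UU" "z \<in> dc (c \<otimes> u)" shows "inv c \<otimes> z \<in> dc u"
  using dc_left_C[OF subgroup.m_inv_closed[OF subgroup_C assms(1)] U_mult[OF C_U[OF assms(1)] assms(2)] assms(3)]
    C_carrier[OF assms(1)] U_carrier[OF assms(2)] by (simp add: inv_cancel)

lemma bar_surj:
  assumes \<alpha>: "\<alpha> \<in> \<Sigma>" and u: "u \<in> UU" and z: "z \<in> dc u \<union> dc (se \<alpha> \<otimes> u) \<union> dc (c_elt G \<alpha> \<otimes> u)"
  obtains t x where "0 \<le> t" "t \<le> 1" "x \<in> dc u" "z = rot \<alpha> t \<otimes> x"
proof -
  note uc = U_carrier[OF u] and cC = ce_C[OF \<alpha>]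
  have "\<exists>t x. 0 \<le> t \<and> t \<le> 1 \<and> x \<in> dc u \<and> z = rot \<alpha> t \<otimes> x"
  proof -
    consider "z \<in> dc u" | "z \<in> dc (c_elt G \<alpha> \<otimes> u)" | "z \<in> dc (se \<alpha> \<otimes> u)" using z by blast
    then show ?thesis
    proof cases
      case 1
      then show ?thesis using dc_carrier[OF uc] by (intro exI[of _ 0] exI[of _ z]) auto
    next
      case 2
      have "z \<in> carrier G" using dc_carrier 2 ce_carrier[OF \<alpha>] uc by blast
      then have "z = rot \<alpha> 1 \<otimes> (inv (c_elt G \<alpha>) \<otimes> z)" using ce_carrier[OF \<alpha>] by (simp add: inv_cancel flip: ce_rot)
      then show ?thesis using dc_left_C_inv[OF cC u 2] by (intro exI[of _ 1]) auto
    next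
      case 3
      show ?thesis
      proof (cases "act (inv u) \<alpha> \<in> \<Delta>p")
        case True
        obtain t x where t: "0 < t" "t < 1" "x \<in> dc u" "z = rot \<alpha> t \<otimes> x" by (rule rot_dc_pos_surj[OF \<alpha> u 3])
        then show ?thesis by (intro exI[of _ t] exI[of _ x]) simp
      next
        case False
        obtain v where v: "v \<in> UU" "u = se \<alpha> \<otimes> v" "act (inv v) \<alpha> \<in> \<Delta>p" "c_elt G \<alpha> \<otimes> v = se \<alpha> \<otimes> u"
          using neg_case[OF \<alpha> u False] .
        have zc: "z \<in> carrier G" by (rule subsetD[OF dc_carrier 3]) (simp add: uc)
        have y: "inv (c_elt G \<alpha>) \<otimes> z \<in> dc v" using dc_left_C_inv[OF cC v(1)] 3 v(4) by simp
        \<comment> \<open>The midpoint of the arc suffices: \<open>se \<alpha>\<close> is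
          \<open>rot \<alpha> (1/2)\<close>, and its square is
          \<open>c_elt G \<alpha>\<close>.\<close>
        have "se \<alpha> \<otimes> (inv (c_elt G \<alpha>) \<otimes> z) \<in> dc u" using se_dc_pos[OF \<alpha> v(1,3) y] v(2) by simp
        moreover have "z = rot \<alpha> (1/2) \<otimes> (se \<alpha> \<otimes> (inv (c_elt G \<alpha>) \<otimes> z))"
          using zc by (simp add: ce_eq inv_mult_group m_assoc inv_cancel flip: se_rot)
        ultimately show ?thesis by (intro exI[of _ "1/2"] exI[of _ "se \<alpha> \<otimes> (inv (c_elt G \<alpha>) \<otimes> z)"]) auto
      qed
    qed
  qed
  with that show ?thesis by blast
qed

section \<open>Words in the elements \<open>se \<alpha>\<close> and generation of
  \<open>U\<close>\<close>

definition sp :: "('e \<Rightarrow> real) list \<Rightarrow> 'g \<Rightarrow> 'g" where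
  "sp \<alpha>s c = foldr (\<lambda>\<alpha> g. se \<alpha> \<otimes> g) \<alpha>s c"

lemma sp_simps [simp]: "sp [] c = c" "sp (\<alpha> # \<alpha>s) c = se \<alpha> \<otimes> sp \<alpha>s c"
  by (simp_all add: sp_def)

lemma sp_U: "set \<alpha>s \<subseteq> \<Sigma> \<Longrightarrow> c \<in> UU \<Longrightarrow> sp \<alpha>s c \<in> UU"
  by (induction \<alpha>s) (auto intro: U_mult se_U)

text \<open>\<open>U\<close> normalizes \<open>C\<close>, so a factor from \<open>C\<close> can be
  moved through the word to its end.\<close>

lemma C_sp: assumes "set \<alpha>s \<subseteq> \<Sigma>" "c \<in> CC" "c' \<in> CC"
  obtains c'' where "c'' \<in> CC" "c' \<otimes> sp \<alpha>s c = sp \<alpha>s c''"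
proof -
  have "\<exists>c''\<in>CC. c' \<otimes> sp \<alpha>s c = sp \<alpha>s c''"
    using assms(1,3)
  proof (induction \<alpha>s arbitrary: c')
    case Nil
    then show ?case using assms(2) subgroup.m_closed[OF subgroup_C] by auto
  next
    case (Cons \<alpha> \<alpha>s)
    have s: "inv (se \<alpha>) \<otimes> c' \<otimes> se \<alpha> \<in> CC" using C_conj(1) se_U Cons.prems by simp
    obtain c'' where c: "c'' \<in> CC" "(inv (se \<alpha>) \<otimes> c' \<otimes> se \<alpha>) \<otimes> sp \<alpha>s c = sp \<alpha>s c''"
      using Cons.IH[OF _ s] Cons.prems by auto
    have "sp \<alpha>s c \<in> carrier G" using U_carrier sp_U Cons.prems C_U[OF assms(2)] by simp
    then have "c' \<otimes> sp (\<alpha> # \<alpha>s) c = se \<alpha> \<otimes> ((inv (se \<alpha>) \<otimes> c' \<otimes> se \<alpha>) \<otimes> sp \<alpha>s c)"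
      using C_carrier[OF Cons.prems(2)] by (simp add: m_assoc inv_cancel)
    then show ?case using c by auto
  qed
  with that show ?thesis by blast
qed

text \<open>The union of the double cosets of products of the \<open>s\<^sub>\<alpha>\<close> is stable under left multiplication by a
  generating set of \<open>G\<close>.\<close>

lemma U_generated:
  assumes u: "u \<in> UU"
  obtains \<alpha>s c where "set \<alpha>s \<subseteq> \<Sigma>" "c \<in> CC" "u = sp \<alpha>s c"
proof -
  define U1 where "U1 = {sp \<alpha>s c | \<alpha>s c. set \<alpha>s \<subseteq> \<Sigma> \<and> c \<in> CC}"
  define Q where "Q = (\<Union>u\<in>U1. dc u)"
  have U1U: "u \<in> UU" if "u \<in> U1" for u using that sp_U C_U by (auto simp: U1_def)
  have U1s: "se \<alpha> \<otimes> u \<in> U1" if u1: "u \<in> U1" and a1: "\<alpha> \<in> \<Sigma>" for u \<alpha>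
  proof -
    obtain \<alpha>s c where "u = sp \<alpha>s c" "set \<alpha>s \<subseteq> \<Sigma>" "c \<in> CC" using u1 unfolding U1_def by blast
    then have "se \<alpha> \<otimes> u = sp (\<alpha> # \<alpha>s) c" "set (\<alpha> # \<alpha>s) \<subseteq> \<Sigma>" using a1 by auto
    then show ?thesis unfolding U1_def using \<open>c \<in> CC\<close> by blast
  qed
  have U1c: "c' \<otimes> u \<in> U1" if u1: "u \<in> U1" and c1: "c' \<in> CC" for u c'
  proof -
    obtain \<alpha>s c where s: "u = sp \<alpha>s c" "set \<alpha>s \<subseteq> \<Sigma>" "c \<in> CC" using u1 unfolding U1_def by blast
    obtain c'' where "c'' \<in> CC" "c' \<otimes> sp \<alpha>s c = sp \<alpha>s c''" using C_sp[OF s(2,3) c1] .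
    then show ?thesis unfolding U1_def s(1) using s(2) by blast
  qed
  have Qc: "x \<in> carrier G" if "x \<in> Q" for x
    using that dc_carrier U_carrier U1U by (auto simp: Q_def)
  \<comment> \<open>Requiring that inverses preserve \<open>Q\<close> as well makes the stabilizer a
    subgroup.\<close>
  define H where "H = {g \<in> carrier G. (\<forall>x\<in>Q. g \<otimes> x \<in> Q) \<and> (\<forall>x\<in>Q. inv g \<otimes> x \<in> Q)}"
  have sH: "subgroup H G"
  proof
    fix x y assume "x \<in> H" "y \<in> H"
    then show "x \<otimes> y \<in> H" by (simp add: H_def m_assoc inv_mult_group Qc)
  qed (auto simp: H_def Qc)
  have AH: "b \<in> H" if b: "b \<in> AN" for b
    using dc_left_AN[OF U1U _ b] dc_left_AN[OF U1U _ AN_inv[OF b]] AN_carrier[OF b]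
    by (auto simp: H_def Q_def) blast+
  have sQ: "se \<alpha> \<otimes> x \<in> Q" if "x \<in> Q" "\<alpha> \<in> \<Sigma>" for x \<alpha>
  proof -
    obtain u where u: "u \<in> U1" "x \<in> dc u" using \<open>x \<in> Q\<close> by (auto simp: Q_def)
    have "rot \<alpha> (1/2) \<otimes> x \<in> dc u \<union> dc (se \<alpha> \<otimes> u) \<union> dc (c_elt G \<alpha> \<otimes> u)"
      by (rule bar_subset[OF that(2) U1U[OF u(1)] u(2)]) auto
    then show ?thesis unfolding se_rot[symmetric] Un_iff Q_def
      using UN_I[OF u(1), of "se \<alpha> \<otimes> x" dc] UN_I[OF U1s[OF u(1) that(2)], of "se \<alpha> \<otimes> x" dc]
        UN_I[OF U1c[OF u(1) ce_C[OF that(2)]], of "se \<alpha> \<otimes> x" dc] by argo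
  qed
  have cQ: "c \<otimes> x \<in> Q" if "x \<in> Q" "c \<in> CC" for x c
    using that dc_left_C[OF that(2) U1U] U1c[OF _ that(2)] by (auto simp: Q_def)
  have seH: "se \<alpha> \<in> H" if "\<alpha> \<in> \<Sigma>" for \<alpha>
  proof -
    have "inv (se \<alpha>) \<otimes> x \<in> Q" if x: "x \<in> Q" for x
    proof -
      have "inv (se \<alpha>) \<otimes> x = se \<alpha> \<otimes> (inv (c_elt G \<alpha>) \<otimes> x)"
        using Qc[OF x] by (simp add: ce_eq inv_mult_group m_assoc inv_cancel)
      then show ?thesis
        using sQ[OF cQ[OF x subgroup.m_inv_closed[OF subgroup_C ce_C[OF \<open>\<alpha> \<in> \<Sigma>\<close>]]] \<open>\<alpha> \<in> \<Sigma>\<close>] by simp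
    qed
    then show ?thesis using sQ that by (simp add: H_def)
  qed
  \<comment> \<open>\<open>H\<close> contains the root groups of simple roots and the elements
    \<open>se \<alpha>\<close>; conjugation carries the former to the root groups of all
    roots.\<close>
  have "\<Delta> \<subseteq> {\<beta> \<in> \<Delta>. \<forall>X\<in>rs \<beta>. lexp G X \<in> H}"
  proof (rule roots_from_simple)
    show "\<Sigma> \<subseteq> {\<beta> \<in> \<Delta>. \<forall>X\<in>rs \<beta>. lexp G X \<in> H}"
    proof
      fix \<alpha> assume a: "\<alpha> \<in> \<Sigma>"
      have "lexp G X \<in> H" if "X \<in> rs \<alpha>" for X
        using AH[OF N_AN[OF NI]] rs_wsp[OF simple_pos[OF a] that] n_eq by simp
      then show "\<alpha> \<in> {\<beta> \<in> \<Delta>. \<forall>X\<in>rs \<beta>. lexp G X \<in> H}" using simple_root[OF a] by blast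
    qed
    fix \<alpha> \<beta> assume a: "\<alpha> \<in> \<Sigma>" and b: "\<beta> \<in> {\<beta> \<in> \<Delta>. \<forall>X\<in>rs \<beta>. lexp G X \<in> H}"
    have "lexp G X \<in> H" if X: "X \<in> rs (act (se \<alpha>) \<beta>)" for X
    proof -
      have "Ad G (inv (se \<alpha>)) X \<in> rs \<beta>"
        using rs_act[OF U_inv[OF se_U[OF a]] X] act_inv(1)[OF se_U[OF a]] by simp
      then have "se \<alpha> \<otimes> lexp G (Ad G (inv (se \<alpha>)) X) \<otimes> inv (se \<alpha>) \<in> H"
        using b by (intro subgroup.m_closed[OF sH] subgroup.m_inv_closed[OF sH] seH[OF a]) blast
      then show ?thesis by (simp add: lexp_conj)
    qed
    then show "act (se \<alpha>) \<beta> \<in> {\<beta> \<in> \<Delta>. \<forall>X\<in>rs \<beta>. lexp G X \<in> H}"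
      using act_root[OF se_U[OF a]] b by blast
  qed
  then have rH: "lexp G X \<in> H" if "\<beta> \<in> \<Delta>" "X \<in> rs \<beta>" for \<beta> X using that by blast
  have "H = carrier G"
  proof (rule subgroup_eq_carrier[OF connected_T sH root_decomposition])
    fix X t assume "X \<in> \<aa> \<union> (\<Union>\<alpha>\<in>\<Delta>. rs \<alpha>)"
    then show "lexp G (t *\<^sub>R X) \<in> H"
      using AH[OF A_AN] a_props(1) rH subspace_rs by (auto simp: subspace_scale)
  qed
  then have uH: "u \<in> H" using U_carrier[OF u] by blast
  have "sp [] \<one> \<in> U1" unfolding U1_def using subgroup.one_closed[OF subgroup_C] by (intro CollectI exI[of _ "[]"] exI[of _ \<one>]) simp
  then have "\<one> \<in> Q" using dc_self[of \<one>] by (auto simp: Q_def)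
  then have "u \<otimes> \<one> \<in> Q" using uH unfolding H_def by blast
  then obtain v where v: "v \<in> U1" "u \<in> dc v" using U_carrier[OF u] by (auto simp: Q_def)
  have "u = v" by (rule dc_disjoint[OF u U1U[OF v(1)] dc_self[OF U_carrier[OF u]] v(2)])
  then show ?thesis using v(1) that by (auto simp: U1_def)
qed

end

section \<open>The length function\<close>

context split begin

lemmas C_mult = subgroup.m_closed[OF subgroup_C]
lemmas C_inv = subgroup.m_inv_closed[OF subgroup_C]
lemmas C_one = subgroup.one_closed[OF subgroup_C]
lemmas U_one = subgroup.one_closed[OF subgroup_U]

lemma wproj_iff: "x \<in> wproj G u \<longleftrightarrow> (\<exists>c\<in>CC. x = c \<otimes> u)"
  by (auto simp: wproj_def r_coset_def)

lemma wproj_eq_iff: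
  assumes "u \<in> UU" "v \<in> UU"
  shows "wproj G u = wproj G v \<longleftrightarrow> (\<exists>c\<in>CC. u = c \<otimes> v)"
proof
  assume "wproj G u = wproj G v"
  moreover have "u \<in> wproj G u" unfolding wproj_iff using C_one U_carrier[OF assms(1)] by (intro bexI[of _ \<one>]) auto
  ultimately show "\<exists>c\<in>CC. u = c \<otimes> v" using wproj_iff by simp
next
  assume "\<exists>c\<in>CC. u = c \<otimes> v"
  then obtain c where c: "c \<in> CC" "u = c \<otimes> v" by blast
  note k = C_carrier U_carrier[OF assms(2)]
  show "wproj G u = wproj G v"
  proof (intro Set.set_eqI iffI)
    fix x assume "x \<in> wproj G u"
    then obtain d where d: "d \<in> CC" "x = d \<otimes> u" using wproj_iff by blast
    then have "x = (d \<otimes> c) \<otimes> v" using c k by (simp add: m_assoc)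
    then show "x \<in> wproj G v" unfolding wproj_iff using C_mult[OF d(1) c(1)] by blast
  next
    fix x assume "x \<in> wproj G v"
    then obtain d where d: "d \<in> CC" "x = d \<otimes> v" using wproj_iff by blast
    then have "x = (d \<otimes> inv c) \<otimes> u" using c k by (simp add: m_assoc inv_cancel)
    then show "x \<in> wproj G u" unfolding wproj_iff using C_mult[OF d(1) C_inv[OF c(1)]] by blast
  qed
qed

lemma wproj_mult:
  assumes "u \<in> UU" "v \<in> UU"
  shows "wproj G u <#> wproj G v = wproj G (u \<otimes> v)"
proof (intro Set.set_eqI iffI)
  note k = C_carrier U_carrier[OF assms(1)] U_carrier[OF assms(2)]
  fix x assume "x \<in> wproj G u <#> wproj G v"
  then obtain c d where c: "c \<in> CC" "d \<in> CC" "x = (c \<otimes> u) \<otimes> (d \<otimes> v)" by (auto simp: set_mult_def wproj_iff)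
  then have "x = (c \<otimes> (u \<otimes> d \<otimes> inv u)) \<otimes> (u \<otimes> v)" using k by (simp add: m_assoc inv_cancel)
  then show "x \<in> wproj G (u \<otimes> v)" unfolding wproj_iff using C_mult[OF c(1) C_conj(2)[OF assms(1) c(2)]] by blast
next
  note k = C_carrier U_carrier[OF assms(1)] U_carrier[OF assms(2)]
  fix x assume "x \<in> wproj G (u \<otimes> v)"
  then obtain c where c: "c \<in> CC" "x = c \<otimes> (u \<otimes> v)" using wproj_iff by blast
  then have x: "x = (c \<otimes> u) \<otimes> (\<one> \<otimes> v)" using k by (simp add: m_assoc)
  have "c \<otimes> u \<in> wproj G u" "\<one> \<otimes> v \<in> wproj G v" unfolding wproj_iff using c(1) C_one by blast+
  then show "x \<in> wproj G u <#> wproj G v" unfolding x set_mult_def by blast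
qed

text \<open>An element of \<open>U\<close> acting on \<open>\<aa>\<close> as the reflection differs
  from \<open>se \<alpha>\<close> by one acting trivially, which lies in \<open>C\<close>.\<close>

lemma simple_refl_eq:
  assumes "\<alpha> \<in> \<Sigma>"
  shows "simple_refl G \<alpha> = wproj G (se \<alpha>)"
proof (intro Set.set_eqI iffI)
  note n = Hvec_norm[OF simple_root[OF assms]]
  note s = se_U[OF assms]
  fix x assume "x \<in> simple_refl G \<alpha>"
  then have x: "x \<in> UU" and A: "\<And>H. H \<in> \<aa> \<Longrightarrow> Ad G x H = Ad G (se \<alpha>) H"
    using Ad_se_H[OF assms] by (auto simp: simple_refl_def n)
  have c: "x \<otimes> inv (se \<alpha>) \<in> CC"
  proof (rule CI[OF U_mult[OF x U_inv[OF s]]])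
    fix H assume "H \<in> \<aa>"
    then have "Ad G (inv (se \<alpha>)) H \<in> \<aa>" by (rule Ad_inv_U_a[OF s])
    from A[OF this] show "Ad G (x \<otimes> inv (se \<alpha>)) H = H" using U_carrier[OF x] by (simp add: Ad_mult)
  qed
  have "x = (x \<otimes> inv (se \<alpha>)) \<otimes> se \<alpha>" using U_carrier[OF x] by (simp add: m_assoc)
  then show "x \<in> wproj G (se \<alpha>)" unfolding wproj_iff using c by blast
next
  note n = Hvec_norm[OF simple_root[OF assms]]
  fix x assume "x \<in> wproj G (se \<alpha>)"
  then obtain c where c: "c \<in> CC" "x = c \<otimes> se \<alpha>" using wproj_iff by blast
  have "Ad G x H = Ad G (se \<alpha>) H" if "H \<in> \<aa>" for H
    using C_Ad[OF c(1) Ad_U_a[OF se_U[OF assms] that]] C_carrier[OF c(1)] c(2) by (simp add: Ad_mult)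
  then show "x \<in> simple_refl G \<alpha>"
    using U_mult[OF C_U[OF c(1)] se_U[OF assms]] Ad_se_H[OF assms] by (simp add: simple_refl_def n c(2))
qed

lemma list_prod_wproj:
  assumes "set \<alpha>s \<subseteq> \<Sigma>"
  shows "list_prod (weyl_group G) (map (simple_refl G) \<alpha>s) = wproj G (sp \<alpha>s \<one>)"
  using assms
proof (induction \<alpha>s)
  case Nil
  have "wproj G \<one> = CC" using C_carrier by (auto simp: wproj_iff)
  then show ?case by (simp add: list_prod_def weyl_group_def FactGroup_def)
next
  case (Cons \<alpha> \<alpha>s)
  have "list_prod (weyl_group G) (map (simple_refl G) (\<alpha> # \<alpha>s)) =
      simple_refl G \<alpha> <#> list_prod (weyl_group G) (map (simple_refl G) \<alpha>s)"
    by (simp add: list_prod_def weyl_group_def FactGroup_def set_mult_def)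
  also have "\<dots> = wproj G (se \<alpha>) <#> wproj G (sp \<alpha>s \<one>)" using Cons by (simp add: simple_refl_eq)
  also have "\<dots> = wproj G (sp (\<alpha> # \<alpha>s) \<one>)" using Cons.prems wproj_mult[OF se_U sp_U[OF _ U_one]] by simp
  finally show ?case .
qed

lemma sp_append: "sp (\<alpha>s @ \<beta>s) c = sp \<alpha>s (sp \<beta>s c)"
  by (simp add: sp_def)

lemma sp_closed [simp]: "c \<in> carrier G \<Longrightarrow> sp \<alpha>s c \<in> carrier G"
  by (induction \<alpha>s) auto

lemma sp_one: "c \<in> carrier G \<Longrightarrow> sp \<alpha>s c = sp \<alpha>s \<one> \<otimes> c"
  by (induction \<alpha>s) (simp_all add: m_assoc)

lemma list_prod_sp: "c \<in> carrier G \<Longrightarrow> list_prod G (map se \<alpha>s @ [c]) = sp \<alpha>s c"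
  by (induction \<alpha>s) (simp_all add: list_prod_def)

lemma expression_of_iff:
  assumes "u \<in> UU"
  shows "expression_of G (wproj G u) \<alpha>s \<longleftrightarrow> set \<alpha>s \<subseteq> \<Sigma> \<and> (\<exists>c\<in>CC. u = sp \<alpha>s c)"
proof (cases "set \<alpha>s \<subseteq> \<Sigma>")
  case True
  let ?p = "sp \<alpha>s \<one>"
  have p: "?p \<in> UU" by (rule sp_U[OF True U_one])
  note pc = U_carrier[OF p]
  have "expression_of G (wproj G u) \<alpha>s \<longleftrightarrow> (\<exists>c\<in>CC. u = c \<otimes> ?p)"
    using True by (simp add: expression_of_def list_prod_wproj wproj_eq_iff[OF assms p])
  also have "\<dots> \<longleftrightarrow> (\<exists>c\<in>CC. u = sp \<alpha>s c)"
  proof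
    assume "\<exists>c\<in>CC. u = c \<otimes> ?p"
    then obtain c where c: "c \<in> CC" "u = c \<otimes> ?p" by blast
    obtain c'' where "c'' \<in> CC" "c \<otimes> ?p = sp \<alpha>s c''" by (rule C_sp[OF True C_one c(1)])
    then show "\<exists>c\<in>CC. u = sp \<alpha>s c" using c(2) by auto
  next
    assume "\<exists>c\<in>CC. u = sp \<alpha>s c"
    then obtain c where c: "c \<in> CC" "u = sp \<alpha>s c" by blast
    have "u = (?p \<otimes> c \<otimes> inv ?p) \<otimes> ?p"
      using c(2) sp_one[OF C_carrier[OF c(1)], of \<alpha>s] C_carrier[OF c(1)] pc by (simp add: m_assoc)
    then show "\<exists>c\<in>CC. u = c \<otimes> ?p" using C_conj(2)[OF p c(1)] by blast
  qed
  finally show ?thesis using True by simp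
qed (simp add: expression_of_def)

section \<open>Length and the exchange property\<close>

definition len :: "'g \<Rightarrow> nat" where "len u = wlen G (wproj G u)"

lemma len_le:
  assumes "set \<alpha>s \<subseteq> \<Sigma>" "c \<in> CC"
  shows "len (sp \<alpha>s c) \<le> length \<alpha>s"
proof -
  have "expression_of G (wproj G (sp \<alpha>s c)) \<alpha>s"
    using expression_of_iff[OF sp_U[OF assms(1) C_U[OF assms(2)]]] assms by blast
  then show ?thesis unfolding len_def wlen_def by (intro Least_le) blast
qed

lemma reduced_exists:
  assumes "u \<in> UU"
  obtains \<alpha>s c where "set \<alpha>s \<subseteq> \<Sigma>" "c \<in> CC" "u = sp \<alpha>s c" "length \<alpha>s = len u"
proof -
  obtain \<beta>s d where s: "set \<beta>s \<subseteq> \<Sigma>" "d \<in> CC" "u = sp \<beta>s d" by (rule U_generated[OF assms])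
  then have "expression_of G (wproj G u) \<beta>s" unfolding expression_of_iff[OF assms] by blast
  then have "\<exists>l \<alpha>s. expression_of G (wproj G u) \<alpha>s \<and> length \<alpha>s = l" by blast
  from LeastI_ex[OF this] obtain \<alpha>s where a: "expression_of G (wproj G u) \<alpha>s" "length \<alpha>s = len u"
    unfolding len_def wlen_def by blast
  then obtain c where "set \<alpha>s \<subseteq> \<Sigma>" "c \<in> CC" "u = sp \<alpha>s c" unfolding expression_of_iff[OF assms] by blast
  then show ?thesis using a(2) by (rule that)
qed

lemma len_C: assumes "c \<in> CC" "u \<in> UU" shows "len (c \<otimes> u) = len u"
proof -
  have "wproj G (c \<otimes> u) = wproj G u" using wproj_eq_iff[OF U_mult[OF C_U[OF assms(1)] assms(2)] assms(2)] assms by blast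
  then show ?thesis by (simp add: len_def)
qed

text \<open>A simple reflection makes no positive root negative except its own. Following
  \<open>\<beta>\<close> along the word, the image therefore equals the next letter when its sign
  first changes.\<close>

lemma sign_change:
  assumes "set \<alpha>s \<subseteq> \<Sigma>" "c \<in> CC" "\<beta> \<in> \<Delta>p" "act (inv (sp \<alpha>s c)) \<beta> \<notin> \<Delta>p"
  obtains \<alpha>s1 \<alpha> \<alpha>s2 where "\<alpha>s = \<alpha>s1 @ \<alpha> # \<alpha>s2" "act (inv (sp \<alpha>s1 \<one>)) \<beta> = \<alpha>"
proof -
  have "\<exists>\<alpha>s1 \<alpha> \<alpha>s2. \<alpha>s = \<alpha>s1 @ \<alpha> # \<alpha>s2 \<and> act (inv (sp \<alpha>s1 \<one>)) \<beta> = \<alpha>"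
    using assms(1,3,4)
  proof (induction \<alpha>s arbitrary: \<beta>)
    case Nil
    then show ?case using C_act[OF C_inv[OF assms(2)] pos_root[OF Nil(2)]] by simp
  next
    case (Cons \<alpha> \<alpha>s)
    have a: "\<alpha> \<in> \<Sigma>" and as: "set \<alpha>s \<subseteq> \<Sigma>" using Cons.prems(1) by auto
    show ?case
    proof (cases "\<beta> = \<alpha>")
      case True
      then have "\<alpha> # \<alpha>s = [] @ \<alpha> # \<alpha>s \<and> act (inv (sp [] \<one>)) \<beta> = \<alpha>" by (simp add: act_one)
      then show ?thesis by (intro exI)
    next
      case False
      have e: "act (inv (sp (\<alpha> # \<alpha>s) x)) \<beta> = act (inv (sp \<alpha>s x)) (act (se \<alpha>) \<beta>)"
        if x: "x \<in> UU" "set \<alpha>s \<subseteq> \<Sigma>" for x \<alpha>s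
        using act_inv_mult[OF se_U[OF a] sp_U[OF x(2,1)], of \<beta>]
          act_inv_se[OF a roots_adual[OF pos_root[OF Cons.prems(2)]]] by simp
      have "act (inv (sp \<alpha>s c)) (act (se \<alpha>) \<beta>) \<notin> \<Delta>p" using Cons.prems(3) e[OF C_U[OF assms(2)] as] by simp
      from Cons.IH[OF as simple_reflection_permutes(1)[OF a Cons.prems(2) False] this]
      obtain \<alpha>s1 \<gamma> \<alpha>s2 where g: "\<alpha>s = \<alpha>s1 @ \<gamma> # \<alpha>s2" "act (inv (sp \<alpha>s1 \<one>)) (act (se \<alpha>) \<beta>) = \<gamma>" by (elim exE conjE)
      have "\<alpha> # \<alpha>s = (\<alpha> # \<alpha>s1) @ \<gamma> # \<alpha>s2 \<and> act (inv (sp (\<alpha> # \<alpha>s1) \<one>)) \<beta> = \<gamma>"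
        using g as e[OF U_one, of \<alpha>s1] by simp
      then show ?thesis by (intro exI)
    qed
  qed
  then show ?thesis using that by (elim exE conjE)
qed

text \<open>\<open>inv p\<close> carries \<open>Hvec G \<alpha>\<close> to
  \<open>Hvec G \<gamma>\<close>, so the conjugate of \<open>se \<alpha>\<close> and
  \<open>se \<gamma>\<close> act on \<open>\<aa>\<close> as the same reflection.\<close>

lemma simple_conj:
  assumes \<alpha>: "\<alpha> \<in> \<Sigma>" and \<gamma>: "\<gamma> \<in> \<Sigma>" and p: "p \<in> UU" and e: "act (inv p) \<alpha> = \<gamma>"
  shows "inv p \<otimes> se \<alpha> \<otimes> p \<otimes> inv (se \<gamma>) \<in> CC"
proof (rule CI)
  note pc = U_carrier[OF p]
  show "inv p \<otimes> se \<alpha> \<otimes> p \<otimes> inv (se \<gamma>) \<in> UU" by (intro U_mult U_inv se_U assms)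
  have eH: "\<gamma> H = \<alpha> (Ad G p H)" for H unfolding e[symmetric] act_def using pc by simp
  note Ha = Hvec_in[OF simple_root[OF \<alpha>]]
  have Hg: "Hvec G \<gamma> = Ad G (inv p) (Hvec G \<alpha>)"
  proof (rule Hvec_unique[OF Ad_inv_U_a[OF p Ha]])
    fix H assume H: "H \<in> \<aa>"
    have "ip (Ad G (inv p) (Hvec G \<alpha>)) H = ip (Ad G p (Ad G (inv p) (Hvec G \<alpha>))) (Ad G p H)"
      using ip_Ad[OF U_K[OF p]] by simp
    also have "\<dots> = ip (Hvec G \<alpha>) (Ad G p H)" using pc by simp
    also have "\<dots> = \<gamma> H" using Hvec_ip[OF simple_root[OF \<alpha>] Ad_U_a[OF p H]] eH by simp
    finally show "ip (Ad G (inv p) (Hvec G \<alpha>)) H = \<gamma> H" .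
  qed
  have n: "\<gamma> (Hvec G \<gamma>) = \<alpha> (Hvec G \<alpha>)" unfolding eH Hg using pc by simp
  have "Ad G (inv p) (Ad G (se \<alpha>) (Ad G p H)) = Ad G (se \<gamma>) H" if "H \<in> \<aa>" for H
    unfolding Ad_se_H[OF \<alpha> Ad_U_a[OF p that]] Ad_se_H[OF \<gamma> that] n[unfolded Hg] Hg eH[of H] using pc
    by (simp add: Ad_diff Ad_scale)
  from this[OF Ad_inv_U_a[OF se_U[OF \<gamma>]]]
  show "Ad G (inv p \<otimes> se \<alpha> \<otimes> p \<otimes> inv (se \<gamma>)) H = H" if "H \<in> \<aa>" for H
    using that pc by (simp add: Ad_mult)
qed

text \<open>Moved past the prefix, \<open>se \<alpha>\<close> becomes an element of \<open>C\<close>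
  times \<open>se \<gamma>\<close>. It meets the letter \<open>\<gamma>\<close> and merges with it
  into \<open>c_elt G \<gamma>\<close>, and the factors from \<open>C\<close> are absorbed at the
  end of the word: one letter has disappeared.\<close>

lemma exchange:
  assumes \<alpha>: "\<alpha> \<in> \<Sigma>" and as: "set \<alpha>s \<subseteq> \<Sigma>" and c: "c \<in> CC" and n: "act (inv (sp \<alpha>s c)) \<alpha> \<notin> \<Delta>p"
  shows "len (se \<alpha> \<otimes> sp \<alpha>s c) < length \<alpha>s"
proof -
  obtain \<alpha>s1 \<gamma> \<alpha>s2 where g: "\<alpha>s = \<alpha>s1 @ \<gamma> # \<alpha>s2" "act (inv (sp \<alpha>s1 \<one>)) \<alpha> = \<gamma>"
    by (rule sign_change[OF as c simple_pos[OF \<alpha>] n])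
  let ?p = "sp \<alpha>s1 \<one>" and ?w = "sp \<alpha>s2 c"
  have s: "set \<alpha>s1 \<subseteq> \<Sigma>" "\<gamma> \<in> \<Sigma>" "set \<alpha>s2 \<subseteq> \<Sigma>" using as g(1) by auto
  have p: "?p \<in> UU" by (rule sp_U[OF s(1) U_one])
  define d where "d = inv ?p \<otimes> se \<alpha> \<otimes> ?p \<otimes> inv (se \<gamma>)"
  have d: "d \<in> CC" unfolding d_def by (rule simple_conj[OF \<alpha> s(2) p g(2)])
  obtain c'' where c'': "c'' \<in> CC" "(d \<otimes> c_elt G \<gamma>) \<otimes> ?w = sp \<alpha>s2 c''"
    by (rule C_sp[OF s(3) c C_mult[OF d ce_C[OF s(2)]]])
  have w: "?w \<in> carrier G" using C_carrier[OF c] by simp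
  have "se \<alpha> \<otimes> sp \<alpha>s c = se \<alpha> \<otimes> (?p \<otimes> (se \<gamma> \<otimes> ?w))"
    using sp_one[of "se \<gamma> \<otimes> ?w" \<alpha>s1] w by (simp add: g(1) sp_append)
  also have "\<dots> = ?p \<otimes> ((d \<otimes> c_elt G \<gamma>) \<otimes> ?w)"
    using w by (simp add: d_def ce_eq m_assoc inv_cancel)
  also have "\<dots> = sp (\<alpha>s1 @ \<alpha>s2) c''"
    unfolding c''(2) sp_append using sp_one[of "sp \<alpha>s2 c''" \<alpha>s1] C_carrier[OF c''(1)] by simp
  finally have "se \<alpha> \<otimes> sp \<alpha>s c = sp (\<alpha>s1 @ \<alpha>s2) c''" .
  then show ?thesis using len_le[of "\<alpha>s1 @ \<alpha>s2", OF _ c''(1)] s g(1) by simp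
qed

lemma len_se_se: assumes "\<alpha> \<in> \<Sigma>" "u \<in> UU" shows "len (se \<alpha> \<otimes> (se \<alpha> \<otimes> u)) = len u"
  using len_C[OF ce_C[OF assms(1)] assms(2)] U_carrier[OF assms(2)] by (simp add: ce_eq m_assoc)

lemma len_se_le: assumes "\<alpha> \<in> \<Sigma>" "u \<in> UU" shows "len (se \<alpha> \<otimes> u) \<le> len u + 1"
proof -
  obtain \<alpha>s c where a: "set \<alpha>s \<subseteq> \<Sigma>" "c \<in> CC" "u = sp \<alpha>s c" "length \<alpha>s = len u" by (rule reduced_exists[OF assms(2)])
  then show ?thesis using len_le[of "\<alpha> # \<alpha>s" c] assms(1) by simp
qed

lemma len_neg:
  assumes "\<alpha> \<in> \<Sigma>" "u \<in> UU" "act (inv u) \<alpha> \<notin> \<Delta>p"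
  shows "len (se \<alpha> \<otimes> u) + 1 = len u"
proof -
  obtain \<alpha>s c where a: "set \<alpha>s \<subseteq> \<Sigma>" "c \<in> CC" "u = sp \<alpha>s c" "length \<alpha>s = len u" by (rule reduced_exists[OF assms(2)])
  have "len (se \<alpha> \<otimes> u) < len u" using exchange[OF assms(1) a(1,2)] a(3,4) assms(3) by simp
  moreover have "len u \<le> len (se \<alpha> \<otimes> u) + 1"
    using len_se_le[OF assms(1) U_mult[OF se_U[OF assms(1)] assms(2)]] len_se_se[OF assms(1,2)] by simp
  ultimately show ?thesis by simp
qed

lemma len_pos:
  assumes "\<alpha> \<in> \<Sigma>" "u \<in> UU" "act (inv u) \<alpha> \<in> \<Delta>p"
  shows "len (se \<alpha> \<otimes> u) = len u + 1"
proof -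
  have "act (inv (se \<alpha> \<otimes> u)) \<alpha> \<notin> \<Delta>p" unfolding act_inv_se_mult[OF assms(1,2)] by (rule pos_not_neg[OF assms(3)])
  from len_neg[OF assms(1) U_mult[OF se_U[OF assms(1)] assms(2)] this]
  show ?thesis using len_se_se[OF assms(1,2)] by simp
qed

end

section \<open>Schubert cells and the Bruhat order\<close>

context split begin

text \<open>The set \<open>bar \<alpha>s c\<close> parametrizes the Schubert cell of \<open>sp \<alpha>s c\<close>: each factor \<open>s\<^sub>\<alpha>\<close> is replaced by an
  arbitrary point of the arc from \<open>\<one>\<close> to \<open>c\<^sub>\<alpha>\<close> through \<open>s\<^sub>\<alpha>\<close>.\<close>

definition bar :: "('e \<Rightarrow> real) list \<Rightarrow> 'g \<Rightarrow> 'g set" where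
  "bar \<alpha>s c = foldr (\<lambda>\<alpha> B. (\<lambda>(t, x). rot \<alpha> t \<otimes> x) ` ({0..1} \<times> B)) \<alpha>s {c}"

definition obar :: "('e \<Rightarrow> real) list \<Rightarrow> 'g \<Rightarrow> 'g set" where
  "obar \<alpha>s c = foldr (\<lambda>\<alpha> B. (\<lambda>(t, x). rot \<alpha> t \<otimes> x) ` ({0<..<1} \<times> B)) \<alpha>s {c}"

definition subs :: "('e \<Rightarrow> real) list \<Rightarrow> 'g \<Rightarrow> 'g set" where
  "subs \<alpha>s c = foldr (\<lambda>\<alpha> B. \<Union>v\<in>B. {v, se \<alpha> \<otimes> v, c_elt G \<alpha> \<otimes> v}) \<alpha>s {c}"

lemma bar_simps [simp]: "bar [] c = {c}" "bar (\<alpha> # \<alpha>s) c = (\<lambda>(t, x). rot \<alpha> t \<otimes> x) ` ({0..1} \<times> bar \<alpha>s c)"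
  by (simp_all add: bar_def)
lemma obar_simps [simp]: "obar [] c = {c}" "obar (\<alpha> # \<alpha>s) c = (\<lambda>(t, x). rot \<alpha> t \<otimes> x) ` ({0<..<1} \<times> obar \<alpha>s c)"
  by (simp_all add: obar_def)
lemma subs_simps [simp]: "subs [] c = {c}" "subs (\<alpha> # \<alpha>s) c = (\<Union>v\<in>subs \<alpha>s c. {v, se \<alpha> \<otimes> v, c_elt G \<alpha> \<otimes> v})"
  by (simp_all add: subs_def)

lemma subs_U:
  assumes "set \<alpha>s \<subseteq> \<Sigma>" "c \<in> CC" "v \<in> subs \<alpha>s c"
  shows "v \<in> UU"
  using assms(1,3)
proof (induction \<alpha>s arbitrary: v)
  case (Cons \<alpha> \<alpha>s)
  obtain w where w: "w \<in> subs \<alpha>s c" "v = w \<or> v = se \<alpha> \<otimes> w \<or> v = c_elt G \<alpha> \<otimes> w" using Cons.prems(2) by auto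
  have "w \<in> UU" "\<alpha> \<in> \<Sigma>" using Cons.IH[OF _ w(1)] Cons.prems(1) by auto
  then show ?case using w(2) U_mult se_U ce_U by metis
qed (use C_U[OF assms(2)] in simp)

lemma sp_subs: "sp \<alpha>s c \<in> subs \<alpha>s c"
  by (induction \<alpha>s) auto

lemma bar_K: assumes "c \<in> CC" shows "bar \<alpha>s c \<subseteq> Kgrp G"
  by (induction \<alpha>s) (use C_K[OF assms] in \<open>auto intro: subgroup.m_closed[OF subgroup_Kgrp] rot_Kgrp\<close>)

lemma dc_C: assumes "c \<in> CC" "z \<in> dc c" obtains b where "b \<in> AN" "z = c \<otimes> b"
proof -
  obtain n b where n: "n \<in> N" "b \<in> AN" "z = n \<otimes> c \<otimes> b" using assms(2) by (auto simp: dc_def)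
  have "inv c \<otimes> n \<otimes> inv (inv c) \<in> N" by (rule C_conj_N[OF C_inv[OF assms(1)] n(1)])
  then have "(inv c \<otimes> n \<otimes> c) \<otimes> b \<in> AN" using AN_mult[OF N_AN n(2)] C_carrier[OF assms(1)] by simp
  moreover have "z = c \<otimes> ((inv c \<otimes> n \<otimes> c) \<otimes> b)"
    using n C_carrier[OF assms(1)] N_carrier[OF n(1)] AN_carrier[OF n(2)] by (simp add: m_assoc inv_cancel)
  ultimately show ?thesis by (rule that)
qed

lemma bar_subs:
  assumes "set \<alpha>s \<subseteq> \<Sigma>" "c \<in> CC" "x \<in> bar \<alpha>s c" "b \<in> AN"
  obtains v where "v \<in> subs \<alpha>s c" "x \<otimes> b \<in> dc v"
proof -
  have "\<exists>v\<in>subs \<alpha>s c. x \<otimes> b \<in> dc v"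
    using assms(1,3)
  proof (induction \<alpha>s arbitrary: x)
    case Nil
    then show ?case using dc_right[OF C_carrier[OF assms(2)] dc_self[OF C_carrier[OF assms(2)]] assms(4)] by simp
  next
    case (Cons \<alpha> \<alpha>s)
    have a: "\<alpha> \<in> \<Sigma>" "set \<alpha>s \<subseteq> \<Sigma>" using Cons.prems(1) by auto
    obtain t y where y: "0 \<le> t" "t \<le> 1" "y \<in> bar \<alpha>s c" "x = rot \<alpha> t \<otimes> y" using Cons.prems(2) by auto
    obtain v where v: "v \<in> subs \<alpha>s c" "y \<otimes> b \<in> dc v" using Cons.IH[OF a(2) y(3)] by blast
    have yc: "y \<in> carrier G" using bar_K[OF assms(2)] y(3) Kgrp_carrier by blast
    have "rot \<alpha> t \<otimes> (y \<otimes> b) \<in> dc v \<union> dc (se \<alpha> \<otimes> v) \<union> dc (c_elt G \<alpha> \<otimes> v)"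
      by (rule bar_subset[OF a(1) subs_U[OF a(2) assms(2) v(1)] v(2) y(1,2)])
    then have "x \<otimes> b \<in> dc v \<union> dc (se \<alpha> \<otimes> v) \<union> dc (c_elt G \<alpha> \<otimes> v)"
      using yc AN_carrier[OF assms(4)] by (simp add: y(4) m_assoc)
    then show ?case using v(1) by auto
  qed
  then show ?thesis using that by blast
qed

lemma subs_bar:
  assumes "set \<alpha>s \<subseteq> \<Sigma>" "c \<in> CC" "v \<in> subs \<alpha>s c" "z \<in> dc v"
  obtains x b where "x \<in> bar \<alpha>s c" "b \<in> AN" "z = x \<otimes> b"
proof -
  have "\<exists>x\<in>bar \<alpha>s c. \<exists>b\<in>AN. z = x \<otimes> b"
    using assms(1,3,4)
  proof (induction \<alpha>s arbitrary: v z)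
    case Nil
    have "z \<in> dc c" using Nil by simp
    then obtain b where "b \<in> AN" "z = c \<otimes> b" by (rule dc_C[OF assms(2)])
    then show ?case by auto
  next
    case (Cons \<alpha> \<alpha>s)
    have a: "\<alpha> \<in> \<Sigma>" "set \<alpha>s \<subseteq> \<Sigma>" using Cons.prems(1) by auto
    obtain w where w: "w \<in> subs \<alpha>s c" "v = w \<or> v = se \<alpha> \<otimes> w \<or> v = c_elt G \<alpha> \<otimes> w" using Cons.prems(2) by auto
    have "z \<in> dc w \<union> dc (se \<alpha> \<otimes> w) \<union> dc (c_elt G \<alpha> \<otimes> w)" using w(2) Cons.prems(3) by auto
    then obtain t y where y: "0 \<le> t" "t \<le> 1" "y \<in> dc w" "z = rot \<alpha> t \<otimes> y"
      by (rule bar_surj[OF a(1) subs_U[OF a(2) assms(2) w(1)]])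
    obtain x b where x: "x \<in> bar \<alpha>s c" "b \<in> AN" "y = x \<otimes> b" using Cons.IH[OF a(2) w(1) y(3)] by blast
    have xc: "x \<in> carrier G" using bar_K[OF assms(2)] x(1) Kgrp_carrier by blast
    have "rot \<alpha> t \<otimes> x \<in> bar (\<alpha> # \<alpha>s) c" using x(1) y(1,2) by force
    moreover have "z = (rot \<alpha> t \<otimes> x) \<otimes> b" using xc AN_carrier[OF x(2)] by (simp add: y(4) x(3) m_assoc)
    ultimately show ?case using x(2) by blast
  qed
  then show ?thesis using that by blast
qed

text \<open>Letter by letter, \<open>bar_subset\<close> and \<open>bar_surj\<close> match products
  of arcs with double cosets up to a right factor in \<open>AN\<close>. Inside \<open>K\<close> that
  factor is trivial, since \<open>K\<close> and \<open>AN\<close> meet only in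
  \<open>\<one>\<close>.\<close>

lemma bar_eq:
  assumes "set \<alpha>s \<subseteq> \<Sigma>" "c \<in> CC"
  shows "bar \<alpha>s c = (\<Union>v\<in>subs \<alpha>s c. bruhat_cell G v)"
proof (intro Set.set_eqI iffI)
  fix x assume x: "x \<in> bar \<alpha>s c"
  have xK: "x \<in> Kgrp G" using bar_K[OF assms(2)] x by blast
  obtain v where v: "v \<in> subs \<alpha>s c" "x \<otimes> \<one> \<in> dc v"
    by (rule bar_subs[OF assms x subgroup.one_closed[OF subgroup_AN]])
  then have "x \<in> bruhat_cell G v"
    using xK Kgrp_carrier[OF xK] by (simp add: bruhat_cell_eq[OF subs_U[OF assms v(1)]])
  then show "x \<in> (\<Union>v\<in>subs \<alpha>s c. bruhat_cell G v)" using v(1) by blast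
next
  fix k assume "k \<in> (\<Union>v\<in>subs \<alpha>s c. bruhat_cell G v)"
  then obtain v where v: "v \<in> subs \<alpha>s c" "k \<in> bruhat_cell G v" by blast
  then have k: "k \<in> Kgrp G" "k \<in> dc v" by (auto simp: bruhat_cell_eq[OF subs_U[OF assms v(1)]])
  obtain x b where x: "x \<in> bar \<alpha>s c" "b \<in> AN" "k = x \<otimes> b" by (rule subs_bar[OF assms v(1) k(2)])
  have xK: "x \<in> Kgrp G" using bar_K[OF assms(2)] x(1) by blast
  note xc = Kgrp_carrier[OF xK]
  have "b = inv x \<otimes> k" using xc AN_carrier[OF x(2)] by (simp add: x(3) inv_cancel)
  then have "b \<in> Kgrp G"
    using subgroup.m_closed[OF subgroup_Kgrp subgroup.m_inv_closed[OF subgroup_Kgrp xK] k(1)] by simp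
  then have "b = \<one>" by (rule K_AN_trivial[OF _ x(2)])
  then show "k \<in> bar \<alpha>s c" using x xc by simp
qed

lemma rot_mult_continuous: "continuous_map (prod_topology euclidean T) T (\<lambda>(t, x). rot \<alpha> t \<otimes> x)"
proof -
  have "continuous_map euclidean T (rot \<alpha>)"
    using lexp_scale_continuous[of "\<lambda>t. t" "Fvec \<alpha>"] by (simp add: rot_def[abs_def] continuous_on_id)
  from continuous_map_mult[OF continuous_map_compose[OF continuous_map_fst this] continuous_map_snd]
  show ?thesis by (simp add: comp_def case_prod_unfold)
qed

lemma bar_closed: assumes "c \<in> CC" shows "closedin T (bar \<alpha>s c)"
proof (rule compactin_imp_closedin[OF Hausdorff_T])
  show "compactin T (bar \<alpha>s c)"
  proof (induction \<alpha>s)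
    case Nil
    then show ?case using C_carrier[OF assms] by (simp add: topspace_T)
  next
    case (Cons \<alpha> \<alpha>s)
    have "compactin (prod_topology euclidean T) ({0..1::real} \<times> bar \<alpha>s c)"
      using Cons by (simp add: compactin_Times compactin_euclidean_iff)
    from image_compactin[OF this rot_mult_continuous] show ?case by simp
  qed
qed

text \<open>Closed intervals are closures of open ones, closure commutes with products, and
  continuous images of closures lie in closures of images.\<close>

lemma bar_closure_obar: assumes "c \<in> CC" shows "bar \<alpha>s c \<subseteq> T closure_of obar \<alpha>s c"
proof (induction \<alpha>s)
  case Nil
  then show ?case using closure_of_subset[of "{c}" T] C_carrier[OF assms] by (simp add: topspace_T)
next
  case (Cons \<alpha> \<alpha>s)
  let ?f = "\<lambda>(t, x). rot \<alpha> t \<otimes> x"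
  have "{0..1} \<times> bar \<alpha>s c \<subseteq> prod_topology euclidean T closure_of ({0<..<1::real} \<times> obar \<alpha>s c)"
    using Cons by (auto simp: closure_of_Times)
  then have "?f ` ({0..1} \<times> bar \<alpha>s c) \<subseteq> ?f ` (prod_topology euclidean T closure_of ({0<..<1::real} \<times> obar \<alpha>s c))"
    by (rule image_mono)
  also have "\<dots> \<subseteq> T closure_of (?f ` ({0<..<1::real} \<times> obar \<alpha>s c))"
    by (rule continuous_map_image_closure_subset[OF rot_mult_continuous])
  finally show ?case by simp
qed

section \<open>Schubert cells of reduced words\<close>

definition reduced :: "('e \<Rightarrow> real) list \<Rightarrow> 'g \<Rightarrow> bool" where
  "reduced \<alpha>s c \<longleftrightarrow> set \<alpha>s \<subseteq> \<Sigma> \<and> c \<in> CC \<and> len (sp \<alpha>s c) = length \<alpha>s"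

lemma reduced_Cons:
  "reduced (\<alpha> # \<alpha>s) c \<longleftrightarrow> \<alpha> \<in> \<Sigma> \<and> reduced \<alpha>s c \<and> len (se \<alpha> \<otimes> sp \<alpha>s c) = len (sp \<alpha>s c) + 1"
proof
  assume r: "reduced (\<alpha> # \<alpha>s) c"
  then have a: "\<alpha> \<in> \<Sigma>" "set \<alpha>s \<subseteq> \<Sigma>" "c \<in> CC" by (auto simp: reduced_def)
  then show "\<alpha> \<in> \<Sigma> \<and> reduced \<alpha>s c \<and> len (se \<alpha> \<otimes> sp \<alpha>s c) = len (sp \<alpha>s c) + 1"
    using len_le[OF a(2,3)] len_se_le[OF a(1) sp_U[OF a(2) C_U[OF a(3)]]] r by (simp add: reduced_def)
qed (auto simp: reduced_def)

lemma reduced_U: "reduced \<alpha>s c \<Longrightarrow> sp \<alpha>s c \<in> UU"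
  using sp_U C_U by (simp add: reduced_def)

lemma len_Suc_iff:
  assumes "\<alpha> \<in> \<Sigma>" "u \<in> UU"
  shows "len (se \<alpha> \<otimes> u) = len u + 1 \<longleftrightarrow> act (inv u) \<alpha> \<in> \<Delta>p"
  using len_pos[OF assms] len_neg[OF assms] by linarith

lemma obar_subset:
  assumes "reduced \<alpha>s c" shows "obar \<alpha>s c \<subseteq> dc (sp \<alpha>s c)"
  using assms
proof (induction \<alpha>s)
  case Nil
  then show ?case using dc_self C_carrier by (simp add: reduced_def)
next
  case (Cons \<alpha> \<alpha>s)
  have r: "\<alpha> \<in> \<Sigma>" "reduced \<alpha>s c" "len (se \<alpha> \<otimes> sp \<alpha>s c) = len (sp \<alpha>s c) + 1"
    using Cons.prems unfolding reduced_Cons by simp_all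
  have p: "act (inv (sp \<alpha>s c)) \<alpha> \<in> \<Delta>p" using r len_Suc_iff[OF r(1) reduced_U[OF r(2)]] by simp
  have "rot \<alpha> t \<otimes> x \<in> dc (se \<alpha> \<otimes> sp \<alpha>s c)" if "0 < t" "t < 1" "x \<in> obar \<alpha>s c" for t x
    by (rule rot_dc_pos[OF r(1) reduced_U[OF r(2)] p subsetD[OF Cons.IH[OF r(2)] that(3)] that(1,2)])
  then show ?case by auto
qed

lemma obar_bar: "obar \<alpha>s c \<subseteq> bar \<alpha>s c"
  by (induction \<alpha>s) (force)+

text \<open>The Bruhat cell lies between \<open>obar\<close> and the closed set \<open>bar\<close>,
  and the closure of \<open>obar\<close> contains \<open>bar\<close>; this determines the closure of
  the cell.\<close>

lemma schubert_cell_eq_bar: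
  assumes "reduced \<alpha>s c"
  shows "schubert_cell G (sp \<alpha>s c) = bar \<alpha>s c"
proof -
  let ?u = "sp \<alpha>s c"
  have a: "set \<alpha>s \<subseteq> \<Sigma>" "c \<in> CC" using assms by (auto simp: reduced_def)
  note B = bruhat_cell_eq[OF reduced_U[OF assms]]
  have S: "schubert_cell G ?u = Kgrp G \<inter> T closure_of bruhat_cell G ?u"
    unfolding schubert_cell_def closure_of_subtopology B by (simp add: Int_assoc[symmetric])
  have "bruhat_cell G ?u \<subseteq> bar \<alpha>s c" unfolding bar_eq[OF a] using sp_subs by blast
  then have "T closure_of bruhat_cell G ?u \<subseteq> bar \<alpha>s c" by (rule closure_of_minimal[OF _ bar_closed[OF a(2)]])
  moreover have "obar \<alpha>s c \<subseteq> bruhat_cell G ?u"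
    unfolding B using obar_subset[OF assms] obar_bar[of \<alpha>s c] bar_K[OF a(2), of \<alpha>s] by auto
  then have "bar \<alpha>s c \<subseteq> T closure_of bruhat_cell G ?u"
    using bar_closure_obar[OF a(2), of \<alpha>s] closure_of_mono[of "obar \<alpha>s c" "bruhat_cell G ?u" T] by auto
  ultimately show ?thesis unfolding S using bar_K[OF a(2), of \<alpha>s] by auto
qed

text \<open>The reflexive order, tested on the point \<open>x\<close> alone: a Schubert cell is a
  union of Bruhat cells, so it contains the cell of \<open>x\<close> as soon as it contains
  \<open>x\<close>.\<close>

definition le :: "'g \<Rightarrow> 'g \<Rightarrow> bool" where "le x u \<longleftrightarrow> x \<in> UU \<and> u \<in> UU \<and> x \<in> schubert_cell G u"

lemma U_bruhat_cell: "u \<in> UU \<Longrightarrow> u \<in> bruhat_cell G u"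
  using bruhat_cell_eq U_K dc_self[OF U_carrier] by simp

lemma bruhat_cell_disjoint:
  "u \<in> UU \<Longrightarrow> v \<in> UU \<Longrightarrow> x \<in> bruhat_cell G u \<Longrightarrow> x \<in> bruhat_cell G v \<Longrightarrow> u = v"
  using dc_disjoint[of u v x] by (simp add: bruhat_cell_eq)

text \<open>The Bruhat cells in the Schubert cell are those of \<open>subs\<close>, and
  \<open>x\<close> lies in no cell but its own. As \<open>le\<close> mentions no word, the set
  \<open>subs\<close> is the same for all reduced words of an element.\<close>

lemma le_reduced:
  assumes "reduced \<alpha>s c"
  shows "le x (sp \<alpha>s c) \<longleftrightarrow> x \<in> subs \<alpha>s c"
proof
  have a: "set \<alpha>s \<subseteq> \<Sigma>" "c \<in> CC" using assms by (auto simp: reduced_def)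
  note S = schubert_cell_eq_bar[OF assms, unfolded bar_eq[OF a]]
  show "x \<in> subs \<alpha>s c" if "le x (sp \<alpha>s c)"
  proof -
    have x: "x \<in> UU" "x \<in> (\<Union>v\<in>subs \<alpha>s c. bruhat_cell G v)" using that S by (auto simp: le_def)
    then obtain v where v: "v \<in> subs \<alpha>s c" "x \<in> bruhat_cell G v" by blast
    have "x = v" by (rule bruhat_cell_disjoint[OF x(1) subs_U[OF a v(1)] U_bruhat_cell[OF x(1)] v(2)])
    then show ?thesis using v(1) by simp
  qed
  show "le x (sp \<alpha>s c)" if x: "x \<in> subs \<alpha>s c"
    using reduced_U[OF assms] subs_U[OF a x] U_bruhat_cell[OF subs_U[OF a x]] x unfolding le_def S by blast
qed

lemma reduced_expression_exists:
  assumes "u \<in> UU"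
  obtains \<alpha>s c where "reduced \<alpha>s c" "u = sp \<alpha>s c"
proof -
  obtain \<alpha>s c where "set \<alpha>s \<subseteq> \<Sigma>" "c \<in> CC" "u = sp \<alpha>s c" "length \<alpha>s = len u" by (rule reduced_exists[OF assms])
  then show ?thesis using that[of \<alpha>s c] by (simp add: reduced_def)
qed

lemma le_cell:
  assumes "le x u" shows "bruhat_cell G x \<subseteq> schubert_cell G u"
proof -
  have u: "u \<in> UU" using assms by (simp add: le_def)
  obtain \<alpha>s c where a: "reduced \<alpha>s c" "u = sp \<alpha>s c" by (rule reduced_expression_exists[OF u])
  have b: "set \<alpha>s \<subseteq> \<Sigma>" "c \<in> CC" using a by (auto simp: reduced_def)
  have "x \<in> subs \<alpha>s c" using assms le_reduced[OF a(1)] a(2) by simp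
  then show ?thesis unfolding a(2) schubert_cell_eq_bar[OF a(1)] bar_eq[OF b] by blast
qed

lemma bruhat_less_iff:
  assumes "x \<in> UU" "u \<in> UU"
  shows "bruhat_less G x u \<longleftrightarrow> le x u \<and> x \<noteq> u"
proof
  assume "bruhat_less G x u"
  then have "x \<in> schubert_cell G u" "x \<notin> bruhat_cell G u"
    using U_bruhat_cell[OF assms(1)] by (auto simp: bruhat_less_def bruhat_boundary_def)
  then show "le x u \<and> x \<noteq> u" using assms U_bruhat_cell[OF assms(2)] by (auto simp: le_def)
next
  assume a: "le x u \<and> x \<noteq> u"
  have "bruhat_cell G x \<inter> bruhat_cell G u = {}" using bruhat_cell_disjoint[OF assms] a by blast
  then show "bruhat_less G x u" using le_cell a unfolding bruhat_less_def bruhat_boundary_def by blast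
qed

lemma le_refl: "u \<in> UU \<Longrightarrow> le u u"
  using le_reduced sp_subs reduced_expression_exists by metis

lemma schubert_cell_closure: "u \<in> UU \<Longrightarrow> schubert_cell G u = Kgrp G \<inter> T closure_of bruhat_cell G u"
  unfolding schubert_cell_def closure_of_subtopology
  by (simp add: Int_assoc[symmetric] bruhat_cell_eq)

lemma le_trans: assumes "le x v" "le v u" shows "le x u"
proof -
  have u: "u \<in> UU" "v \<in> UU" "x \<in> UU" using assms by (auto simp: le_def)
  have "T closure_of bruhat_cell G v \<subseteq> T closure_of bruhat_cell G u"
    by (rule closure_of_minimal) (use le_cell[OF assms(2)] schubert_cell_closure[OF u(1)] in auto)
  then show ?thesis using assms(1) u by (auto simp: le_def schubert_cell_closure)
qed

lemma le_C: assumes "le x v" "c \<in> CC" shows "le (c \<otimes> x) (c \<otimes> v)"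
proof -
  have u: "v \<in> UU" "x \<in> UU" using assms by (auto simp: le_def)
  note cu = U_mult[OF C_U[OF assms(2)] u(1)]
  have cont: "continuous_map T T (\<lambda>x. c \<otimes> x)"
    using C_carrier[OF assms(2)] by (intro continuous_map_mult) (auto simp: topspace_T)
  have "(\<lambda>x. c \<otimes> x) ` bruhat_cell G v \<subseteq> bruhat_cell G (c \<otimes> v)"
    using dc_left_C[OF assms(2) u(1)] subgroup.m_closed[OF subgroup_Kgrp C_K[OF assms(2)]]
    by (auto simp: bruhat_cell_eq[OF u(1)] bruhat_cell_eq[OF cu])
  from closure_of_mono[OF this] continuous_map_image_closure_subset[OF cont]
  have "(\<lambda>x. c \<otimes> x) ` (T closure_of bruhat_cell G v) \<subseteq> T closure_of bruhat_cell G (c \<otimes> v)" by blast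
  moreover have "x \<in> T closure_of bruhat_cell G v" using assms(1) u by (simp add: le_def schubert_cell_closure)
  ultimately have "c \<otimes> x \<in> T closure_of bruhat_cell G (c \<otimes> v)" by blast
  then show ?thesis using cu U_mult[OF C_U[OF assms(2)] u(2)] U_K by (simp add: le_def schubert_cell_closure)
qed

text \<open>The subword criterion for a reduced word of \<open>v\<close> is compared with that for
  the same word preceded by \<open>\<alpha>\<close>. This is the lifting property in the form suited
  to \<open>U\<close>.\<close>

lemma le_se:
  assumes "\<alpha> \<in> \<Sigma>" "v \<in> UU" "len (se \<alpha> \<otimes> v) = len v + 1"
  shows "le x (se \<alpha> \<otimes> v) \<longleftrightarrow> (\<exists>y. le y v \<and> (x = y \<or> x = se \<alpha> \<otimes> y \<or> x = c_elt G \<alpha> \<otimes> y))"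
proof -
  obtain \<alpha>s c where a: "reduced \<alpha>s c" "v = sp \<alpha>s c" by (rule reduced_expression_exists[OF assms(2)])
  have "reduced (\<alpha> # \<alpha>s) c" using a assms by (simp add: reduced_Cons)
  from le_reduced[OF this] le_reduced[OF a(1)] show ?thesis using a(2) by auto
qed

text \<open>Write \<open>u = se \<alpha> \<otimes> v\<close> with \<open>v\<close> shorter. Both
  \<open>v\<close> and \<open>c_elt G \<alpha> \<otimes> v\<close> lie below \<open>u\<close> with
  length one less, so the case left is \<open>x = se \<alpha> \<otimes> y\<close> with
  \<open>y\<close> strictly below \<open>v\<close>; there induction supplies an element
  \<open>w\<close> between \<open>y\<close> and \<open>v\<close>.\<close>

lemma le_cover:
  assumes "le x u" "x \<noteq> u"
  obtains w where "le x w" "le w u" "len w + 1 = len u"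
proof -
  have "\<exists>w. le x w \<and> le w u \<and> len w + 1 = len u"
    using assms
  proof (induction "len u" arbitrary: x u rule: less_induct)
    case less
    have u: "u \<in> UU" using less.prems by (simp add: le_def)
    obtain \<beta>s c where b: "reduced \<beta>s c" "u = sp \<beta>s c" by (rule reduced_expression_exists[OF u])
    have "\<beta>s \<noteq> []" using le_reduced[OF b(1)] b(2) less.prems by auto
    then obtain \<alpha> \<alpha>s where e: "\<beta>s = \<alpha> # \<alpha>s" by (cases \<beta>s) auto
    define v where "v = sp \<alpha>s c"
    have a: "\<alpha> \<in> \<Sigma>" and v: "v \<in> UU" and uv: "u = se \<alpha> \<otimes> v" and lv: "len (se \<alpha> \<otimes> v) = len v + 1"
      using b reduced_U[of \<alpha>s c] by (auto simp: e reduced_Cons v_def)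
    note ce = ce_C[OF a]
    note lift = le_se[OF a v lv, folded uv]
    have vu: "le v u" unfolding lift using le_refl[OF v] by blast
    have cvu: "le (c_elt G \<alpha> \<otimes> v) u" unfolding lift using le_refl[OF v] by blast
    have lcv: "len (c_elt G \<alpha> \<otimes> v) = len v" by (rule len_C[OF ce v])
    have ?case if "le x v" using that vu lv uv by auto
    note done1 = this
    have ?case if "le x (c_elt G \<alpha> \<otimes> v)" using that cvu lcv lv uv by auto
    note done2 = this
    obtain y where y: "le y v" "x = y \<or> x = se \<alpha> \<otimes> y \<or> x = c_elt G \<alpha> \<otimes> y" using less.prems(1) lift by blast
    have yU: "y \<in> UU" using y(1) by (simp add: le_def)
    show ?case
    proof (cases "x = y \<or> x = c_elt G \<alpha> \<otimes> y")
      case True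
      then show ?thesis using y(1) le_C[OF y(1) ce] done1 done2 by auto
    next
      case False
      then have x: "x = se \<alpha> \<otimes> y" using y(2) by blast
      have "y \<noteq> v" using x uv less.prems(2) by blast
      have "len v < len u" using uv lv by simp
      from less.hyps[OF this y(1) \<open>y \<noteq> v\<close>]
      obtain w where w: "le y w" "le w v" "len w + 1 = len v" by (elim exE conjE)
      have wU: "w \<in> UU" using w by (simp add: le_def)
      show ?thesis
      \<comment> \<open>If \<open>se \<alpha>\<close> lengthens \<open>w\<close>, the translate of
        \<open>w\<close> lies between \<open>x\<close> and \<open>u\<close>. If it shortens
        \<open>w\<close>, the lifting property for \<open>w\<close> shows that \<open>x\<close> is
        already below \<open>v\<close> or \<open>c_elt G \<alpha> \<otimes> v\<close>.\<close>
      proof (cases "act (inv w) \<alpha> \<in> \<Delta>p")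
        case True
        have l: "len (se \<alpha> \<otimes> w) = len w + 1" by (rule len_pos[OF a wU True])
        have "le (se \<alpha> \<otimes> w) u" unfolding lift using w(2) by blast
        moreover have "le x (se \<alpha> \<otimes> w)" unfolding le_se[OF a wU l] x using w(1) by blast
        ultimately show ?thesis using l w(3) lv uv by auto
      next
        case False
        obtain w0 where w0: "w0 \<in> UU" "w = se \<alpha> \<otimes> w0" "act (inv w0) \<alpha> \<in> \<Delta>p"
          using neg_case[OF a wU False] .
        note lift0 = le_se[OF a w0(1) len_pos[OF a w0(1,3)], folded w0(2)]
        obtain z where z: "le z w0" "y = z \<or> y = se \<alpha> \<otimes> z \<or> y = c_elt G \<alpha> \<otimes> z" using w(1) lift0 by blast
        have zc: "z \<in> carrier G" using z(1) U_carrier by (simp add: le_def)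
        have s: "le (se \<alpha> \<otimes> z) v" "le (c_elt G \<alpha> \<otimes> z) v"
          by (rule le_trans[OF _ w(2)], use lift0 z(1) in blast)+
        from z(2) show ?thesis
        proof (elim disjE)
          assume "y = z"
          then show ?thesis using s(1) done1 x by simp
        next
          assume "y = se \<alpha> \<otimes> z"
          then have "x = c_elt G \<alpha> \<otimes> z" using x zc by (simp add: ce_eq m_assoc)
          then show ?thesis using s(2) done1 by simp
        next
          assume "y = c_elt G \<alpha> \<otimes> z"
          then have "x = c_elt G \<alpha> \<otimes> (se \<alpha> \<otimes> z)" using x zc by (simp add: ce_eq m_assoc)
          then show ?thesis using le_C[OF s(1) ce] done2 by simp
        qed
      qed
    qed
  qed
  then show ?thesis using that by blast
qed

section \<open>Deletions and codimension one\<close>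

lemma list_prod_append: "list_prod G (map se \<alpha>s @ xs) = sp \<alpha>s (list_prod G xs)"
  by (induction \<alpha>s) (simp_all add: list_prod_def)

lemma u_del_sp:
  assumes "c \<in> carrier G"
  shows "u_del0 G \<alpha>s i c = sp (take i \<alpha>s) (sp (drop (Suc i) \<alpha>s) c)"
    and "u_del1 G \<alpha>s i c = sp (take i \<alpha>s) (c_elt G (\<alpha>s ! i) \<otimes> sp (drop (Suc i) \<alpha>s) c)"
proof -
  have 1: "list_prod G (x # xs) = x \<otimes> list_prod G xs" for x xs by (simp add: list_prod_def)
  show "u_del0 G \<alpha>s i c = sp (take i \<alpha>s) (sp (drop (Suc i) \<alpha>s) c)"
    "u_del1 G \<alpha>s i c = sp (take i \<alpha>s) (c_elt G (\<alpha>s ! i) \<otimes> sp (drop (Suc i) \<alpha>s) c)"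
    using list_prod_sp[OF assms] by (simp_all add: u_del0_def u_del1_def list_prod_append 1)
qed

definition dels :: "('e \<Rightarrow> real) list \<Rightarrow> 'g \<Rightarrow> 'g set" where
  "dels \<alpha>s c = {v. \<exists>i<length \<alpha>s. v = u_del0 G \<alpha>s i c \<or> v = u_del1 G \<alpha>s i c}"

lemma dels_Cons:
  assumes "c \<in> carrier G"
  shows "dels (\<alpha> # \<alpha>s) c = {sp \<alpha>s c, c_elt G \<alpha> \<otimes> sp \<alpha>s c} \<union> (\<lambda>v. se \<alpha> \<otimes> v) ` dels \<alpha>s c"
proof -
  have "dels (\<alpha> # \<alpha>s) c = {v. (\<exists>i<Suc (length \<alpha>s). v = u_del0 G (\<alpha> # \<alpha>s) i c \<or> v = u_del1 G (\<alpha> # \<alpha>s) i c)}"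
    by (simp add: dels_def)
  then show ?thesis unfolding Ex_less_Suc2 by (auto simp: dels_def u_del_sp[OF assms])
qed

lemma dels_subs:
  assumes "c \<in> carrier G" shows "dels \<alpha>s c \<subseteq> subs \<alpha>s c"
proof (induction \<alpha>s)
  case Nil
  then show ?case by (simp add: dels_def)
next
  case (Cons \<alpha> \<alpha>s)
  then show ?case unfolding dels_Cons[OF assms] using sp_subs[of \<alpha>s c] by auto
qed

text \<open>Only a kept letter can raise the length, and by at most one; full length therefore
  forces every letter to be kept.\<close>

lemma subs_len:
  assumes "set \<alpha>s \<subseteq> \<Sigma>" "c \<in> CC" "v \<in> subs \<alpha>s c"
  shows "len v < length \<alpha>s \<or> len v = length \<alpha>s \<and> v = sp \<alpha>s c"
  using assms(1,3)
proof (induction \<alpha>s arbitrary: v)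
  case Nil
  then show ?case using len_le[of "[]" c] assms(2) by simp
next
  case (Cons \<alpha> \<alpha>s)
  have a: "\<alpha> \<in> \<Sigma>" "set \<alpha>s \<subseteq> \<Sigma>" using Cons.prems(1) by auto
  obtain w where w: "w \<in> subs \<alpha>s c" "v = w \<or> v = se \<alpha> \<otimes> w \<or> v = c_elt G \<alpha> \<otimes> w" using Cons.prems(2) by auto
  note wU = subs_U[OF a(2) assms(2) w(1)]
  from w(2) show ?case
    using Cons.IH[OF a(2) w(1)] len_se_le[OF a(1) wU] len_C[OF ce_C[OF a(1)] wU] by fastforce
qed

text \<open>If the first letter is replaced, the rest must have full length and is untouched by
  \<open>subs_len\<close>. If it is kept, the rest has codimension one and induction
  applies.\<close>

lemma subs_codim_1:
  assumes "reduced \<alpha>s c" "v \<in> subs \<alpha>s c" "len v + 1 = length \<alpha>s"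
  shows "v \<in> dels \<alpha>s c"
  using assms
proof (induction \<alpha>s arbitrary: v)
  case Nil
  then show ?case by simp
next
  case (Cons \<alpha> \<alpha>s)
  have r: "\<alpha> \<in> \<Sigma>" "reduced \<alpha>s c" "len (se \<alpha> \<otimes> sp \<alpha>s c) = len (sp \<alpha>s c) + 1"
    using Cons.prems(1) unfolding reduced_Cons by simp_all
  have a: "set \<alpha>s \<subseteq> \<Sigma>" "c \<in> CC" "len (sp \<alpha>s c) = length \<alpha>s" using r(2) by (auto simp: reduced_def)
  note d = dels_Cons[OF C_carrier[OF a(2)]]
  obtain w where w: "w \<in> subs \<alpha>s c" "v = w \<or> v = se \<alpha> \<otimes> w \<or> v = c_elt G \<alpha> \<otimes> w" using Cons.prems(2) by auto
  note wU = subs_U[OF a(1,2) w(1)]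
  note wl = subs_len[OF a(1,2) w(1)]
  from w(2) show ?case
  proof (elim disjE)
    assume "v = w"
    then show ?thesis using wl Cons.prems(3) unfolding d by auto
  next
    assume "v = c_elt G \<alpha> \<otimes> w"
    then show ?thesis using wl Cons.prems(3) len_C[OF ce_C[OF r(1)] wU] unfolding d by auto
  next
    assume v: "v = se \<alpha> \<otimes> w"
    have "w \<noteq> sp \<alpha>s c" using v r(3) a(3) Cons.prems(3) by auto
    then have "len w + 1 = length \<alpha>s" using wl len_se_le[OF r(1) wU] v Cons.prems(3) by auto
    from Cons.IH[OF r(2) w(1) this] show ?thesis unfolding d v by blast
  qed
qed

text \<open>\<open>deletion_cond\<close> determines \<open>c\<close> only through the factorization
  of \<open>u\<close>. The equivalence is therefore proved for every such \<open>c\<close>, and the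
  given expression supplies one.\<close>

lemma part_1:
  assumes u: "u \<in> UU" and u': "u' \<in> UU" and l: "len u' + 1 = len u"
    and r: "reduced_expression G (wproj G u) \<alpha>s"
  shows "bruhat_less G u' u \<longleftrightarrow> deletion_cond G \<alpha>s u' u"
proof -
  have as: "set \<alpha>s \<subseteq> \<Sigma>" and ex: "\<exists>c\<in>CC. u = sp \<alpha>s c" and ln: "length \<alpha>s = len u"
    using r by (auto simp: reduced_expression_def expression_of_iff[OF u] len_def)
  have "u' \<noteq> u" using l by auto
  have iff: "bruhat_less G u' u \<longleftrightarrow> u' \<in> dels \<alpha>s c" if c: "c \<in> CC" and e: "u = sp \<alpha>s c" for c
  proof -
    have red: "reduced \<alpha>s c" using as c e ln by (simp add: reduced_def)
    have "bruhat_less G u' u \<longleftrightarrow> u' \<in> subs \<alpha>s c"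
      using bruhat_less_iff[OF u' u] le_reduced[OF red] \<open>u' \<noteq> u\<close> e by simp
    also have "\<dots> \<longleftrightarrow> u' \<in> dels \<alpha>s c"
      using subs_codim_1[OF red] dels_subs[OF C_carrier[OF c]] l ln by auto
    finally show ?thesis .
  qed
  have "deletion_cond G \<alpha>s u' u \<longleftrightarrow> (\<exists>c\<in>CC. u = sp \<alpha>s c \<and> u' \<in> dels \<alpha>s c)"
    unfolding deletion_cond_def by (rule bex_cong) (auto simp: list_prod_sp C_carrier dels_def)
  then show ?thesis using iff ex by blast
qed

section \<open>Chains of covers\<close>

definition chain :: "'g \<Rightarrow> 'g \<Rightarrow> nat \<Rightarrow> (nat \<Rightarrow> 'g) \<Rightarrow> bool" where
  "chain x u n v \<longleftrightarrow> n \<ge> 2 \<and> (\<forall>k\<in>{1..n}. v k \<in> UU) \<and> v 1 = x \<and> v n = u \<and>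
    (\<forall>k. 1 \<le> k \<and> k < n \<longrightarrow> len (v (k + 1)) = len (v k) + 1 \<and> bruhat_less G (v k) (v (k + 1)))"

text \<open>The chain is extended at its upper end: \<open>le_cover\<close> splits one step off
  \<open>u\<close>, and the induction is on the length of \<open>u\<close>.\<close>

lemma chain_exists:
  assumes "le x u" "x \<noteq> u"
  shows "\<exists>n v. chain x u n v"
  using assms
proof (induction "len u" arbitrary: u rule: less_induct)
  case less
  obtain w where w: "le x w" "le w u" "len w + 1 = len u" by (rule le_cover[OF less.prems])
  have U: "x \<in> UU" "w \<in> UU" "u \<in> UU" using w by (auto simp: le_def)
  have wu: "bruhat_less G w u" unfolding bruhat_less_iff[OF U(2,3)] using w by auto
  show ?case
  proof (cases "x = w")
    case True
    define v where "v k = (if k = 1 then x else u)" for k :: nat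
    have "chain x u 2 v" unfolding chain_def using U wu w(3) True by (auto simp: v_def)
    then show ?thesis by blast
  next
    case False
    obtain n v where c: "chain x w n v" using less.hyps[OF _ w(1) False] w(3) by auto
    define v' where "v' k = (if k \<le> n then v k else u)" for k
    have "len (v' (k + 1)) = len (v' k) + 1 \<and> bruhat_less G (v' k) (v' (k + 1))" if k: "1 \<le> k" "k < n + 1" for k
    proof (cases "k = n")
      case True
      then show ?thesis using c wu w(3) by (simp add: v'_def chain_def)
    next
      case False
      then show ?thesis using c k by (simp add: v'_def chain_def)
    qed
    then have "chain x u (n + 1) v'" using c U(3) by (auto simp: chain_def v'_def)
    then show ?thesis by blast
  qed
qed

text \<open>Transitivity gives the weak relation; since lengths grow along the chain, the end points
  differ.\<close>

lemma chain_less: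
  assumes "chain x u n v"
  shows "bruhat_less G x u"
proof -
  have U: "v k \<in> UU" if "1 \<le> k" "k \<le> n" for k using assms that by (simp add: chain_def)
  have "le (v 1) (v (1 + k)) \<and> len (v (1 + k)) = len (v 1) + k" if "k < n" for k
    using that
  proof (induction k)
    case 0
    then show ?case using le_refl[OF U[of 1]] by simp
  next
    case (Suc k)
    have k: "1 \<le> 1 + k" "1 + k < n" using Suc.prems by auto
    then have s: "len (v (1 + k + 1)) = len (v (1 + k)) + 1" "bruhat_less G (v (1 + k)) (v (1 + k + 1))"
      using assms unfolding chain_def by blast+
    have "le (v (1 + k)) (v (1 + k + 1))" using s(2) bruhat_less_iff[OF U U] k by simp
    from le_trans[OF _ this, of "v 1"] show ?case using Suc.IH k s(1) by simp
  qed
  from this[of "n - 1"] show ?thesis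
    using assms U[of 1] U[of n] bruhat_less_iff[of x u] by (auto simp: chain_def)
qed

end

theorem theorem1p1:
  fixes G :: "('g, 'e::euclidean_space) cartan_data" and u u' :: 'g
  assumes "split_setting G" and "u \<in> Ugrp G" and "u' \<in> Ugrp G"
  shows "(\<forall>d. wlen G (wproj G u) = d \<and> wlen G (wproj G u') + 1 = d \<longrightarrow>
      (bruhat_less G u' u \<longleftrightarrow>
        (\<exists>\<alpha>s. reduced_expression G (wproj G u) \<alpha>s \<and> deletion_cond G \<alpha>s u' u)) \<and>
      (bruhat_less G u' u \<longleftrightarrow>
        (\<forall>\<alpha>s. reduced_expression G (wproj G u) \<alpha>s \<longrightarrow> deletion_cond G \<alpha>s u' u))) \<and>
    (bruhat_less G u' u \<longleftrightarrow>
      (\<exists>n (v :: nat \<Rightarrow> 'g). n \<ge> 2 \<and> (\<forall>k\<in>{1..n}. v k \<in> Ugrp G) \<and> v 1 = u' \<and> v n = u \<and>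
        (\<forall>k. 1 \<le> k \<and> k < n \<longrightarrow>
          wlen G (wproj G (v (k + 1))) = wlen G (wproj G (v k)) + 1 \<and>
          bruhat_less G (v k) (v (k + 1)))))"
proof -
  interpret split G using assms(1) by unfold_locales
  \<comment> \<open>Existence of a reduced expression links the two forms: without one the universal
    form would hold vacuously and the existential form would fail.\<close>
  obtain \<beta>s c where b: "reduced \<beta>s c" "u = sp \<beta>s c" by (rule reduced_expression_exists[OF assms(2)])
  then have r: "reduced_expression G (wproj G u) \<beta>s"
    using expression_of_iff[OF assms(2)] by (auto simp: reduced_expression_def reduced_def len_def)
  have 1: "bruhat_less G u' u \<longleftrightarrow> deletion_cond G \<alpha>s u' u"
    if "wlen G (wproj G u') + 1 = wlen G (wproj G u)" "reduced_expression G (wproj G u) \<alpha>s" for \<alpha>s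
    using part_1[OF assms(2,3) _ that(2)] that(1) by (simp add: len_def)
  have 2: "bruhat_less G u' u \<longleftrightarrow> (\<exists>n v. chain u' u n v)"
    using bruhat_less_iff[OF assms(3,2)] chain_exists[of u' u] chain_less[of u' u] by auto
  show ?thesis
  proof (intro conjI allI impI)
    fix d assume d: "wlen G (wproj G u) = d \<and> wlen G (wproj G u') + 1 = d"
    then have l: "wlen G (wproj G u') + 1 = wlen G (wproj G u)" by simp
    show "bruhat_less G u' u \<longleftrightarrow>
        (\<exists>\<alpha>s. reduced_expression G (wproj G u) \<alpha>s \<and> deletion_cond G \<alpha>s u' u)"
      "bruhat_less G u' u \<longleftrightarrow>
        (\<forall>\<alpha>s. reduced_expression G (wproj G u) \<alpha>s \<longrightarrow> deletion_cond G \<alpha>s u' u)"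
      using 1[OF l] r by metis+
  qed (rule 2[unfolded chain_def len_def])
qed

end
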